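(* Let $\alpha\ge1$. The mapping $\iota:G^\alpha_\alpha(\mathbb{R}^d_+)\to\mathfrak{s}^\alpha$, $\iota(f)=\{\langle f,\mathcal{L}_n\rangle\}_{n\in\mathbb{N}_0^d}$, is a topological isomorphism between $G^\alpha_\alpha(\mathbb{R}^d_+)$ and $\mathfrak{s}^\alpha$. In particular, $G^\alpha_\alpha(\mathbb{R}^d_+)$ is a $(DFN)$-space and its strong dual $(G^\alpha_\alpha(\mathbb{R}^d_+))'$ is an $(FN)$-space. Moreover, for each $f\in G^\alpha_\alpha(\mathbb{R}^d_+)$, $\sum_{n\in\mathbb{N}_0^d}\langle f,\mathcal{L}_n\rangle\mathcal{L}_n$ is summable to $f$ in $G^\alpha_\alpha(\mathbb{R}^d_+)$.
   Context: $\mathbb{R}^d_+=(0,\infty)^d$, $\mathbb{N}_0=\{0,1,2,\dots\}$. Multi-index notation: $|n|=n_1+\dots+n_d$, $x^t=\prod_lx_l^{t_l}$, $p^{\beta p}=\prod_lp_l^{\beta p_l}$, with $0^0=1$. $\|\cdot\|_2$ is the norm of $L^2(\mathbb{R}^d_+)$. Laguerre functions: $L_j(t)=\frac{e^t}{j!}\frac{d^j}{dt^j}(e^{-t}t^j)$ and $\mathcal{L}_n(t)=\prod_{l=1}^dL_{n_l}(t_l)e^{-t_l/2}$ for $n\in\mathbb{N}_0^d$; $\langle f,\mathcal{L}_n\rangle=\int_{\mathbb{R}^d_+}f\mathcal{L}_n\,dt$. $\mathcal{S}(\mathbb{R}^d_+)$ is the Fréchet space of all $f\in C^\infty(\mathbb{R}^d_+)$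 all of whose derivatives extend continuously to $[0,\infty)^d$ and with $\sup_{x\in\mathbb{R}^d_+}x^k|D^pf(x)|<\infty$ for all $k,p\in\mathbb{N}_0^d$ (these are the defining seminorms). For $A>0$, $G^{\alpha,A}_{\alpha,A}(\mathbb{R}^d_+)$ is the Fréchet space of all $f\in\mathcal{S}(\mathbb{R}^d_+)$ with $\sup_{p,k}\frac{\|t^{(p+k)/2}D^pf\|_2}{A^{|p+k|}k^{(\alpha/2)k}p^{(\alpha/2)p}}<\infty$, with seminorms $\sigma_{A,j}(f)=\sup_{p,k}\frac{\|t^{(p+k)/2}D^pf\|_2}{A^{|p+k|}k^{(\alpha/2)k}p^{(\alpha/2)p}}+\sup_{|p|\le j,|k|\le j}\sup_{t\in\mathbb{R}^d_+}|t^kD^pf(t)|$, $j\in\mathbb{N}_0$; and $G^\alpha_\alpha(\mathbb{R}^d_+)=\varinjlim_{A\to\infty}G^{\alpha,A}_{\alpha,A}(\mathbb{R}^d_+)$ (locally convex inductive limit). For $a>1$, $\mathfrak{s}^{\alpha,a}$ is the Banach space of complex sequences $\{a_n\}_{n\in\mathbb{N}_0^d}$ with norm $\sup_n|a_n|a^{|n|^{1/\alpha}}<\infty$, and $\mathfrak{s}^\alpha=\varinjlim_{a\to1^+}\mathfrak{s}^{\alpha,a}$ (locally convex inductive limit). An $(FN)$-space is a nuclear Fréchet space; a $(DFN)$-space is the strong dual of an $(FN)$-space. A family is summable to $f$ if the net of its finite partial sums, indexed by finite subsets of $\mathbb{N}_0^d$ ordered by inclusion, converges to $f$. *)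

theory Defs
  imports "HOL-Analysis.Analysis" "HOL-Library.Function_Algebras"
begin

section \<open>Complex vector spaces of functions\<close>

text \<open>
  Every vector space below is a subspace of \<open>'i \<Rightarrow> complex\<close> for some \<open>'i\<close>, with the pointwise
  operations.  A locally convex space is represented by its topology alone; the vector space is the
  \<^const>\<open>topspace\<close>.
\<close>

definition cscale :: "complex \<Rightarrow> ('i \<Rightarrow> complex) \<Rightarrow> ('i \<Rightarrow> complex)"  (infixr "*\<^sub>F" 75)
  where "c *\<^sub>F f = (\<lambda>x. c * f x)"

interpretation cfun: vector_space cscale
  by unfold_locales (auto simp: cscale_def fun_eq_iff algebra_simps)

definition linear_map_on ::
    "('i \<Rightarrow> complex) set \<Rightarrow> (('i \<Rightarrow> complex) \<Rightarrow> ('j \<Rightarrow> complex)) \<Rightarrow> bool" where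
  "linear_map_on S f \<longleftrightarrow>
     (\<forall>x\<in>S. \<forall>y\<in>S. f (x + y) = f x + f y) \<and> (\<forall>c. \<forall>x\<in>S. f (c *\<^sub>F x) = c *\<^sub>F f x)"

definition linear_form_on ::
    "('i \<Rightarrow> complex) set \<Rightarrow> (('i \<Rightarrow> complex) \<Rightarrow> complex) \<Rightarrow> bool" where
  "linear_form_on S \<phi> \<longleftrightarrow>
     (\<forall>x\<in>S. \<forall>y\<in>S. \<phi> (x + y) = \<phi> x + \<phi> y) \<and> (\<forall>c. \<forall>x\<in>S. \<phi> (c *\<^sub>F x) = c * \<phi> x)"

definition seminorm_on ::
    "('i \<Rightarrow> complex) set \<Rightarrow> (('i \<Rightarrow> complex) \<Rightarrow> real) \<Rightarrow> bool" where
  "seminorm_on S p \<longleftrightarrow>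
     (\<forall>x\<in>S. 0 \<le> p x) \<and>
     (\<forall>x\<in>S. \<forall>y\<in>S. p (x + y) \<le> p x + p y) \<and>
     (\<forall>c. \<forall>x\<in>S. p (c *\<^sub>F x) = cmod c * p x)"


section \<open>Locally convex spaces\<close>

text \<open>\<open>S\<close> itself is in the subbasis so that the carrier is \<open>S\<close> also when \<open>P\<close> is empty.\<close>

definition seminorm_topology ::
    "('i \<Rightarrow> complex) set \<Rightarrow> (('i \<Rightarrow> complex) \<Rightarrow> real) set \<Rightarrow> ('i \<Rightarrow> complex) topology" where
  "seminorm_topology S P =
     topology_generated_by (insert S {{y \<in> S. p (y - x) < e} | p x e. p \<in> P \<and> x \<in> S \<and> 0 < e})"

lemma topspace_seminorm_topology [simp]: "topspace (seminorm_topology S P) = S"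
  by (auto simp: seminorm_topology_def topology_generated_by_topspace)

definition locally_convex_space :: "('i \<Rightarrow> complex) topology \<Rightarrow> bool" where
  "locally_convex_space E \<longleftrightarrow>
     cfun.subspace (topspace E) \<and>
     (\<exists>P. (\<forall>p\<in>P. seminorm_on (topspace E) p) \<and> E = seminorm_topology (topspace E) P)"

definition continuous_seminorm ::
    "('i \<Rightarrow> complex) topology \<Rightarrow> (('i \<Rightarrow> complex) \<Rightarrow> real) \<Rightarrow> bool" where
  "continuous_seminorm E p \<longleftrightarrow> seminorm_on (topspace E) p \<and> continuous_map E euclideanreal p"

definition topological_isomorphism ::
    "('i \<Rightarrow> complex) topology \<Rightarrow> ('j \<Rightarrow> complex) topology \<Rightarrow>
     (('i \<Rightarrow> complex) \<Rightarrow> ('j \<Rightarrow> complex)) \<Rightarrow> bool" where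
  "topological_isomorphism E F f \<longleftrightarrow> linear_map_on (topspace E) f \<and> homeomorphic_map E F f"

text \<open>
  The inductive limit of a system of subspaces \<open>E k\<close>, directed by (continuous) inclusion: the finest
  locally convex topology on the union for which all inclusions are continuous, i.e. the one whose
  continuous seminorms are exactly those with continuous restriction to every \<open>E k\<close>.
\<close>

definition lc_inductive_limit ::
    "'k set \<Rightarrow> ('k \<Rightarrow> ('i \<Rightarrow> complex) topology) \<Rightarrow> ('i \<Rightarrow> complex) topology" where
  "lc_inductive_limit I E =
     (let S = (\<Union>k\<in>I. topspace (E k))
      in seminorm_topology S
           {p. seminorm_on S p \<and> (\<forall>k\<in>I. continuous_map (E k) euclideanreal p)})"

definition tvs_bounded :: "('i \<Rightarrow> complex) topology \<Rightarrow> ('i \<Rightarrow> complex) set \<Rightarrow> bool" where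
  "tvs_bounded E B \<longleftrightarrow>
     B \<subseteq> topspace E \<and>
     (\<forall>U. openin E U \<and> 0 \<in> U \<longrightarrow> (\<exists>r::real. 0 < r \<and> B \<subseteq> (\<lambda>u. complex_of_real r *\<^sub>F u) ` U))"

text \<open>
  Functionals on a proper subspace \<open>topspace E\<close> are extended by \<open>0\<close> to the whole type, so that
  distinct elements of the dual are distinct HOL functions and the vector space operations remain
  pointwise.
\<close>

definition dual_space :: "('i \<Rightarrow> complex) topology \<Rightarrow> (('i \<Rightarrow> complex) \<Rightarrow> complex) set" where
  "dual_space E =
     {\<phi>. linear_form_on (topspace E) \<phi> \<and> continuous_map E euclidean \<phi> \<and>
         (\<forall>x. x \<notin> topspace E \<longrightarrow> \<phi> x = 0)}"

definition strong_dual ::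
    "('i \<Rightarrow> complex) topology \<Rightarrow> (('i \<Rightarrow> complex) \<Rightarrow> complex) topology" where
  "strong_dual E =
     seminorm_topology (dual_space E)
       {\<lambda>\<phi>. SUP x\<in>B. cmod (\<phi> x) | B. tvs_bounded E B \<and> B \<noteq> {}}"

definition frechet_space :: "('i \<Rightarrow> complex) topology \<Rightarrow> bool" where
  "frechet_space E \<longleftrightarrow>
     locally_convex_space E \<and>
     (\<exists>d. Metric_space (topspace E) d \<and>
          Metric_space.mtopology (topspace E) d = E \<and>
          Metric_space.mcomplete (topspace E) d \<and>
          (\<forall>x\<in>topspace E. \<forall>y\<in>topspace E. \<forall>z\<in>topspace E. d (x + z) (y + z) = d x y))"


section \<open>Nuclear spaces\<close>

text \<open>
  For a seminorm \<open>p\<close> on \<open>S\<close>, the local Banach space \<open>S\<^sub>p\<close> is the completion of \<open>S / ker p\<close>.  An element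
  of it is represented by a \<open>p\<close>-Cauchy sequence in \<open>S\<close> (two of them representing the same element iff
  their difference is \<open>p\<close>-null), its norm being the limit of the values of \<open>p\<close>; the canonical map
  from \<open>S\<close> sends \<open>x\<close> to the constant sequence.
\<close>

definition seminorm_Cauchy ::
    "('i \<Rightarrow> complex) set \<Rightarrow> (('i \<Rightarrow> complex) \<Rightarrow> real) \<Rightarrow> (nat \<Rightarrow> 'i \<Rightarrow> complex) \<Rightarrow> bool" where
  "seminorm_Cauchy S p y \<longleftrightarrow>
     range y \<subseteq> S \<and> (\<forall>e>0. \<exists>N. \<forall>m\<ge>N. \<forall>n\<ge>N. p (y m - y n) < e)"

definition completion_norm ::
    "(('i \<Rightarrow> complex) \<Rightarrow> real) \<Rightarrow> (nat \<Rightarrow> 'i \<Rightarrow> complex) \<Rightarrow> real" where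
  "completion_norm p y = lim (\<lambda>k. p (y k))"

text \<open>
  The dual of \<open>S\<^sub>q\<close> consists (by restriction to \<open>S\<close> along the canonical map) of the \<open>q\<close>-bounded
  linear forms on \<open>S\<close>, with the operator norm \<open>dual_norm S q\<close>.
\<close>

definition seminorm_bounded_form ::
    "('i \<Rightarrow> complex) set \<Rightarrow> (('i \<Rightarrow> complex) \<Rightarrow> real) \<Rightarrow> (('i \<Rightarrow> complex) \<Rightarrow> complex) \<Rightarrow> bool" where
  "seminorm_bounded_form S q \<phi> \<longleftrightarrow>
     linear_form_on S \<phi> \<and> (\<exists>C. \<forall>x\<in>S. cmod (\<phi> x) \<le> C * q x)"

definition dual_norm ::
    "('i \<Rightarrow> complex) set \<Rightarrow> (('i \<Rightarrow> complex) \<Rightarrow> real) \<Rightarrow> (('i \<Rightarrow> complex) \<Rightarrow> complex) \<Rightarrow> real" where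
  "dual_norm S q \<phi> = Inf {C. 0 \<le> C \<and> (\<forall>x\<in>S. cmod (\<phi> x) \<le> C * q x)}"

text \<open>
  For \<open>p \<le> q\<close>: the canonical map \<open>S\<^sub>q \<rightarrow> S\<^sub>p\<close> is a nuclear operator, i.e. of the form
  \<open>x \<mapsto> (\<Sum>n. \<phi>\<^sub>n(x) y\<^sub>n)\<close> with \<open>\<phi>\<^sub>n\<close> in the dual of \<open>S\<^sub>q\<close>, \<open>y\<^sub>n\<close> in \<open>S\<^sub>p\<close> and \<open>(\<Sum>n. \<parallel>\<phi>\<^sub>n\<parallel> \<parallel>y\<^sub>n\<parallel>)\<close> finite.
  Both sides being continuous, it suffices to require the identity on the dense image of \<open>S\<close>.
\<close>

definition nuclear_canonical_map ::
    "('i \<Rightarrow> complex) set \<Rightarrow> (('i \<Rightarrow> complex) \<Rightarrow> real) \<Rightarrow> (('i \<Rightarrow> complex) \<Rightarrow> real) \<Rightarrow> bool" where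
  "nuclear_canonical_map S q p \<longleftrightarrow>
     (\<exists>\<phi> y. (\<forall>n. seminorm_bounded_form S q (\<phi> n)) \<and>
            (\<forall>n. seminorm_Cauchy S p (y n)) \<and>
            summable (\<lambda>n. dual_norm S q (\<phi> n) * completion_norm p (y n)) \<and>
            (\<forall>x\<in>S. (\<lambda>N. completion_norm p (\<lambda>k. x - (\<Sum>n<N. \<phi> n x *\<^sub>F y n k))) \<longlonglongrightarrow> 0))"

definition nuclear_space :: "('i \<Rightarrow> complex) topology \<Rightarrow> bool" where
  "nuclear_space E \<longleftrightarrow>
     locally_convex_space E \<and>
     (\<forall>p. continuous_seminorm E p \<longrightarrow>
        (\<exists>q. continuous_seminorm E q \<and> (\<forall>x\<in>topspace E. p x \<le> q x) \<and>
             nuclear_canonical_map (topspace E) q p))"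

definition FN_space :: "('i \<Rightarrow> complex) topology \<Rightarrow> bool" where
  "FN_space E \<longleftrightarrow> nuclear_space E \<and> frechet_space E"

text \<open>
  HOL cannot quantify over the type underlying the predual \<open>F\<close>.  The type chosen here is no
  restriction: an \<open>(FN)\<close>-space is reflexive, so \<open>F\<close> is isomorphic to its strong bidual and hence to
  \<open>strong_dual E\<close>, which has this type.
\<close>

definition DFN_space :: "('i \<Rightarrow> complex) topology \<Rightarrow> bool" where
  "DFN_space E \<longleftrightarrow>
     (\<exists>(F :: (('i \<Rightarrow> complex) \<Rightarrow> complex) topology) h.
        FN_space F \<and> topological_isomorphism E (strong_dual F) h)"


section \<open>Derivatives on the positive orthant\<close>

definition orthant :: "(real^'d) set" where
  "orthant = {x. \<forall>l. 0 < x $ l}"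

definition closed_orthant :: "(real^'d) set" where
  "closed_orthant = {x. \<forall>l. 0 \<le> x $ l}"

definition msize :: "nat^'d \<Rightarrow> nat" where
  "msize n = (\<Sum>l\<in>UNIV. n $ l)"

definition mpow :: "real^'d \<Rightarrow> nat^'d \<Rightarrow> real" where
  "mpow x k = (\<Prod>l\<in>UNIV. x $ l ^ k $ l)"

text \<open>\<open>p\<close> to the power \<open>\<beta> p\<close>; the case distinction is needed since \<open>0 powr 0 = 0\<close> in HOL.\<close>

definition mselfpow :: "real \<Rightarrow> nat^'d \<Rightarrow> real" where
  "mselfpow \<beta> p =
     (\<Prod>l\<in>UNIV. if p $ l = 0 then 1 else real (p $ l) powr (\<beta> * real (p $ l)))"

definition partial_deriv :: "'d \<Rightarrow> (real^'d \<Rightarrow> complex) \<Rightarrow> (real^'d \<Rightarrow> complex)" where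
  "partial_deriv i f = (\<lambda>x. vector_derivative (\<lambda>s. f (x + s *\<^sub>R axis i 1)) (at 0))"

fun iter_deriv :: "'d list \<Rightarrow> (real^'d \<Rightarrow> complex) \<Rightarrow> (real^'d \<Rightarrow> complex)" where
  "iter_deriv [] f = f"
| "iter_deriv (i # js) f = partial_deriv i (iter_deriv js f)"

definition smooth_on_orthant :: "(real^'d \<Rightarrow> complex) \<Rightarrow> bool" where
  "smooth_on_orthant f \<longleftrightarrow>
     (\<forall>js. continuous_on orthant (iter_deriv js f) \<and>
           (\<forall>i. \<forall>x\<in>orthant. (\<lambda>s::real. iter_deriv js f (x + s *\<^sub>R axis i 1)) differentiable at 0))"

text \<open>For smooth \<open>f\<close> the order of differentiation is irrelevant on the orthant, hence so is the choice.\<close>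

definition mderiv :: "nat^'d \<Rightarrow> (real^'d \<Rightarrow> complex) \<Rightarrow> (real^'d \<Rightarrow> complex)" where
  "mderiv p f = iter_deriv (SOME js. \<forall>i. count_list js i = p $ i) f"


section \<open>The function spaces\<close>

text \<open>A function on the orthant is extended by \<open>0\<close> to the whole space.\<close>

definition schwartz_orthant :: "(real^'d \<Rightarrow> complex) set" where
  "schwartz_orthant =
     {f. (\<forall>x. x \<notin> orthant \<longrightarrow> f x = 0) \<and>
         smooth_on_orthant f \<and>
         (\<forall>p. \<exists>g. continuous_on closed_orthant g \<and> (\<forall>x\<in>orthant. g x = mderiv p f x)) \<and>
         (\<forall>k p. bdd_above ((\<lambda>x. mpow x k * cmod (mderiv p f x)) ` orthant))}"

text \<open>
  Applied below only to \<open>t\<^bsup>(p+k)/2\<^esup> D\<^sup>p f\<close> with \<open>f\<close> in \<^const>\<open>schwartz_orthant\<close>, which is always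
  square-integrable.
\<close>

definition l2_norm_orthant :: "(real^'d \<Rightarrow> complex) \<Rightarrow> real" where
  "l2_norm_orthant g = sqrt (LINT t:orthant|lborel. (cmod (g t))\<^sup>2)"

definition GS_quotient ::
    "real \<Rightarrow> real \<Rightarrow> (real^'d \<Rightarrow> complex) \<Rightarrow> nat^'d \<Rightarrow> nat^'d \<Rightarrow> real" where
  "GS_quotient \<alpha> A f p k =
     l2_norm_orthant
       (\<lambda>t. complex_of_real (\<Prod>l\<in>UNIV. t $ l powr (real (p $ l + k $ l) / 2)) * mderiv p f t)
     / (A ^ msize (p + k) * mselfpow (\<alpha> / 2) k * mselfpow (\<alpha> / 2) p)"

definition GS_step_carrier :: "real \<Rightarrow> real \<Rightarrow> (real^'d \<Rightarrow> complex) set" where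
  "GS_step_carrier \<alpha> A =
     {f \<in> schwartz_orthant. bdd_above (range (\<lambda>(p, k). GS_quotient \<alpha> A f p k))}"

definition GS_seminorm :: "real \<Rightarrow> real \<Rightarrow> nat \<Rightarrow> (real^'d \<Rightarrow> complex) \<Rightarrow> real" where
  "GS_seminorm \<alpha> A j f =
     (SUP (p, k). GS_quotient \<alpha> A f p k) +
     (SUP (p, k)\<in>{(p, k). msize p \<le> j \<and> msize k \<le> j}.
        SUP t\<in>orthant. cmod (complex_of_real (mpow t k) * mderiv p f t))"

definition GS_step :: "real \<Rightarrow> real \<Rightarrow> (real^'d \<Rightarrow> complex) topology" where
  "GS_step \<alpha> A = seminorm_topology (GS_step_carrier \<alpha> A) (range (GS_seminorm \<alpha> A))"

definition GS_space :: "real \<Rightarrow> (real^'d \<Rightarrow> complex) topology" where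
  "GS_space \<alpha> = lc_inductive_limit {0<..} (GS_step \<alpha>)"


section \<open>The sequence spaces\<close>

definition seq_step_carrier :: "real \<Rightarrow> real \<Rightarrow> (nat^'d \<Rightarrow> complex) set" where
  "seq_step_carrier \<alpha> a =
     {u. bdd_above (range (\<lambda>n. cmod (u n) * a powr (real (msize n) powr (1 / \<alpha>))))}"

definition seq_norm :: "real \<Rightarrow> real \<Rightarrow> (nat^'d \<Rightarrow> complex) \<Rightarrow> real" where
  "seq_norm \<alpha> a u = (SUP n. cmod (u n) * a powr (real (msize n) powr (1 / \<alpha>)))"

definition seq_step :: "real \<Rightarrow> real \<Rightarrow> (nat^'d \<Rightarrow> complex) topology" where
  "seq_step \<alpha> a = seminorm_topology (seq_step_carrier \<alpha> a) {seq_norm \<alpha> a}"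

definition seq_space :: "real \<Rightarrow> (nat^'d \<Rightarrow> complex) topology" where
  "seq_space \<alpha> = lc_inductive_limit {1<..} (seq_step \<alpha>)"


section \<open>Laguerre functions\<close>

definition laguerre_poly :: "nat \<Rightarrow> real \<Rightarrow> real" where
  "laguerre_poly j t = exp t / fact j * (deriv ^^ j) (\<lambda>s. exp (- s) * s ^ j) t"

definition laguerre_fun :: "nat^'d \<Rightarrow> real^'d \<Rightarrow> complex" where
  "laguerre_fun n t =
     (if t \<in> orthant
      then complex_of_real (\<Prod>l\<in>UNIV. laguerre_poly (n $ l) (t $ l) * exp (- (t $ l) / 2))
      else 0)"

definition laguerre_coeff :: "(real^'d \<Rightarrow> complex) \<Rightarrow> nat^'d \<Rightarrow> complex" where
  "laguerre_coeff f n = (LINT t:orthant|lborel. f t * laguerre_fun n t)"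

end

theory Submission
  imports Defs "HOL-Computational_Algebra.Polynomial"
begin

text \<open>
  The Laguerre operator \<open>R = D x D - x / 4\<close> in one variable satisfies \<open>R L = - (n + 1/2) L\<close> for the
  \<open>n\<close>-th Laguerre function \<open>L\<close>, and it is symmetric.  Hence
  \<open>(n + 1/2)\<^sup>m |\<langle>f, L\<rangle>| \<le> \<parallel>R\<^sup>m f\<parallel>\<close>.  A Hardy inequality bounds \<open>\<parallel>R\<^sup>m f\<parallel>\<close> by the weighted norms
  \<open>\<parallel>x\<^bsup>(p+k)/2\<^esup> D\<^sup>p f\<parallel>\<close> with \<open>p + k \<le> 2 m\<close>, so it grows at most like \<open>C\<^sup>m m\<^bsup>\<alpha> m\<^esup>\<close>; the optimal choice
  of \<open>m\<close> in the direction of the largest component of the index gives coefficients of order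
  \<open>exp (- c |n|\<^bsup>1/\<alpha>\<^esup>)\<close>.  Conversely, an energy identity for the differentiated Laguerre equation
  shows that the weighted norms of a Laguerre function are at most
  \<open>C\<^bsup>|p+k|\<^esup> exp (\<delta> |n|\<^bsup>1/\<alpha>\<^esup>) p\<^bsup>(\<alpha>/2) p\<^esup> k\<^bsup>(\<alpha>/2) k\<^esup>\<close> with \<open>\<delta>\<close> as small as one likes, so that a
  series with coefficients in the sequence space converges.  The two maps are mutually inverse because
  the Laguerre functions are complete: by Parseval's identity for \<open>exp (- (m + 1/2) x)\<close>, a function
  orthogonal to all of them is orthogonal to \<open>exp (- x / 2)\<close> times each polynomial in \<open>exp (- x)\<close>,
  and the Stone-Weierstrass theorem applies.

  Nuclearity, reflexivity and summability only depend on the sequence space: its unit vectors form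
  an absolute basis, and the ratio of the weights of two consecutive steps is summable.
\<close>

section \<open>Locally convex topologies given by seminorms: neighbourhoods, continuity, bounded
  sets, inductive limits\<close>

section \<open>Seminorm topologies\<close>

text \<open>One direction suffices for the coefficients: the largest component \<open>n_l\<close> of
  \<open>n\<close> satisfies \<open>|n| \<le> d * n_l\<close>, so powers of the operator in
  \<open>x $ l\<close> alone already give decay in \<open>|n|\<close>. The seminorms control
  \<open>D^p f\<close> only with a weight whose exponent \<open>(p + k) / 2\<close> is at least
  \<open>p / 2\<close>, whereas \<open>R\<close> creates \<open>(p + 1) D^(p+1) f\<close> with
  exponent \<open>(p + k) / 2\<close>, too little if \<open>k = 0\<close>; the Hardy inequality
  repairs this. In the other direction the rate \<open>a > 1\<close> of the given coefficients may
  be arbitrarily close to 1, so the growth of the weighted norms of the Laguerre functions must be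
  made arbitrarily slow; this costs only a larger constant \<open>A\<close> of the step. For the
  dual, the crux is regularity of the inductive limit: each bounded set lies in a ball of one step.
  It reduces the strong topology to countably many norms, and passing from one of them to the next
  gains a summable factor, which yields nuclearity.\<close>

lemma sum_fun_apply: "(\<Sum>i\<in>A. f i) x = (\<Sum>i\<in>A. f i x)"
  for f :: "'a \<Rightarrow> 'b \<Rightarrow> 'c::comm_monoid_add"
  by (induction A rule: infinite_finite_induct) auto

lemma cscale_apply [simp]: "(c *\<^sub>F f) x = c * f x"
  by (simp add: cscale_def)

lemma seminorm_onD:
  assumes "seminorm_on S p"
  shows "x \<in> S \<Longrightarrow> 0 \<le> p x"
    and "x \<in> S \<Longrightarrow> y \<in> S \<Longrightarrow> p (x + y) \<le> p x + p y"
    and "x \<in> S \<Longrightarrow> p (c *\<^sub>F x) = cmod c * p x"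
  using assms by (auto simp: seminorm_on_def)

lemma seminorm_on_minus_commute:
  assumes "seminorm_on S p" "cfun.subspace S" "x \<in> S" "y \<in> S"
  shows "p (x - y) = p (y - x)"
proof -
  have "x - y = (-1) *\<^sub>F (y - x)" by (auto simp: fun_eq_iff)
  then show ?thesis using seminorm_onD(3)[OF assms(1), of "y - x" "-1"] assms
    by (simp add: cfun.subspace_diff)
qed

lemma seminorm_on_triangle3:
  assumes "seminorm_on S p" "cfun.subspace S" "x \<in> S" "y \<in> S" "z \<in> S"
  shows "p (x - z) \<le> p (x - y) + p (y - z)"
proof -
  have "x - z = (x - y) + (y - z)" by (simp add: fun_eq_iff)
  then show ?thesis using seminorm_onD(2)[OF assms(1), of "x - y" "y - z"] assms
    by (simp add: cfun.subspace_diff)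
qed

lemma seminorm_on_le_add:
  assumes "seminorm_on S p" "cfun.subspace S" "x \<in> S" "y \<in> S"
  shows "p x \<le> p y + p (x - y)"
proof -
  have "x = y + (x - y)" by (simp add: fun_eq_iff)
  then show ?thesis using seminorm_onD(2)[OF assms(1), of "y" "x - y"] assms
    by (simp add: cfun.subspace_diff)
qed

lemma seminorm_on_zero:
  assumes "seminorm_on S p" "cfun.subspace S"
  shows "p 0 = 0"
proof -
  have "(0::'a \<Rightarrow> complex) = 0 *\<^sub>F 0" by (auto simp: fun_eq_iff)
  then show ?thesis using seminorm_onD(3)[OF assms(1), of 0 0] assms(2)
    by (simp add: cfun.subspace_0)
qed

lemma seminorm_on_sum:
  assumes p: "seminorm_on S p" and S: "cfun.subspace S" and "finite N" "\<And>i. i \<in> N \<Longrightarrow> f i \<in> S"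
  shows "p (\<Sum>i\<in>N. f i) \<le> (\<Sum>i\<in>N. p (f i))"
  using assms(3,4)
proof (induction N)
  case empty then show ?case using seminorm_on_zero[OF p S] by (simp only: sum.empty order_refl)
next
  case (insert i N)
  have "(\<Sum>i\<in>N. f i) \<in> S" using insert by (intro cfun.subspace_sum[OF S]) auto
  then have "p (f i + (\<Sum>i\<in>N. f i)) \<le> p (f i) + p (\<Sum>i\<in>N. f i)"
    using insert by (intro seminorm_onD(2)[OF p]) auto
  moreover have "p (\<Sum>i\<in>N. f i) \<le> (\<Sum>i\<in>N. p (f i))" using insert by blast
  ultimately show ?case unfolding sum.insert[OF insert.hyps] by linarith
qed

lemma seminorm_on_subset: "seminorm_on S p \<Longrightarrow> S' \<subseteq> S \<Longrightarrow> seminorm_on S' p"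
  unfolding seminorm_on_def by blast

lemma seminorm_on_sum_family:
  assumes "finite F" "\<And>q. q \<in> F \<Longrightarrow> seminorm_on S (g q)"
  shows "seminorm_on S (\<lambda>x. \<Sum>q\<in>F. g q x)"
  using assms unfolding seminorm_on_def
  by (auto simp: sum_nonneg sum_distrib_left sum.distrib[symmetric] intro!: sum_mono)

lemma seminorm_on_cmult:
  assumes "seminorm_on S p" "0 \<le> c"
  shows "seminorm_on S (\<lambda>x. c * p x)"
  unfolding seminorm_on_def
proof (intro conjI ballI allI)
  fix x y assume xy: "x \<in> S" "y \<in> S"
  have "c * p (x + y) \<le> c * (p x + p y)"
    using seminorm_onD(2)[OF assms(1) xy] assms(2) by (rule mult_left_mono)
  then show "c * p (x + y) \<le> c * p x + c * p y" by (simp add: distrib_left)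
qed (use assms seminorm_onD[OF assms(1)] in auto)

lemma seminorm_on_compose:
  assumes "seminorm_on S' q" "linear_map_on S f" "f ` S \<subseteq> S'"
  shows "seminorm_on S (\<lambda>x. q (f x))"
  using assms unfolding seminorm_on_def linear_map_on_def by (auto simp: image_subset_iff)

lemma seminorm_on_SUP:
  assumes "K \<noteq> {}" "\<And>k. k \<in> K \<Longrightarrow> seminorm_on S (g k)"
    and bdd: "\<And>x. x \<in> S \<Longrightarrow> bdd_above ((\<lambda>k. g k x) ` K)" and S: "cfun.subspace S"
  shows "seminorm_on S (\<lambda>x. SUP k\<in>K. g k x)"
  unfolding seminorm_on_def
proof (intro conjI ballI allI)
  fix x assume x: "x \<in> S"
  obtain k where k: "k \<in> K" using assms(1) by auto
  show "0 \<le> (SUP k\<in>K. g k x)"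
    using cSUP_upper[OF k bdd[OF x]] seminorm_onD(1)[OF assms(2)[OF k] x] by linarith
next
  fix x y assume x: "x \<in> S" and y: "y \<in> S"
  show "(SUP k\<in>K. g k (x + y)) \<le> (SUP k\<in>K. g k x) + (SUP k\<in>K. g k y)"
  proof (rule cSUP_least[OF assms(1)])
    fix k assume k: "k \<in> K"
    show "g k (x + y) \<le> (SUP k\<in>K. g k x) + (SUP k\<in>K. g k y)"
      using seminorm_onD(2)[OF assms(2)[OF k] x y] cSUP_upper[OF k bdd[OF x]]
        cSUP_upper[OF k bdd[OF y]] by linarith
  qed
next
  fix c x assume x: "x \<in> S"
  have eq: "(SUP k\<in>K. g k (c *\<^sub>F x)) = (SUP k\<in>K. cmod c * g k x)"
    using seminorm_onD(3)[OF assms(2) x] by (intro SUP_cong) auto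
  show "(SUP k\<in>K. g k (c *\<^sub>F x)) = cmod c * (SUP k\<in>K. g k x)"
  proof (cases "c = 0")
    case True
    then show ?thesis using eq assms(1) by simp
  next
    case False
    have "(SUP k\<in>K. cmod c * g k x) \<le> cmod c * (SUP k\<in>K. g k x)"
      by (intro cSUP_least assms(1) mult_left_mono cSUP_upper bdd x) auto
    moreover have "(SUP k\<in>K. g k x) \<le> (SUP k\<in>K. cmod c * g k x) / cmod c"
    proof (intro cSUP_least assms(1))
      fix k assume k: "k \<in> K"
      have "bdd_above ((\<lambda>k. cmod c * g k x) ` K)"
      proof -
        obtain M where "\<And>k. k \<in> K \<Longrightarrow> g k x \<le> M" using bdd[OF x] by (auto simp: bdd_above_def)
        then show ?thesis by (intro bdd_aboveI2[of _ _ "cmod c * M"] mult_left_mono) auto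
      qed
      from cSUP_upper[OF k this] show "g k x \<le> (SUP k\<in>K. cmod c * g k x) / cmod c"
        using False by (simp add: field_simps)
    qed
    ultimately show ?thesis using eq False by (simp add: field_simps)
  qed
qed

lemma openin_seminorm_subbasis:
  "p \<in> P \<Longrightarrow> x \<in> S \<Longrightarrow> 0 < e \<Longrightarrow> openin (seminorm_topology S P) {y \<in> S. p (y - x) < e}"
  unfolding seminorm_topology_def by (rule topology_generated_by_Basis) blast

text \<open>The subbasic sets are balls around arbitrary centres; the triangle inequality places a
  smaller ball around each of their points, so finite intersections of balls centred at the point
  form a neighbourhood base.\<close>

lemma openin_seminorm_topology_iff:
  assumes S: "cfun.subspace S" and P: "\<And>p. p \<in> P \<Longrightarrow> seminorm_on S p"
  shows "openin (seminorm_topology S P) U \<longleftrightarrow>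
    U \<subseteq> S \<and> (\<forall>x\<in>U. \<exists>F e. finite F \<and> F \<subseteq> P \<and> 0 < e \<and> {y \<in> S. \<forall>p\<in>F. p (y - x) < e} \<subseteq> U)"
proof
  assume "openin (seminorm_topology S P) U"
  then have "generate_topology_on
      (insert S {{y \<in> S. p (y - x) < e} | p x e. p \<in> P \<and> x \<in> S \<and> 0 < e}) U"
    by (simp add: seminorm_topology_def openin_topology_generated_by_iff)
  then show "U \<subseteq> S \<and> (\<forall>x\<in>U. \<exists>F e. finite F \<and> F \<subseteq> P \<and> 0 < e \<and>
      {y \<in> S. \<forall>p\<in>F. p (y - x) < e} \<subseteq> U)"
  proof induction
    case Empty then show ?case by simp
  next
    case (Int a b)
    show ?case
    proof (intro conjI ballI)
      show "a \<inter> b \<subseteq> S" using Int by blast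
      fix x assume x: "x \<in> a \<inter> b"
      obtain F e where 1: "finite F" "F \<subseteq> P" "0 < e" "{y \<in> S. \<forall>p\<in>F. p (y - x) < e} \<subseteq> a"
        using Int x by blast
      obtain G d where 2: "finite G" "G \<subseteq> P" "0 < d" "{y \<in> S. \<forall>p\<in>G. p (y - x) < d} \<subseteq> b"
        using Int x by blast
      show "\<exists>F e. finite F \<and> F \<subseteq> P \<and> 0 < e \<and> {y \<in> S. \<forall>p\<in>F. p (y - x) < e} \<subseteq> a \<inter> b"
        using 1 2 by (intro exI[of _ "F \<union> G"] exI[of _ "min e d"]) (auto simp: subset_iff)
    qed
  next
    case (UN K)
    show ?case
    proof (intro conjI ballI)
      show "\<Union>K \<subseteq> S" using UN.IH by blast
      fix x assume "x \<in> \<Union>K"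
      then obtain k where k: "k \<in> K" "x \<in> k" by blast
      then obtain F e where "finite F" "F \<subseteq> P" "0 < e" "{y \<in> S. \<forall>p\<in>F. p (y - x) < e} \<subseteq> k"
        using UN.IH[of k] by blast
      with k(1) show "\<exists>F e. finite F \<and> F \<subseteq> P \<and> 0 < e \<and> {y \<in> S. \<forall>p\<in>F. p (y - x) < e} \<subseteq> \<Union>K"
        by (intro exI[of _ F] exI[of _ e]) blast
    qed
  next
    case (Basis s)
    then consider "s = S" | p x e where "s = {y \<in> S. p (y - x) < e}" "p \<in> P" "x \<in> S" "0 < e"
      by blast
    then show ?case
    proof cases
      case 1 then show ?thesis
        by (auto intro!: exI[of _ "{}"] exI[of _ "1::real"])
    next
      case 2
      show ?thesis
      proof (intro conjI ballI)
        show "s \<subseteq> S" using 2 by blast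
        fix z assume z: "z \<in> s"
        have "{y \<in> S. \<forall>p\<in>{p}. p (y - z) < e - p (z - x)} \<subseteq> s"
          using 2 z seminorm_on_triangle3[OF P[OF 2(2)] S] by fastforce
        then show "\<exists>F e. finite F \<and> F \<subseteq> P \<and> 0 < e \<and> {y \<in> S. \<forall>p\<in>F. p (y - z) < e} \<subseteq> s"
          using 2 z by (intro exI[of _ "{p}"] exI[of _ "e - p (z - x)"]) auto
      qed
    qed
  qed
next
  assume U: "U \<subseteq> S \<and> (\<forall>x\<in>U. \<exists>F e. finite F \<and> F \<subseteq> P \<and> 0 < e \<and>
      {y \<in> S. \<forall>p\<in>F. p (y - x) < e} \<subseteq> U)"
  show "openin (seminorm_topology S P) U"
  proof (subst openin_subopen, intro ballI)
    fix x assume x: "x \<in> U"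
    then obtain F e where F: "finite F" "F \<subseteq> P" "0 < e" "{y \<in> S. \<forall>p\<in>F. p (y - x) < e} \<subseteq> U"
      using U by blast
    have xS: "x \<in> S" using x U by blast
    let ?V = "\<Inter>(insert S ((\<lambda>p. {y \<in> S. p (y - x) < e}) ` F))"
    have "openin (seminorm_topology S P) S"
      using openin_topspace[of "seminorm_topology S P"] by simp
    then have "openin (seminorm_topology S P) ?V"
      using F xS by (intro openin_Inter) (auto intro!: openin_seminorm_subbasis)
    moreover have "?V \<subseteq> U" using F(4) by auto
    moreover have "x \<in> ?V"
    proof -
      have "p (x - x) < e" if "p \<in> F" for p
        using seminorm_on_zero[OF P S, of p] F that by auto
      then show ?thesis using xS by blast
    qed
    ultimately show "\<exists>T. openin (seminorm_topology S P) T \<and> x \<in> T \<and> T \<subseteq> U" by blast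
  qed
qed

lemma openin_seminormI:
  assumes S: "cfun.subspace S" and P: "\<And>p. p \<in> P \<Longrightarrow> seminorm_on S p" and "U \<subseteq> S"
    and "\<And>x. x \<in> U \<Longrightarrow> \<exists>p\<in>P. \<exists>e>0. {y \<in> S. p (y - x) < e} \<subseteq> U"
  shows "openin (seminorm_topology S P) U"
proof (subst openin_seminorm_topology_iff)
  show "U \<subseteq> S \<and> (\<forall>x\<in>U. \<exists>F e. finite F \<and> F \<subseteq> P \<and> 0 < e \<and> {y \<in> S. \<forall>p\<in>F. p (y - x) < e} \<subseteq> U)"
  proof (intro conjI ballI)
    fix x assume "x \<in> U"
    then obtain p e where "p \<in> P" "e > 0" "{y \<in> S. p (y - x) < e} \<subseteq> U" using assms(4) by blast
    then show "\<exists>F e. finite F \<and> F \<subseteq> P \<and> 0 < e \<and> {y \<in> S. \<forall>p\<in>F. p (y - x) < e} \<subseteq> U"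
      by (intro exI[of _ "{p}"] exI[of _ e]) auto
  qed fact
qed (use S P in auto)

lemma openin_seminormD:
  assumes S: "cfun.subspace S" and P: "\<And>p. p \<in> P \<Longrightarrow> seminorm_on S p"
    and "openin (seminorm_topology S P) U" "x \<in> U"
  obtains F e where "finite F" "F \<subseteq> P" "0 < e" "{y \<in> S. \<forall>p\<in>F. p (y - x) < e} \<subseteq> U"
proof -
  have "\<forall>x\<in>U. \<exists>F e. finite F \<and> F \<subseteq> P \<and> 0 < e \<and> {y \<in> S. \<forall>p\<in>F. p (y - x) < e} \<subseteq> U"
    by (rule iffD1[OF openin_seminorm_topology_iff[OF S P] assms(3), THEN conjunct2])
  then obtain F e where "finite F" "F \<subseteq> P" "0 < e" "{y \<in> S. \<forall>p\<in>F. p (y - x) < e} \<subseteq> U"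
    using assms(4) by (elim ballE exE conjE) auto
  then show thesis by (rule that)
qed

lemma linear_map_on_diff:
  assumes "linear_map_on S f" "cfun.subspace S" "x \<in> S" "y \<in> S"
  shows "f (y - x) = f y - f x"
proof -
  have "f (y + (-1) *\<^sub>F x) = f y + f ((-1) *\<^sub>F x)"
    using assms cfun.subspace_scale unfolding linear_map_on_def by blast
  moreover have "f ((-1) *\<^sub>F x) = (-1) *\<^sub>F f x" using assms unfolding linear_map_on_def by blast
  moreover have "y + (-1) *\<^sub>F x = y - x" "f y + (-1) *\<^sub>F f x = f y - f x"
    by (auto simp: fun_eq_iff)
  ultimately show ?thesis by simp
qed

lemma linear_map_on_inv_into:
  assumes "cfun.subspace S" "linear_map_on S f" "bij_betw f S S'"
  shows "linear_map_on S' (inv_into S f)"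
proof -
  let ?g = "inv_into S f"
  have gf: "?g (f x) = x" if "x \<in> S" for x using assms that by (simp add: bij_betw_inv_into_left)
  have fg: "f (?g y) = y" "?g y \<in> S" if "y \<in> S'" for y
    using assms that by (auto simp: bij_betw_inv_into_right bij_betw_def inv_into_into)
  show ?thesis
    unfolding linear_map_on_def
  proof (intro conjI ballI allI)
    fix x y assume "x \<in> S'" "y \<in> S'"
    then have "f (?g x + ?g y) = x + y" "?g x + ?g y \<in> S"
      using assms fg cfun.subspace_add[OF assms(1)] unfolding linear_map_on_def by auto
    then show "?g (x + y) = ?g x + ?g y" using gf by metis
  next
    fix c x assume "x \<in> S'"
    then have "f (c *\<^sub>F ?g x) = c *\<^sub>F x" "c *\<^sub>F ?g x \<in> S"
      using assms fg cfun.subspace_scale[OF assms(1)] unfolding linear_map_on_def by auto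
    then show "?g (c *\<^sub>F x) = c *\<^sub>F ?g x" using gf by metis
  qed
qed

text \<open>A linear estimate \<open>q (f x) \<le> C * p x\<close> maps balls into balls. One
  dominating \<open>p\<close> is asked for rather than a finite sum; every later estimate is of this
  kind.\<close>

lemma continuous_map_seminorm_topology:
  assumes S: "cfun.subspace S" and P: "\<And>p. p \<in> P \<Longrightarrow> seminorm_on S p"
    and S': "cfun.subspace S'" and Q: "\<And>q. q \<in> Q \<Longrightarrow> seminorm_on S' q"
    and f: "linear_map_on S f" "f ` S \<subseteq> S'"
    and dom: "\<And>q. q \<in> Q \<Longrightarrow> \<exists>p\<in>P. \<exists>C. \<forall>x\<in>S. q (f x) \<le> C * p x"
  shows "continuous_map (seminorm_topology S P) (seminorm_topology S' Q) f"
proof -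
  have fdiff: "f (y - x) = f y - f x" if "x \<in> S" "y \<in> S" for x y
    using linear_map_on_diff[OF f(1) S that] .
  show ?thesis
    unfolding seminorm_topology_def[of S' Q]
  proof (rule continuous_on_generated_topo)
    show "f ` topspace (seminorm_topology S P) \<subseteq>
      \<Union> (insert S' {{y \<in> S'. p (y - x) < e} |p x e. p \<in> Q \<and> x \<in> S' \<and> 0 < e})"
      using f by auto
    fix U assume "U \<in> insert S' {{y \<in> S'. p (y - x) < e} |p x e. p \<in> Q \<and> x \<in> S' \<and> 0 < e}"
    then consider "U = S'" | q z e where "U = {y \<in> S'. q (y - z) < e}" "q \<in> Q" "z \<in> S'" "0 < e"
      by blast
    then show "openin (seminorm_topology S P) (f -` U \<inter> topspace (seminorm_topology S P))"
    proof cases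
      case 1
      then have "f -` U \<inter> topspace (seminorm_topology S P) = topspace (seminorm_topology S P)"
        using f by auto
      then show ?thesis by (metis openin_topspace)
    next
      case 2
      obtain p C where p: "p \<in> P" "\<And>x. x \<in> S \<Longrightarrow> q (f x) \<le> C * p x" using dom[OF 2(2)] by blast
      show ?thesis
      proof (rule openin_seminormI[OF S P])
        show "f -` U \<inter> topspace (seminorm_topology S P) \<subseteq> S" by simp
        fix x assume "x \<in> f -` U \<inter> topspace (seminorm_topology S P)"
        then have x: "x \<in> S" "f x \<in> S'" "q (f x - z) < e" using 2 by auto
        \<comment> \<open>\<open>\<bar>C\<bar> + 1\<close> is positive for every real
          \<open>C\<close>, so no sign has to be assumed.\<close>
        define d where "d = (e - q (f x - z)) / (\<bar>C\<bar> + 1)"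
        have d: "0 < d" using x by (simp add: d_def)
        have "{y \<in> S. \<forall>p\<in>{p}. p (y - x) < d} \<subseteq> f -` U \<inter> topspace (seminorm_topology S P)"
        proof
          fix y assume "y \<in> {y \<in> S. \<forall>p\<in>{p}. p (y - x) < d}"
          then have y: "y \<in> S" "p (y - x) < d" by auto
          have yx: "y - x \<in> S" using S x y by (simp add: cfun.subspace_diff)
          have p0: "0 \<le> p (y - x)" using seminorm_onD(1)[OF P[OF p(1)] yx] .
          have "q (f y - f x) \<le> C * p (y - x)" using p(2)[OF yx] fdiff x y by simp
          also have "\<dots> \<le> \<bar>C\<bar> * p (y - x)" using p0 by (intro mult_right_mono) auto
          also have "\<dots> \<le> (\<bar>C\<bar> + 1) * p (y - x)" using p0 by (intro mult_right_mono) auto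
          also have "\<dots> < (\<bar>C\<bar> + 1) * d" using y by (intro mult_strict_left_mono) auto
          also have "\<dots> = e - q (f x - z)" by (simp add: d_def)
          finally have "q (f y - f x) < e - q (f x - z)" .
          moreover have "f y \<in> S'" using f y by auto
          moreover have "q (f y - z) \<le> q (f y - f x) + q (f x - z)"
            using seminorm_on_triangle3[OF Q[OF 2(2)] S' \<open>f y \<in> S'\<close> x(2) 2(3)] .
          ultimately show "y \<in> f -` U \<inter> topspace (seminorm_topology S P)"
            using 2 y by auto
        qed
        then show "\<exists>p\<in>P. \<exists>e>0. {y \<in> S. p (y - x) < e} \<subseteq> f -` U \<inter> topspace (seminorm_topology S P)"
          using p d by (intro bexI[of _ p] exI[of _ d]) auto
      qed
    qed
  qed
qed

lemma linear_map_on_id: "linear_map_on S (\<lambda>x. x)"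
  by (simp add: linear_map_on_def)

lemma seminorm_topology_eq:
  assumes S: "cfun.subspace S" and P: "\<And>p. p \<in> P \<Longrightarrow> seminorm_on S p"
    and Q: "\<And>q. q \<in> Q \<Longrightarrow> seminorm_on S q"
    and "\<And>q. q \<in> Q \<Longrightarrow> \<exists>p\<in>P. \<exists>C. \<forall>x\<in>S. q x \<le> C * p x"
    and "\<And>p. p \<in> P \<Longrightarrow> \<exists>q\<in>Q. \<exists>C. \<forall>x\<in>S. p x \<le> C * q x"
  shows "seminorm_topology S P = seminorm_topology S Q"
proof -
  have "continuous_map (seminorm_topology S P) (seminorm_topology S Q) (\<lambda>x. x)"
    using assms by (intro continuous_map_seminorm_topology linear_map_on_id) auto
  moreover have "continuous_map (seminorm_topology S Q) (seminorm_topology S P) (\<lambda>x. x)"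
    using assms by (intro continuous_map_seminorm_topology linear_map_on_id) auto
  moreover have "openin (seminorm_topology S P') U"
    if "continuous_map (seminorm_topology S P') (seminorm_topology S Q') (\<lambda>x. x)"
      "openin (seminorm_topology S Q') U" for P' Q' U
  proof -
    have "U \<subseteq> S" using openin_subset[OF that(2)] by simp
    then have "{x \<in> topspace (seminorm_topology S P'). x \<in> U} = U" by auto
    then show ?thesis using openin_continuous_map_preimage[OF that] by simp
  qed
  ultimately show ?thesis unfolding topology_eq by blast
qed

lemma continuous_map_seminormI:
  assumes S: "cfun.subspace S" and P: "\<And>p. p \<in> P \<Longrightarrow> seminorm_on S p"
    and p: "seminorm_on S p" and q: "q \<in> P" and dom: "\<And>x. x \<in> S \<Longrightarrow> p x \<le> C * q x"
  shows "continuous_map (seminorm_topology S P) euclideanreal p"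
  unfolding continuous_map_def
proof (intro conjI allI impI)
  show "p \<in> topspace (seminorm_topology S P) \<rightarrow> topspace euclideanreal" by simp
  fix U :: "real set" assume "openin euclideanreal U"
  then have U: "open U" by simp
  show "openin (seminorm_topology S P) {x \<in> topspace (seminorm_topology S P). p x \<in> U}"
  proof (rule openin_seminormI[OF S P])
    show "{x \<in> topspace (seminorm_topology S P). p x \<in> U} \<subseteq> S" by auto
    fix x assume "x \<in> {x \<in> topspace (seminorm_topology S P). p x \<in> U}"
    then have x: "x \<in> S" "p x \<in> U" by auto
    then obtain e where e: "0 < e" "ball (p x) e \<subseteq> U" using U open_contains_ball by blast
    define d where "d = e / (\<bar>C\<bar> + 1)"
    have d: "0 < d" using e by (simp add: d_def)
    have "{y \<in> S. \<forall>p\<in>{q}. p (y - x) < d} \<subseteq> {x \<in> topspace (seminorm_topology S P). p x \<in> U}"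
    proof
      fix y assume "y \<in> {y \<in> S. \<forall>p\<in>{q}. p (y - x) < d}"
      then have y: "y \<in> S" "q (y - x) < d" by auto
      have yx: "y - x \<in> S" using S x y by (simp add: cfun.subspace_diff)
      have q0: "0 \<le> q (y - x)" using seminorm_onD(1)[OF P[OF q] yx] .
      have "p (y - x) \<le> C * q (y - x)" using dom[OF yx] .
      also have "\<dots> \<le> (\<bar>C\<bar> + 1) * q (y - x)" using q0 by (intro mult_right_mono) auto
      also have "\<dots> < (\<bar>C\<bar> + 1) * d" using y by (intro mult_strict_left_mono) auto
      also have "\<dots> = e" by (simp add: d_def)
      finally have "p (y - x) < e" .
      then have "dist (p x) (p y) < e"
        using seminorm_on_le_add[OF p S x(1) y(1)] seminorm_on_le_add[OF p S y(1) x(1)]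
          seminorm_on_minus_commute[OF p S x(1) y(1)] by (simp add: dist_real_def)
      then show "y \<in> {x \<in> topspace (seminorm_topology S P). p x \<in> U}" using e y by auto
    qed
    then show "\<exists>q\<in>P. \<exists>e>0. {y \<in> S. q (y - x) < e} \<subseteq> {x \<in> topspace (seminorm_topology S P). p x \<in> U}"
      using q d by (intro bexI[of _ q] exI[of _ d]) auto
  qed
qed

text \<open>Homogeneity: a continuous \<open>p\<close> is below 1 on some finite intersection of
  balls at 0, and every \<open>x\<close> can be scaled into that set. This is the counterpart of
  \<open>continuous_map_seminormI\<close>.\<close>

lemma continuous_seminorm_bound:
  assumes S: "cfun.subspace S" and P: "\<And>p. p \<in> P \<Longrightarrow> seminorm_on S p"
    and p: "seminorm_on S p" and cont: "continuous_map (seminorm_topology S P) euclideanreal p"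
  obtains F C where "finite F" "F \<subseteq> P" "0 \<le> C" "\<And>x. x \<in> S \<Longrightarrow> p x \<le> C * (\<Sum>q\<in>F. q x)"
proof -
  have "openin (seminorm_topology S P) {x \<in> topspace (seminorm_topology S P). p x \<in> {..<1}}"
    using cont by (rule openin_continuous_map_preimage) auto
  moreover have "0 \<in> {x \<in> topspace (seminorm_topology S P). p x \<in> {..<1}}"
    using seminorm_on_zero[OF p S] cfun.subspace_0[OF S] by simp
  ultimately obtain F e where F: "finite F" "F \<subseteq> P" "0 < e"
    and sub: "{y \<in> S. \<forall>p\<in>F. p (y - 0) < e} \<subseteq> {x \<in> topspace (seminorm_topology S P). p x \<in> {..<1}}"
    by (rule openin_seminormD[OF S P, rotated]) blast
  have "p x \<le> (1 / e) * (\<Sum>q\<in>F. q x)" if x: "x \<in> S" for x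
  proof (rule field_le_epsilon)
    fix d :: real assume d: "0 < d"
    let ?Q = "\<Sum>q\<in>F. q x"
    have nn: "0 \<le> q x" if "q \<in> F" for q using seminorm_onD(1)[OF P x] F that by blast
    have Q: "0 \<le> ?Q" using nn by (rule sum_nonneg)
    \<comment> \<open>The summand \<open>e * d\<close> keeps the scaling factor finite even if all
      \<open>q x\<close> vanish; \<open>d\<close> is arbitrary and disappears through
      \<open>field_le_epsilon\<close>.\<close>
    define t where "t = ?Q + e * d"
    have t: "0 < t" using Q d F by (simp add: t_def add_nonneg_pos)
    let ?y = "complex_of_real (e / t) *\<^sub>F x"
    have y: "?y \<in> S" using x S by (simp add: cfun.subspace_scale)
    have "q ?y < e" if q: "q \<in> F" for q
    proof -
      have "q ?y = (e / t) * q x"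
        using seminorm_onD(3)[OF P x, of q "complex_of_real (e / t)"] F q t
        by (auto simp: norm_divide)
      also have "\<dots> \<le> (e / t) * ?Q"
        using F t q nn by (intro mult_left_mono member_le_sum) auto
      also have "\<dots> < (e / t) * t"
        using F t d by (intro mult_strict_left_mono) (auto simp: t_def)
      finally show ?thesis using t by simp
    qed
    then have "p ?y < 1" using sub y by auto
    moreover have "p ?y = (e / t) * p x"
      using seminorm_onD(3)[OF p x, of "complex_of_real (e / t)"] F t
      by (auto simp: norm_divide)
    ultimately have "(e / t) * p x < 1" by linarith
    then have "p x < t / e" using t F by (simp add: field_simps)
    then show "p x \<le> (1 / e) * ?Q + d" using F by (simp add: t_def field_simps)
  qed
  then show thesis using F by (intro that[of F "1/e"]) auto
qed

lemma continuous_seminorm_bound_ex: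
  assumes "cfun.subspace S" "\<And>p. p \<in> P \<Longrightarrow> seminorm_on S p"
    and "seminorm_on S p" "continuous_map (seminorm_topology S P) euclideanreal p"
  shows "\<exists>F C. finite F \<and> F \<subseteq> P \<and> 0 \<le> C \<and> (\<forall>x\<in>S. p x \<le> C * (\<Sum>q\<in>F. q x))"
proof -
  show ?thesis
  proof (rule continuous_seminorm_bound[OF assms], assumption)
    fix F C assume "finite F" "F \<subseteq> P" "0 \<le> C" "\<And>x. x \<in> S \<Longrightarrow> p x \<le> C * (\<Sum>q\<in>F. q x)"
    then show ?thesis by blast
  qed
qed

text \<open>The generating seminorms of a limit are those continuous on every step. Such a seminorm
  composed with \<open>f\<close> is again of this kind as soon as \<open>f\<close> maps each step
  continuously into some step of the other system; the steps need not correspond one to one.\<close>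

lemma lc_inductive_limit_isomorphism:
  fixes E :: "'k \<Rightarrow> ('i \<Rightarrow> complex) topology" and F :: "'l \<Rightarrow> ('j \<Rightarrow> complex) topology"
    and I :: "'k set" and J :: "'l set"
  defines "S \<equiv> (\<Union>k\<in>I. topspace (E k))" and "S' \<equiv> (\<Union>k\<in>J. topspace (F k))"
  assumes S: "cfun.subspace S" and lin: "linear_map_on S f" and bij: "bij_betw f S S'"
    and fE: "\<And>k. k \<in> I \<Longrightarrow> \<exists>l\<in>J. continuous_map (E k) (F l) f"
    and gF: "\<And>l. l \<in> J \<Longrightarrow> \<exists>k\<in>I. continuous_map (F l) (E k) (inv_into S f)"
  shows "topological_isomorphism (lc_inductive_limit I E) (lc_inductive_limit J F) f"
proof -
  define g where "g = inv_into S f"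
  have gf: "g (f x) = x" if "x \<in> S" for x using bij that by (simp add: g_def bij_betw_inv_into_left)
  have fg: "f (g y) = y" "g y \<in> S" if "y \<in> S'" for y
    using bij that by (auto simp: g_def bij_betw_inv_into_right bij_betw_def inv_into_into)
  have fS: "f x \<in> S'" if "x \<in> S" for x using bij that by (auto simp: bij_betw_def)
  have fdiff: "f (y - x) = f y - f x" if "x \<in> S" "y \<in> S" for x y
    using linear_map_on_diff[OF lin S that] .
  have ling: "linear_map_on S' g"
    unfolding g_def by (rule linear_map_on_inv_into[OF S lin bij])
  have gdiff: "g (y - x) = g y - g x" if "x \<in> S'" "y \<in> S'" for x y
    using fdiff fg gf S that by (metis cfun.subspace_diff)
  let ?P = "{p. seminorm_on S p \<and> (\<forall>k\<in>I. continuous_map (E k) euclideanreal p)}"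
  let ?Q = "{p. seminorm_on S' p \<and> (\<forall>k\<in>J. continuous_map (F k) euclideanreal p)}"
  have E: "lc_inductive_limit I E = seminorm_topology S ?P"
    by (simp add: lc_inductive_limit_def S_def Let_def)
  have F: "lc_inductive_limit J F = seminorm_topology S' ?Q"
    by (simp add: lc_inductive_limit_def S'_def Let_def)
  have contf: "continuous_map (seminorm_topology S ?P) (seminorm_topology S' ?Q) f"
    unfolding seminorm_topology_def[of S']
  proof (rule continuous_on_generated_topo)
    show "f ` topspace (seminorm_topology S ?P) \<subseteq>
      \<Union> (insert S' {{y \<in> S'. p (y - x) < e} |p x e. p \<in> ?Q \<and> x \<in> S' \<and> 0 < e})"
      using fS by auto
    fix U assume "U \<in> insert S' {{y \<in> S'. p (y - x) < e} |p x e. p \<in> ?Q \<and> x \<in> S' \<and> 0 < e}"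
    then consider "U = S'" | q z e where "U = {y \<in> S'. q (y - z) < e}" "q \<in> ?Q" "z \<in> S'" "0 < e"
      by blast
    then show "openin (seminorm_topology S ?P) (f -` U \<inter> topspace (seminorm_topology S ?P))"
    proof cases
      case 1
      then have "f -` U \<inter> topspace (seminorm_topology S ?P) = topspace (seminorm_topology S ?P)"
        using fS by auto
      then show ?thesis by (metis openin_topspace)
    next
      case 2
      have "f -` U \<inter> topspace (seminorm_topology S ?P) = {x \<in> S. (q \<circ> f) (x - g z) < e}"
        using 2 fS fdiff fg by auto
      moreover have "seminorm_on S (q \<circ> f)"
        using seminorm_on_compose[of S' q S f] 2 lin fS by (auto simp: comp_def)
      moreover have "continuous_map (E k) euclideanreal (q \<circ> f)" if k: "k \<in> I" for k
        using fE[OF k] 2(2) by (auto intro: continuous_map_compose)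
      ultimately show ?thesis
        using openin_seminorm_subbasis[of "q \<circ> f" ?P "g z" S e] 2 fg by (simp only: mem_Collect_eq) blast
    qed
  qed
  have contg: "continuous_map (seminorm_topology S' ?Q) (seminorm_topology S ?P) g"
    unfolding seminorm_topology_def[of S]
  proof (rule continuous_on_generated_topo)
    show "g ` topspace (seminorm_topology S' ?Q) \<subseteq>
      \<Union> (insert S {{y \<in> S. p (y - x) < e} |p x e. p \<in> ?P \<and> x \<in> S \<and> 0 < e})"
      using fg by auto
    fix U assume "U \<in> insert S {{y \<in> S. p (y - x) < e} |p x e. p \<in> ?P \<and> x \<in> S \<and> 0 < e}"
    then consider "U = S" | q z e where "U = {y \<in> S. q (y - z) < e}" "q \<in> ?P" "z \<in> S" "0 < e"
      by blast
    then show "openin (seminorm_topology S' ?Q) (g -` U \<inter> topspace (seminorm_topology S' ?Q))"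
    proof cases
      case 1
      then have "g -` U \<inter> topspace (seminorm_topology S' ?Q) = topspace (seminorm_topology S' ?Q)"
        using fg by auto
      then show ?thesis by (metis openin_topspace)
    next
      case 2
      have "g -` U \<inter> topspace (seminorm_topology S' ?Q) = {x \<in> S'. (q \<circ> g) (x - f z) < e}"
        using 2 fS gdiff fg gf by auto
      moreover have "seminorm_on S' (q \<circ> g)"
        using seminorm_on_compose[of S q S' g] 2 ling fg by (auto simp: comp_def)
      moreover have "continuous_map (F k) euclideanreal (q \<circ> g)" if k: "k \<in> J" for k
        using gF[OF k] 2(2) by (auto simp: g_def intro: continuous_map_compose)
      ultimately show ?thesis
        using openin_seminorm_subbasis[of "q \<circ> g" ?Q "f z" S' e] 2 fS by (simp only: mem_Collect_eq) blast
    qed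
  qed
  have "homeomorphic_maps (seminorm_topology S ?P) (seminorm_topology S' ?Q) f g"
    using contf contg gf fg by (simp add: homeomorphic_maps_def)
  then have "homeomorphic_map (seminorm_topology S ?P) (seminorm_topology S' ?Q) f"
    by (rule homeomorphic_maps_imp_map)
  then show ?thesis using lin by (simp add: topological_isomorphism_def E F)
qed

text \<open>In one direction the unit ball of each seminorm is a test neighbourhood; conversely a
  neighbourhood of 0 involves finitely many seminorms, whose bounds on \<open>B\<close> can be added
  up.\<close>

lemma seminorm_topology_bounded_iff:
  assumes S: "cfun.subspace S" and P: "\<And>p. p \<in> P \<Longrightarrow> seminorm_on S p"
  shows "tvs_bounded (seminorm_topology S P) B \<longleftrightarrow> B \<subseteq> S \<and> (\<forall>p\<in>P. bdd_above (p ` B))"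
proof
  assume B: "tvs_bounded (seminorm_topology S P) B"
  have "bdd_above (p ` B)" if p: "p \<in> P" for p
  proof -
    have "openin (seminorm_topology S P) {y \<in> S. p (y - 0) < 1}"
      by (intro openin_seminorm_subbasis p cfun.subspace_0 S) simp
    moreover have "0 \<in> {y \<in> S. p (y - 0) < 1}"
      using seminorm_on_zero[OF P[OF p] S] cfun.subspace_0[OF S] by simp
    ultimately obtain r :: real where r: "0 < r"
      "B \<subseteq> (\<lambda>u. complex_of_real r *\<^sub>F u) ` {y \<in> S. p (y - 0) < 1}"
      using B unfolding tvs_bounded_def by blast
    have "p b \<le> r" if "b \<in> B" for b
    proof -
      obtain u where u: "u \<in> S" "p u < 1" "b = complex_of_real r *\<^sub>F u"
        using subsetD[OF r(2) \<open>b \<in> B\<close>] by auto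
      then have "p b = r * p u" using seminorm_onD(3)[OF P[OF p] u(1)] r by simp
      then show ?thesis using u r by (simp add: mult_le_cancel_left1)
    qed
    then show ?thesis by (intro bdd_aboveI2) auto
  qed
  then show "B \<subseteq> S \<and> (\<forall>p\<in>P. bdd_above (p ` B))" using B by (auto simp: tvs_bounded_def)
next
  assume B: "B \<subseteq> S \<and> (\<forall>p\<in>P. bdd_above (p ` B))"
  show "tvs_bounded (seminorm_topology S P) B"
    unfolding tvs_bounded_def
  proof (intro conjI allI impI)
    show "B \<subseteq> topspace (seminorm_topology S P)" using B by simp
    fix U assume U: "openin (seminorm_topology S P) U \<and> 0 \<in> U"
    obtain F e where F: "finite F" "F \<subseteq> P" "0 < e" "{y \<in> S. \<forall>p\<in>F. p (y - 0) < e} \<subseteq> U"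
      by (rule openin_seminormD[OF S P conjunct1[OF U] conjunct2[OF U]])
    have "\<forall>p\<in>F. \<exists>M. \<forall>b\<in>B. p b \<le> M" using B F(2) by (auto simp: bdd_above_def)
    then obtain M where M: "\<And>p b. p \<in> F \<Longrightarrow> b \<in> B \<Longrightarrow> p b \<le> M p" by metis
    \<comment> \<open>One scaling for all \<open>p\<close> in \<open>F\<close>: the sum dominates
      each \<open>M p\<close>, and the summand 1 makes the comparison with \<open>e\<close>
      strict.\<close>
    define r where "r = (1 + (\<Sum>p\<in>F. \<bar>M p\<bar>)) / e"
    have s: "0 \<le> (\<Sum>p\<in>F. \<bar>M p\<bar>)" by (rule sum_nonneg) simp
    have r: "0 < r" using F s by (auto simp: r_def intro!: divide_pos_pos add_pos_nonneg)
    have "b \<in> (\<lambda>u. complex_of_real r *\<^sub>F u) ` U" if b: "b \<in> B" for b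
    proof
      let ?u = "complex_of_real (1 / r) *\<^sub>F b"
      show "b = complex_of_real r *\<^sub>F ?u" using r by (auto simp: fun_eq_iff)
      have bS: "b \<in> S" using b B by auto
      have "p ?u < e" if p: "p \<in> F" for p
      proof -
        have "p ?u = p b / r" using seminorm_onD(3)[OF P bS, of p "complex_of_real (1/r)"] p F r
          by (auto simp: norm_divide)
        also have "\<dots> \<le> \<bar>M p\<bar> / r" using M[OF p b] r by (intro divide_right_mono) auto
        also have "\<dots> \<le> (\<Sum>p\<in>F. \<bar>M p\<bar>) / r"
          using F p r by (intro divide_right_mono member_le_sum) auto
        also have "\<dots> < (1 + (\<Sum>p\<in>F. \<bar>M p\<bar>)) / r" using r by (intro divide_strict_right_mono) auto
        also have "\<dots> = e"
        proof -
          have "1 + (\<Sum>p\<in>F. \<bar>M p\<bar>) \<noteq> 0" using s by linarith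
          then show ?thesis using F by (simp add: r_def)
        qed
        finally show ?thesis .
      qed
      moreover have "?u \<in> S" using bS S by (rule cfun.subspace_scale[rotated])
      ultimately show "?u \<in> U" using F(4) by (auto simp: subset_iff)
    qed
    then show "\<exists>r::real. 0 < r \<and> B \<subseteq> (\<lambda>u. complex_of_real r *\<^sub>F u) ` U" using r by blast
  qed
qed

text \<open>
  The supremum of truncations \<open>min (1 / (k + 1)) (N k (x - y))\<close> is a translation-invariant metric:
  smallness below \<open>1 / (m + 1)\<close> only involves the seminorms \<open>N 0, \<dots>, N m\<close>.
\<close>

lemma frechet_space_seminorm_topology:
  fixes N :: "nat \<Rightarrow> ('i \<Rightarrow> complex) \<Rightarrow> real"
  assumes S: "cfun.subspace S" and N: "\<And>k. seminorm_on S (N k)"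
    and sep: "\<And>x. x \<in> S \<Longrightarrow> (\<And>k. N k x = 0) \<Longrightarrow> x = 0"
    and complete: "\<And>y. range y \<subseteq> S \<Longrightarrow> (\<And>k e. e > 0 \<Longrightarrow> \<exists>M::nat. \<forall>m\<ge>M. \<forall>n\<ge>M. N k (y m - y n) < e) \<Longrightarrow>
       \<exists>x\<in>S. \<forall>k. (\<lambda>m. N k (y m - x)) \<longlonglongrightarrow> 0"
  shows "frechet_space (seminorm_topology S (range N))"
proof -
  let ?E = "seminorm_topology S (range N)"
  define \<tau> where "\<tau> = (\<lambda>k x y. min (1 / (real k + 1)) (N k (x - y)))"
  define d where "d x y = (if x \<in> S \<and> y \<in> S then (SUP k. \<tau> k x y) else 0)" for x y
  have P: "seminorm_on S p" if "p \<in> range N" for p using N that by auto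
  have bdd: "bdd_above (range (\<lambda>k. \<tau> k x y))" for x y
    unfolding \<tau>_def by (intro bdd_aboveI2[of _ _ 1] min.coboundedI1) simp
  have N0: "0 \<le> N k (x - y)" if "x \<in> S" "y \<in> S" for k x y
    using seminorm_onD(1)[OF N] S that by (simp add: cfun.subspace_diff)
  have \<tau>0: "0 \<le> \<tau> k x y" if "x \<in> S" "y \<in> S" for k x y using N0[OF that] by (simp add: \<tau>_def)
  have \<tau>d: "\<tau> k x y \<le> d x y" if "x \<in> S" "y \<in> S" for k x y
    using cSUP_upper[OF _ bdd, of k] that by (simp add: d_def)
  have d_le: "d x y \<le> e" if "x \<in> S" "y \<in> S" "1 / (real K + 1) \<le> e" "\<And>k. k \<le> K \<Longrightarrow> N k (x - y) \<le> e"
    for x y e K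
  proof -
    have "(SUP k. \<tau> k x y) \<le> e"
    proof (rule cSUP_least)
      fix k
      show "\<tau> k x y \<le> e"
      proof (cases "k \<le> K")
        case True then show ?thesis using that(4)[of k] by (simp add: \<tau>_def min.coboundedI2)
      next
        case False
        then have "1 / (real k + 1) \<le> 1 / (real K + 1)" by (simp add: field_simps)
        then show ?thesis using that(3) by (simp add: \<tau>_def min.coboundedI1)
      qed
    qed simp
    then show ?thesis using that by (simp add: d_def)
  qed
  have N_less: "N k (x - y) < e" if "x \<in> S" "y \<in> S" "d x y < e" "e \<le> 1 / (real k + 1)" for x y e k
    using \<tau>d[OF that(1,2), of k] that(3,4) by (auto simp: \<tau>_def min_def split: if_splits)
  have com: "N k (x - y) = N k (y - x)" if "x \<in> S" "y \<in> S" for k x y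
    using seminorm_on_minus_commute[OF N S that] .
  have d_nonneg: "0 \<le> d x y" for x y
    using \<tau>0[of x y 0] \<tau>d[of x y 0] by (cases "x \<in> S \<and> y \<in> S") (auto simp: d_def)
  interpret M: Metric_space S d
  proof
    show "0 \<le> d x y" for x y by (rule d_nonneg)
    show "d x y = d y x" for x y
      using com[of x y] by (auto simp: d_def \<tau>_def)
    show "d x y = 0 \<longleftrightarrow> x = y" if xy: "x \<in> S" "y \<in> S" for x y
    proof
      assume "d x y = 0"
      then have "N k (x - y) = 0" for k
        using \<tau>d[OF xy, of k] N0[OF xy, of k] by (auto simp: \<tau>_def min_def split: if_splits)
      then have "x - y = 0" using sep[of "x - y"] S xy by (simp add: cfun.subspace_diff)
      then show "x = y" by simp
    next
      assume "x = y"
      moreover have "N k 0 = 0" for k using seminorm_on_zero[OF N S] .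
      ultimately show "d x y = 0" using xy by (simp add: d_def \<tau>_def)
    qed
    show "d x z \<le> d x y + d y z" if xyz: "x \<in> S" "y \<in> S" "z \<in> S" for x y z
    proof -
      have "(SUP k. \<tau> k x z) \<le> d x y + d y z"
      proof (rule cSUP_least)
        fix k
        have "N k (x - z) \<le> N k (x - y) + N k (y - z)"
          using seminorm_on_triangle3[OF N S xyz] .
        moreover have "min c a \<le> min c b + min c b'" if "0 \<le> b" "0 \<le> b'" "a \<le> b + b'" "0 \<le> c"
          for a b b' c :: real using that by linarith
        ultimately have "\<tau> k x z \<le> \<tau> k x y + \<tau> k y z"
          unfolding \<tau>_def using N0[OF xyz(1,2), of k] N0[OF xyz(2,3), of k] by simp
        then show "\<tau> k x z \<le> d x y + d y z"
          using \<tau>d[OF xyz(1,2), of k] \<tau>d[OF xyz(2,3), of k] by linarith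
      qed simp
      then show ?thesis using xyz by (simp add: d_def)
    qed
  qed
  have "openin M.mtopology U \<longleftrightarrow> openin ?E U" for U
  proof
    assume U: "openin M.mtopology U"
    show "openin ?E U"
    proof (subst openin_seminorm_topology_iff[OF S P], simp, intro conjI ballI)
      show "U \<subseteq> S" using U by (simp add: M.openin_mtopology)
      fix x assume x: "x \<in> U"
      then obtain r where r: "0 < r" "M.mball x r \<subseteq> U" using U M.openin_mtopology by blast
      have xS: "x \<in> S" using x U by (auto simp: M.openin_mtopology)
      obtain K where K: "1 / (real K + 1) < r / 2"
        using reals_Archimedean[of "r / 2"] r by (auto simp: inverse_eq_divide add.commute)
      have "{y \<in> S. \<forall>p\<in>N ` {..K}. p (y - x) < r / 2} \<subseteq> U"
      proof
        fix y assume "y \<in> {y \<in> S. \<forall>p\<in>N ` {..K}. p (y - x) < r / 2}"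
        then have y: "y \<in> S" "\<And>k. k \<le> K \<Longrightarrow> N k (y - x) < r / 2" by auto
        have "d x y \<le> r / 2"
          using y com[OF xS y(1)] K by (intro d_le[OF xS y(1), of K]) (auto intro: less_imp_le)
        then show "y \<in> U" using r y xS by auto
      qed
      then show "\<exists>F e. finite F \<and> F \<subseteq> range N \<and> 0 < e \<and> {y \<in> S. \<forall>p\<in>F. p (y - x) < e} \<subseteq> U"
        using r by (intro exI[of _ "N ` {..K}"] exI[of _ "r / 2"]) auto
    qed
  next
    assume U: "openin ?E U"
    show "openin M.mtopology U"
      unfolding M.openin_mtopology
    proof (intro conjI allI impI)
      show US: "U \<subseteq> S" using openin_subset[OF U] by simp
      fix x assume x: "x \<in> U"
      obtain F e where F: "finite F" "F \<subseteq> range N" "0 < e" "{y \<in> S. \<forall>p\<in>F. p (y - x) < e} \<subseteq> U"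
        by (rule openin_seminormD[OF S P U x])
      obtain C where C: "finite C" "F = N ` C" using finite_subset_image[OF F(1,2)] by auto
      obtain m where m: "\<And>k. k \<in> C \<Longrightarrow> k \<le> m" using Max_ge[OF C(1)] that by metis
      define r where "r = min e (1 / (real m + 1))"
      have "M.mball x r \<subseteq> U"
      proof
        fix y assume "y \<in> M.mball x r"
        then have y: "y \<in> S" "x \<in> S" "d y x < r" by (auto simp: M.commute)
        have "N k (y - x) < e" if k: "k \<in> C" for k
        proof -
          have "1 / (real m + 1) \<le> 1 / (real k + 1)" using m[OF k] by (simp add: field_simps)
          then have "N k (y - x) < r" using y by (intro N_less) (auto simp: r_def)
          then show ?thesis by (simp add: r_def)
        qed
        then show "y \<in> U" using F(4) C y by auto
      qed
      moreover have "0 < r" using F by (simp add: r_def)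
      ultimately show "\<exists>r>0. M.mball x r \<subseteq> U" by blast
    qed
  qed
  then have top: "M.mtopology = ?E" by (simp add: topology_eq)
  have "M.mcomplete"
    unfolding M.mcomplete_def
  proof (intro allI impI)
    fix y assume "M.MCauchy y"
    then have y: "range y \<subseteq> S" "\<And>e. e > 0 \<Longrightarrow> \<exists>M. \<forall>m n. M \<le> m \<longrightarrow> M \<le> n \<longrightarrow> d (y m) (y n) < e"
      by (auto simp: M.MCauchy_def)
    have "\<exists>M. \<forall>m\<ge>M. \<forall>n\<ge>M. N k (y m - y n) < e" if "e > 0" for k e
    proof -
      define e' where "e' = min e (1 / (real k + 1))"
      have "0 < e'" using that by (simp add: e'_def)
      then obtain M where "\<forall>m n. M \<le> m \<longrightarrow> M \<le> n \<longrightarrow> d (y m) (y n) < e'" using y(2) by blast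
      moreover have "y m \<in> S" for m using y(1) by auto
      moreover have "e' \<le> 1 / (real k + 1)" by (simp add: e'_def)
      ultimately have "\<forall>m\<ge>M. \<forall>n\<ge>M. N k (y m - y n) < e'" using N_less by blast
      then show ?thesis by (auto simp: e'_def)
    qed
    then obtain x where x: "x \<in> S" "\<And>k. (\<lambda>m. N k (y m - x)) \<longlonglongrightarrow> 0" using complete[OF y(1)] by blast
    have "limitin M.mtopology y x sequentially"
      unfolding M.limit_metric_sequentially
    proof (intro conjI allI impI)
      fix e :: real assume e: "0 < e"
      obtain K where K: "1 / (real K + 1) < e / 2"
        using reals_Archimedean[of "e / 2"] e by (auto simp: inverse_eq_divide add.commute)
      have "\<forall>\<^sub>F m in sequentially. \<forall>k\<in>{..K}. N k (y m - x) < e / 2"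
        using e x(2) by (intro eventually_ball_finite ballI order_tendstoD) auto
      then obtain M where M: "\<And>m k. m \<ge> M \<Longrightarrow> k \<le> K \<Longrightarrow> N k (y m - x) < e / 2"
        by (auto simp: eventually_sequentially)
      have "y m \<in> S \<and> d (y m) x < e" if "m \<ge> M" for m
      proof -
        have ym: "y m \<in> S" using y by auto
        have "d (y m) x \<le> e / 2"
          using M[OF that] K by (intro d_le[OF ym x(1), of K]) (auto intro: less_imp_le)
        then show ?thesis using ym e by simp
      qed
      then show "\<exists>N. \<forall>n\<ge>N. y n \<in> S \<and> d (y n) x < e" by blast
    qed (use x in auto)
    then show "\<exists>x. limitin M.mtopology y x sequentially" by blast
  qed
  moreover have "d (x + z) (y + z) = d x y" if "x \<in> S" "y \<in> S" "z \<in> S" for x y z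
  proof -
    have "x + z \<in> S" "y + z \<in> S" using that S by (auto intro: cfun.subspace_add)
    moreover have "x + z - (y + z) = x - y" by (simp add: fun_eq_iff)
    ultimately show ?thesis using that by (simp add: d_def \<tau>_def)
  qed
  moreover have "locally_convex_space ?E"
    unfolding locally_convex_space_def using S N by (auto intro!: exI[of _ "range N"])
  ultimately show ?thesis
    unfolding frechet_space_def using M.Metric_space_axioms top
    by (intro conjI exI[of _ d]) auto
qed

text \<open>This is how an abstract \<open>E\<close> receives the seminorms of the sequence space.
  Linearity turns balls around \<open>f x\<close> into images of balls around \<open>x\<close>, and
  openness is preserved in both directions by a homeomorphism.\<close>

lemma seminorm_topology_pullback:
  assumes S: "cfun.subspace S" and S': "cfun.subspace S'" and Q: "\<And>q. q \<in> Q \<Longrightarrow> seminorm_on S' q"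
    and f: "linear_map_on S f" "topspace E = S" and hom: "homeomorphic_map E (seminorm_topology S' Q) f"
  shows "E = seminorm_topology S ((\<lambda>q. q \<circ> f) ` Q)"
proof -
  have fS: "f ` S = S'" using homeomorphic_imp_surjective_map[OF hom] f by simp
  have inj: "inj_on f S" using homeomorphic_imp_injective_map[OF hom] f by simp
  have P: "seminorm_on S p" if "p \<in> (\<lambda>q. q \<circ> f) ` Q" for p
    using that Q f(1) fS seminorm_on_compose[of S' _ S f] by (auto simp: comp_def)
  have "openin E U \<longleftrightarrow> openin (seminorm_topology S ((\<lambda>q. q \<circ> f) ` Q)) U" for U
  proof (cases "U \<subseteq> S")
    case False
    then show ?thesis using openin_subset[of E U] openin_subset[of "seminorm_topology S ((\<lambda>q. q \<circ> f) ` Q)" U] f by auto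
  next
    case True
    have "openin E U \<longleftrightarrow> openin (seminorm_topology S' Q) (f ` U)"
      using homeomorphic_map_openness[OF hom] True f by simp
    also have "\<dots> \<longleftrightarrow> (\<forall>x\<in>U. \<exists>F e. finite F \<and> F \<subseteq> Q \<and> 0 < e \<and> {y \<in> S'. \<forall>q\<in>F. q (y - f x) < e} \<subseteq> f ` U)"
      using True fS by (subst openin_seminorm_topology_iff[OF S' Q]) auto
    also have "\<dots> \<longleftrightarrow> (\<forall>x\<in>U. \<exists>F e. finite F \<and> F \<subseteq> Q \<and> 0 < e \<and>
        {y \<in> S. \<forall>p\<in>(\<lambda>q. q \<circ> f) ` F. p (y - x) < e} \<subseteq> U)"
    proof (intro ball_cong refl ex_cong1 conj_cong)
      fix x F e assume x: "x \<in> U"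
      have "{y \<in> S'. \<forall>q\<in>F. q (y - f x) < e} = f ` {y \<in> S. \<forall>p\<in>(\<lambda>q. q \<circ> f) ` F. p (y - x) < e}"
        using x True by (auto simp: fS[symmetric] linear_map_on_diff[OF f(1) S] subset_iff)
      then show "({y \<in> S'. \<forall>q\<in>F. q (y - f x) < e} \<subseteq> f ` U) =
          ({y \<in> S. \<forall>p\<in>(\<lambda>q. q \<circ> f) ` F. p (y - x) < e} \<subseteq> U)"
        using inj_on_image_subset_iff[OF inj _ True, of "{y \<in> S. \<forall>p\<in>(\<lambda>q. q \<circ> f) ` F. p (y - x) < e}"]
        by auto
    qed
    also have "\<dots> \<longleftrightarrow> (\<forall>x\<in>U. \<exists>F e. finite F \<and> F \<subseteq> (\<lambda>q. q \<circ> f) ` Q \<and> 0 < e \<and>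
        {y \<in> S. \<forall>p\<in>F. p (y - x) < e} \<subseteq> U)"
    proof (intro ball_cong refl iffI)
      fix x assume "\<exists>F e. finite F \<and> F \<subseteq> Q \<and> 0 < e \<and> {y \<in> S. \<forall>p\<in>(\<lambda>q. q \<circ> f) ` F. p (y - x) < e} \<subseteq> U"
      then obtain F e where "finite F" "F \<subseteq> Q" "0 < e" "{y \<in> S. \<forall>p\<in>(\<lambda>q. q \<circ> f) ` F. p (y - x) < e} \<subseteq> U"
        by blast
      then show "\<exists>F e. finite F \<and> F \<subseteq> (\<lambda>q. q \<circ> f) ` Q \<and> 0 < e \<and> {y \<in> S. \<forall>p\<in>F. p (y - x) < e} \<subseteq> U"
        by (intro exI[of _ "(\<lambda>q. q \<circ> f) ` F"] exI[of _ e] conjI finite_imageI image_mono)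
    next
      fix x assume "\<exists>F e. finite F \<and> F \<subseteq> (\<lambda>q. q \<circ> f) ` Q \<and> 0 < e \<and> {y \<in> S. \<forall>p\<in>F. p (y - x) < e} \<subseteq> U"
      then obtain G e where G: "finite G" "G \<subseteq> (\<lambda>q. q \<circ> f) ` Q" "0 < e" "{y \<in> S. \<forall>p\<in>G. p (y - x) < e} \<subseteq> U"
        by blast
      obtain F where "finite F" "F \<subseteq> Q" "G = (\<lambda>q. q \<circ> f) ` F" using finite_subset_image[OF G(1,2)] by blast
      with G show "\<exists>F e. finite F \<and> F \<subseteq> Q \<and> 0 < e \<and> {y \<in> S. \<forall>p\<in>(\<lambda>q. q \<circ> f) ` F. p (y - x) < e} \<subseteq> U"
        by (intro exI[of _ F] exI[of _ e]) simp
    qed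
    also have "\<dots> \<longleftrightarrow> openin (seminorm_topology S ((\<lambda>q. q \<circ> f) ` Q)) U"
      by (subst openin_seminorm_topology_iff[OF S P]) (use True in auto)
    finally show ?thesis .
  qed
  then show ?thesis by (simp add: topology_eq)
qed

section \<open>Subexponential weights and summability over multi-indices\<close>

section \<open>Weights\<close>

lemma sum_box_product:
  shows "(\<Sum>n\<in>{n::nat^'d::finite. \<forall>l. n $ l \<le> B}. \<Prod>l\<in>UNIV. f l (n $ l)) = (\<Prod>l\<in>UNIV. \<Sum>j\<le>B. f l j :: 'b::comm_semiring_1)"
proof -
  have "(\<Prod>l\<in>(UNIV::'d set). \<Sum>j\<le>B. f l j) = (\<Sum>h\<in>PiE UNIV (\<lambda>_. {..B}). \<Prod>l\<in>UNIV. f l (h l))"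
    by (rule prod_sum_PiE) auto
  also have "\<dots> = (\<Sum>n\<in>{n::nat^'d. \<forall>l. n $ l \<le> B}. \<Prod>l\<in>UNIV. f l (n $ l))"
    by (rule sum.reindex_bij_witness[of _ "vec_nth" "vec_lambda"]) auto
  finally show ?thesis by simp
qed

lemma finite_box: "finite {n::nat^'d::finite. \<forall>l. n $ l \<le> B}"
proof -
  have "{n::nat^'d. \<forall>l. n $ l \<le> B} = vec_lambda ` (PiE UNIV (\<lambda>_. {..B}))"
    by (force simp: image_iff intro: bexI[of _ "vec_nth _"])
  then show ?thesis by (auto intro!: finite_imageI finite_PiE)
qed

lemma component_le_msize: "n $ l \<le> msize (n :: nat^'d::finite)"
  unfolding msize_def by (rule member_le_sum) auto

lemma finite_msize_le: "finite {n::nat^'d::finite. msize n \<le> B}"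
  by (rule finite_subset[OF _ finite_box[of B]]) (auto intro: order_trans[OF component_le_msize])

lemma infinite_multi_index: "infinite (UNIV :: (nat^'d::finite) set)"
proof -
  have "inj (\<lambda>k::nat. \<chi> i::'d. k)" by (auto simp: inj_def vec_eq_iff)
  then show ?thesis using finite_subset[of "range (\<lambda>k::nat. \<chi> i::'d. k)" UNIV]
    range_inj_infinite by blast
qed

text \<open>An enumeration turns unordered sums over multi-indices into ordinary series, which suits
  dominated convergence and termwise differentiation.\<close>

definition enum_index :: "nat \<Rightarrow> nat^'d::finite" where
  "enum_index = from_nat_into UNIV"

lemma bij_enum_index: "bij enum_index"
  unfolding enum_index_def by (rule bij_betw_from_nat_into) (auto simp: infinite_multi_index)

text \<open>Each of the \<open>d\<close> factors \<open>(1 + n_l)^2\<close> is at most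
  \<open>(1 + |n|)^2\<close>, hence the exponent \<open>2 * CARD('d)\<close>: a sum over a box is at
  most a product of \<open>d\<close> convergent series.\<close>

lemma summable_on_msize_inverse:
  "(\<lambda>n::nat^'d::finite. 1 / (1 + real (msize n)) ^ (2 * CARD('d))) summable_on UNIV"
proof (rule nonneg_bdd_above_summable_on)
  show "bdd_above (sum (\<lambda>n::nat^'d. 1 / (1 + real (msize n)) ^ (2 * CARD('d))) ` {F. F \<subseteq> UNIV \<and> finite F})"
  proof (rule bdd_aboveI2)
    fix F :: "(nat^'d) set" assume "F \<in> {F. F \<subseteq> UNIV \<and> finite F}"
    then have F: "finite F" by simp
    define B where "B = Max (insert 0 (msize ` F))"
    have B: "F \<subseteq> {n::nat^'d. \<forall>l. n $ l \<le> B}"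
    proof (safe)
      fix n l assume "n \<in> F"
      then have "msize n \<le> B" using F by (auto simp: B_def)
      then show "n $ l \<le> B" using component_le_msize order_trans by blast
    qed
    have le: "1 / (1 + real (msize n)) ^ (2 * CARD('d)) \<le> (\<Prod>l\<in>UNIV. 1 / (1 + real (n $ l))\<^sup>2)"
      for n :: "nat^'d"
    proof -
      have "(\<Prod>l\<in>(UNIV::'d set). (1 + real (n $ l))\<^sup>2) \<le> (\<Prod>l\<in>(UNIV::'d set). (1 + real (msize n))\<^sup>2)"
        by (intro prod_mono conjI power_mono) (auto simp: component_le_msize)
      also have "\<dots> = (1 + real (msize n)) ^ (2 * CARD('d))" by (simp add: power_mult)
      finally have "1 / (1 + real (msize n)) ^ (2 * CARD('d)) \<le> 1 / (\<Prod>l\<in>(UNIV::'d set). (1 + real (n $ l))\<^sup>2)"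
        by (intro divide_left_mono mult_pos_pos prod_pos) (auto simp: add_pos_nonneg)
      also have "\<dots> = (\<Prod>l\<in>UNIV. 1 / (1 + real (n $ l))\<^sup>2)" by (simp add: prod_dividef)
      finally show ?thesis .
    qed
    have summ: "summable (\<lambda>j. 1 / (1 + real j)\<^sup>2)"
      using summable_Suc_iff[of "\<lambda>n. 1 / real n ^ 2"] inverse_power_summable[of 2, where 'a=real]
      by (simp add: inverse_eq_divide add.commute)
    have "(\<Sum>n\<in>F. 1 / (1 + real (msize n)) ^ (2 * CARD('d))) \<le> (\<Sum>n\<in>F. \<Prod>l\<in>UNIV. 1 / (1 + real (n $ l))\<^sup>2)"
      by (intro sum_mono le)
    also have "\<dots> \<le> (\<Sum>n\<in>{n::nat^'d. \<forall>l. n $ l \<le> B}. \<Prod>l\<in>UNIV. 1 / (1 + real (n $ l))\<^sup>2)"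
      by (rule sum_mono2[OF finite_box B]) (simp add: prod_nonneg)
    also have "\<dots> = (\<Prod>l\<in>(UNIV::'d set). \<Sum>j\<le>B. 1 / (1 + real j)\<^sup>2)" by (rule sum_box_product)
    also have "\<dots> \<le> (\<Prod>l\<in>(UNIV::'d set). \<Sum>j. 1 / (1 + real j)\<^sup>2)"
      using summ by (intro prod_mono conjI sum_nonneg sum_le_suminf) auto
    finally show "(\<Sum>n\<in>F. 1 / (1 + real (msize n)) ^ (2 * CARD('d))) \<le> (\<Prod>l\<in>(UNIV::'d set). \<Sum>j. 1 / (1 + real j)\<^sup>2)" .
  qed
qed simp

definition weight :: "real \<Rightarrow> real \<Rightarrow> nat^'d \<Rightarrow> real" where
  "weight \<alpha> a n = a powr (real (msize n) powr (1 / \<alpha>))"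

lemma weight_pos [simp]: "0 < a \<Longrightarrow> 0 < weight \<alpha> a n"
  by (simp add: weight_def)

lemma weight_mono: "0 < a \<Longrightarrow> a \<le> b \<Longrightarrow> weight \<alpha> a n \<le> weight \<alpha> b n"
  by (simp add: weight_def powr_mono2)

lemma weight_ge_1: "1 \<le> a \<Longrightarrow> 1 \<le> weight \<alpha> a n"
  by (simp add: weight_def ge_one_powr_ge_zero)

lemma weight_mult: "0 < a \<Longrightarrow> 0 < b \<Longrightarrow> weight \<alpha> (a * b) n = weight \<alpha> a n * weight \<alpha> b n"
  by (simp add: weight_def powr_mult)

lemma weight_divide: "0 < a \<Longrightarrow> 0 < b \<Longrightarrow> weight \<alpha> (a / b) n = weight \<alpha> a n / weight \<alpha> b n"
  by (simp add: weight_def powr_divide)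

text \<open>In terms of \<open>y = |n|^(1/\<alpha>)\<close> the left side is of order
  \<open>y^(\<alpha> M)\<close>, while the weight is \<open>exp (y * ln a)\<close> and exceeds each
  term of its power series.\<close>

lemma msize_power_le_weight:
  assumes "0 < \<alpha>" "1 < a"
  obtains C where "0 < C" "\<And>n :: nat^'d::finite. (1 + real (msize n)) ^ M \<le> C * weight \<alpha> a n"
proof -
  \<comment> \<open>An integer not below \<open>\<alpha> * M\<close>, so that a single term of the
    exponential series can be used.\<close>
  define K where "K = nat \<lceil>\<alpha> * real M\<rceil>"
  have K: "\<alpha> * real M \<le> real K" unfolding K_def by linarith
  define C where "C = 1 + 2 ^ M * fact K / ln a ^ K"
  have C: "1 \<le> C" using assms by (simp add: C_def)
  have "(1 + real (msize n)) ^ M \<le> C * weight \<alpha> a n" for n :: "nat^'d"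
  proof (cases "msize n = 0")
    case True
    then show ?thesis using C weight_ge_1[of a \<alpha> n] assms mult_mono[of 1 C 1 "weight \<alpha> a n"] by simp
  next
    case False
    define y where "y = real (msize n) powr (1 / \<alpha>)"
    have m: "1 \<le> real (msize n)" using False by simp
    have y: "1 \<le> y" using m assms by (simp add: y_def ge_one_powr_ge_zero)
    have "(1 + real (msize n)) ^ M \<le> (2 * real (msize n)) ^ M" using m by (intro power_mono) auto
    also have "\<dots> = 2 ^ M * real (msize n) ^ M" by (simp add: power_mult_distrib)
    also have "real (msize n) ^ M = y powr (\<alpha> * real M)"
      using m assms by (simp add: y_def powr_powr powr_realpow)
    also have "\<dots> \<le> y powr real K" using y K by (intro powr_mono) auto
    also have "\<dots> = y ^ K" using y by (simp add: powr_realpow)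
    also have "2 ^ M * y ^ K = (2 ^ M * fact K / ln a ^ K) * ((ln a * y) ^ K / fact K)"
      using assms by (simp add: power_mult_distrib)
    also have "\<dots> \<le> C * exp (ln a * y)"
    proof (intro mult_mono)
      have "0 \<le> ln a * y" using assms y by simp
      then have "(\<lambda>n. (ln a * y) ^ n / fact n) sums exp (ln a * y)" "\<And>n. 0 \<le> (ln a * y) ^ n / fact n"
        using exp_converges[of "ln a * y"] by (auto simp: divide_inverse mult.commute)
      then show "(ln a * y) ^ K / fact K \<le> exp (ln a * y)"
        using sum_le_suminf[of "\<lambda>n. (ln a * y) ^ n / fact n" "{K}"] by (auto simp: sums_iff)
    qed (use assms y in \<open>auto simp: C_def\<close>)
    also have "exp (ln a * y) = weight \<alpha> a n" using assms by (simp add: weight_def y_def powr_def mult.commute)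
    finally show ?thesis by simp
  qed
  then show thesis using C by (intro that[of C]) auto
qed

lemma summable_on_weight:
  assumes "0 < \<alpha>" "1 < a"
  shows "(\<lambda>n :: nat^'d::finite. (1 + real (msize n)) ^ M / weight \<alpha> a n) summable_on UNIV"
proof -
  obtain C where C: "0 < C" "\<And>n :: nat^'d. (1 + real (msize n)) ^ (M + 2 * CARD('d)) \<le> C * weight \<alpha> a n"
    using msize_power_le_weight[OF assms] by blast
  have "(\<lambda>n::nat^'d. C * (1 / (1 + real (msize n)) ^ (2 * CARD('d)))) summable_on UNIV"
    by (intro summable_on_cmult_right summable_on_msize_inverse)
  moreover have "(1 + real (msize n)) ^ M / weight \<alpha> a n \<le> C * (1 / (1 + real (msize n)) ^ (2 * CARD('d)))"
    for n :: "nat^'d"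
    using C(2)[of n] assms weight_pos[of a \<alpha> n]
    by (simp add: field_simps power_add add_pos_nonneg)
  ultimately show ?thesis
    using assms weight_pos[of a \<alpha>]
    by (elim summable_on_comparison_test) (auto intro: less_imp_le)
qed

section \<open>Continuous seminorms and bounded sets of a space identified with the sequence
  space\<close>

section \<open>Spaces isomorphic to the sequence space\<close>

lemma subspace_seq_step_carrier: "cfun.subspace (seq_step_carrier \<alpha> a)"
proof (rule cfun.subspaceI)
  show "0 \<in> seq_step_carrier \<alpha> a" by (auto simp: seq_step_carrier_def)
next
  fix u v :: "nat^'d \<Rightarrow> complex" assume "u \<in> seq_step_carrier \<alpha> a" "v \<in> seq_step_carrier \<alpha> a"
  then obtain A B where AB: "\<And>n. cmod (u n) * a powr (real (msize n) powr (1 / \<alpha>)) \<le> A"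
    "\<And>n. cmod (v n) * a powr (real (msize n) powr (1 / \<alpha>)) \<le> B"
    by (auto simp: seq_step_carrier_def bdd_above_def)
  have "cmod ((u + v) n) * a powr (real (msize n) powr (1 / \<alpha>)) \<le> A + B" for n
  proof -
    have "cmod ((u + v) n) * a powr (real (msize n) powr (1 / \<alpha>))
        \<le> (cmod (u n) + cmod (v n)) * a powr (real (msize n) powr (1 / \<alpha>))"
      by (intro mult_right_mono) (auto intro: norm_triangle_ineq)
    also have "\<dots> \<le> A + B" using AB[of n] by (simp add: distrib_right)
    finally show ?thesis .
  qed
  then show "u + v \<in> seq_step_carrier \<alpha> a"
    unfolding seq_step_carrier_def by (auto intro!: bdd_aboveI2[of _ _ "A + B"])
next
  fix c and u :: "nat^'d \<Rightarrow> complex" assume "u \<in> seq_step_carrier \<alpha> a"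
  then obtain A where A: "\<And>n. cmod (u n) * a powr (real (msize n) powr (1 / \<alpha>)) \<le> A"
    by (auto simp: seq_step_carrier_def bdd_above_def)
  have "cmod ((c *\<^sub>F u) n) * a powr (real (msize n) powr (1 / \<alpha>)) \<le> cmod c * A" for n
    using mult_left_mono[OF A[of n], of "cmod c"] by (simp add: norm_mult mult.assoc)
  then show "c *\<^sub>F u \<in> seq_step_carrier \<alpha> a"
    unfolding seq_step_carrier_def mem_Collect_eq by (rule bdd_aboveI2)
qed

lemma seminorm_on_seq_norm: "seminorm_on (seq_step_carrier \<alpha> a) (seq_norm \<alpha> a)"
  unfolding seq_norm_def
proof (rule seminorm_on_SUP)
  show "seminorm_on (seq_step_carrier \<alpha> a) (\<lambda>x. cmod (x n) * a powr real (msize n) powr (1 / \<alpha>))" for n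
    unfolding seminorm_on_def
    by (auto simp: norm_mult distrib_right[symmetric] intro!: mult_right_mono norm_triangle_ineq)
qed (auto simp: seq_step_carrier_def intro: subspace_seq_step_carrier[unfolded seq_step_carrier_def])

lemma mem_seq_step_carrierI:
  assumes "\<And>n. cmod (u n) * weight \<alpha> a n \<le> R"
  shows "u \<in> seq_step_carrier \<alpha> a"
  unfolding seq_step_carrier_def mem_Collect_eq
  by (rule bdd_aboveI2[of _ _ R]) (use assms in \<open>simp add: weight_def\<close>)

lemma seq_norm_leI:
  assumes "\<And>n. cmod (u n) * weight \<alpha> a n \<le> R"
  shows "seq_norm \<alpha> a u \<le> R"
  unfolding seq_norm_def by (rule cSUP_least) (use assms in \<open>simp_all add: weight_def\<close>)

lemma le_seq_norm:
  assumes "u \<in> seq_step_carrier \<alpha> a"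
  shows "cmod (u n) * weight \<alpha> a n \<le> seq_norm \<alpha> a u"
  unfolding seq_norm_def weight_def
  by (rule cSUP_upper) (use assms in \<open>auto simp: seq_step_carrier_def\<close>)

lemma topspace_seq_space: "topspace (seq_space \<alpha>) = (\<Union>a\<in>{1<..}. seq_step_carrier \<alpha> a)"
  by (simp add: seq_space_def lc_inductive_limit_def Let_def seq_step_def)

lemma seq_step_carrier_antimono:
  assumes "0 < a" "a \<le> b"
  shows "seq_step_carrier \<alpha> b \<subseteq> seq_step_carrier \<alpha> a"
proof
  fix u :: "nat^'d \<Rightarrow> complex" assume u: "u \<in> seq_step_carrier \<alpha> b"
  show "u \<in> seq_step_carrier \<alpha> a"
  proof (rule mem_seq_step_carrierI)
    show "cmod (u n) * weight \<alpha> a n \<le> seq_norm \<alpha> b u" for n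
      using le_seq_norm[OF u, of n] weight_mono[OF assms, of \<alpha> n]
      by (meson mult_left_mono norm_ge_zero order_trans)
  qed
qed

lemma subspace_seq_space: "cfun.subspace (topspace (seq_space \<alpha>))"
  unfolding topspace_seq_space
proof (rule cfun.subspaceI)
  show "0 \<in> (\<Union>a\<in>{1<..}. seq_step_carrier \<alpha> a)"
    using cfun.subspace_0[OF subspace_seq_step_carrier] by (intro UN_I[of 2]) auto
next
  fix u v :: "nat^'d \<Rightarrow> complex"
  assume "u \<in> (\<Union>a\<in>{1<..}. seq_step_carrier \<alpha> a)" "v \<in> (\<Union>a\<in>{1<..}. seq_step_carrier \<alpha> a)"
  then obtain a b where ab: "1 < a" "u \<in> seq_step_carrier \<alpha> a" "1 < b" "v \<in> seq_step_carrier \<alpha> b" by auto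
  then have "u \<in> seq_step_carrier \<alpha> (min a b)" "v \<in> seq_step_carrier \<alpha> (min a b)"
    using seq_step_carrier_antimono[of "min a b" a \<alpha>] seq_step_carrier_antimono[of "min a b" b \<alpha>]
    by (auto simp: subset_iff)
  then show "u + v \<in> (\<Union>a\<in>{1<..}. seq_step_carrier \<alpha> a)"
    using ab cfun.subspace_add[OF subspace_seq_step_carrier] by (intro UN_I[of "min a b"]) auto
next
  fix c and u :: "nat^'d \<Rightarrow> complex" assume "u \<in> (\<Union>a\<in>{1<..}. seq_step_carrier \<alpha> a)"
  then show "c *\<^sub>F u \<in> (\<Union>a\<in>{1<..}. seq_step_carrier \<alpha> a)"
    using cfun.subspace_scale[OF subspace_seq_step_carrier] by blast
qed

text \<open>The parameters \<open>a > 1\<close> form an uncountable family; this decreasing sequence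
  is cofinal for \<open>a\<close> tending to 1 and leaves countably many balls, hence countably many
  norms on the dual.\<close>

definition radius :: "nat \<Rightarrow> real" where
  "radius k = 1 + 1 / (real k + 1)"

lemma radius_gt_1: "1 < radius k"
  by (simp add: radius_def)

lemma radius_antimono: "j \<le> k \<Longrightarrow> radius k \<le> radius j"
  by (simp add: radius_def field_simps)

lemma radius_Suc_less: "radius (Suc k) < radius k"
  by (simp add: radius_def field_simps)

lemma radius_less: assumes "1 < a" obtains k where "radius k \<le> a"
proof -
  obtain k where "1 / (real k + 1) < a - 1"
    using reals_Archimedean[of "a - 1"] assms by (auto simp: inverse_eq_divide add.commute)
  then show thesis by (intro that[of k]) (simp add: radius_def)
qed

text \<open>Duality, nuclearity and reflexivity are derived for any space identified with
  \<open>seq_space\<close> through \<open>\<iota>\<close>, so that they hold for the function space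
  directly and need not be transported afterwards.\<close>

locale coefficient_space =
  fixes \<alpha> :: real and E :: "('i \<Rightarrow> complex) topology"
    and \<iota> :: "('i \<Rightarrow> complex) \<Rightarrow> nat^'d::finite \<Rightarrow> complex"
  assumes alpha: "1 \<le> \<alpha>" and subspace: "cfun.subspace (topspace E)"
    and iso: "topological_isomorphism E (seq_space \<alpha>) \<iota>"
begin

abbreviation "S \<equiv> topspace E"
abbreviation "w k \<equiv> weight \<alpha> (radius k) :: nat^'d \<Rightarrow> real"

text \<open>The ball of radius \<open>R\<close> in the step with parameter \<open>radius k\<close>,
  seen in \<open>E\<close>. It grows with \<open>k\<close>, because the weights decrease.\<close>

definition sball :: "nat \<Rightarrow> real \<Rightarrow> ('i \<Rightarrow> complex) set" where
  "sball k R = {x \<in> S. \<forall>n. cmod (\<iota> x n) * w k n \<le> R}"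

text \<open>These are the continuous seminorms of the limit: on a normed step, continuity of a
  seminorm means boundedness on the unit ball.\<close>

definition step_bounded :: "(('i \<Rightarrow> complex) \<Rightarrow> real) \<Rightarrow> bool" where
  "step_bounded p \<longleftrightarrow> seminorm_on S p \<and> (\<forall>k. \<exists>C. \<forall>x\<in>sball k 1. p x \<le> C)"

lemma w_pos [simp]: "0 < w k n"
  using radius_gt_1[of k] by simp

lemma w_antimono: "j \<le> k \<Longrightarrow> w k n \<le> w j n"
  using radius_gt_1[of k] radius_antimono[of j k] by (intro weight_mono) auto

lemma linear: "linear_map_on S \<iota>"
  using iso by (simp add: topological_isomorphism_def)

lemma hom: "homeomorphic_map E (seq_space \<alpha>) \<iota>"
  using iso by (simp add: topological_isomorphism_def)

lemma bij: "bij_betw \<iota> S (topspace (seq_space \<alpha>))"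
  using homeomorphic_imp_injective_map[OF hom] homeomorphic_imp_surjective_map[OF hom]
  by (simp add: bij_betw_def)

lemma iota_add: "x \<in> S \<Longrightarrow> y \<in> S \<Longrightarrow> \<iota> (x + y) = \<iota> x + \<iota> y"
  using linear by (simp add: linear_map_on_def)

lemma iota_scale: "x \<in> S \<Longrightarrow> \<iota> (c *\<^sub>F x) = c *\<^sub>F \<iota> x"
  using linear by (simp add: linear_map_on_def)

lemma iota_diff: "x \<in> S \<Longrightarrow> y \<in> S \<Longrightarrow> \<iota> (x - y) = \<iota> x - \<iota> y"
  using linear_map_on_diff[OF linear subspace] by simp

lemma iota_zero: "\<iota> 0 = 0"
  using iota_diff[of 0 0] cfun.subspace_0[OF subspace] by simp

lemma iota_sum: "finite N \<Longrightarrow> (\<And>i. i \<in> N \<Longrightarrow> f i \<in> S) \<Longrightarrow> \<iota> (\<Sum>i\<in>N. f i) = (\<Sum>i\<in>N. \<iota> (f i))"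
proof (induction N rule: finite_induct)
  case empty then show ?case by (simp only: sum.empty iota_zero)
next
  case (insert i N)
  then have "(\<Sum>i\<in>N. f i) \<in> S" by (intro cfun.subspace_sum[OF subspace]) auto
  then have "\<iota> (f i + (\<Sum>i\<in>N. f i)) = \<iota> (f i) + \<iota> (\<Sum>i\<in>N. f i)"
    using insert.prems by (intro iota_add) auto
  moreover have "\<iota> (\<Sum>i\<in>N. f i) = (\<Sum>i\<in>N. \<iota> (f i))" using insert by blast
  ultimately show ?case by (simp only: sum.insert[OF insert.hyps])
qed

lemma iota_inj: "x \<in> S \<Longrightarrow> y \<in> S \<Longrightarrow> \<iota> x = \<iota> y \<Longrightarrow> x = y"
  using bij by (auto simp: bij_betw_def inj_on_def)

lemma iota_surj:
  assumes "\<And>n. cmod (u n) * w k n \<le> R"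
  obtains x where "x \<in> S" "\<iota> x = u"
proof -
  have "u \<in> topspace (seq_space \<alpha>)"
    unfolding topspace_seq_space using mem_seq_step_carrierI[OF assms] radius_gt_1 by blast
  then have "u \<in> \<iota> ` S" using bij by (simp add: bij_betw_def)
  then show thesis using that by blast
qed

lemma sball_cover: assumes "x \<in> S" obtains k R where "0 < R" "x \<in> sball k R"
proof -
  have "\<iota> x \<in> topspace (seq_space \<alpha>)" using assms bij by (auto simp: bij_betw_def)
  then obtain a where a: "1 < a" "\<iota> x \<in> seq_step_carrier \<alpha> a" by (auto simp: topspace_seq_space)
  obtain k where k: "radius k \<le> a" using radius_less[OF a(1)] .
  have "cmod (\<iota> x n) * w k n \<le> max 1 (seq_norm \<alpha> a (\<iota> x))" for n
    using le_seq_norm[OF a(2), of n] weight_mono[of "radius k" a \<alpha> n] k radius_gt_1[of k]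
    by (smt (verit) mult_left_mono norm_ge_zero)
  then show thesis using assms by (intro that[of "max 1 (seq_norm \<alpha> a (\<iota> x))" k]) (auto simp: sball_def)
qed

lemma sball_subset: "sball k R \<subseteq> S"
  by (auto simp: sball_def)

lemma sball_mono: "j \<le> k \<Longrightarrow> R \<le> R' \<Longrightarrow> sball j R \<subseteq> sball k R'"
  unfolding sball_def using w_antimono by (smt (verit) Collect_mono mult_left_mono norm_ge_zero)

lemma sball_scale:
  assumes "x \<in> sball k R" "0 < R"
  shows "complex_of_real (1 / R) *\<^sub>F x \<in> sball k 1"
  using assms by (auto simp: sball_def iota_scale cfun.subspace_scale[OF subspace] norm_mult norm_divide
      pos_divide_le_eq)

lemma zero_in_sball: "0 \<le> R \<Longrightarrow> 0 \<in> sball k R"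
  unfolding sball_def using cfun.subspace_0[OF subspace] iota_zero by simp

lemma step_bounded_seminorm: "step_bounded p \<Longrightarrow> seminorm_on S p"
  by (simp add: step_bounded_def)

lemma step_boundedE:
  assumes "step_bounded p"
  obtains C where "0 < C" "\<And>R x. 0 < R \<Longrightarrow> x \<in> sball k R \<Longrightarrow> p x \<le> C * R"
proof -
  obtain C where C: "\<And>x. x \<in> sball k 1 \<Longrightarrow> p x \<le> C"
    using assms unfolding step_bounded_def by metis
  have "p x \<le> max 1 C * R" if "0 < R" "x \<in> sball k R" for R x
  proof -
    have "p (complex_of_real (1 / R) *\<^sub>F x) = p x / R"
      using seminorm_onD(3)[OF step_bounded_seminorm[OF assms], of x "complex_of_real (1 / R)"] that
      by (auto simp: sball_def norm_divide)
    then have "p x / R \<le> max 1 C" using C[OF sball_scale[OF that(2,1)]] by simp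
    then show ?thesis using that by (simp add: pos_divide_le_eq)
  qed
  then show thesis by (intro that[of "max 1 C"]) auto
qed

lemma seq_seminorm_bound:
  assumes q: "seminorm_on (topspace (seq_space \<alpha>)) q"
    and cont: "continuous_map (seq_step \<alpha> a) euclideanreal q" and a: "1 < a"
  obtains C where "\<And>u :: nat^'d \<Rightarrow> complex. u \<in> seq_step_carrier \<alpha> a \<Longrightarrow> q u \<le> C * seq_norm \<alpha> a u"
proof -
  have q': "seminorm_on (seq_step_carrier \<alpha> a) q"
    using seminorm_on_subset[OF q] a by (auto simp: topspace_seq_space)
  obtain F C where F: "F \<subseteq> {seq_norm \<alpha> a}" "finite F" "0 \<le> C"
    "\<And>u :: nat^'d \<Rightarrow> complex. u \<in> seq_step_carrier \<alpha> a \<Longrightarrow> q u \<le> C * (\<Sum>r\<in>F. r u)"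
    using continuous_seminorm_bound[OF subspace_seq_step_carrier _ q' cont[unfolded seq_step_def]]
      seminorm_on_seq_norm by (metis singletonD)
  have "q u \<le> C * seq_norm \<alpha> a u" if u: "u \<in> seq_step_carrier \<alpha> a" for u :: "nat^'d \<Rightarrow> complex"
  proof -
    have "(\<Sum>r\<in>F. r u) \<le> seq_norm \<alpha> a u"
      using F(1) seminorm_onD(1)[OF seminorm_on_seq_norm u] by (auto simp: subset_singleton_iff)
    then show ?thesis using F(3) F(4)[OF u] mult_left_mono by fastforce
  qed
  then show thesis by (rule that)
qed

text \<open>A seminorm is continuous on the normed step \<open>a\<close> iff it is bounded on the
  unit ball, and below each \<open>a > 1\<close> there is some \<open>radius k\<close>. Up to
  composition with \<open>\<iota>\<close> both families therefore consist of the same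
  seminorms.\<close>

lemma topology_eq_step_bounded: "E = seminorm_topology S (Collect step_bounded)"
proof -
  let ?s = "topspace (seq_space \<alpha>) :: (nat^'d \<Rightarrow> complex) set"
  let ?Q = "{q. seminorm_on ?s q \<and> (\<forall>a\<in>{1<..}. continuous_map (seq_step \<alpha> a) euclideanreal q)}"
  have seq: "seq_space \<alpha> = seminorm_topology ?s ?Q"
    by (simp add: seq_space_def lc_inductive_limit_def Let_def seq_step_def)
  have E: "E = seminorm_topology S ((\<lambda>q. q \<circ> \<iota>) ` ?Q)"
    by (rule seminorm_topology_pullback[OF subspace subspace_seq_space _ linear refl])
      (use hom seq in auto)
  have "(\<lambda>q. q \<circ> \<iota>) ` ?Q \<subseteq> Collect step_bounded"
  proof safe
    fix q assume q: "seminorm_on ?s q" "\<forall>a\<in>{1<..}. continuous_map (seq_step \<alpha> a) euclideanreal q"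
    show "step_bounded (q \<circ> \<iota>)"
      unfolding step_bounded_def
    proof (intro conjI allI)
      show "seminorm_on S (q \<circ> \<iota>)"
        using seminorm_on_compose[OF q(1) linear] bij by (simp add: comp_def bij_betw_def)
      fix k
      have c: "continuous_map (seq_step \<alpha> (radius k)) euclideanreal q" using q(2) radius_gt_1 by simp
      obtain C where C: "\<And>u :: nat^'d \<Rightarrow> complex. u \<in> seq_step_carrier \<alpha> (radius k) \<Longrightarrow>
          q u \<le> C * seq_norm \<alpha> (radius k) u"
        using seq_seminorm_bound[OF q(1) c radius_gt_1] by metis
      have "q (\<iota> x) \<le> \<bar>C\<bar>" if x: "x \<in> sball k 1" for x
      proof -
        have x1: "\<And>n. cmod (\<iota> x n) * w k n \<le> 1" using x by (auto simp: sball_def)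
        have c1: "\<iota> x \<in> seq_step_carrier \<alpha> (radius k)" using x1 by (rule mem_seq_step_carrierI)
        have "0 \<le> seq_norm \<alpha> (radius k) (\<iota> x)" "seq_norm \<alpha> (radius k) (\<iota> x) \<le> 1"
          using seminorm_onD(1)[OF seminorm_on_seq_norm c1] seq_norm_leI[OF x1] by auto
        then have "C * seq_norm \<alpha> (radius k) (\<iota> x) \<le> \<bar>C\<bar> * 1" by (intro mult_mono) auto
        then show ?thesis using C[OF c1] by simp
      qed
      then show "\<exists>C. \<forall>x\<in>sball k 1. (q \<circ> \<iota>) x \<le> C" by auto
    qed
  qed
  moreover have "Collect step_bounded \<subseteq> {p. \<exists>q\<in>?Q. \<forall>x\<in>S. p x = q (\<iota> x)}"
  proof safe
    fix p assume p: "step_bounded p"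
    let ?T = "inv_into S \<iota>"
    have T: "?T ` ?s \<subseteq> S" "\<And>x. x \<in> S \<Longrightarrow> ?T (\<iota> x) = x" "\<And>u. u \<in> ?s \<Longrightarrow> \<iota> (?T u) = u"
      using bij by (auto simp: bij_betw_def inv_into_into f_inv_into_f)
    have q: "seminorm_on ?s (\<lambda>u. p (?T u))"
      by (rule seminorm_on_compose[OF step_bounded_seminorm[OF p] linear_map_on_inv_into[OF subspace linear bij] T(1)])
    have "continuous_map (seq_step \<alpha> a) euclideanreal (\<lambda>u. p (?T u))" if a: "1 < a" for a
      unfolding seq_step_def
    proof -
      obtain k where k: "radius k \<le> a" using radius_less[OF a] .
      obtain C where C: "0 < C" "\<And>R x. 0 < R \<Longrightarrow> x \<in> sball k R \<Longrightarrow> p x \<le> C * R"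
        using step_boundedE[OF p] by blast
      have sub: "seq_step_carrier \<alpha> a \<subseteq> ?s" using a by (auto simp: topspace_seq_space)
      show "continuous_map (seminorm_topology (seq_step_carrier \<alpha> a) {seq_norm \<alpha> a}) euclideanreal (\<lambda>u. p (?T u))"
      proof (rule continuous_map_seminormI[OF subspace_seq_step_carrier _ seminorm_on_subset[OF q sub]])
        fix u :: "nat^'d \<Rightarrow> complex" assume u: "u \<in> seq_step_carrier \<alpha> a"
        show "p (?T u) \<le> C * seq_norm \<alpha> a u"
        proof (rule field_le_epsilon)
          fix e :: real assume e: "0 < e"
          \<comment> \<open>\<open>step_boundedE\<close> speaks of positive radii, while
            \<open>seq_norm\<close> may vanish; the surplus \<open>e / C\<close> costs only
            \<open>e\<close> after multiplication by \<open>C\<close>.\<close>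
          let ?R = "seq_norm \<alpha> a u + e / C"
          have nn: "0 \<le> seq_norm \<alpha> a u" using seminorm_onD(1)[OF seminorm_on_seq_norm u] .
          have "cmod (u n) * w k n \<le> ?R" for n
          proof -
            have "cmod (u n) * w k n \<le> cmod (u n) * weight \<alpha> a n"
              using weight_mono[of "radius k" a \<alpha> n] k radius_gt_1[of k] by (intro mult_left_mono) auto
            also have "\<dots> \<le> seq_norm \<alpha> a u" using le_seq_norm[OF u] .
            finally show ?thesis using e C divide_pos_pos[of e C] by linarith
          qed
          moreover have us: "u \<in> ?s" using u sub by blast
          moreover have "?T u \<in> S" using T(1) us by blast
          ultimately have "?T u \<in> sball k ?R" using T(3) by (simp add: sball_def)
          moreover have "0 < ?R" using nn e C divide_pos_pos[of e C] by linarith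
          ultimately have "p (?T u) \<le> C * ?R" using C(2) by blast
          then show "p (?T u) \<le> C * seq_norm \<alpha> a u + e" using C by (simp add: distrib_left)
        qed
      qed (auto simp: seminorm_on_seq_norm)
    qed
    then show "\<exists>q\<in>?Q. \<forall>x\<in>S. p x = q (\<iota> x)" using q T
      by (intro bexI[of _ "\<lambda>u. p (?T u)"]) auto
  qed
  ultimately have "seminorm_topology S ((\<lambda>q. q \<circ> \<iota>) ` ?Q) = seminorm_topology S (Collect step_bounded)"
  proof (intro seminorm_topology_eq[OF subspace])
    fix q assume 1: "Collect step_bounded \<subseteq> {p. \<exists>q\<in>?Q. \<forall>x\<in>S. p x = q (\<iota> x)}" and q: "q \<in> Collect step_bounded"
    obtain p where p: "p \<in> ?Q" "\<forall>x\<in>S. q x = p (\<iota> x)" using subsetD[OF 1 q] by blast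
    show "\<exists>p\<in>(\<lambda>q. q \<circ> \<iota>) ` ?Q. \<exists>C. \<forall>x\<in>S. q x \<le> C * p x"
      using p by (intro bexI[of _ "p \<circ> \<iota>"] exI[of _ 1]) auto
  next
    fix p assume 1: "(\<lambda>q. q \<circ> \<iota>) ` ?Q \<subseteq> Collect step_bounded" and p: "p \<in> (\<lambda>q. q \<circ> \<iota>) ` ?Q"
    show "\<exists>q\<in>Collect step_bounded. \<exists>C. \<forall>x\<in>S. p x \<le> C * q x"
      using subsetD[OF 1 p] by (intro bexI[of _ p] exI[of _ 1]) auto
  qed (auto simp: step_bounded_def subset_iff)
  then show ?thesis using E by simp
qed

lemma seminorms: "p \<in> Collect step_bounded \<Longrightarrow> seminorm_on S p"
  by (simp add: step_bounded_def)

lemma openin_step_bounded: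
  "step_bounded p \<Longrightarrow> x \<in> S \<Longrightarrow> 0 < e \<Longrightarrow> openin E {y \<in> S. p (y - x) < e}"
  using openin_seminorm_subbasis[of p "Collect step_bounded" x S e] topology_eq_step_bounded by simp

lemma step_bounded_continuous:
  assumes "seminorm_on S p" "continuous_map E euclideanreal p"
  shows "step_bounded p"
proof -
  have c: "continuous_map (seminorm_topology S (Collect step_bounded)) euclideanreal p"
    using assms(2) by (subst topology_eq_step_bounded[symmetric])
  obtain F C where F: "finite F" "F \<subseteq> Collect step_bounded" "0 \<le> C"
    "\<And>x. x \<in> S \<Longrightarrow> p x \<le> C * (\<Sum>q\<in>F. q x)"
    using continuous_seminorm_bound_ex[OF subspace seminorms assms(1) c] by auto
  show ?thesis
    unfolding step_bounded_def
  proof (intro conjI allI)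
    fix k
    have "\<forall>q\<in>F. \<exists>M. \<forall>x\<in>sball k 1. q x \<le> M" using F(2) by (auto simp: step_bounded_def)
    then obtain M where M: "\<And>q x. q \<in> F \<Longrightarrow> x \<in> sball k 1 \<Longrightarrow> q x \<le> M q" by metis
    have "p x \<le> C * (\<Sum>q\<in>F. M q)" if "x \<in> sball k 1" for x
      using F(4)[of x] that M by (smt (verit, best) F(3) sball_subset mult_left_mono subsetD sum_mono)
    then show "\<exists>C. \<forall>x\<in>sball k 1. p x \<le> C" by blast
  qed fact
qed

lemma tvs_bounded_iff: "tvs_bounded E B \<longleftrightarrow> B \<subseteq> S \<and> (\<forall>p. step_bounded p \<longrightarrow> bdd_above (p ` B))"
proof -
  have "tvs_bounded (seminorm_topology S (Collect step_bounded)) B \<longleftrightarrow>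
      B \<subseteq> S \<and> (\<forall>p\<in>Collect step_bounded. bdd_above (p ` B))"
    by (rule seminorm_topology_bounded_iff[OF subspace seminorms])
  then show ?thesis using topology_eq_step_bounded by simp
qed

lemma tvs_bounded_sball: "tvs_bounded E (sball k R)"
  unfolding tvs_bounded_iff
proof (intro conjI sball_subset allI impI)
  fix p assume "step_bounded p"
  then obtain C where C: "0 < C" "\<And>R x. 0 < R \<Longrightarrow> x \<in> sball k R \<Longrightarrow> p x \<le> C * R"
    using step_boundedE by blast
  have "p x \<le> C * max R 1" if "x \<in> sball k R" for x
    using C(2)[of "max R 1" x] sball_mono[of k k R "max R 1"] that by auto
  then show "bdd_above (p ` sball k R)" by (intro bdd_aboveI2) auto
qed

text \<open>Regularity of the inductive limit. If \<open>B\<close> leaves every ball, elements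
  \<open>X k\<close> of \<open>B\<close> and indices \<open>n k\<close> with large weighted
  coordinates are combined into one seminorm \<open>q\<close>. It is bounded on the ball of every
  step because the weights decrease in \<open>k\<close>, yet unbounded on \<open>B\<close>.\<close>

lemma tvs_bounded_subset_sball:
  assumes B: "tvs_bounded E B"
  obtains k R where "0 < R" "B \<subseteq> sball k R"
proof (rule ccontr)
  assume "\<not> thesis"
  then have no: "\<not> B \<subseteq> sball k R" if "0 < R" for k R using that \<open>\<And>R k. \<lbrakk>0 < R; B \<subseteq> sball k R\<rbrakk> \<Longrightarrow> thesis\<close> by blast
  have BS: "B \<subseteq> S" using B by (simp add: tvs_bounded_iff)
  have "\<exists>x n. x \<in> B \<and> real k + 1 < cmod (\<iota> x n) * w k n" for k
  proof -
    have "\<not> B \<subseteq> sball k (real k + 1)" by (rule no) simp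
    then obtain x where "x \<in> B" "x \<notin> sball k (real k + 1)" by blast
    then show ?thesis using BS by (auto simp: sball_def not_le)
  qed
  then obtain X n where X: "\<And>k. X k \<in> B" "\<And>k. real k + 1 < cmod (\<iota> (X k) (n k)) * w k (n k)" by metis
  define q where "q x = (SUP k. w k (n k) * cmod (\<iota> x (n k)))" for x
  \<comment> \<open>For \<open>k \<ge> j\<close> the weight \<open>w k\<close> is below
    \<open>w j\<close>, and the ball of step \<open>j\<close> gives the bound; the finitely many
    \<open>k < j\<close> are paid for by the sum.\<close>
  have bd: "w k (n k) * cmod (\<iota> x (n k)) \<le> (1 + (\<Sum>i<j. w i (n i))) * R" if x: "x \<in> sball j R" "0 < R" for x j k R
  proof -
    have s0: "0 \<le> (\<Sum>i<j. w i (n i))" by (intro sum_nonneg) (simp add: less_imp_le)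
    have w1: "1 \<le> w j m" for m using radius_gt_1[of j] by (intro weight_ge_1) simp
    have c: "cmod (\<iota> x m) * w j m \<le> R" for m using x by (auto simp: sball_def)
    have c': "cmod (\<iota> x m) \<le> R" for m
      using c[of m] mult_left_mono[OF w1, of "cmod (\<iota> x m)" m] by simp
    show ?thesis
    proof (cases "k < j")
      case True
      have "w k (n k) * cmod (\<iota> x (n k)) \<le> (\<Sum>i<j. w i (n i)) * R"
        using True c' s0 by (intro mult_mono member_le_sum) (auto simp: less_imp_le)
      also have "\<dots> \<le> (1 + (\<Sum>i<j. w i (n i))) * R" using x by (intro mult_right_mono) auto
      finally show ?thesis .
    next
      case False
      then have "w k (n k) * cmod (\<iota> x (n k)) \<le> w j (n k) * cmod (\<iota> x (n k))"
        by (intro mult_right_mono w_antimono) auto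
      also have "\<dots> \<le> 1 * R" using c[of "n k"] by (simp add: mult.commute)
      also have "\<dots> \<le> (1 + (\<Sum>i<j. w i (n i))) * R" using s0 x by (intro mult_right_mono) auto
      finally show ?thesis .
    qed
  qed
  have bdd: "bdd_above (range (\<lambda>k. w k (n k) * cmod (\<iota> x (n k))))" if "x \<in> S" for x
  proof -
    obtain j R where "0 < R" "x \<in> sball j R" using sball_cover[OF \<open>x \<in> S\<close>] .
    then show ?thesis using bd by (intro bdd_aboveI2) auto
  qed
  have "step_bounded q"
    unfolding step_bounded_def
  proof (intro conjI allI)
    show "seminorm_on S q"
      unfolding q_def
    proof (rule seminorm_on_SUP[OF _ _ bdd subspace])
      show "seminorm_on S (\<lambda>x. w k (n k) * cmod (\<iota> x (n k)))" for k
        unfolding seminorm_on_def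
        by (auto simp: iota_add iota_scale norm_mult less_imp_le distrib_left[symmetric]
            intro!: mult_left_mono norm_triangle_ineq)
    qed auto
    show "\<exists>C. \<forall>x\<in>sball j 1. q x \<le> C" for j
      unfolding q_def using bd[of _ j 1] by (intro exI[of _ "1 + (\<Sum>i<j. w i (n i))"] ballI cSUP_least) auto
  qed
  then have "bdd_above (q ` B)" using B by (simp add: tvs_bounded_iff)
  then obtain M where M: "\<And>x. x \<in> B \<Longrightarrow> q x \<le> M" by (auto simp: bdd_above_def)
  obtain k :: nat where k: "M < real k" using reals_Archimedean2 by blast
  have "real k + 1 < w k (n k) * cmod (\<iota> (X k) (n k))" using X(2)[of k] by (simp add: mult.commute)
  also have "\<dots> \<le> q (X k)" unfolding q_def using X(1) BS by (intro cSUP_upper bdd) auto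
  also have "\<dots> \<le> M" using M X by blast
  finally show False using k by simp
qed

end

context coefficient_space
begin

section \<open>Unit vectors and the convergence of coordinate expansions\<close>

subsection \<open>Expansions in the unit vectors\<close>

definition e :: "nat^'d \<Rightarrow> 'i \<Rightarrow> complex" where
  "e n = inv_into S \<iota> (\<lambda>m. if m = n then 1 else 0)"

lemma e_in [simp]: "e n \<in> S" and iota_e: "\<iota> (e n) = (\<lambda>m. if m = n then 1 else 0)"
proof -
  have "cmod ((\<lambda>m. if m = n then 1 else 0) m) * w 0 m \<le> w 0 n" for m
    by (auto simp: less_imp_le)
  then obtain x where "x \<in> S" "\<iota> x = (\<lambda>m. if m = n then 1 else 0)" by (rule iota_surj)
  then have "(\<lambda>m. if m = n then 1 else 0) \<in> \<iota> ` S" by (metis imageI)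
  then show "e n \<in> S" "\<iota> (e n) = (\<lambda>m. if m = n then 1 else 0)"
    unfolding e_def by (auto simp: inv_into_into f_inv_into_f)
qed

definition part :: "('i \<Rightarrow> complex) \<Rightarrow> (nat^'d) set \<Rightarrow> 'i \<Rightarrow> complex" where
  "part x N = (\<Sum>n\<in>N. \<iota> x n *\<^sub>F e n)"

lemma scale_e_in [simp]: "c *\<^sub>F e n \<in> S"
  using cfun.subspace_scale[OF subspace] by simp

lemma part_in [simp]: "part x N \<in> S"
  unfolding part_def by (intro cfun.subspace_sum[OF subspace]) simp

lemma iota_part: "finite N \<Longrightarrow> \<iota> (part x N) m = (if m \<in> N then \<iota> x m else 0)"
  unfolding part_def by (subst iota_sum) (auto simp: iota_scale iota_e sum_fun_apply if_distrib cong: if_cong)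

lemma diff_in: "x \<in> S \<Longrightarrow> y \<in> S \<Longrightarrow> x - y \<in> S"
  using cfun.subspace_diff[OF subspace] .

lemma ratio_eq: "w (Suc k) n / w k n = 1 / weight \<alpha> (radius k / radius (Suc k)) n"
  using radius_gt_1[of k] radius_gt_1[of "Suc k"] by (simp add: weight_divide)

lemma radius_ratio: "1 < radius k / radius (Suc k)"
  using radius_gt_1[of "Suc k"] radius_Suc_less[of k] by simp

lemma summable_on_ratio: "(\<lambda>n. w (Suc k) n / w k n) summable_on UNIV"
  using summable_on_weight[OF _ radius_ratio, of \<alpha> 0] alpha unfolding ratio_eq by simp

lemma finite_ratio_ge: "0 < \<epsilon> \<Longrightarrow> finite {n. \<epsilon> \<le> w (Suc k) n / w k n}"
proof -
  assume eps: "0 < \<epsilon>"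
  have "\<forall>n. 0 \<le> w (Suc k) n / w k n" using w_pos by (simp add: less_imp_le)
  let ?F = "{n. \<epsilon> \<le> w (Suc k) n / w k n}"
  let ?I = "infsum (\<lambda>n. w (Suc k) n / w k n) UNIV"
  obtain B :: nat where B: "?I / \<epsilon> < real B" using reals_Archimedean2 by blast
  show "finite ?F"
  proof (rule ccontr)
    assume "infinite ?F"
    then obtain G where G: "G \<subseteq> ?F" "finite G" "card G = B" using infinite_arbitrarily_large by blast
    have "real B * \<epsilon> = (\<Sum>n\<in>G. \<epsilon>)" using G by simp
    also have "\<dots> \<le> (\<Sum>n\<in>G. w (Suc k) n / w k n)" using G by (intro sum_mono) auto
    also have "\<dots> \<le> ?I" using summable_on_ratio w_pos G(2)
      by (intro finite_sum_le_infsum) (auto simp: less_imp_le)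
    finally show False using B eps by (simp add: field_simps)
  qed
qed

text \<open>In step \<open>k\<close> the remainders are merely bounded. Passing to step
  \<open>Suc k\<close> multiplies the weights by a summable ratio, which is below
  \<open>\<epsilon>\<close> outside a finite index set, so there the remainders become
  small.\<close>

lemma expansion_tendsto:
  assumes p: "step_bounded p" and x: "x \<in> S"
  shows "((\<lambda>N. p (x - part x N)) \<longlongrightarrow> 0) (finite_subsets_at_top UNIV)"
proof (rule tendstoI)
  fix \<delta> :: real assume d: "0 < \<delta>"
  obtain k R where R: "0 < R" "x \<in> sball k R" using sball_cover[OF x] .
  obtain C where C: "0 < C" "\<And>R x. 0 < R \<Longrightarrow> x \<in> sball (Suc k) R \<Longrightarrow> p x \<le> C * R"
    using step_boundedE[OF p] by blast
  define \<epsilon> where "\<epsilon> = \<delta> / (2 * C * R)"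
  have eps: "0 < \<epsilon>" using d C R by (simp add: \<epsilon>_def)
  let ?F = "{n. \<epsilon> \<le> w (Suc k) n / w k n}"
  have "dist (p (x - part x N)) 0 < \<delta>" if N: "finite N" "?F \<subseteq> N" for N
  proof -
    have "cmod (\<iota> (x - part x N) n) * w (Suc k) n \<le> R * \<epsilon>" for n
    proof (cases "n \<in> N")
      case True
      then show ?thesis using R eps N by (simp add: iota_diff x iota_part)
    next
      case False
      then have "\<not> \<epsilon> \<le> w (Suc k) n / w k n" using N by blast
      then have "w (Suc k) n / w k n \<le> \<epsilon>" by linarith
      then have "w (Suc k) n \<le> \<epsilon> * w k n" using w_pos[of k n] by (simp add: pos_divide_le_eq)
      then have "cmod (\<iota> x n) * w (Suc k) n \<le> cmod (\<iota> x n) * (\<epsilon> * w k n)" by (intro mult_left_mono) auto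
      also have "\<dots> = (cmod (\<iota> x n) * w k n) * \<epsilon>" by simp
      also have "\<dots> \<le> R * \<epsilon>" using R eps by (intro mult_right_mono) (auto simp: sball_def)
      finally show ?thesis using False N by (simp add: iota_diff x iota_part)
    qed
    then have "x - part x N \<in> sball (Suc k) (R * \<epsilon>)" by (simp add: sball_def diff_in x)
    then have "p (x - part x N) \<le> C * (R * \<epsilon>)" using C R eps by simp
    also have "\<dots> = \<delta> / 2" using C R by (simp add: \<epsilon>_def)
    finally show ?thesis using d seminorm_onD(1)[OF step_bounded_seminorm[OF p], of "x - part x N"]
      by (simp add: diff_in x)
  qed
  then show "\<forall>\<^sub>F N in finite_subsets_at_top UNIV. dist (p (x - part x N)) 0 < \<delta>"
    using finite_ratio_ge[OF eps, of k] by (auto simp: eventually_finite_subsets_at_top)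
qed

lemma limitin_expansion:
  assumes x: "x \<in> S"
  shows "limitin E (part x) x (finite_subsets_at_top UNIV)"
  unfolding limitin_def
proof (intro conjI allI impI)
  fix U assume U: "openin E U \<and> x \<in> U"
  have U': "openin (seminorm_topology S (Collect step_bounded)) U"
    using U by (subst topology_eq_step_bounded[symmetric]) simp
  obtain F \<epsilon> where F: "finite F" "F \<subseteq> Collect step_bounded" "0 < \<epsilon>" "{y \<in> S. \<forall>p\<in>F. p (y - x) < \<epsilon>} \<subseteq> U"
    by (rule openin_seminormD[OF subspace seminorms U' conjunct2[OF U]])
  have "\<forall>\<^sub>F N in finite_subsets_at_top UNIV. \<forall>p\<in>F. p (x - part x N) < \<epsilon>"
    using F expansion_tendsto[OF _ x] by (intro eventually_ball_finite ballI order_tendstoD) auto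
  then show "\<forall>\<^sub>F N in finite_subsets_at_top UNIV. part x N \<in> U"
  proof eventually_elim
    case (elim N)
    have "p (part x N - x) < \<epsilon>" if "p \<in> F" for p
      using elim that seminorm_on_minus_commute[OF seminorms subspace, of p "part x N" x] F(2) x by auto
    then show ?case using F(4) by auto
  qed
qed (use x in auto)

text \<open>By the expansion a continuous seminorm is governed by its values on the unit vectors, so
  that estimates reduce to finite sums.\<close>

lemma step_bounded_le_sum:
  assumes p: "step_bounded p" and x: "x \<in> S"
    and le: "\<And>N. finite N \<Longrightarrow> (\<Sum>n\<in>N. cmod (\<iota> x n) * p (e n)) \<le> B"
  shows "p x \<le> B"
proof -
  have "p x \<le> p (x - part x N) + B" if N: "finite N" for N
  proof -
    note sp = step_bounded_seminorm[OF p]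
    have "p (part x N) \<le> (\<Sum>n\<in>N. p (\<iota> x n *\<^sub>F e n))"
      unfolding part_def by (rule seminorm_on_sum[OF sp subspace N]) simp
    also have "\<dots> = (\<Sum>n\<in>N. cmod (\<iota> x n) * p (e n))" by (intro sum.cong refl seminorm_onD(3)[OF sp]) simp
    finally show ?thesis
      using seminorm_on_le_add[OF sp subspace x part_in, of x N] le[OF N] by linarith
  qed
  then have "\<forall>\<^sub>F N in finite_subsets_at_top UNIV. p x \<le> p (x - part x N) + B"
    by (intro eventually_finite_subsets_at_top_weakI) simp
  then have "p x \<le> 0 + B"
    using expansion_tendsto[OF p x]
    by (intro tendsto_lowerbound[OF tendsto_add[OF _ tendsto_const]]) auto
  then show ?thesis by simp
qed

section \<open>The strong dual as a nuclear Frechet space\<close>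

subsection \<open>The strong dual\<close>

abbreviation "D \<equiv> dual_space E"

lemma seminorm_on_cmod:
  assumes "linear_form_on S \<phi>" shows "seminorm_on S (\<lambda>x. cmod (\<phi> x))"
  using assms unfolding linear_form_on_def seminorm_on_def by (auto simp: norm_mult norm_triangle_ineq)

lemma linear_form_diff:
  assumes "linear_form_on S \<phi>" "x \<in> S" "y \<in> S"
  shows "\<phi> (x - y) = \<phi> x - \<phi> y"
proof -
  have "x - y = x + (-1) *\<^sub>F y" by (auto simp: fun_eq_iff)
  moreover have "\<phi> (x + (-1) *\<^sub>F y) = \<phi> x + \<phi> ((-1) *\<^sub>F y)"
    using assms cfun.subspace_scale[OF subspace] unfolding linear_form_on_def by blast
  moreover have "\<phi> ((-1) *\<^sub>F y) = -1 * \<phi> y" using assms unfolding linear_form_on_def by blast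
  ultimately show ?thesis by simp
qed

text \<open>Continuity of a form amounts to continuity of the seminorm
  \<open>cmod (\<phi> x)\<close>; membership in the dual can thus be tested on the balls
  alone.\<close>

lemma dual_iff: "\<phi> \<in> D \<longleftrightarrow> linear_form_on S \<phi> \<and> (\<forall>x. x \<notin> S \<longrightarrow> \<phi> x = 0) \<and> step_bounded (\<lambda>x. cmod (\<phi> x))"
proof
  assume "\<phi> \<in> D"
  then have \<phi>: "linear_form_on S \<phi>" "\<forall>x. x \<notin> S \<longrightarrow> \<phi> x = 0" "continuous_map E euclidean \<phi>"
    by (auto simp: dual_space_def)
  have "continuous_map E euclideanreal (\<lambda>x. cmod (\<phi> x))"
    using continuous_map_norm[OF \<phi>(3)] .
  then show "linear_form_on S \<phi> \<and> (\<forall>x. x \<notin> S \<longrightarrow> \<phi> x = 0) \<and> step_bounded (\<lambda>x. cmod (\<phi> x))"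
    using \<phi> step_bounded_continuous[OF seminorm_on_cmod] by blast
next
  assume "linear_form_on S \<phi> \<and> (\<forall>x. x \<notin> S \<longrightarrow> \<phi> x = 0) \<and> step_bounded (\<lambda>x. cmod (\<phi> x))"
  then have \<phi>: "linear_form_on S \<phi>" "\<forall>x. x \<notin> S \<longrightarrow> \<phi> x = 0" "step_bounded (\<lambda>x. cmod (\<phi> x))" by auto
  have "continuous_map E euclidean \<phi>"
    unfolding continuous_map_def
  proof (intro conjI allI impI)
    fix V :: "complex set" assume "openin euclidean V"
    then have V: "open V" by simp
    show "openin E {x \<in> topspace E. \<phi> x \<in> V}"
    proof (subst openin_subopen, intro ballI)
      fix x assume "x \<in> {x \<in> topspace E. \<phi> x \<in> V}"
      then have x: "x \<in> S" "\<phi> x \<in> V" by auto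
      then obtain \<epsilon> where eps: "0 < \<epsilon>" "ball (\<phi> x) \<epsilon> \<subseteq> V" using V open_contains_ball by blast
      have "{y \<in> S. cmod (\<phi> (y - x)) < \<epsilon>} \<subseteq> {x \<in> topspace E. \<phi> x \<in> V}"
        using eps x by (auto simp: linear_form_diff[OF \<phi>(1)] dist_norm norm_minus_commute subset_iff)
      moreover have "openin E {y \<in> S. cmod (\<phi> (y - x)) < \<epsilon>}"
        using openin_step_bounded[OF \<phi>(3) x(1) eps(1)] .
      moreover have "x \<in> {y \<in> S. cmod (\<phi> (y - x)) < \<epsilon>}"
        using x eps linear_form_diff[OF \<phi>(1) x(1) x(1)] by simp
      ultimately show "\<exists>T. openin E T \<and> x \<in> T \<and> T \<subseteq> {x \<in> topspace E. \<phi> x \<in> V}" by blast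
    qed
  qed simp
  then show "\<phi> \<in> D" using \<phi> by (simp add: dual_space_def)
qed

lemma dual_linear: "\<phi> \<in> D \<Longrightarrow> linear_form_on S \<phi>"
  and dual_step_bounded: "\<phi> \<in> D \<Longrightarrow> step_bounded (\<lambda>x. cmod (\<phi> x))"
  and dual_outside: "\<phi> \<in> D \<Longrightarrow> x \<notin> S \<Longrightarrow> \<phi> x = 0"
  by (auto simp: dual_iff)

lemma subspace_dual: "cfun.subspace D"
proof (rule cfun.subspaceI)
  show "0 \<in> D" by (auto simp: dual_iff linear_form_on_def step_bounded_def seminorm_on_def)
next
  fix \<phi> \<psi> assume \<phi>: "\<phi> \<in> D" and \<psi>: "\<psi> \<in> D"
  have lin: "linear_form_on S (\<phi> + \<psi>)"
    using dual_linear[OF \<phi>] dual_linear[OF \<psi>] unfolding linear_form_on_def by (auto simp: algebra_simps)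
  have "step_bounded (\<lambda>x. cmod ((\<phi> + \<psi>) x))"
    unfolding step_bounded_def
  proof (intro conjI allI seminorm_on_cmod lin)
    fix k
    obtain A B where "\<And>x. x \<in> sball k 1 \<Longrightarrow> cmod (\<phi> x) \<le> A" "\<And>x. x \<in> sball k 1 \<Longrightarrow> cmod (\<psi> x) \<le> B"
      using dual_step_bounded[OF \<phi>] dual_step_bounded[OF \<psi>] unfolding step_bounded_def by metis
    then have "cmod ((\<phi> + \<psi>) x) \<le> A + B" if "x \<in> sball k 1" for x
      using that norm_triangle_ineq[of "\<phi> x" "\<psi> x"] by fastforce
    then show "\<exists>C. \<forall>x\<in>sball k 1. cmod ((\<phi> + \<psi>) x) \<le> C" by blast
  qed
  then show "\<phi> + \<psi> \<in> D" using lin dual_outside[OF \<phi>] dual_outside[OF \<psi>] by (simp add: dual_iff)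
next
  fix c \<phi> assume \<phi>: "\<phi> \<in> D"
  have lin: "linear_form_on S (c *\<^sub>F \<phi>)"
    using dual_linear[OF \<phi>] unfolding linear_form_on_def by (auto simp: algebra_simps)
  have "step_bounded (\<lambda>x. cmod ((c *\<^sub>F \<phi>) x))"
    unfolding step_bounded_def
  proof (intro conjI allI seminorm_on_cmod lin)
    fix k
    obtain A where "\<And>x. x \<in> sball k 1 \<Longrightarrow> cmod (\<phi> x) \<le> A"
      using dual_step_bounded[OF \<phi>] unfolding step_bounded_def by metis
    then have "cmod ((c *\<^sub>F \<phi>) x) \<le> cmod c * A" if "x \<in> sball k 1" for x
      using that by (simp add: norm_mult mult_left_mono)
    then show "\<exists>C. \<forall>x\<in>sball k 1. cmod ((c *\<^sub>F \<phi>) x) \<le> C" by blast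
  qed
  then show "c *\<^sub>F \<phi> \<in> D" using lin dual_outside[OF \<phi>] by (simp add: dual_iff)
qed

definition nrm :: "nat \<Rightarrow> (('i \<Rightarrow> complex) \<Rightarrow> complex) \<Rightarrow> real" where
  "nrm k \<phi> = (SUP x\<in>sball k 1. cmod (\<phi> x))"

lemma bdd_above_dual:
  assumes "\<phi> \<in> D" "tvs_bounded E B" shows "bdd_above ((\<lambda>x. cmod (\<phi> x)) ` B)"
  using assms dual_step_bounded[OF assms(1)] by (auto simp: tvs_bounded_iff)

lemma seminorm_on_bounded_sup:
  assumes "tvs_bounded E B" "B \<noteq> {}"
  shows "seminorm_on D (\<lambda>\<phi>. SUP x\<in>B. cmod (\<phi> x))"
  by (rule seminorm_on_SUP[OF assms(2) _ bdd_above_dual[OF _ assms(1)] subspace_dual])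
    (auto simp: seminorm_on_def norm_mult norm_triangle_ineq)

lemma sball_nonempty: "sball k 1 \<noteq> {}"
  using zero_in_sball[of 1 k] by auto

lemma seminorm_on_nrm: "seminorm_on D (nrm k)"
  using seminorm_on_bounded_sup[OF tvs_bounded_sball sball_nonempty] unfolding nrm_def[abs_def] .

lemma cmod_le_nrm:
  assumes "\<phi> \<in> D" "x \<in> sball k 1" shows "cmod (\<phi> x) \<le> nrm k \<phi>"
  unfolding nrm_def by (rule cSUP_upper[OF assms(2) bdd_above_dual[OF assms(1) tvs_bounded_sball]])

lemma cmod_le_nrm_scaled:
  assumes "\<phi> \<in> D" "x \<in> sball k R" "0 < R" shows "cmod (\<phi> x) \<le> R * nrm k \<phi>"
proof -
  have x: "x \<in> S" using assms(2) sball_subset by blast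
  have "\<phi> (complex_of_real (1/R) *\<^sub>F x) = complex_of_real (1/R) * \<phi> x"
    using dual_linear[OF assms(1)] x unfolding linear_form_on_def by blast
  then have "cmod (\<phi> (complex_of_real (1/R) *\<^sub>F x)) = cmod (\<phi> x) / R"
    using assms by (simp add: norm_mult norm_divide)
  then show ?thesis using cmod_le_nrm[OF assms(1) sball_scale[OF assms(2,3)]] assms(3)
    by (simp add: pos_divide_le_eq mult.commute)
qed

lemma nrm_leI: "(\<And>x. x \<in> sball k 1 \<Longrightarrow> cmod (\<phi> x) \<le> B) \<Longrightarrow> nrm k \<phi> \<le> B"
  unfolding nrm_def by (rule cSUP_least[OF sball_nonempty])

lemma nrm_mono: "\<phi> \<in> D \<Longrightarrow> j \<le> k \<Longrightarrow> nrm j \<phi> \<le> nrm k \<phi>"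
  by (rule nrm_leI, rule cmod_le_nrm) (use sball_mono[of j k 1 1] in auto)

text \<open>Regularity puts every bounded set into some \<open>sball k R\<close>, so the suprema
  over the unit balls already generate the strong topology. This countable family is what makes it
  metrizable.\<close>

lemma strong_dual_eq: "strong_dual E = seminorm_topology D (range nrm)"
  unfolding strong_dual_def
proof (rule seminorm_topology_eq[OF subspace_dual])
  fix q assume "q \<in> range nrm"
  then obtain k where "q = nrm k" by blast
  then show "\<exists>p\<in>{\<lambda>\<phi>. SUP x\<in>B. cmod (\<phi> x) |B. tvs_bounded E B \<and> B \<noteq> {}}. \<exists>C. \<forall>x\<in>D. q x \<le> C * p x"
    using tvs_bounded_sball[of k 1] sball_nonempty[of k]
    by (intro bexI[of _ "nrm k"] exI[of _ 1]) (auto simp: nrm_def[abs_def])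
next
  fix p assume "p \<in> {\<lambda>\<phi>. SUP x\<in>B. cmod (\<phi> x) |B. tvs_bounded E B \<and> B \<noteq> {}}"
  then obtain B where B: "p = (\<lambda>\<phi>. SUP x\<in>B. cmod (\<phi> x))" "tvs_bounded E B" "B \<noteq> {}" by blast
  obtain k R where R: "0 < R" "B \<subseteq> sball k R" using tvs_bounded_subset_sball[OF B(2)] .
  have "p \<phi> \<le> R * nrm k \<phi>" if "\<phi> \<in> D" for \<phi>
    unfolding B(1) using R cmod_le_nrm_scaled[OF that] by (intro cSUP_least[OF B(3)]) auto
  then show "\<exists>q\<in>range nrm. \<exists>C. \<forall>x\<in>D. p x \<le> C * q x" by blast
qed (auto intro: seminorm_on_nrm seminorm_on_bounded_sup)

text \<open>A Cauchy sequence of forms converges uniformly on each ball; the pointwise limit is then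
  bounded on each ball, which by \<open>dual_iff\<close> is all that continuity asks.\<close>

lemma frechet_strong_dual: "frechet_space (strong_dual E)"
  unfolding strong_dual_eq
proof (rule frechet_space_seminorm_topology[OF subspace_dual seminorm_on_nrm])
  fix \<phi> assume \<phi>: "\<phi> \<in> D" "\<And>k. nrm k \<phi> = 0"
  show "\<phi> = 0"
  proof
    fix x
    show "\<phi> x = 0 x"
    proof (cases "x \<in> S")
      case True
      then obtain k R where "0 < R" "x \<in> sball k R" using sball_cover by blast
      then show ?thesis using cmod_le_nrm_scaled[OF \<phi>(1), of x k R] \<phi>(2) by simp
    next
      case False then show ?thesis using dual_outside[OF \<phi>(1)] by simp
    qed
  qed
next
  fix y :: "nat \<Rightarrow> ('i \<Rightarrow> complex) \<Rightarrow> complex"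
  assume y: "range y \<subseteq> D" and cau: "\<And>k \<epsilon>. \<epsilon> > 0 \<Longrightarrow> \<exists>M. \<forall>m\<ge>M. \<forall>n\<ge>M. nrm k (y m - y n) < \<epsilon>"
  have yD: "y m \<in> D" for m using y by auto
  have yd: "y m - y n \<in> D" for m n using cfun.subspace_diff[OF subspace_dual yD yD] .
  have unif: "\<exists>M. \<forall>m\<ge>M. \<forall>n\<ge>M. cmod (y m x - y n x) < \<epsilon>" if eps: "0 < \<epsilon>" and x: "x \<in> S" for \<epsilon> x
  proof -
    obtain k R where R: "0 < R" "x \<in> sball k R" using sball_cover[OF x] .
    obtain M where M: "\<forall>m\<ge>M. \<forall>n\<ge>M. nrm k (y m - y n) < \<epsilon> / R" using cau[of "\<epsilon> / R" k] R eps by auto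
    have "cmod (y m x - y n x) < \<epsilon>" if "m \<ge> M" "n \<ge> M" for m n
    proof -
      have "R * nrm k (y m - y n) < \<epsilon>" using M that R by (simp add: pos_less_divide_eq mult.commute)
      then show ?thesis using cmod_le_nrm_scaled[OF yd R(2,1), of m n] by simp
    qed
    then show ?thesis by blast
  qed
  have "Cauchy (\<lambda>m. y m x)" for x
  proof (cases "x \<in> S")
    case True then show ?thesis using unif by (auto simp: Cauchy_def dist_norm)
  next
    case False then show ?thesis using dual_outside[OF yD] by (simp add: Cauchy_def)
  qed
  then have "\<exists>z. (\<lambda>m. y m x) \<longlonglongrightarrow> z" for x
    using Cauchy_convergent_iff convergent_def by blast
  then obtain \<phi> where \<phi>: "\<And>x. (\<lambda>m. y m x) \<longlonglongrightarrow> \<phi> x" by metis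
  have lim_unif: "\<exists>M. \<forall>m\<ge>M. \<forall>x\<in>sball k 1. cmod (y m x - \<phi> x) \<le> \<epsilon>" if "0 < \<epsilon>" for k \<epsilon>
  proof -
    obtain M where M: "\<forall>m\<ge>M. \<forall>n\<ge>M. nrm k (y m - y n) < \<epsilon>" using cau[OF \<open>0 < \<epsilon>\<close>] by blast
    have "cmod (y m x - \<phi> x) \<le> \<epsilon>" if m: "m \<ge> M" and x: "x \<in> sball k 1" for m x
    proof (rule tendsto_upperbound)
      show "(\<lambda>n. cmod (y m x - y n x)) \<longlonglongrightarrow> cmod (y m x - \<phi> x)" by (intro tendsto_intros \<phi>)
      show "\<forall>\<^sub>F n in sequentially. cmod (y m x - y n x) \<le> \<epsilon>"
        unfolding eventually_sequentially
      proof (intro exI[of _ M] allI impI)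
        fix n assume "n \<ge> M"
        then have "nrm k (y m - y n) < \<epsilon>" using M m by blast
        then show "cmod (y m x - y n x) \<le> \<epsilon>" using cmod_le_nrm[OF yd x, of m n] by simp
      qed
    qed simp
    then show ?thesis by blast
  qed
  have lin: "linear_form_on S \<phi>"
    unfolding linear_form_on_def
  proof (intro conjI ballI allI)
    fix a b assume ab: "a \<in> S" "b \<in> S"
    have "y m (a + b) = y m a + y m b" for m using dual_linear[OF yD] ab unfolding linear_form_on_def by blast
    then have "(\<lambda>m. y m (a + b)) \<longlonglongrightarrow> \<phi> a + \<phi> b" using tendsto_add[OF \<phi>[of a] \<phi>[of b]] by simp
    then show "\<phi> (a + b) = \<phi> a + \<phi> b" using LIMSEQ_unique \<phi> by blast
  next
    fix c a assume a: "a \<in> S"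
    have "y m (c *\<^sub>F a) = c * y m a" for m using dual_linear[OF yD] a unfolding linear_form_on_def by blast
    then have "(\<lambda>m. y m (c *\<^sub>F a)) \<longlonglongrightarrow> c * \<phi> a" using tendsto_mult_left[OF \<phi>[of a], of c] by simp
    then show "\<phi> (c *\<^sub>F a) = c * \<phi> a" using LIMSEQ_unique \<phi> by blast
  qed
  have "step_bounded (\<lambda>x. cmod (\<phi> x))"
    unfolding step_bounded_def
  proof (intro conjI allI seminorm_on_cmod lin)
    fix k
    obtain M where M: "\<And>x. x \<in> sball k 1 \<Longrightarrow> cmod (y M x - \<phi> x) \<le> 1" using lim_unif[of 1 k] by auto
    have "cmod (\<phi> x) \<le> nrm k (y M) + 1" if "x \<in> sball k 1" for x
      using M[OF that] cmod_le_nrm[OF yD[of M] that] norm_triangle_sub[of "\<phi> x" "y M x"]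
      by (simp add: norm_minus_commute)
    then show "\<exists>C. \<forall>x\<in>sball k 1. cmod (\<phi> x) \<le> C" by blast
  qed
  moreover have "\<phi> x = 0" if "x \<notin> S" for x
    using \<phi>[of x] dual_outside[OF yD that] LIMSEQ_unique tendsto_const by (simp add: LIMSEQ_const_iff)
  ultimately have \<phi>D: "\<phi> \<in> D" using lin by (simp add: dual_iff)
  have "(\<lambda>m. nrm k (y m - \<phi>)) \<longlonglongrightarrow> 0" for k
  proof (rule tendstoI)
    fix \<epsilon> :: real assume e: "0 < \<epsilon>"
    obtain M where M: "\<And>m x. m \<ge> M \<Longrightarrow> x \<in> sball k 1 \<Longrightarrow> cmod (y m x - \<phi> x) \<le> \<epsilon> / 2"
      using lim_unif[of "\<epsilon> / 2" k] e by auto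
    have "dist (nrm k (y m - \<phi>)) 0 < \<epsilon>" if "m \<ge> M" for m
    proof -
      have "nrm k (y m - \<phi>) \<le> \<epsilon> / 2" by (rule nrm_leI) (use M that in simp)
      moreover have "0 \<le> nrm k (y m - \<phi>)"
        using seminorm_onD(1)[OF seminorm_on_nrm cfun.subspace_diff[OF subspace_dual yD \<phi>D]] .
      ultimately show ?thesis using e by simp
    qed
    then show "\<forall>\<^sub>F m in sequentially. dist (nrm k (y m - \<phi>)) 0 < \<epsilon>"
      by (auto simp: eventually_sequentially)
  qed
  then show "\<exists>x\<in>D. \<forall>k. (\<lambda>m. nrm k (y m - x)) \<longlonglongrightarrow> 0" using \<phi>D by blast
qed

text \<open>Zero outside \<open>S\<close> by the convention of \<open>dual_space\<close>, so that it
  is literally an element of \<open>D\<close>.\<close>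

definition coord :: "nat^'d \<Rightarrow> ('i \<Rightarrow> complex) \<Rightarrow> complex" where
  "coord n = (\<lambda>x. if x \<in> S then \<iota> x n else 0)"

lemma coord_le: "x \<in> sball k 1 \<Longrightarrow> cmod (coord n x) \<le> 1 / w k n"
  using w_pos[of k n] by (auto simp: sball_def coord_def pos_le_divide_eq)

lemma coord_in [simp]: "coord n \<in> D"
proof -
  have lin: "linear_form_on S (coord n)"
    unfolding linear_form_on_def coord_def
    using cfun.subspace_add[OF subspace] cfun.subspace_scale[OF subspace]
    by (auto simp: iota_add iota_scale)
  moreover have "step_bounded (\<lambda>x. cmod (coord n x))"
    unfolding step_bounded_def using seminorm_on_cmod[OF lin] coord_le by blast
  ultimately show ?thesis by (simp add: dual_iff coord_def)
qed

lemma nrm_coord_le: "nrm k (coord n) \<le> 1 / w k n"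
  by (rule nrm_leI) (rule coord_le)

lemma cmod_dual_e_le:
  assumes "\<phi> \<in> D" shows "cmod (\<phi> (e n)) \<le> w k n * nrm k \<phi>"
  by (rule cmod_le_nrm_scaled[OF assms]) (auto simp: sball_def iota_e less_imp_le)

abbreviation en :: "nat \<Rightarrow> nat^'d" where "en \<equiv> enum_index"

lemma bij_en: "bij en"
  by (rule bij_enum_index)

lemma summable_ratio: "summable (\<lambda>i. w (Suc k) (en i) / w k (en i))"
proof -
  have "(\<lambda>i. w (Suc k) (en i) / w k (en i)) summable_on UNIV"
    using summable_on_reindex_bij_betw[OF bij_en, of "\<lambda>n. w (Suc k) n / w k n"] summable_on_ratio by simp
  then show ?thesis using summable_on_imp_summable by blast
qed

lemma filterlim_en: "filterlim (\<lambda>M. en ` {..<M}) (finite_subsets_at_top UNIV) sequentially"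
  unfolding filterlim_def le_filter_def eventually_filtermap
proof (intro allI impI)
  fix P :: "(nat^'d) set \<Rightarrow> bool" assume "eventually P (finite_subsets_at_top UNIV)"
  then obtain X where X: "finite X" "\<And>Y. finite Y \<Longrightarrow> X \<subseteq> Y \<Longrightarrow> P Y"
    by (auto simp: eventually_finite_subsets_at_top)
  have "finite (inv en ` X)" using X by simp
  then obtain M where M: "inv en ` X \<subseteq> {..<M}" using finite_nat_iff_bounded by blast
  have sub: "X \<subseteq> en ` {..<m}" if "m \<ge> M" for m
  proof
    fix x assume "x \<in> X"
    then have "inv en x < m" using M that by auto
    moreover have "x = en (inv en x)" using bij_en by (simp add: bij_is_surj surj_f_inv_f)
    ultimately show "x \<in> en ` {..<m}" by blast
  qed
  then show "\<forall>\<^sub>F m in sequentially. P (en ` {..<m})"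
    unfolding eventually_sequentially by (intro exI[of _ M] allI impI X(2) sub finite_imageI finite_lessThan)
qed

definition tail :: "nat \<Rightarrow> nat \<Rightarrow> real" where
  "tail k M = (\<Sum>i. w (Suc k) (en (i + M)) / w k (en (i + M)))"

lemma tail_tendsto: "tail k \<longlonglongrightarrow> 0"
  unfolding tail_def using suminf_exist_split2[OF summable_ratio, of k] by simp

text \<open>Transpose of the expansion in \<open>E\<close>. The remainder vanishes on the first
  \<open>M\<close> unit vectors; on the others the bound
  \<open>w (Suc k) n * nrm (Suc k) \<phi>\<close> for \<open>\<phi> (e n)\<close> meets the bound
  \<open>1 / w k n\<close> for the coordinate, which leaves the tail of the summable ratio.\<close>

lemma dual_expansion:
  assumes \<phi>: "\<phi> \<in> D"
  shows "nrm k (\<phi> - (\<Sum>i<M. \<phi> (e (en i)) *\<^sub>F coord (en i))) \<le> nrm (Suc k) \<phi> * tail k M"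
    and "\<phi> - (\<Sum>i<M. \<phi> (e (en i)) *\<^sub>F coord (en i)) \<in> D"
proof -
  define \<psi> where "\<psi> = \<phi> - (\<Sum>i<M. \<phi> (e (en i)) *\<^sub>F coord (en i))"
  show \<psi>: "\<phi> - (\<Sum>i<M. \<phi> (e (en i)) *\<^sub>F coord (en i)) \<in> D"
    by (intro cfun.subspace_diff[OF subspace_dual \<phi>] cfun.subspace_sum[OF subspace_dual]
        cfun.subspace_scale[OF subspace_dual] coord_in)
  have inj: "inj en" using bij_en by (simp add: bij_is_inj)
  have \<psi>e: "\<psi> (e (en j)) = (if j < M then 0 else \<phi> (e (en j)))" for j
  proof -
    have "(\<Sum>i<M. \<phi> (e (en i)) * coord (en i) (e (en j))) = (\<Sum>i<M. if i = j then \<phi> (e (en j)) else 0)"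
      using inj by (intro sum.cong) (auto simp: coord_def iota_e inj_eq)
    then show ?thesis by (simp add: \<psi>_def sum_fun_apply)
  qed
  have "nrm k \<psi> \<le> nrm (Suc k) \<phi> * tail k M"
  proof (rule nrm_leI)
    fix x assume x: "x \<in> sball k 1"
    have sm: "summable (\<lambda>i. w (Suc k) (en (i + M)) / w k (en (i + M)))"
      using summable_ratio summable_iff_shift[of "\<lambda>i. w (Suc k) (en i) / w k (en i)" M] by simp
    have n0: "0 \<le> nrm (Suc k) \<phi>" using seminorm_onD(1)[OF seminorm_on_nrm \<phi>] .
    show "cmod (\<psi> x) \<le> nrm (Suc k) \<phi> * tail k M"
    proof (rule step_bounded_le_sum[where p="\<lambda>x. cmod (\<psi> x)"])
      show "step_bounded (\<lambda>x. cmod (\<psi> x))" using dual_step_bounded[OF \<psi>] by (simp only: \<psi>_def)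
      show "x \<in> S" using x sball_subset by blast
      fix N :: "(nat^'d) set" assume N: "finite N"
      \<comment> \<open>Positions of the surviving indices after a shift by \<open>M\<close>; they
        turn the sum over \<open>N\<close> into a part of the series
        \<open>tail k M\<close>.\<close>
      define I where "I = {i. en (i + M) \<in> N}"
      have inj': "inj (\<lambda>i. en (i + M))" by (rule injI) (drule injD[OF inj], simp)
      have I: "finite I" unfolding I_def using finite_vimageI[OF N inj'] by (simp add: vimage_def)
      let ?r = "\<lambda>n. w (Suc k) n / w k n"
      have "(\<Sum>n\<in>N. cmod (\<iota> x n) * cmod (\<psi> (e n))) = (\<Sum>n\<in>(\<lambda>i. en (i + M)) ` I. cmod (\<iota> x n) * cmod (\<psi> (e n)))"
      proof (rule sum.mono_neutral_right[OF N])
        show "\<forall>n\<in>N - (\<lambda>i. en (i + M)) ` I. cmod (\<iota> x n) * cmod (\<psi> (e n)) = 0"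
        proof
          fix n assume n: "n \<in> N - (\<lambda>i. en (i + M)) ` I"
          obtain j where j: "n = en j" using bij_en by (metis bij_pointE)
          have "j < M"
          proof (rule ccontr)
            assume "\<not> j < M"
            then have "n = en ((j - M) + M)" using j by simp
            then show False using n unfolding I_def by blast
          qed
          then show "cmod (\<iota> x n) * cmod (\<psi> (e n)) = 0" using j \<psi>e by simp
        qed
      qed (auto simp: I_def)
      also have "\<dots> \<le> (\<Sum>n\<in>(\<lambda>i. en (i + M)) ` I. nrm (Suc k) \<phi> * ?r n)"
      proof (rule sum_mono)
        fix n
        obtain j where j: "n = en j" using bij_en by (metis bij_pointE)
        have "cmod (\<psi> (e n)) \<le> cmod (\<phi> (e n))" using \<psi>e[of j] j by simp
        also have "\<dots> \<le> w (Suc k) n * nrm (Suc k) \<phi>" by (rule cmod_dual_e_le[OF \<phi>])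
        finally have 1: "cmod (\<psi> (e n)) \<le> w (Suc k) n * nrm (Suc k) \<phi>" .
        have "cmod (\<iota> x n) \<le> 1 / w k n" using x w_pos[of k n] by (auto simp: sball_def pos_le_divide_eq)
        then have "cmod (\<iota> x n) * cmod (\<psi> (e n)) \<le> (1 / w k n) * (w (Suc k) n * nrm (Suc k) \<phi>)"
          using 1 by (intro mult_mono) (auto simp: less_imp_le)
        then show "cmod (\<iota> x n) * cmod (\<psi> (e n)) \<le> nrm (Suc k) \<phi> * ?r n" by (simp add: mult_ac)
      qed
      also have "\<dots> = nrm (Suc k) \<phi> * (\<Sum>i\<in>I. ?r (en (i + M)))"
        using inj' by (simp add: sum.reindex inj_on_subset sum_distrib_left)
      also have "\<dots> \<le> nrm (Suc k) \<phi> * tail k M"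
        unfolding tail_def by (intro mult_left_mono n0 sum_le_suminf[OF sm I]) (auto simp: less_imp_le)
      finally show "(\<Sum>n\<in>N. cmod (\<iota> x n) * cmod (\<psi> (e n))) \<le> nrm (Suc k) \<phi> * tail k M" .
    qed
  qed
  then show "nrm k (\<phi> - (\<Sum>i<M. \<phi> (e (en i)) *\<^sub>F coord (en i))) \<le> nrm (Suc k) \<phi> * tail k M"
    by (simp only: \<psi>_def)
qed

text \<open>The norms \<open>nrm k\<close> increase with \<open>k\<close>, so the finitely many of
  them that bound \<open>p\<close> can be replaced by the largest.\<close>

lemma strong_dual_seminorm_bound:
  assumes "seminorm_on D p" "continuous_map (strong_dual E) euclideanreal p"
  obtains k C where "0 < C" "\<And>\<phi>. \<phi> \<in> D \<Longrightarrow> p \<phi> \<le> C * nrm k \<phi>"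
proof -
  have P: "q \<in> range nrm \<Longrightarrow> seminorm_on D q" for q using seminorm_on_nrm by auto
  obtain F C where F: "finite F" "F \<subseteq> range nrm" "0 \<le> C" "\<And>\<phi>. \<phi> \<in> D \<Longrightarrow> p \<phi> \<le> C * (\<Sum>q\<in>F. q \<phi>)"
    using continuous_seminorm_bound_ex[OF subspace_dual P assms(1) assms(2)[unfolded strong_dual_eq]] by auto
  obtain K where K: "finite K" "F = nrm ` K" using finite_subset_image[OF F(1,2)] by auto
  define k where "k = Max (insert 0 K)"
  have k: "j \<le> k" if "j \<in> K" for j using K that by (simp add: k_def)
  have "p \<phi> \<le> (C * card F + 1) * nrm k \<phi>" if \<phi>: "\<phi> \<in> D" for \<phi>
  proof -
    have n0: "0 \<le> nrm k \<phi>" using seminorm_onD(1)[OF seminorm_on_nrm \<phi>] .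
    have "(\<Sum>q\<in>F. q \<phi>) \<le> (\<Sum>q\<in>F. nrm k \<phi>)" using K k nrm_mono[OF \<phi>] by (intro sum_mono) auto
    then have "(\<Sum>q\<in>F. q \<phi>) \<le> card F * nrm k \<phi>" by simp
    then have "C * (\<Sum>q\<in>F. q \<phi>) \<le> C * (card F * nrm k \<phi>)" using F(3) by (rule mult_left_mono)
    then have "p \<phi> \<le> C * (card F * nrm k \<phi>)" using F(4)[OF \<phi>] by linarith
    then show ?thesis using n0 by (simp add: algebra_simps)
  qed
  moreover have "0 < C * card F + 1" using F(3) by (simp add: add_nonneg_pos)
  ultimately show thesis using that by blast
qed

text \<open>The expansion in coordinate functionals is itself a nuclear representation: evaluation
  at \<open>e n\<close> has norm at most \<open>w (Suc k) n / C\<close> with respect to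
  \<open>q\<close>, the value of \<open>p\<close> on \<open>coord n\<close> is at most
  \<open>C / w k n\<close>, and the product is the summable ratio of the weights.\<close>

lemma nuclear_strong_dual: "nuclear_space (strong_dual E)"
proof -
  have top: "topspace (strong_dual E) = D" by (simp add: strong_dual_eq)
  have P: "q \<in> range nrm \<Longrightarrow> seminorm_on D q" for q using seminorm_on_nrm by auto
  have "locally_convex_space (strong_dual E)"
    unfolding locally_convex_space_def top strong_dual_eq using subspace_dual P by auto
  moreover have "\<exists>q. continuous_seminorm (strong_dual E) q \<and> (\<forall>x\<in>D. p x \<le> q x) \<and> nuclear_canonical_map D q p"
    if "continuous_seminorm (strong_dual E) p" for p
  proof -
    have p: "seminorm_on D p" "continuous_map (strong_dual E) euclideanreal p"
      using that top by (auto simp: continuous_seminorm_def)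
    obtain k C where C: "0 < C" "\<And>\<phi>. \<phi> \<in> D \<Longrightarrow> p \<phi> \<le> C * nrm k \<phi>"
      using strong_dual_seminorm_bound[OF p] by blast
    \<comment> \<open>The factor \<open>C\<close> gives \<open>p \<le> q\<close> literally, as the
      definition of nuclearity demands.\<close>
    define q where "q = (\<lambda>\<phi>. C * nrm (Suc k) \<phi>)"
    have q: "seminorm_on D q" unfolding q_def using C seminorm_on_cmult[OF seminorm_on_nrm] by simp
    have "continuous_map (seminorm_topology D (range nrm)) euclideanreal q"
      by (rule continuous_map_seminormI[OF subspace_dual P q, of _ "nrm (Suc k)" C]) (auto simp: q_def)
    then have cq: "continuous_seminorm (strong_dual E) q"
      using q top by (simp add: continuous_seminorm_def strong_dual_eq)
    have pq: "p \<phi> \<le> q \<phi>" if "\<phi> \<in> D" for \<phi>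
      using C(2)[OF that] nrm_mono[OF that, of k "Suc k"] C(1) by (simp add: q_def order_trans)
    let ?f = "\<lambda>i (\<phi> :: ('i \<Rightarrow> complex) \<Rightarrow> complex). \<phi> (e (en i))"
    \<comment> \<open>Elements of the local Banach space are Cauchy sequences; the vectors needed
      here lie in \<open>D\<close> already and become constant sequences.\<close>
    let ?y = "\<lambda>i (j::nat). coord (en i)"
    let ?r = "\<lambda>i. w (Suc k) (en i) / w k (en i)"
    have f_le: "cmod (?f i \<phi>) \<le> (w (Suc k) (en i) / C) * q \<phi>" if "\<phi> \<in> D" for i \<phi>
      using cmod_dual_e_le[OF that, of "en i" "Suc k"] C(1) by (simp add: q_def)
    have p0: "p 0 = 0" using seminorm_on_zero[OF p(1) subspace_dual] .
    have "nuclear_canonical_map D q p"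
      unfolding nuclear_canonical_map_def
    proof (intro exI[of _ ?f] exI[of _ ?y] conjI allI ballI)
      show "seminorm_bounded_form D q (?f i)" for i
        unfolding seminorm_bounded_form_def linear_form_on_def using f_le by (auto simp: intro!: exI[of _ "w (Suc k) (en i) / C"])
      show "seminorm_Cauchy D p (?y i)" for i
        unfolding seminorm_Cauchy_def using p0 by (auto simp: image_subset_iff)
      have dn: "0 \<le> dual_norm D q (?f i) \<and> dual_norm D q (?f i) \<le> w (Suc k) (en i) / C" for i
      proof -
        let ?A = "{B. 0 \<le> B \<and> (\<forall>\<phi>\<in>D. cmod (?f i \<phi>) \<le> B * q \<phi>)}"
        have mem: "w (Suc k) (en i) / C \<in> ?A" using f_le C(1) by (auto simp: less_imp_le)
        have "bdd_below ?A" by (intro bdd_belowI[of _ 0]) auto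
        then show ?thesis
          unfolding dual_norm_def using mem cInf_lower[OF mem] by (auto intro!: cInf_greatest)
      qed
      have cn: "completion_norm p (?y i) = p (coord (en i))" for i
        unfolding completion_norm_def by (simp add: limI)
      have pn: "0 \<le> p (coord (en i)) \<and> p (coord (en i)) \<le> C / w k (en i)" for i
      proof -
        have "p (coord (en i)) \<le> C * nrm k (coord (en i))" by (rule C(2)) simp
        also have "\<dots> \<le> C * (1 / w k (en i))" using C(1) nrm_coord_le by (intro mult_left_mono) auto
        finally show ?thesis using seminorm_onD(1)[OF p(1)] by simp
      qed
      show "summable (\<lambda>i. dual_norm D q (?f i) * completion_norm p (?y i))"
      proof (rule summable_comparison_test'[OF summable_ratio[of k], of 0])
        fix i
        have "dual_norm D q (?f i) * p (coord (en i)) \<le> (w (Suc k) (en i) / C) * (C / w k (en i))"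
          using dn[of i] pn[of i] C(1) by (intro mult_mono) (auto simp: less_imp_le)
        also have "\<dots> = ?r i" using C(1) by simp
        finally show "norm (dual_norm D q (?f i) * completion_norm p (?y i)) \<le> ?r i"
          using dn[of i] pn[of i] unfolding cn by (simp add: abs_mult)
      qed
      fix \<phi> assume \<phi>: "\<phi> \<in> D"
      let ?R = "\<lambda>M. \<phi> - (\<Sum>i<M. ?f i \<phi> *\<^sub>F coord (en i))"
      have "(\<lambda>M. p (?R M)) \<longlonglongrightarrow> 0"
      proof (rule tendsto_sandwich)
        have RD: "?R M \<in> D" for M by (rule dual_expansion(2)[OF \<phi>])
        show "\<forall>\<^sub>F M in sequentially. 0 \<le> p (?R M)"
          using seminorm_onD(1)[OF p(1) RD] by simp
        have "p (?R M) \<le> C * (nrm (Suc k) \<phi> * tail k M)" for M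
          using C(2)[OF RD[of M]] dual_expansion(1)[OF \<phi>, of k M] C(1)
          by (meson less_imp_le mult_left_mono order_trans)
        then show "\<forall>\<^sub>F M in sequentially. p (?R M) \<le> C * (nrm (Suc k) \<phi> * tail k M)" by simp
        show "(\<lambda>M. C * (nrm (Suc k) \<phi> * tail k M)) \<longlonglongrightarrow> 0"
          by (intro tendsto_mult_right_zero tail_tendsto)
      qed simp
      then show "(\<lambda>M. completion_norm p (\<lambda>j. \<phi> - (\<Sum>i<M. ?f i \<phi> *\<^sub>F ?y i j))) \<longlonglongrightarrow> 0"
        unfolding completion_norm_def by (simp add: limI)
    qed
    then show ?thesis using cq pq by blast
  qed
  ultimately show ?thesis unfolding nuclear_space_def top by blast
qed

lemma FN_strong_dual: "FN_space (strong_dual E)"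
  unfolding FN_space_def using nuclear_strong_dual frechet_strong_dual by blast

end

lemma continuous_map_linear_form:
  assumes S: "cfun.subspace S" and P: "\<And>p. p \<in> P \<Longrightarrow> seminorm_on S p"
    and \<phi>: "linear_form_on S \<phi>" and p: "p \<in> P" and dom: "\<And>x. x \<in> S \<Longrightarrow> cmod (\<phi> x) \<le> C * p x"
  shows "continuous_map (seminorm_topology S P) euclidean \<phi>"
  unfolding continuous_map_def
proof (intro conjI allI impI)
  have diff: "\<phi> (y - x) = \<phi> y - \<phi> x" if "x \<in> S" "y \<in> S" for x y
  proof -
    have "y - x = y + (-1) *\<^sub>F x" by (auto simp: fun_eq_iff)
    moreover have "\<phi> (y + (-1) *\<^sub>F x) = \<phi> y + \<phi> ((-1) *\<^sub>F x)"
      using \<phi> that cfun.subspace_scale[OF S] unfolding linear_form_on_def by blast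
    moreover have "\<phi> ((-1) *\<^sub>F x) = -1 * \<phi> x" using \<phi> that unfolding linear_form_on_def by blast
    ultimately show ?thesis by simp
  qed
  fix V :: "complex set" assume "openin euclidean V"
  then have V: "open V" by simp
  show "openin (seminorm_topology S P) {x \<in> topspace (seminorm_topology S P). \<phi> x \<in> V}"
  proof (rule openin_seminormI[OF S P])
    show "{x \<in> topspace (seminorm_topology S P). \<phi> x \<in> V} \<subseteq> S" by auto
    fix x assume "x \<in> {x \<in> topspace (seminorm_topology S P). \<phi> x \<in> V}"
    then have x: "x \<in> S" "\<phi> x \<in> V" by auto
    then obtain \<epsilon> where eps: "0 < \<epsilon>" "ball (\<phi> x) \<epsilon> \<subseteq> V" using V open_contains_ball by blast
    define d where "d = \<epsilon> / (\<bar>C\<bar> + 1)"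
    have d: "0 < d" using eps by (simp add: d_def)
    have "{y \<in> S. p (y - x) < d} \<subseteq> {x \<in> topspace (seminorm_topology S P). \<phi> x \<in> V}"
    proof
      fix y assume "y \<in> {y \<in> S. p (y - x) < d}"
      then have y: "y \<in> S" "p (y - x) < d" by auto
      have yx: "y - x \<in> S" using S x y by (simp add: cfun.subspace_diff)
      have p0: "0 \<le> p (y - x)" using seminorm_onD(1)[OF P[OF p] yx] .
      have "cmod (\<phi> (y - x)) \<le> C * p (y - x)" using dom[OF yx] .
      also have "\<dots> \<le> (\<bar>C\<bar> + 1) * p (y - x)" using p0 by (intro mult_right_mono) auto
      also have "\<dots> < (\<bar>C\<bar> + 1) * d" using y by (intro mult_strict_left_mono) auto
      also have "\<dots> = \<epsilon>" by (simp add: d_def)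
      finally have "dist (\<phi> x) (\<phi> y) < \<epsilon>" using diff[OF x(1) y(1)] by (simp add: dist_norm norm_minus_commute)
      then show "y \<in> {x \<in> topspace (seminorm_topology S P). \<phi> x \<in> V}" using eps y by auto
    qed
    then show "\<exists>p\<in>P. \<exists>e>0. {y \<in> S. p (y - x) < e} \<subseteq> {x \<in> topspace (seminorm_topology S P). \<phi> x \<in> V}"
      using p d by (intro bexI[of _ p] exI[of _ d]) auto
  qed
qed simp

lemma tendsto_cmod_diff:
  assumes "(\<lambda>M. cmod (l - a M)) \<longlonglongrightarrow> 0" shows "a \<longlonglongrightarrow> l"
  using tendsto_diff[OF tendsto_const[of l] tendsto_norm_zero_cancel[OF assms]] by simp

context coefficient_space
begin

section \<open>Evaluation as an isomorphism onto the strong bidual\<close>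

subsection \<open>Reflexivity\<close>

abbreviation "DD \<equiv> dual_space (strong_dual E)"

definition evl :: "('i \<Rightarrow> complex) \<Rightarrow> (('i \<Rightarrow> complex) \<Rightarrow> complex) \<Rightarrow> complex" where
  "evl x = (\<lambda>\<phi>. if \<phi> \<in> D then \<phi> x else 0)"

lemma topspace_strong_dual: "topspace (strong_dual E) = D"
  by (simp add: strong_dual_def)

lemma range_nrm: "q \<in> range nrm \<Longrightarrow> seminorm_on D q"
  using seminorm_on_nrm by auto

lemma evl_in: assumes x: "x \<in> S" shows "evl x \<in> DD"
proof -
  obtain k R where R: "0 < R" "x \<in> sball k R" using sball_cover[OF x] .
  have lin: "linear_form_on D (evl x)"
    unfolding linear_form_on_def evl_def
    using cfun.subspace_add[OF subspace_dual] cfun.subspace_scale[OF subspace_dual] by auto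
  have "continuous_map (seminorm_topology D (range nrm)) euclidean (evl x)"
    by (rule continuous_map_linear_form[OF subspace_dual range_nrm lin, of _ "nrm k" R])
      (use cmod_le_nrm_scaled[OF _ R(2,1)] in \<open>auto simp: evl_def\<close>)
  then show ?thesis
    using lin by (simp add: dual_space_def[of "strong_dual E"] topspace_strong_dual)
      (simp add: strong_dual_eq evl_def)
qed

lemma evl_linear: "linear_map_on S evl"
  unfolding linear_map_on_def
proof (intro conjI ballI allI)
  fix x y assume "x \<in> S" "y \<in> S"
  then show "evl (x + y) = evl x + evl y"
    using dual_linear unfolding linear_form_on_def by (auto simp: evl_def fun_eq_iff)
next
  fix c x assume "x \<in> S"
  then show "evl (c *\<^sub>F x) = c *\<^sub>F evl x"
    using dual_linear unfolding linear_form_on_def by (auto simp: evl_def fun_eq_iff)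
qed

lemma evl_inj: "inj_on evl S"
proof (rule inj_onI)
  fix x y assume xy: "x \<in> S" "y \<in> S" "evl x = evl y"
  have "\<iota> x n = \<iota> y n" for n
  proof -
    have "coord n x = coord n y" using fun_cong[OF xy(3), of "coord n"] by (simp add: evl_def)
    then show ?thesis using xy(1,2) by (simp add: coord_def)
  qed
  then show "x = y" using iota_inj xy by blast
qed

lemma bidual_bound:
  assumes \<Phi>: "\<Phi> \<in> DD"
  obtains k C where "0 < C" "\<And>\<phi>. \<phi> \<in> D \<Longrightarrow> cmod (\<Phi> \<phi>) \<le> C * nrm k \<phi>"
proof -
  have lin: "linear_form_on D \<Phi>" and cont: "continuous_map (strong_dual E) euclidean \<Phi>"
    using \<Phi> by (auto simp: dual_space_def[of "strong_dual E"] topspace_strong_dual)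
  have "seminorm_on D (\<lambda>\<phi>. cmod (\<Phi> \<phi>))"
    using lin unfolding linear_form_on_def seminorm_on_def by (auto simp: norm_mult norm_triangle_ineq)
  then show thesis
    using strong_dual_seminorm_bound[OF _ continuous_map_norm[OF cont]] that by blast
qed

text \<open>An element of the bidual is determined by its values on the coordinate functionals.
  Since \<open>nrm k (coord n) \<le> 1 / w k n\<close>, these values belong to step \<open>k\<close>
  and define \<open>x\<close>; for \<open>\<phi>\<close> in \<open>D\<close> both
  \<open>\<Phi> \<phi>\<close> and \<open>\<phi> x\<close> are limits of the same partial
  sums.\<close>

lemma evl_surj: assumes \<Phi>: "\<Phi> \<in> DD" shows "\<Phi> \<in> evl ` S"
proof -
  have lin: "linear_form_on D \<Phi>" and out: "\<phi> \<notin> D \<Longrightarrow> \<Phi> \<phi> = 0" for \<phi>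
    using \<Phi> by (auto simp: dual_space_def[of "strong_dual E"] topspace_strong_dual)
  obtain k C where C: "0 < C" "\<And>\<phi>. \<phi> \<in> D \<Longrightarrow> cmod (\<Phi> \<phi>) \<le> C * nrm k \<phi>"
    using bidual_bound[OF \<Phi>] by metis
  have "cmod (\<Phi> (coord n)) * w k n \<le> C" for n
  proof -
    have "cmod (\<Phi> (coord n)) \<le> C * nrm k (coord n)" by (rule C(2)) simp
    also have "\<dots> \<le> C * (1 / w k n)" using C(1) nrm_coord_le by (intro mult_left_mono) auto
    finally show ?thesis using w_pos[of k n] by (simp add: pos_le_divide_eq)
  qed
  then obtain x where x: "x \<in> S" "\<iota> x = (\<lambda>n. \<Phi> (coord n))" by (rule iota_surj)
  have "\<Phi> \<phi> = \<phi> x" if \<phi>: "\<phi> \<in> D" for \<phi>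
  proof -
    let ?s = "\<lambda>M. \<Sum>i<M. \<phi> (e (en i)) *\<^sub>F coord (en i)"
    have trm: "\<phi> (e (en i)) *\<^sub>F coord (en i) \<in> D" for i
      by (intro cfun.subspace_scale[OF subspace_dual] coord_in)
    have sD: "?s M \<in> D" for M by (intro cfun.subspace_sum[OF subspace_dual] trm)
    have \<Phi>s: "\<Phi> (?s M) = (\<Sum>i<M. \<phi> (e (en i)) * \<iota> x (en i))" for M
    proof (induction M)
      case 0
      have "\<Phi> (0 *\<^sub>F 0) = 0 * \<Phi> 0"
        using lin cfun.subspace_0[OF subspace_dual] unfolding linear_form_on_def by blast
      then have "\<Phi> 0 = 0" by simp
      then show ?case by (simp only: lessThan_0 sum.empty)
    next
      case (Suc M)
      have "\<Phi> (?s M + \<phi> (e (en M)) *\<^sub>F coord (en M)) = \<Phi> (?s M) + \<Phi> (\<phi> (e (en M)) *\<^sub>F coord (en M))"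
        using lin sD trm unfolding linear_form_on_def by blast
      moreover have "\<Phi> (\<phi> (e (en M)) *\<^sub>F coord (en M)) = \<phi> (e (en M)) * \<Phi> (coord (en M))"
        using lin coord_in unfolding linear_form_on_def by blast
      ultimately show ?case using Suc x(2) by (simp only: sum.lessThan_Suc)
    qed
    have "(\<lambda>M. nrm k (\<phi> - ?s M)) \<longlonglongrightarrow> 0"
    proof (rule tendsto_sandwich)
      show "\<forall>\<^sub>F M in sequentially. 0 \<le> nrm k (\<phi> - ?s M)"
        using seminorm_onD(1)[OF seminorm_on_nrm dual_expansion(2)[OF \<phi>]] by simp
      show "\<forall>\<^sub>F M in sequentially. nrm k (\<phi> - ?s M) \<le> nrm (Suc k) \<phi> * tail k M"
        using dual_expansion(1)[OF \<phi>] by simp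
      show "(\<lambda>M. nrm (Suc k) \<phi> * tail k M) \<longlonglongrightarrow> 0" by (intro tendsto_mult_right_zero tail_tendsto)
    qed simp
    then have "(\<lambda>M. C * nrm k (\<phi> - ?s M)) \<longlonglongrightarrow> 0" by (rule tendsto_mult_right_zero)
    then have "(\<lambda>M. cmod (\<Phi> \<phi> - \<Phi> (?s M))) \<longlonglongrightarrow> 0"
    proof (rule Lim_null_comparison[rotated], intro always_eventually allI)
      fix M
      have "\<Phi> ((\<phi> - ?s M) + ?s M) = \<Phi> (\<phi> - ?s M) + \<Phi> (?s M)"
        using lin dual_expansion(2)[OF \<phi>, of M] sD[of M] unfolding linear_form_on_def by blast
      then have "\<Phi> \<phi> = \<Phi> (\<phi> - ?s M) + \<Phi> (?s M)" by (simp only: diff_add_cancel)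
      then show "norm (cmod (\<Phi> \<phi> - \<Phi> (?s M))) \<le> C * nrm k (\<phi> - ?s M)"
        using C(2)[OF dual_expansion(2)[OF \<phi>], of M] by simp
    qed
    then have 1: "(\<lambda>M. \<Sum>i<M. \<phi> (e (en i)) * \<iota> x (en i)) \<longlonglongrightarrow> \<Phi> \<phi>"
      unfolding \<Phi>s by (rule tendsto_cmod_diff)
    have "(\<lambda>M. cmod (\<phi> (x - part x (en ` {..<M})))) \<longlonglongrightarrow> 0"
      by (rule filterlim_compose[OF expansion_tendsto[OF dual_step_bounded[OF \<phi>] x(1)] filterlim_en])
    moreover have "\<phi> (part x (en ` {..<M})) = (\<Sum>i<M. \<phi> (e (en i)) * \<iota> x (en i))" for M
    proof -
      have "inj_on en {..<M}" using bij_en by (meson bij_is_inj inj_on_subset subset_UNIV)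
      then have pt: "part x (en ` {..<M}) = (\<Sum>i<M. \<iota> x (en i) *\<^sub>F e (en i))"
        unfolding part_def by (subst sum.reindex) auto
      have "\<phi> (\<Sum>i<M. \<iota> x (en i) *\<^sub>F e (en i)) = (\<Sum>i<M. \<phi> (e (en i)) * \<iota> x (en i))"
      proof (induction M)
        case 0
        have "\<phi> (0 *\<^sub>F 0) = 0 * \<phi> 0"
          using dual_linear[OF \<phi>] cfun.subspace_0[OF subspace] unfolding linear_form_on_def by blast
        then have "\<phi> 0 = 0" by simp
        then show ?case by (simp only: lessThan_0 sum.empty)
      next
        case (Suc M)
        have "(\<Sum>i<M. \<iota> x (en i) *\<^sub>F e (en i)) \<in> S" by (intro cfun.subspace_sum[OF subspace]) simp
        then have "\<phi> ((\<Sum>i<M. \<iota> x (en i) *\<^sub>F e (en i)) + \<iota> x (en M) *\<^sub>F e (en M)) =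
            \<phi> (\<Sum>i<M. \<iota> x (en i) *\<^sub>F e (en i)) + \<phi> (\<iota> x (en M) *\<^sub>F e (en M))"
          using dual_linear[OF \<phi>] scale_e_in unfolding linear_form_on_def by blast
        moreover have "\<phi> (\<iota> x (en M) *\<^sub>F e (en M)) = \<iota> x (en M) * \<phi> (e (en M))"
          using dual_linear[OF \<phi>] e_in unfolding linear_form_on_def by blast
        ultimately show ?case using Suc by (simp only: sum.lessThan_Suc mult.commute)
      qed
      then show ?thesis by (simp only: pt)
    qed
    ultimately have "(\<lambda>M. cmod (\<phi> x - (\<Sum>i<M. \<phi> (e (en i)) * \<iota> x (en i)))) \<longlonglongrightarrow> 0"
      by (simp add: linear_form_diff[OF dual_linear[OF \<phi>] x(1)])
    then have 2: "(\<lambda>M. \<Sum>i<M. \<phi> (e (en i)) * \<iota> x (en i)) \<longlonglongrightarrow> \<phi> x"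
      by (rule tendsto_cmod_diff)
    show ?thesis using LIMSEQ_unique[OF 1 2] .
  qed
  then have "\<Phi> = evl x" using out by (auto simp: evl_def fun_eq_iff)
  then show ?thesis using x(1) by blast
qed

lemma evl_image: "evl ` S = DD"
  using evl_in evl_surj by blast

lemma tvs_bounded_strong_dual_iff:
  "tvs_bounded (strong_dual E) B \<longleftrightarrow> B \<subseteq> D \<and> (\<forall>k. bdd_above (nrm k ` B))"
  unfolding strong_dual_eq by (subst seminorm_topology_bounded_iff[OF subspace_dual range_nrm]) auto

text \<open>A strongly bounded set of forms is bounded for every \<open>nrm k\<close>, hence
  uniformly bounded on each ball; its supremum is therefore a continuous seminorm on
  \<open>E\<close>.\<close>

lemma sup_bounded_dual:
  assumes B: "tvs_bounded (strong_dual E) B" "B \<noteq> {}"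
  shows "step_bounded (\<lambda>x. SUP \<phi>\<in>B. cmod (\<phi> x))"
    and "x \<in> S \<Longrightarrow> bdd_above ((\<lambda>\<phi>. cmod (\<phi> x)) ` B)"
proof -
  have BD: "B \<subseteq> D" using B by (simp add: tvs_bounded_strong_dual_iff)
  have "\<forall>k. \<exists>M. \<forall>\<phi>\<in>B. nrm k \<phi> \<le> M" using B by (auto simp: tvs_bounded_strong_dual_iff bdd_above_def)
  then obtain M where M: "\<And>k \<phi>. \<phi> \<in> B \<Longrightarrow> nrm k \<phi> \<le> M k" by metis
  show bdd: "bdd_above ((\<lambda>\<phi>. cmod (\<phi> x)) ` B)" if x: "x \<in> S" for x
  proof -
    obtain k R where R: "0 < R" "x \<in> sball k R" using sball_cover[OF x] .
    have "cmod (\<phi> x) \<le> R * M k" if "\<phi> \<in> B" for \<phi>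
      using cmod_le_nrm_scaled[OF subsetD[OF BD that] R(2,1)] M[OF that, of k] R(1)
      by (meson less_imp_le mult_left_mono order_trans)
    then show ?thesis by (intro bdd_aboveI2) auto
  qed
  show "step_bounded (\<lambda>x. SUP \<phi>\<in>B. cmod (\<phi> x))"
    unfolding step_bounded_def
  proof (intro conjI allI)
    show "seminorm_on S (\<lambda>x. SUP \<phi>\<in>B. cmod (\<phi> x))"
      by (rule seminorm_on_SUP[OF B(2) seminorm_on_cmod[OF dual_linear] bdd subspace]) (use BD in auto)
    fix k
    have "cmod (\<phi> x) \<le> M k" if "\<phi> \<in> B" "x \<in> sball k 1" for x \<phi>
      using cmod_le_nrm[OF subsetD[OF BD that(1)] that(2)] M[OF that(1), of k] by linarith
    then show "\<exists>C. \<forall>x\<in>sball k 1. (SUP \<phi>\<in>B. cmod (\<phi> x)) \<le> C"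
      by (intro exI[of _ "M k"] ballI cSUP_least B(2)) auto
  qed
qed

text \<open>
  The functionals \<open>\<Sum>n\<in>N. \<theta> n * p (e n) * \<iota> x n\<close> with \<open>|\<theta> n| \<le> 1\<close> replace the polar of \<open>p\<close>, so that
  the Hahn-Banach theorem is not needed.
\<close>

lemma seminorm_le_bounded_sup:
  assumes p: "step_bounded p"
  obtains B where "tvs_bounded (strong_dual E) B" "B \<noteq> {}"
    "\<And>x. x \<in> S \<Longrightarrow> p x \<le> (SUP \<phi>\<in>B. cmod (\<phi> x))"
proof -
  define f where "f N \<theta> = (\<Sum>n\<in>N. (\<theta> n * complex_of_real (p (e n))) *\<^sub>F coord n)" for N \<theta>
  define B where "B = {f N \<theta> | N \<theta>. finite N \<and> (\<forall>n. cmod (\<theta> n) \<le> 1)}"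
  note sp = step_bounded_seminorm[OF p]
  have p0: "0 \<le> p (e n)" for n using seminorm_onD(1)[OF sp] by simp
  have fD: "f N \<theta> \<in> D" for N \<theta>
    unfolding f_def
    by (intro cfun.subspace_sum[OF subspace_dual] cfun.subspace_scale[OF subspace_dual] coord_in)
  have f_apply: "f N \<theta> x = (\<Sum>n\<in>N. \<theta> n * complex_of_real (p (e n)) * \<iota> x n)" if "x \<in> S" for N \<theta> x
    using that by (simp add: f_def sum_fun_apply coord_def)
  have bd: "\<exists>M. \<forall>\<phi>\<in>B. nrm k \<phi> \<le> M" for k
  proof -
    obtain C where C: "0 < C" "\<And>R x. 0 < R \<Longrightarrow> x \<in> sball (Suc k) R \<Longrightarrow> p x \<le> C * R"
      using step_boundedE[OF p] by blast
    have pe: "p (e n) \<le> C * w (Suc k) n" for n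
      by (rule C(2)) (auto simp: sball_def iota_e less_imp_le)
    have "nrm k (f N \<theta>) \<le> C * infsum (\<lambda>n. w (Suc k) n / w k n) UNIV"
      if N: "finite N" "\<forall>n. cmod (\<theta> n) \<le> 1" for N \<theta>
    proof (rule nrm_leI)
      fix x assume x: "x \<in> sball k 1"
      then have xS: "x \<in> S" using sball_subset by blast
      have "cmod (f N \<theta> x) \<le> (\<Sum>n\<in>N. cmod (\<theta> n * complex_of_real (p (e n)) * \<iota> x n))"
        unfolding f_apply[OF xS] by (rule norm_sum)
      also have "\<dots> \<le> (\<Sum>n\<in>N. C * (w (Suc k) n / w k n))"
      proof (rule sum_mono)
        fix n
        have "cmod (\<iota> x n) \<le> 1 / w k n" using x w_pos[of k n] by (auto simp: sball_def pos_le_divide_eq)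
        then have "cmod (\<theta> n) * p (e n) * cmod (\<iota> x n) \<le> 1 * (C * w (Suc k) n) * (1 / w k n)"
          using N(2) pe p0 C(1) by (intro mult_mono) (auto simp: less_imp_le)
        then show "cmod (\<theta> n * complex_of_real (p (e n)) * \<iota> x n) \<le> C * (w (Suc k) n / w k n)"
          using p0 by (simp add: norm_mult)
      qed
      also have "\<dots> = C * (\<Sum>n\<in>N. w (Suc k) n / w k n)" by (simp add: sum_distrib_left)
      also have "\<dots> \<le> C * infsum (\<lambda>n. w (Suc k) n / w k n) UNIV"
        using C(1) N(1) summable_on_ratio
        by (intro mult_left_mono finite_sum_le_infsum) (auto simp: less_imp_le)
      finally show "cmod (f N \<theta> x) \<le> C * infsum (\<lambda>n. w (Suc k) n / w k n) UNIV" .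
    qed
    then show ?thesis unfolding B_def by blast
  qed
  have Bb: "tvs_bounded (strong_dual E) B"
    unfolding tvs_bounded_strong_dual_iff using fD bd by (auto simp: B_def bdd_above_def)
  have "f {} (\<lambda>_. 0) \<in> B" unfolding B_def by force
  then have Bne: "B \<noteq> {}" by blast
  have "p x \<le> (SUP \<phi>\<in>B. cmod (\<phi> x))" if x: "x \<in> S" for x
  proof (rule step_bounded_le_sum[OF p x])
    fix N :: "(nat^'d) set" assume N: "finite N"
    \<comment> \<open>The conjugate phase of the coordinate makes every summand of
      \<open>f N \<theta> x\<close> nonnegative, so that the modulus is the whole sum.\<close>
    define \<theta> where "\<theta> n = cnj (sgn (\<iota> x n))" for n
    have 1: "\<theta> n * \<iota> x n = complex_of_real (cmod (\<iota> x n))" for n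
    proof (cases "\<iota> x n = 0")
      case False
      have "\<theta> n * \<iota> x n = cnj (\<iota> x n) * \<iota> x n / complex_of_real (cmod (\<iota> x n))"
        by (simp add: \<theta>_def sgn_eq)
      also have "cnj (\<iota> x n) * \<iota> x n = complex_of_real (cmod (\<iota> x n)) ^ 2"
        by (metis complex_norm_square mult.commute of_real_power)
      finally show ?thesis using False by (simp add: power2_eq_square)
    qed simp
    have "\<forall>n. cmod (\<theta> n) \<le> 1" by (simp add: \<theta>_def norm_sgn)
    then have mem: "f N \<theta> \<in> B" using N unfolding B_def by blast
    have "f N \<theta> x = (\<Sum>n\<in>N. complex_of_real (cmod (\<iota> x n) * p (e n)))"
      unfolding f_apply[OF x] using 1 by (intro sum.cong refl) (simp add: mult.assoc mult.left_commute)
    then have "cmod (f N \<theta> x) = \<bar>\<Sum>n\<in>N. cmod (\<iota> x n) * p (e n)\<bar>"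
      by (simp only: of_real_sum[symmetric] norm_of_real)
    then have "(\<Sum>n\<in>N. cmod (\<iota> x n) * p (e n)) \<le> cmod (f N \<theta> x)" by simp
    also have "\<dots> \<le> (SUP \<phi>\<in>B. cmod (\<phi> x))"
      by (rule cSUP_upper[OF mem sup_bounded_dual(2)[OF Bb Bne x]])
    finally show "(\<Sum>n\<in>N. cmod (\<iota> x n) * p (e n)) \<le> (SUP \<phi>\<in>B. cmod (\<phi> x))" .
  qed
  then show thesis using that Bb Bne by blast
qed

lemma evl_diff_sup:
  assumes "tvs_bounded (strong_dual E) B" "x \<in> S" "y \<in> S"
  shows "(SUP \<phi>\<in>B. cmod ((evl y - evl x) \<phi>)) = (SUP \<phi>\<in>B. cmod (\<phi> (y - x)))"
proof (intro SUP_cong refl)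
  fix \<phi> assume "\<phi> \<in> B"
  then have "\<phi> \<in> D" using assms(1) by (auto simp: tvs_bounded_strong_dual_iff)
  then show "cmod ((evl y - evl x) \<phi>) = cmod (\<phi> (y - x))"
    using linear_form_diff[OF dual_linear assms(3,2)] by (simp add: evl_def)
qed

lemma topspace_bidual: "topspace (strong_dual (strong_dual E)) = DD"
  by (simp add: strong_dual_def[of "strong_dual E"])

text \<open>Suprema over strongly bounded sets are continuous seminorms of \<open>E\<close>, which
  gives continuity; every continuous seminorm of \<open>E\<close> lies below such a supremum, which
  gives openness.\<close>

lemma evl_homeomorphic: "homeomorphic_map E (strong_dual (strong_dual E)) evl"
proof (rule bijective_open_imp_homeomorphic_map)
  define P where "P = {\<lambda>\<Phi>. SUP \<phi>\<in>B. cmod (\<Phi> \<phi>) |B. tvs_bounded (strong_dual E) B \<and> B \<noteq> {}}"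
  have bid: "strong_dual (strong_dual E) = seminorm_topology DD P"
    by (simp add: strong_dual_def[of "strong_dual E"] P_def)
  show "continuous_map E (strong_dual (strong_dual E)) evl"
    unfolding bid seminorm_topology_def
  proof (rule continuous_on_generated_topo)
    show "evl ` topspace E \<subseteq> \<Union> (insert DD {{y \<in> DD. p (y - x) < e} |p x e. p \<in> P \<and> x \<in> DD \<and> 0 < e})"
      using evl_in by blast
    fix U assume "U \<in> insert DD {{y \<in> DD. p (y - x) < e} |p x e. p \<in> P \<and> x \<in> DD \<and> 0 < e}"
    then consider "U = DD" | p \<Phi> \<epsilon> where "U = {y \<in> DD. p (y - \<Phi>) < \<epsilon>}" "p \<in> P" "\<Phi> \<in> DD" "0 < \<epsilon>" by blast
    then show "openin E (evl -` U \<inter> S)"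
    proof cases
      case 1
      then have "evl -` U \<inter> S = S" using evl_in by auto
      then show ?thesis by simp
    next
      case 2
      obtain B where B: "p = (\<lambda>\<Phi>. SUP \<phi>\<in>B. cmod (\<Phi> \<phi>))" "tvs_bounded (strong_dual E) B" "B \<noteq> {}"
        using 2(2) unfolding P_def by blast
      obtain z where z: "z \<in> S" "\<Phi> = evl z" using evl_surj[OF 2(3)] by blast
      have "evl -` U \<inter> S = {y \<in> S. (SUP \<phi>\<in>B. cmod (\<phi> (y - z))) < \<epsilon>}"
        unfolding 2(1) B(1) z(2) using evl_in evl_diff_sup[OF B(2) z(1)] by auto
      then show ?thesis using openin_step_bounded[OF sup_bounded_dual(1)[OF B(2,3)] z(1) 2(4)] by simp
    qed
  qed
  show "open_map E (strong_dual (strong_dual E)) evl"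
    unfolding open_map_def
  proof (intro allI impI)
    fix U assume U: "openin E U"
    have U': "openin (seminorm_topology S (Collect step_bounded)) U"
      using U by (subst topology_eq_step_bounded[symmetric]) simp
    have US: "U \<subseteq> S" using openin_subset[OF U] .
    show "openin (strong_dual (strong_dual E)) (evl ` U)"
    proof (subst openin_subopen, intro ballI)
      fix \<Phi> assume "\<Phi> \<in> evl ` U"
      then obtain x where x: "x \<in> U" "\<Phi> = evl x" by blast
      then have xS: "x \<in> S" using US by blast
      obtain F \<epsilon> where F: "finite F" "F \<subseteq> Collect step_bounded" "0 < \<epsilon>" "{y \<in> S. \<forall>p\<in>F. p (y - x) < \<epsilon>} \<subseteq> U"
        by (rule openin_seminormD[OF subspace seminorms U' x(1)])
      \<comment> \<open>The finitely many seminorms of the neighbourhood are added so that one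
        bounded set dominates all of them.\<close>
      define p where "p x = (\<Sum>q\<in>F. q x)" for x
      have "step_bounded p"
        unfolding step_bounded_def
      proof (intro conjI allI)
        show "seminorm_on S p"
          unfolding p_def using F by (intro seminorm_on_sum_family step_bounded_seminorm) auto
        fix k
        have "\<forall>q\<in>F. \<exists>M. \<forall>x\<in>sball k 1. q x \<le> M" using F(2) by (auto simp: step_bounded_def)
        then obtain M where "\<And>q x. q \<in> F \<Longrightarrow> x \<in> sball k 1 \<Longrightarrow> q x \<le> M q" by metis
        then have "p x \<le> (\<Sum>q\<in>F. M q)" if "x \<in> sball k 1" for x
          unfolding p_def using that by (intro sum_mono) auto
        then show "\<exists>C. \<forall>x\<in>sball k 1. p x \<le> C" by blast
      qed
      then obtain B where B: "tvs_bounded (strong_dual E) B" "B \<noteq> {}"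
        "\<And>x. x \<in> S \<Longrightarrow> p x \<le> (SUP \<phi>\<in>B. cmod (\<phi> x))" using seminorm_le_bounded_sup by blast
      let ?q = "\<lambda>\<Phi>. SUP \<phi>\<in>B. cmod (\<Phi> \<phi> :: complex)"
      let ?T = "{\<Psi> \<in> DD. ?q (\<Psi> - \<Phi>) < \<epsilon>}"
      have "openin (strong_dual (strong_dual E)) ?T"
        unfolding bid using B(1,2) x xS evl_in F(3) by (intro openin_seminorm_subbasis) (auto simp: P_def)
      moreover have "\<Phi> \<in> ?T"
        using x xS evl_in[OF xS] evl_diff_sup[OF B(1) xS xS] F(3) B(2)
          seminorm_on_zero[OF step_bounded_seminorm[OF sup_bounded_dual(1)[OF B(1,2)]] subspace]
        by simp
      moreover have "?T \<subseteq> evl ` U"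
      proof
        fix \<Psi> assume "\<Psi> \<in> ?T"
        then obtain y where y: "y \<in> S" "\<Psi> = evl y" "?q (evl y - evl x) < \<epsilon>"
          using evl_surj x by blast
        have yx: "y - x \<in> S" using y xS by (simp add: diff_in)
        have "p (y - x) < \<epsilon>" using B(3)[OF yx] y(3) evl_diff_sup[OF B(1) xS y(1)] by simp
        moreover have "q (y - x) \<le> p (y - x)" if "q \<in> F" for q
          unfolding p_def using F that seminorm_onD(1)[OF seminorms _ , of _ "y - x"] yx
          by (intro member_le_sum) auto
        ultimately have "y \<in> U" using F(4) y(1) by fastforce
        then show "\<Psi> \<in> evl ` U" using y by blast
      qed
      ultimately show "\<exists>T. openin (strong_dual (strong_dual E)) T \<and> \<Phi> \<in> T \<and> T \<subseteq> evl ` U" by blast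
    qed
  qed
qed (use evl_image evl_inj topspace_bidual in auto)

text \<open>The predual is the strong dual of \<open>E\<close> itself; evaluation identifies
  \<open>E\<close> with the strong dual of that space.\<close>

lemma DFN: "DFN_space E"
  unfolding DFN_space_def topological_isomorphism_def
  using FN_strong_dual evl_linear evl_homeomorphic by blast

end

section \<open>Laguerre polynomials: differential equation, recurrences and orthogonality in
  algebraic form\<close>

section \<open>Laguerre polynomials\<close>

lemma has_bochner_integral_power_exp:
  fixes b :: real
  assumes b: "0 < b"
  shows "has_bochner_integral lborel (\<lambda>x. indicator {0<..} x * (x ^ k * exp (- b * x))) (fact k / b ^ Suc k)"
proof -
  have 1: "has_bochner_integral lborel (\<lambda>x::real. indicator {0<..} x * (x ^ k * exp (- x))) (fact k)"
  proof (rule has_bochner_integral_nn_integral)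
    have "((\<lambda>t. t powr (real k + 1 - 1) / exp t) has_integral Gamma (real k + 1)) {0..}"
      by (rule Gamma_integral_real) simp
    then have "(\<integral>\<^sup>+x. ennreal (indicator {0..} x * (x powr (real k + 1 - 1) / exp x)) \<partial>lborel) = ennreal (Gamma (real k + 1))"
      by (intro nn_integral_has_integral_lebesgue) auto
    also have "Gamma (real k + 1) = fact k" using Gamma_fact[of k, where 'a=real] by (simp add: add.commute)
    also have "(\<integral>\<^sup>+x. ennreal (indicator {0..} x * (x powr (real k + 1 - 1) / exp x)) \<partial>lborel) =
        (\<integral>\<^sup>+x. ennreal (indicator {0<..} x * (x ^ k * exp (- x))) \<partial>lborel)"
    proof (rule nn_integral_cong_AE)
      show "AE x in lborel. ennreal (indicator {0..} x * (x powr (real k + 1 - 1) / exp x)) =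
          ennreal (indicator {0<..} x * (x ^ k * exp (- x)))"
        using AE_lborel_singleton[of "0::real"]
        by eventually_elim (auto simp: indicator_def powr_realpow exp_minus divide_inverse)
    qed
    finally show "(\<integral>\<^sup>+x. ennreal (indicator {0<..} x * (x ^ k * exp (- x))) \<partial>lborel) = ennreal (fact k)" .
  qed (auto simp: indicator_def)
  have "has_bochner_integral lborel (\<lambda>x. indicator {0<..} (0 + b * x) * ((0 + b * x) ^ k * exp (- (0 + b * x)))) (fact k /\<^sub>R \<bar>b\<bar>)"
    using 1 b by (subst (asm) lborel_has_bochner_integral_real_affine_iff[of b _ _ 0]) (auto simp: inverse_eq_divide)
  then have "has_bochner_integral lborel (\<lambda>x. (1 / b ^ k) * (indicator {0<..} (b * x) * ((b * x) ^ k * exp (- (b * x))))) ((1 / b ^ k) * (fact k / b))"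
    using b by (intro has_bochner_integral_mult_right) (auto simp: divide_inverse mult.commute)
  moreover have "(1 / b ^ k) * (indicator {0<..} (b * x) * ((b * x) ^ k * exp (- (b * x)))) =
      indicator {0<..} x * (x ^ k * exp (- b * x))" for x
    using b by (auto simp: indicator_def power_mult_distrib zero_less_mult_iff)
  ultimately show ?thesis by (simp add: mult.commute)
qed

text \<open>The functional \<open>P \<mapsto> \<integral>\<^sub>0\<^sup>\<infinity> P(x) exp(-x) dx\<close> in algebraic form.\<close>

definition laplace :: "real poly \<Rightarrow> real" where
  "laplace P = (\<Sum>i\<le>degree P. coeff P i * fact i)"

lemma laplace_eq_sum: "degree P \<le> N \<Longrightarrow> laplace P = (\<Sum>i\<le>N. coeff P i * fact i)"
  unfolding laplace_def by (rule sum.mono_neutral_left) (auto simp: coeff_eq_0)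

lemma laplace_add: "laplace (P + Q) = laplace P + laplace Q"
proof -
  let ?N = "max (degree P) (degree Q)"
  have "degree (P + Q) \<le> ?N" by (rule degree_add_le_max)
  then show ?thesis
    using laplace_eq_sum[of "P + Q" ?N] laplace_eq_sum[of P ?N] laplace_eq_sum[of Q ?N]
    by (simp add: sum.distrib distrib_right)
qed

lemma laplace_smult: "laplace (smult c P) = c * laplace P"
  using laplace_eq_sum[of "smult c P" "degree P"]
  by (simp add: degree_smult_le laplace_def sum_distrib_left mult.assoc)

lemma laplace_0 [simp]: "laplace 0 = 0"
  by (simp add: laplace_def)

lemma laplace_uminus: "laplace (- P) = - laplace P"
  using laplace_smult[of "-1" P] by simp

lemma laplace_diff: "laplace (P - Q) = laplace P - laplace Q"
  using laplace_add[of P "- Q"] laplace_uminus[of Q] by simp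

lemma laplace_sum: "laplace (\<Sum>i\<in>A. f i) = (\<Sum>i\<in>A. laplace (f i))"
  by (induction A rule: infinite_finite_induct) (auto simp: laplace_add)

text \<open>Integration by parts against \<open>exp (- x)\<close>, with the boundary value at 0; on
  coefficients it is only \<open>fact (Suc i) = Suc i * fact i\<close>.\<close>

lemma laplace_pderiv: "laplace (pderiv P) = laplace P - coeff P 0"
proof -
  have "laplace (pderiv P) = (\<Sum>i\<le>degree P. coeff (pderiv P) i * fact i)"
    by (rule laplace_eq_sum) (simp add: degree_pderiv)
  also have "\<dots> = (\<Sum>i\<le>degree P. coeff P (Suc i) * fact (Suc i))"
    by (intro sum.cong refl) (simp add: coeff_pderiv algebra_simps)
  also have "\<dots> = (\<Sum>i\<le>Suc (degree P). coeff P i * fact i) - coeff P 0"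
    by (subst sum.atMost_Suc_shift) simp
  also have "(\<Sum>i\<le>Suc (degree P). coeff P i * fact i) = laplace P"
    by (rule laplace_eq_sum[symmetric]) simp
  finally show ?thesis .
qed

lemma has_bochner_integral_poly_exp:
  "has_bochner_integral lborel (\<lambda>x. indicator {0<..} x * (poly P x * exp (- x))) (laplace P)"
proof -
  have "has_bochner_integral lborel (\<lambda>x. \<Sum>i\<le>degree P. coeff P i * (indicator {0<..} x * (x ^ i * exp (- 1 * x))))
      (\<Sum>i\<le>degree P. coeff P i * (fact i / 1 ^ Suc i))"
    by (intro has_bochner_integral_sum has_bochner_integral_mult_right has_bochner_integral_power_exp) simp
  then show ?thesis
    by (simp add: laplace_def poly_altdef sum_distrib_left sum_distrib_right mult_ac)
qed

lemma laplace_nonneg: "(\<And>x. 0 < x \<Longrightarrow> 0 \<le> poly P x) \<Longrightarrow> 0 \<le> laplace P"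
  unfolding has_bochner_integral_integral_eq[OF has_bochner_integral_poly_exp, symmetric]
  by (rule Bochner_Integration.integral_nonneg) (auto simp: indicator_def)

abbreviation X :: "real poly" where "X \<equiv> [:0, 1:]"

text \<open>Among the properties of \<open>laplace\<close> used in the energy estimates, positivity
  is the one drawn from the integral; the identities are formal.\<close>

lemma laplace_X_power_nonneg: "0 \<le> laplace (X ^ s * Q ^ 2)"
  by (rule laplace_nonneg) (simp add: poly_power)

text \<open>Explicit coefficients turn the differential equation and the recurrences into
  comparisons of binomial coefficients; \<open>laguerre_poly_eq\<close> links them to the Rodrigues
  formula.\<close>

definition lag :: "nat \<Rightarrow> real poly" where
  "lag n = (\<Sum>k\<le>n. monom ((-1) ^ k * real (n choose k) / fact k) k)"

lemma coeff_lag: "coeff (lag n) k = (-1) ^ k * real (n choose k) / fact k"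
  by (simp add: lag_def coeff_sum binomial_eq_0)

lemma lag_0 [simp]: "lag 0 = 1"
  by (simp add: lag_def monom_0 one_pCons)

lemma coeff_lag_Suc: "real (Suc k) * coeff (lag n) (Suc k) = - ((-1) ^ k * real (n choose Suc k) / fact k)"
  unfolding coeff_lag fact_Suc by simp

text \<open>\<open>pderiv P - P\<close> is what differentiation of \<open>exp (- s) * P\<close> does
  to the polynomial factor, so its iterates compute the Rodrigues formula. The induction step is
  Pascal's rule.\<close>

lemma coeff_rodrigues:
  "coeff (((\<lambda>P. pderiv P - P) ^^ m) (monom (1::real) j)) i =
     (if i \<le> j then (-1) ^ (m + j + i) * real (m choose (j - i)) * fact j / fact i else 0)"
proof (induction m arbitrary: i)
  case 0
  then show ?case by (auto simp: binomial_eq_0 power_add[symmetric] mult_2[symmetric])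
next
  case (Suc m)
  let ?c = "coeff (((\<lambda>P. pderiv P - P) ^^ m) (monom 1 j))"
  have rec: "coeff (((\<lambda>P. pderiv P - P) ^^ Suc m) (monom 1 j)) i = real (Suc i) * ?c (Suc i) - ?c i"
    by (simp add: coeff_pderiv)
  consider "i < j" | "i = j" | "j < i" by linarith
  then show ?case
  proof cases
    case 1
    then have ji: "j - i = Suc (j - Suc i)" by simp
    have "real (Suc i) * ?c (Suc i) = (-1) ^ (m + j + Suc i) * real (m choose (j - Suc i)) * fact j / fact i"
    proof -
      have f: "real (Suc i) * (a / fact (Suc i)) = a / fact i" for a :: real
        unfolding fact_Suc by simp
      show ?thesis using 1 Suc[of "Suc i"] f by simp
    qed
    then show ?thesis
      unfolding rec using 1 Suc[of i] by (simp add: ji field_simps)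
  next
    case 2
    then show ?thesis unfolding rec using Suc[of i] Suc[of "Suc i"] by simp
  next
    case 3
    then show ?thesis unfolding rec using Suc[of i] Suc[of "Suc i"] by simp
  qed
qed

lemma laguerre_poly_eq: "laguerre_poly j = poly (lag j)"
proof
  fix t :: real
  have "(deriv ^^ m) (\<lambda>s. exp (- s) * poly P s) = (\<lambda>s. exp (- s) * poly (((\<lambda>P. pderiv P - P) ^^ m) P) s)"
    for m and P :: "real poly"
  proof (induction m)
    case (Suc m)
    let ?Q = "((\<lambda>P. pderiv P - P) ^^ m) P"
    have "deriv (\<lambda>s. exp (- s) * poly ?Q s) s = exp (- s) * poly (pderiv ?Q - ?Q) s" for s
      by (rule DERIV_imp_deriv) (auto intro!: derivative_eq_intros simp: algebra_simps)
    then show ?case using Suc by auto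
  qed simp
  from fun_cong[OF this[of j "monom 1 j"], of t]
  have 1: "(deriv ^^ j) (\<lambda>s. exp (- s) * s ^ j) t = exp (- t) * poly (((\<lambda>P. pderiv P - P) ^^ j) (monom 1 j)) t"
    by (simp add: poly_monom)
  have "((\<lambda>P. pderiv P - P) ^^ j) (monom 1 j) = smult (fact j) (lag j)"
  proof (rule poly_eqI)
    fix i
    show "coeff (((\<lambda>P. pderiv P - P) ^^ j) (monom 1 j)) i = coeff (smult (fact j) (lag j)) i"
      unfolding coeff_rodrigues
      by (auto simp: coeff_lag binomial_eq_0 binomial_symmetric[symmetric] power_add mult_2[symmetric])
  qed
  then show "laguerre_poly j t = poly (lag j) t"
    unfolding laguerre_poly_def 1 by (simp add: exp_minus)
qed

text \<open>Each coefficient vanishes by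
  \<open>(k + 1) * (n choose (k + 1)) = (n - k) * (n choose k)\<close>, read over the reals so that
  it also covers \<open>k > n\<close>.\<close>

lemma lag_ode: "X * pderiv (pderiv (lag n)) + pderiv (lag n) - X * pderiv (lag n) + smult (real n) (lag n) = 0"
proof (rule poly_eqI)
  fix k
  have ab: "real (Suc k) * real (n choose Suc k) = (real n - real k) * real (n choose k)"
  proof (cases "k \<le> n")
    case True
    have "Suc k * (n choose Suc k) = (n - k) * (n choose k)"
      by (metis binomial_absorb_comp binomial_absorption mult.commute)
    then show ?thesis using True by (metis of_nat_diff of_nat_mult)
  qed (simp add: binomial_eq_0)
  have "real (Suc k) * real (Suc k) * coeff (lag n) (Suc k) + (real n - real k) * coeff (lag n) k =
      real (Suc k) * (real (Suc k) * coeff (lag n) (Suc k)) + (real n - real k) * coeff (lag n) k" by simp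
  also have "\<dots> = (-1) ^ k / fact k * ((real n - real k) * real (n choose k) - real (Suc k) * real (n choose Suc k))"
    unfolding coeff_lag_Suc unfolding coeff_lag by (simp add: add_divide_distrib diff_divide_distrib algebra_simps)
  finally have key: "real (Suc k) * real (Suc k) * coeff (lag n) (Suc k) + (real n - real k) * coeff (lag n) k = 0"
    using ab by simp
  show "coeff (X * pderiv (pderiv (lag n)) + pderiv (lag n) - X * pderiv (lag n) + smult (real n) (lag n)) k = coeff 0 k"
    using key by (cases k) (simp_all add: coeff_pderiv algebra_simps)
qed

lemma pderiv_lag_Suc: "pderiv (lag (Suc n)) = pderiv (lag n) - lag n"
proof (rule poly_eqI)
  fix k
  show "coeff (pderiv (lag (Suc n))) k = coeff (pderiv (lag n) - lag n) k"
    unfolding coeff_pderiv coeff_diff coeff_lag_Suc unfolding coeff_lag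
    by (simp add: add_divide_distrib distrib_left)
qed

lemma pderiv_lag: "pderiv (lag n) = - (\<Sum>j<n. lag j)"
  by (induction n) (simp_all add: pderiv_lag_Suc)

text \<open>The three-term recurrence. For \<open>n = 0\<close> the truncated index
  \<open>n - 1\<close> is 0, but its coefficient vanishes.\<close>

lemma X_lag: "X * lag n = smult (2 * real n + 1) (lag n) - smult (real n + 1) (lag (Suc n)) - smult (real n) (lag (n - 1))"
proof (rule poly_eqI)
  fix k
  show "coeff (X * lag n) k = coeff (smult (2 * real n + 1) (lag n) - smult (real n + 1) (lag (Suc n)) - smult (real n) (lag (n - 1))) k"
  proof (cases k)
    case 0
    then show ?thesis by (simp add: coeff_lag)
  next
    case (Suc i)
    have a1: "real (Suc i) * real (n choose Suc i) = (real n - real i) * real (n choose i)"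
    proof (cases "i \<le> n")
      case True
      have "Suc i * (n choose Suc i) = (n - i) * (n choose i)"
        by (metis binomial_absorb_comp binomial_absorption mult.commute)
      then show ?thesis using True by (metis of_nat_diff of_nat_mult)
    qed (simp add: binomial_eq_0)
    have a2: "real n * real ((n - 1) choose Suc i) = (real n - real (Suc i)) * real (n choose Suc i)"
    proof (cases "Suc i \<le> n")
      case True
      have "n * ((n - 1) choose Suc i) = (n - Suc i) * (n choose Suc i)"
        by (metis binomial_absorb_comp)
      then show ?thesis using True by (metis of_nat_diff of_nat_mult)
    qed (simp add: binomial_eq_0)
    define A where "A = real (n choose i)"
    define B where "B = real (n choose Suc i)"
    \<comment> \<open>Common factor of all four coefficients: what remains is a linear relation
      between the binomial coefficients \<open>A\<close> and \<open>B\<close>.\<close>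
    define s where "s = (-1::real) ^ i / fact (Suc i)"
    have "real (Suc i) * s = (-1) ^ i / fact i" unfolding s_def fact_Suc by simp
    then have c1: "coeff (lag n) i = s * (real i + 1) * A"
      by (simp add: coeff_lag A_def mult_ac add_ac)
    have c2: "coeff (lag n) (Suc i) = - s * B"
      by (simp add: coeff_lag s_def B_def)
    have c3: "coeff (lag (Suc n)) (Suc i) = - s * (A + B)"
      by (simp add: coeff_lag s_def A_def B_def del: fact_Suc)
    have c4: "real n * coeff (lag (n - 1)) (Suc i) = - s * ((real n - real (Suc i)) * B)"
    proof -
      have "real n * coeff (lag (n - 1)) (Suc i) = - s * (real n * real ((n - 1) choose Suc i))"
        by (simp add: coeff_lag s_def del: fact_Suc)
      then show ?thesis unfolding a2 B_def .
    qed
    have "coeff (X * lag n) k = s * (real i + 1) * A" using Suc c1 by simp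
    also have "\<dots> = (2 * real n + 1) * (- s * B) - (real n + 1) * (- s * (A + B)) + s * ((real n - real (Suc i)) * B)"
    proof -
      have "(real i + 1) * B = (real n - real i) * A" using a1 by (simp add: A_def B_def add_ac)
      then have "s * ((real i + 1) * B) = s * ((real n - real i) * A)" by simp
      then show ?thesis by (simp add: algebra_simps)
    qed
    finally show ?thesis using Suc c2 c3 c4 by simp
  qed
qed

text \<open>In divergence form the equation says that the derivative of
  \<open>x * exp (- x) * L_n'\<close> is \<open>- n * exp (- x) * L_n\<close>. Testing with
  \<open>lag m\<close> leaves no boundary term because of the factor \<open>X\<close>, and the right
  side is symmetric in \<open>n\<close> and \<open>m\<close>, which gives orthogonality.\<close>

lemma laplace_lag_lag_symm: "real n * laplace (lag n * lag m) = laplace (X * pderiv (lag n) * pderiv (lag m))"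
proof -
  let ?R = "X * pderiv (lag n) * lag m"
  have 0: "laplace (pderiv ?R) = laplace ?R" using laplace_pderiv[of ?R] by simp
  have "smult (real n) (lag n) = X * pderiv (lag n) - pderiv (lag n) - X * pderiv (pderiv (lag n))"
    using lag_ode[of n] by (simp add: algebra_simps eq_neg_iff_add_eq_0 add_eq_0_iff)
  then have "smult (real n) (lag n * lag m) = (X * pderiv (lag n) - pderiv (lag n) - X * pderiv (pderiv (lag n))) * lag m"
    by (metis mult_smult_left)
  also have "\<dots> = ?R - pderiv ?R + X * pderiv (lag n) * pderiv (lag m)"
    by (simp add: pderiv_mult pderiv_pCons algebra_simps)
  finally have "laplace (smult (real n) (lag n * lag m)) = laplace (X * pderiv (lag n) * pderiv (lag m))"
    using 0 by (simp add: laplace_add laplace_diff)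
  then show ?thesis by (simp add: laplace_smult)
qed

lemma laplace_lag_orthogonal: assumes "n \<noteq> m" shows "laplace (lag n * lag m) = 0"
proof -
  have "real n * laplace (lag n * lag m) = real m * laplace (lag n * lag m)"
    using laplace_lag_lag_symm[of n m] laplace_lag_lag_symm[of m n] by (simp add: mult_ac)
  then show ?thesis using assms by simp
qed

text \<open>The recurrence evaluates \<open>X * lag n * lag (Suc n)\<close> from either side; the
  comparison shows that the norm does not depend on \<open>n\<close>.\<close>

lemma laplace_lag_square: "laplace (lag n * lag n) = 1"
proof (induction n)
  case 0
  then show ?case by (simp add: laplace_def)
next
  case (Suc n)
  have "laplace (X * lag n * lag (Suc n)) = - (real n + 1) * laplace (lag (Suc n) * lag (Suc n))"
    unfolding X_lag by (simp add: left_diff_distrib laplace_diff laplace_smult laplace_lag_orthogonal) (simp_all add: algebra_simps)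
  moreover have "laplace (X * lag (Suc n) * lag n) = - (real n + 1) * laplace (lag n * lag n)"
    unfolding X_lag by (simp add: left_diff_distrib laplace_diff laplace_smult laplace_lag_orthogonal) (simp_all add: algebra_simps)
  moreover have "X * lag n * lag (Suc n) = X * lag (Suc n) * lag n" by (simp add: mult_ac)
  ultimately have "- (real n + 1) * laplace (lag (Suc n) * lag (Suc n)) = - (real n + 1) * laplace (lag n * lag n)"
    by metis
  then show ?case using Suc by simp
qed

lemma laplace_lag: "laplace (lag n * lag m) = (if n = m then 1 else 0)"
  using laplace_lag_orthogonal laplace_lag_square by simp

section \<open>Differentiated Laguerre functions and their weighted energies\<close>

subsection \<open>Derivatives of the Laguerre functions\<close>

text \<open>\<open>shift_deriv P\<close> is \<open>exp (x / 2)\<close> times the derivative of \<open>exp (- x / 2) P\<close>.\<close>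

definition shift_deriv :: "real poly \<Rightarrow> real poly" where
  "shift_deriv P = pderiv P - smult (1/2) P"

text \<open>The polynomial factor of the \<open>p\<close>-th derivative of the Laguerre function;
  with it all identities stay within polynomials.\<close>

definition lagd :: "nat \<Rightarrow> nat \<Rightarrow> real poly" where
  "lagd n p = (shift_deriv ^^ p) (lag n)"

definition lfun :: "nat \<Rightarrow> nat \<Rightarrow> real \<Rightarrow> real" where
  "lfun n p x = poly (lagd n p) x * exp (- x / 2)"

lemma lagd_0: "lagd n 0 = lag n" and lagd_Suc: "lagd n (Suc p) = shift_deriv (lagd n p)"
  by (simp_all add: lagd_def)

lemma shift_deriv_add: "shift_deriv (P + Q) = shift_deriv P + shift_deriv Q"
  and shift_deriv_smult: "shift_deriv (smult c P) = smult c (shift_deriv P)"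
  and shift_deriv_diff: "shift_deriv (P - Q) = shift_deriv P - shift_deriv Q"
  and shift_deriv_X: "shift_deriv (X * P) = X * shift_deriv P + P"
  by (simp_all add: shift_deriv_def pderiv_add pderiv_smult pderiv_diff pderiv_mult pderiv_pCons
      smult_add_right smult_diff_right algebra_simps)

lemma shift_deriv_power_add: "(shift_deriv ^^ p) (P + Q) = (shift_deriv ^^ p) P + (shift_deriv ^^ p) Q"
  by (induction p) (simp_all add: shift_deriv_add)

lemma shift_deriv_power_smult: "(shift_deriv ^^ p) (smult c P) = smult c ((shift_deriv ^^ p) P)"
  by (induction p) (simp_all add: shift_deriv_smult)

lemma shift_deriv_power_diff: "(shift_deriv ^^ p) (P - Q) = (shift_deriv ^^ p) P - (shift_deriv ^^ p) Q"
  by (induction p) (simp_all add: shift_deriv_diff)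

lemma shift_deriv_power_sum: "(shift_deriv ^^ p) (\<Sum>i\<in>A. f i) = (\<Sum>i\<in>A. (shift_deriv ^^ p) (f i))"
proof -
  have "(shift_deriv ^^ p) 0 = 0" by (induction p) (simp_all add: shift_deriv_def)
  then show ?thesis
    by (induction A rule: infinite_finite_induct) (auto simp: shift_deriv_power_add)
qed

text \<open>Leibniz rule for a factor \<open>x\<close>; at \<open>p = 0\<close> the truncated
  \<open>p - 1\<close> is multiplied by 0.\<close>

lemma shift_deriv_power_X:
  "(shift_deriv ^^ p) (X * P) = X * (shift_deriv ^^ p) P + smult (real p) ((shift_deriv ^^ (p - 1)) P)"
proof (induction p)
  case (Suc p)
  have "(shift_deriv ^^ Suc p) (X * P) = shift_deriv (X * (shift_deriv ^^ p) P) + smult (real p) (shift_deriv ((shift_deriv ^^ (p - 1)) P))"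
    using Suc by (simp add: shift_deriv_add shift_deriv_smult)
  also have "smult (real p) (shift_deriv ((shift_deriv ^^ (p - 1)) P)) = smult (real p) ((shift_deriv ^^ p) P)"
    by (cases p) simp_all
  also have "shift_deriv (X * (shift_deriv ^^ p) P) = X * (shift_deriv ^^ Suc p) P + (shift_deriv ^^ p) P"
    using shift_deriv_X[of "(shift_deriv ^^ p) P"] by simp
  finally show ?case by (simp add: smult_add_left algebra_simps)
qed simp

text \<open>Trades one derivative for a sum over the indices up to \<open>n\<close>, so that each
  derivative costs one power of \<open>n\<close> in pointwise bounds.\<close>

lemma lagd_recurrence: "lagd n (Suc p) = - smult (1/2) (lagd n p) - (\<Sum>j<n. lagd j p)"
proof -
  have "lagd n (Suc p) = (shift_deriv ^^ p) (shift_deriv (lag n))"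
    by (simp add: lagd_def funpow_swap1)
  also have "shift_deriv (lag n) = smult (-1/2) (lag n) - (\<Sum>j<n. lag j)"
    by (simp add: shift_deriv_def pderiv_lag)
  finally show ?thesis
    unfolding shift_deriv_power_diff shift_deriv_power_smult shift_deriv_power_sum by (simp add: lagd_def)
qed

lemma X_lagd: "X * lagd n p = smult (2 * real n + 1) (lagd n p) - smult (real n + 1) (lagd (Suc n) p)
    - smult (real n) (lagd (n - 1) p) - smult (real p) (lagd n (p - 1))"
  using arg_cong[OF X_lag[of n], of "shift_deriv ^^ p"]
  unfolding shift_deriv_power_X shift_deriv_power_diff shift_deriv_power_smult lagd_def[symmetric]
  by (simp add: algebra_simps)

text \<open>The eigenvalue equation \<open>R L = - (n + 1/2) L\<close>, freed of the factor
  \<open>exp (- x / 2)\<close> and differentiated \<open>p\<close> times; the two products with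
  \<open>x\<close> produce the contributions \<open>p\<close> and \<open>p / 4\<close>.\<close>

lemma lagd_ode: "X * lagd n (Suc (Suc p)) + smult (real p + 1) (lagd n (Suc p)) - smult (1/4) (X * lagd n p)
    - smult (real p / 4) (lagd n (p - 1)) + smult (real n + 1/2) (lagd n p) = 0"
proof -
  let ?L = "lag n"
  have "X * shift_deriv (shift_deriv ?L) + shift_deriv ?L - smult (1/4) (X * ?L) + smult (real n + 1/2) ?L =
      X * pderiv (pderiv ?L) + pderiv ?L - X * pderiv ?L + smult (real n) ?L"
    by (rule poly_ext) (simp add: shift_deriv_def pderiv_diff pderiv_smult algebra_simps)
  then have 0: "X * shift_deriv (shift_deriv ?L) + shift_deriv ?L - smult (1/4) (X * ?L) + smult (real n + 1/2) ?L = 0"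
    using lag_ode by simp
  have z: "(shift_deriv ^^ p) 0 = 0" by (induction p) (simp_all add: shift_deriv_def)
  have sw: "(shift_deriv ^^ p) (shift_deriv P) = shift_deriv ((shift_deriv ^^ p) P)" for P
    by (simp add: funpow_swap1)
  have sw2: "(shift_deriv ^^ (p - 1)) (shift_deriv (shift_deriv ?L)) = (if p = 0 then shift_deriv (shift_deriv ?L) else lagd n (Suc p))"
    by (cases p) (simp_all add: lagd_def funpow_swap1)
  show ?thesis
    using arg_cong[OF 0, of "shift_deriv ^^ p"]
    unfolding shift_deriv_power_X shift_deriv_power_diff shift_deriv_power_smult shift_deriv_power_add z sw sw2
    by (cases "p = 0") (simp_all add: lagd_def smult_add_left smult_add_right algebra_simps)
qed

text \<open>Integration by parts on the half line for two functions that each carry a factor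
  \<open>exp (- x / 2)\<close>.\<close>

lemma laplace_by_parts: "laplace (shift_deriv P * Q) + laplace (P * shift_deriv Q) = - coeff (P * Q) 0"
proof -
  have "shift_deriv P * Q + P * shift_deriv Q = pderiv (P * Q) - P * Q"
    by (rule poly_ext) (simp add: shift_deriv_def pderiv_mult algebra_simps)
  then show ?thesis using laplace_pderiv[of "P * Q"] by (simp flip: laplace_add add: laplace_diff)
qed

lemma shift_deriv_X_power: "shift_deriv (X ^ s * P) = X ^ s * shift_deriv P + smult (real s) (X ^ (s - 1) * P)"
proof -
  have "(shift_deriv (X ^ s * P)) = X ^ s * shift_deriv P + pderiv (X ^ s) * P"
    by (rule poly_ext) (simp add: shift_deriv_def pderiv_mult algebra_simps)
  also have "pderiv (X ^ s) = smult (real s) (X ^ (s - 1))"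
    by (simp add: pderiv_power pderiv_pCons)
  finally show ?thesis by simp
qed

text \<open>The integral of \<open>x^s\<close> times the squared \<open>p\<close>-th derivative of
  the Laguerre function, see \<open>has_bochner_integral_lfun_energy\<close>.\<close>

definition lenergy :: "nat \<Rightarrow> nat \<Rightarrow> nat \<Rightarrow> real" where
  "lenergy n p s = laplace (X ^ s * lagd n p ^ 2)"

lemma lenergy_nonneg: "0 \<le> lenergy n p s"
  unfolding lenergy_def by (rule laplace_X_power_nonneg)

text \<open>The differentiated Laguerre equation is multiplied by \<open>x ^ s D ^ p L\<close> and integrated by parts.\<close>

lemma energy_identity:
  "lenergy n (Suc p) (Suc s) + lenergy n p (Suc s) / 4 =
     (real n + 1/2) * lenergy n p s - real p / 4 * laplace (X ^ s * lagd n p * lagd n (p - 1))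
     + (real p - real s) * laplace (X ^ s * lagd n p * lagd n (Suc p))"
proof -
  let ?P = "lagd n p" and ?P1 = "lagd n (Suc p)" and ?P2 = "lagd n (Suc (Suc p))" and ?Pm = "lagd n (p - 1)"
  have "laplace (shift_deriv (X ^ Suc s * ?P) * ?P1) + laplace (X ^ Suc s * ?P * shift_deriv ?P1) = 0"
    using laplace_by_parts[of "X ^ Suc s * ?P" ?P1] by (simp add: coeff_mult_0 mult.assoc)
  moreover have "shift_deriv (X ^ Suc s * ?P) * ?P1 = X ^ Suc s * ?P1 ^ 2 + smult (real s + 1) (X ^ s * ?P * ?P1)"
    unfolding shift_deriv_X_power lagd_Suc by (rule poly_ext) (simp add: power2_eq_square algebra_simps)
  ultimately have ibp: "laplace (X ^ Suc s * ?P * ?P2) =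
      - lenergy n (Suc p) (Suc s) - (real s + 1) * laplace (X ^ s * ?P * ?P1)"
    unfolding lenergy_def lagd_Suc[of n "Suc p"] by (simp add: laplace_add laplace_smult)
  have "X ^ Suc s * ?P * ?P2 + smult (real p + 1) (X ^ s * ?P * ?P1) - smult (1/4) (X ^ Suc s * ?P ^ 2)
      - smult (real p / 4) (X ^ s * ?P * ?Pm) + smult (real n + 1/2) (X ^ s * ?P ^ 2)
     = X ^ s * ?P * (X * ?P2 + smult (real p + 1) ?P1 - smult (1/4) (X * ?P) - smult (real p / 4) ?Pm + smult (real n + 1/2) ?P)"
    by (rule poly_ext) (simp add: power2_eq_square algebra_simps)
  also have "\<dots> = 0" by (simp only: lagd_ode mult_zero_right)
  finally have "laplace (X ^ Suc s * ?P * ?P2) + (real p + 1) * laplace (X ^ s * ?P * ?P1) - lenergy n p (Suc s) / 4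
      - real p / 4 * laplace (X ^ s * ?P * ?Pm) + (real n + 1/2) * lenergy n p s = 0"
    unfolding lenergy_def by (metis (no_types, lifting) laplace_add laplace_diff laplace_smult laplace_0 divide_inverse inverse_eq_divide mult.commute mult_1)
  then show ?thesis using ibp by (simp add: algebra_simps)
qed

text \<open>The integrand is half of \<open>x^(s+1)\<close> times the derivative of a square, so
  integration by parts removes the derivative and lowers the weight.\<close>

lemma laplace_cross_Suc: "laplace (X ^ Suc s * lagd n p * lagd n (Suc p)) = - (real s + 1) / 2 * lenergy n p s"
proof -
  let ?P = "lagd n p"
  have "laplace (shift_deriv (X ^ Suc s * ?P) * ?P) + laplace (X ^ Suc s * ?P * shift_deriv ?P) = 0"
    using laplace_by_parts[of "X ^ Suc s * ?P" ?P] by (simp add: coeff_mult_0 mult.assoc)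
  moreover have "shift_deriv (X ^ Suc s * ?P) * ?P = X ^ Suc s * ?P * shift_deriv ?P + smult (real s + 1) (X ^ s * ?P ^ 2)"
    unfolding shift_deriv_X_power by (rule poly_ext) (simp add: power2_eq_square algebra_simps)
  ultimately show ?thesis
    unfolding lenergy_def lagd_Suc by (simp add: laplace_add laplace_smult field_simps)
qed

text \<open>Positivity on the squares of sum and difference, the arithmetic-mean form of
  Cauchy-Schwarz.\<close>

lemma laplace_cross_bound:
  "\<bar>laplace (X ^ s * lagd n p * lagd n q)\<bar> \<le> (lenergy n p s + lenergy n q s) / 2"
proof -
  have "0 \<le> laplace (X ^ s * (lagd n p + lagd n q) ^ 2)" "0 \<le> laplace (X ^ s * (lagd n p - lagd n q) ^ 2)"
    by (rule laplace_X_power_nonneg)+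
  moreover have "X ^ s * (lagd n p + lagd n q) ^ 2 = X ^ s * lagd n p ^ 2 + X ^ s * lagd n q ^ 2 + smult 2 (X ^ s * lagd n p * lagd n q)"
    by (rule poly_ext) (simp add: power2_eq_square algebra_simps)
  moreover have "X ^ s * (lagd n p - lagd n q) ^ 2 = X ^ s * lagd n p ^ 2 + X ^ s * lagd n q ^ 2 - smult 2 (X ^ s * lagd n p * lagd n q)"
    by (rule poly_ext) (simp add: power2_eq_square algebra_simps)
  ultimately show ?thesis by (simp add: lenergy_def laplace_add laplace_diff laplace_smult)
qed

text \<open>Strong induction on the weight: the energy identity bounds two energies of weight
  \<open>Suc r\<close> by energies of weight \<open>r\<close> and, for \<open>q < r\<close>, of
  weight \<open>r - 1\<close>. The condition \<open>p \<le> s\<close> is preserved, since the cross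
  term with \<open>Suc q\<close> disappears at \<open>q = r\<close> and otherwise leads to weight
  \<open>r - 1 \<ge> q\<close>.\<close>

lemma lenergy_bound: "p \<le> s \<Longrightarrow> lenergy n p s \<le> 5 ^ s * (real n + real s) ^ s"
proof (induction s arbitrary: p rule: less_induct)
  case (less s)
  show ?case
  proof (cases s)
    case 0
    then show ?thesis using less.prems laplace_lag_square[of n]
      by (simp add: lenergy_def lagd_0 power2_eq_square)
  next
    case (Suc r)
    define Y where "Y = real n + real r"
    have Y: "0 \<le> Y" by (simp add: Y_def)
    \<comment> \<open>The identity controls one of the two energies only with the factor 1/4. The
      right side adds up to at most \<open>1 + 1/10\<close> times
      \<open>5 ^ r * (Y + 1) ^ Suc r\<close>, and \<open>11/10 \<le> 5/4\<close>: this is why the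
      base 5 suffices.\<close>
    have main: "lenergy n (Suc q) (Suc r) + lenergy n q (Suc r) / 4 \<le> 5 ^ Suc r * (Y + 1) ^ Suc r / 4" if q: "q \<le> r" for q
    proof -
      let ?B = "5 ^ r * Y ^ r"
      have e1: "lenergy n q r \<le> ?B" using less.IH[of r q] Suc q by (simp add: Y_def)
      have e2: "lenergy n (q - 1) r \<le> ?B" using less.IH[of r "q - 1"] Suc q by (simp add: Y_def)
      have B0: "0 \<le> ?B" using Y by simp
      have "\<bar>laplace (X ^ r * lagd n q * lagd n (q - 1))\<bar> \<le> ?B"
        by (rule order_trans[OF laplace_cross_bound]) (use add_mono[OF e1 e2] in \<open>simp add: mult_ac\<close>)
      then have t2: "- real q / 4 * laplace (X ^ r * lagd n q * lagd n (q - 1)) \<le> real r / 4 * ?B"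
      proof -
        assume a: "\<bar>laplace (X ^ r * lagd n q * lagd n (q - 1))\<bar> \<le> ?B"
        have "- real q / 4 * laplace (X ^ r * lagd n q * lagd n (q - 1)) \<le> \<bar>real q / 4 * laplace (X ^ r * lagd n q * lagd n (q - 1))\<bar>"
          by linarith
        also have "\<dots> \<le> real r / 4 * ?B" unfolding abs_mult using a q by (intro mult_mono) auto
        finally show ?thesis .
      qed
      have t3: "(real q - real r) * laplace (X ^ r * lagd n q * lagd n (Suc q)) \<le> 5 ^ r * (Y + 1) ^ Suc r / 10"
      proof (cases "q = r")
        case True
        then show ?thesis using Y by simp
      next
        case False
        then obtain t where t: "r = Suc t" "q \<le> t" using q by (cases r) auto
        have "lenergy n q t \<le> 5 ^ t * (real n + real t) ^ t" using less.IH[of t q] Suc t by simp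
        also have "\<dots> \<le> 5 ^ t * (Y + 1) ^ t" by (intro mult_left_mono power_mono) (auto simp: Y_def t)
        finally have e3: "lenergy n q t \<le> 5 ^ t * (Y + 1) ^ t" .
        have cr: "laplace (X ^ r * lagd n q * lagd n (Suc q)) = - (real t + 1) / 2 * lenergy n q t"
          unfolding t(1) by (rule laplace_cross_Suc)
        have "(real q - real r) * laplace (X ^ r * lagd n q * lagd n (Suc q)) = (real r - real q) * (real r / 2) * lenergy n q t"
          unfolding cr by (simp add: t algebra_simps)
        also have "\<dots> \<le> (Y + 1) * ((Y + 1) / 2) * (5 ^ t * (Y + 1) ^ t)"
          using t e3 lenergy_nonneg[of n q t] by (intro mult_mono) (auto simp: Y_def)
        also have "\<dots> = 5 ^ r * (Y + 1) ^ Suc r / 10"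
          by (simp add: t field_simps power2_eq_square)
        finally show ?thesis .
      qed
      have "lenergy n (Suc q) (Suc r) + lenergy n q (Suc r) / 4 \<le>
          (real n + 1/2) * ?B + real r / 4 * ?B + 5 ^ r * (Y + 1) ^ Suc r / 10"
      proof -
        define L1 where "L1 = - real q / 4 * laplace (X ^ r * lagd n q * lagd n (q - 1))"
        define L2 where "L2 = (real q - real r) * laplace (X ^ r * lagd n q * lagd n (Suc q))"
        have "lenergy n (Suc q) (Suc r) + lenergy n q (Suc r) / 4 = (real n + 1/2) * lenergy n q r + L1 + L2"
          unfolding energy_identity L1_def L2_def by simp
        moreover have "(real n + 1/2) * lenergy n q r \<le> (real n + 1/2) * ?B"
          using e1 by (intro mult_left_mono) auto
        ultimately show ?thesis using t2[folded L1_def] t3[folded L2_def] by linarith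
      qed
      also have "(real n + 1/2) * ?B + real r / 4 * ?B \<le> 5 ^ r * (Y + 1) ^ Suc r"
      proof -
        have "(real n + 1/2) * ?B + real r / 4 * ?B = (real n + 1/2 + real r / 4) * ?B" by (simp add: algebra_simps)
        also have "\<dots> \<le> (Y + 1) * (5 ^ r * (Y + 1) ^ r)"
          using Y by (intro mult_mono power_mono) (auto simp: Y_def)
        finally show ?thesis by (simp add: mult_ac)
      qed
      finally have "lenergy n (Suc q) (Suc r) + lenergy n q (Suc r) / 4 \<le>
          5 ^ r * (Y + 1) ^ Suc r + 5 ^ r * (Y + 1) ^ Suc r / 10" by simp
      moreover have "0 \<le> 5 ^ r * (Y + 1) ^ Suc r" using Y by simp
      moreover have "5 ^ Suc r * (Y + 1) ^ Suc r = 5 * (5 ^ r * (Y + 1) ^ Suc r)" by simp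
      ultimately show ?thesis by linarith
    qed
    have pos: "0 \<le> 5 ^ Suc r * (Y + 1) ^ Suc r" using Y by simp
    have "lenergy n p (Suc r) \<le> 5 ^ Suc r * (Y + 1) ^ Suc r"
    proof (cases "p = Suc r")
      case True
      show ?thesis unfolding True using main[of r, OF order_refl] lenergy_nonneg[of n r "Suc r"] pos by linarith
    next
      case False
      then show ?thesis using main[of p] lenergy_nonneg[of n "Suc p" "Suc r"] less.prems Suc by simp
    qed
    then show ?thesis using Suc by (simp add: Y_def add_ac)
  qed
qed

section \<open>Pointwise bounds and exponential moments of one-variable Laguerre functions\<close>

subsection \<open>Bounds for the Laguerre functions\<close>

lemma lfun_0: "lfun n 0 x = laguerre_poly n x * exp (- x / 2)"
  by (simp add: lfun_def lagd_0 laguerre_poly_eq)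

lemma has_field_derivative_lfun: "(lfun n p has_field_derivative lfun n (Suc p) x) (at x within A)"
  unfolding lfun_def lagd_Suc shift_deriv_def
  by (auto intro!: derivative_eq_intros simp: algebra_simps)

lemma continuous_on_lfun: "continuous_on A (lfun n p)"
  unfolding lfun_def by (intro continuous_intros) auto

lemma lfun_mult: "lfun n p x * lfun m q x = poly (lagd n p * lagd m q) x * exp (- x)"
proof -
  have "exp (- x) = exp (- x / 2) * exp (- x / 2)" by (simp flip: exp_add)
  then show ?thesis by (simp add: lfun_def mult_ac)
qed

lemma has_bochner_integral_lfun_mult:
  "has_bochner_integral lborel (\<lambda>x. indicator {0<..} x * (lfun n 0 x * lfun m 0 x)) (if n = m then 1 else 0)"
  using has_bochner_integral_poly_exp[of "lag n * lag m"] unfolding lfun_mult lagd_0 laplace_lag .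

lemma has_bochner_integral_lfun_energy:
  "has_bochner_integral lborel (\<lambda>x. indicator {0<..} x * (x ^ s * (lfun n p x)\<^sup>2)) (lenergy n p s)"
proof -
  have "x ^ s * (lfun n p x)\<^sup>2 = poly (X ^ s * lagd n p ^ 2) x * exp (- x)" for x
    by (simp add: power2_eq_square lfun_mult poly_power mult_ac)
  then show ?thesis unfolding lenergy_def by (simp only: has_bochner_integral_poly_exp)
qed

lemma lfun_tendsto_0: "(lfun n p \<longlongrightarrow> 0) at_top"
proof -
  have e: "x ^ i * exp (- x / 2) = 2 ^ i * ((x / 2) ^ i / exp (x / 2))" for x :: real and i
  proof -
    have "exp (- x / 2) = 1 / exp (x / 2)" by (simp add: exp_minus inverse_eq_divide)
    then show ?thesis by (simp add: power_divide)
  qed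
  have h: "filterlim (\<lambda>x::real. x / 2) at_top at_top"
    using filterlim_tendsto_pos_mult_at_top[OF tendsto_const[of "1/2::real"] _ filterlim_ident] by simp
  have "((\<lambda>x::real. x ^ i * exp (- x / 2)) \<longlongrightarrow> 0) at_top" for i
    unfolding e by (intro tendsto_mult_right_zero filterlim_compose[OF tendsto_power_div_exp_0 h])
  then have "((\<lambda>x. \<Sum>i\<le>degree (lagd n p). coeff (lagd n p) i * (x ^ i * exp (- x / 2))) \<longlongrightarrow> 0) at_top"
    by (intro tendsto_null_sum tendsto_mult_right_zero)
  then show ?thesis
    by (simp add: lfun_def[abs_def] poly_altdef sum_distrib_right mult.assoc)
qed

lemma lenergy_0_0: "lenergy n 0 0 = 1"
  using laplace_lag_square[of n] by (simp add: lenergy_def lagd_0 power2_eq_square)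

text \<open>The derivative of the Laguerre function is \<open>- L_n / 2\<close> minus the sum of the
  \<open>n\<close> previous ones; orthonormality adds up the squares.\<close>

lemma lenergy_1_0: "lenergy n 1 0 = 1/4 + real n"
proof -
  have sums: "(\<Sum>j<n. lag j) ^ 2 = (\<Sum>i<n. \<Sum>j<n. lag i * lag j)"
    by (simp add: power2_eq_square sum_product)
  have "laplace ((\<Sum>j<n. lag j) ^ 2) = (\<Sum>i<n. \<Sum>j<n. (if i = j then 1 else 0))"
    unfolding sums laplace_sum laplace_lag ..
  also have "\<dots> = real n" by simp
  finally have 1: "laplace ((\<Sum>j<n. lag j) ^ 2) = real n" .
  have "laplace (lag n * (\<Sum>j<n. lag j)) = (\<Sum>j<n. laplace (lag n * lag j))"
    by (simp add: sum_distrib_left laplace_sum)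
  also have "\<dots> = 0" by (intro sum.neutral) (auto simp: laplace_lag)
  finally have 2: "laplace (lag n * (\<Sum>j<n. lag j)) = 0" .
  have l1: "lagd n 1 = - smult (1/2) (lag n) - (\<Sum>j<n. lag j)"
    using lagd_recurrence[of n 0] by (simp add: lagd_0)
  have "lagd n 1 ^ 2 = smult (1/4) (lag n * lag n) + lag n * (\<Sum>j<n. lag j) + (\<Sum>j<n. lag j) ^ 2"
    unfolding l1 by (rule poly_ext) (simp add: power2_eq_square algebra_simps)
  then show ?thesis
    using 1 2 laplace_lag_square[of n] by (simp add: lenergy_def laplace_add laplace_smult)
qed

text \<open>The value at \<open>x\<close> is recovered from infinity: minus the integral of
  \<open>2 f f'\<close> over \<open>[x, y]\<close> is at most the integral of
  \<open>f^2 + f'^2\<close> over the half line, that is \<open>1 + (n + 1/4)\<close>, and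
  \<open>f\<close> tends to 0.\<close>

lemma lfun_square_le: assumes x: "0 \<le> x" shows "(lfun n 0 x)\<^sup>2 \<le> real n + 2"
proof -
  let ?g = "\<lambda>t. (lfun n 0 t)\<^sup>2" and ?g' = "\<lambda>t. 2 * lfun n 0 t * lfun n 1 t"
  let ?Q = "\<lambda>t. indicator {0<..} t * (t ^ 0 * (lfun n 0 t)\<^sup>2) + indicator {0<..} t * (t ^ 0 * (lfun n 1 t)\<^sup>2)"
  have Q: "has_bochner_integral lborel ?Q (lenergy n 0 0 + lenergy n 1 0)"
    by (intro has_bochner_integral_add has_bochner_integral_lfun_energy)
  have main: "?g x \<le> ?g y + (real n + 5/4)" if y: "x < y" for y
  proof -
    have "has_bochner_integral lborel (\<lambda>t. indicator {x..y} t *\<^sub>R ?g' t) (?g y - ?g x)"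
    proof (rule has_bochner_integral_FTC_Icc)
      fix t
      have "(?g has_field_derivative ?g' t) (at t within {x..y})"
        by (auto intro!: derivative_eq_intros has_field_derivative_lfun[of n 0, simplified])
      then show "(?g has_vector_derivative ?g' t) (at t within {x..y})"
        by (simp add: has_real_derivative_iff_has_vector_derivative)
    qed (use y in \<open>auto intro!: continuous_intros continuous_on_lfun\<close>)
    then have "has_bochner_integral lborel (\<lambda>t. - (indicator {x..y} t *\<^sub>R ?g' t)) (- (?g y - ?g x))"
      by (rule has_bochner_integral_minus)
    note F = this
    have "- (?g y - ?g x) \<le> lenergy n 0 0 + lenergy n 1 0"
      unfolding has_bochner_integral_integral_eq[OF F, symmetric] has_bochner_integral_integral_eq[OF Q, symmetric]
    proof (rule integral_mono_AE[OF integrable.intros[OF F] integrable.intros[OF Q]])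
      have le: "- (2 * a * b) \<le> a\<^sup>2 + b\<^sup>2" for a b :: real
        using zero_le_power2[of "a + b"] by (simp add: power2_sum)
      show "AE t in lborel. - (indicator {x..y} t *\<^sub>R ?g' t) \<le> ?Q t"
        using AE_lborel_singleton[of "0::real"] by eventually_elim (use x le in \<open>auto simp: indicator_def\<close>)
    qed
    then show ?thesis by (simp add: lenergy_0_0 lenergy_1_0[unfolded One_nat_def])
  qed
  have "((\<lambda>y. ?g y + (real n + 5/4)) \<longlongrightarrow> 0\<^sup>2 + (real n + 5/4)) at_top"
    by (intro tendsto_intros lfun_tendsto_0)
  then have "?g x \<le> 0\<^sup>2 + (real n + 5/4)"
    by (rule tendsto_lowerbound) (auto intro: eventually_mono[OF eventually_gt_at_top[of x]] main)
  then show ?thesis by simp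
qed

lemma lfun_recurrence: "lfun n (Suc p) x = - lfun n p x / 2 - (\<Sum>j<n. lfun j p x)"
  by (simp add: lfun_def lagd_recurrence poly_sum sum_distrib_left algebra_simps)

lemma X_lfun: "x * lfun n p x = (2 * real n + 1) * lfun n p x - (real n + 1) * lfun (Suc n) p x
    - real n * lfun (n - 1) p x - real p * lfun n (p - 1) x"
  using arg_cong[OF X_lagd[of n p], of "\<lambda>P. poly P x * exp (- x / 2)"]
  by (simp add: lfun_def algebra_simps)

text \<open>Powers of \<open>x\<close> are removed by \<open>X_lfun\<close> and derivatives by
  \<open>lfun_recurrence\<close>; either raises the exponent of \<open>n + 1\<close>. Polynomial
  growth in \<open>n\<close> is harmless against the weights of the sequence space.\<close>

lemma lfun_bound:
  "\<exists>C>0. \<exists>N. \<forall>n. \<forall>x\<ge>0. x ^ k * \<bar>lfun n p x\<bar> \<le> C * (real n + 1) ^ N"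
proof (induction k arbitrary: p)
  case 0
  show ?case
  proof (induction p)
    case 0
    have "\<bar>lfun n 0 x\<bar> \<le> 2 * (real n + 1) ^ 1" if x: "0 \<le> x" for n x
    proof -
      have "(lfun n 0 x)\<^sup>2 \<le> real n + 2" using lfun_square_le[OF x] .
      also have "\<dots> \<le> (2 * (real n + 1))\<^sup>2" by (simp add: power2_eq_square algebra_simps)
      finally show ?thesis using abs_le_square_iff[of "lfun n 0 x" "2 * (real n + 1)"] by simp
    qed
    then show ?case by (intro exI[of _ "2::real"] conjI exI[of _ "1::nat"]) auto
  next
    case (Suc p)
    then obtain C N where C: "C > 0" "\<And>n x. 0 \<le> x \<Longrightarrow> \<bar>lfun n p x\<bar> \<le> C * (real n + 1) ^ N" by auto
    have "\<bar>lfun n (Suc p) x\<bar> \<le> C * (real n + 1) ^ Suc N" if x: "0 \<le> x" for n x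
    proof -
      have "\<bar>lfun n (Suc p) x\<bar> \<le> \<bar>lfun n p x\<bar> + (\<Sum>j<n. \<bar>lfun j p x\<bar>)"
        unfolding lfun_recurrence[of n p x] using sum_abs[of "\<lambda>j. lfun j p x" "{..<n}"] by linarith
      also have "\<dots> \<le> C * (real n + 1) ^ N + (\<Sum>j<n. C * (real n + 1) ^ N)"
      proof (intro add_mono C x sum_mono)
        fix j assume "j \<in> {..<n}"
        then have "C * (real j + 1) ^ N \<le> C * (real n + 1) ^ N"
          using C(1) by (intro mult_left_mono power_mono) auto
        then show "\<bar>lfun j p x\<bar> \<le> C * (real n + 1) ^ N" using C(2)[OF x, of j] by linarith
      qed
      also have "\<dots> = C * (real n + 1) ^ Suc N" by (simp add: algebra_simps)
      finally show ?thesis .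
    qed
    then show ?case using C(1) by (intro exI[of _ C] conjI exI[of _ "Suc N"]) auto
  qed
next
  case (Suc k)
  obtain C N where C: "C > 0" "\<And>n x. 0 \<le> x \<Longrightarrow> x ^ k * \<bar>lfun n p x\<bar> \<le> C * (real n + 1) ^ N"
    using Suc[of p] by auto
  obtain C' N' where C': "C' > 0" "\<And>n x. 0 \<le> x \<Longrightarrow> x ^ k * \<bar>lfun n (p - 1) x\<bar> \<le> C' * (real n + 1) ^ N'"
    using Suc[of "p - 1"] by auto
  define M where "M = max N N'"
  \<comment> \<open>The factor \<open>2 ^ M\<close> pays for the index \<open>Suc n\<close>, since
    \<open>n + 2 \<le> 2 * (n + 1)\<close>.\<close>
  define K where "K = max C C' * 2 ^ M"
  have K: "0 < K" using C by (simp add: K_def)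
  have b1: "x ^ k * \<bar>lfun m p x\<bar> \<le> K * (real n + 1) ^ M" if "m \<le> Suc n" "0 \<le> x" for m n x
  proof -
    have "x ^ k * \<bar>lfun m p x\<bar> \<le> C * (real m + 1) ^ N" using C(2) that by simp
    also have "\<dots> \<le> max C C' * (2 * (real n + 1)) ^ M"
    proof (intro mult_mono)
      have "(real m + 1) ^ N \<le> (real m + 1) ^ M" by (intro power_increasing) (auto simp: M_def)
      also have "\<dots> \<le> (2 * (real n + 1)) ^ M" using that by (intro power_mono) auto
      finally show "(real m + 1) ^ N \<le> (2 * (real n + 1)) ^ M" .
    qed (use C in auto)
    also have "max C C' * (2 * (real n + 1)) ^ M = K * (real n + 1) ^ M"
      unfolding K_def power_mult_distrib by (simp only: mult_ac)
    finally show ?thesis .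
  qed
  have b2: "x ^ k * \<bar>lfun n (p - 1) x\<bar> \<le> K * (real n + 1) ^ M" if "0 \<le> x" for n x
  proof -
    have "x ^ k * \<bar>lfun n (p - 1) x\<bar> \<le> C' * (real n + 1) ^ N'" using C'(2) that by simp
    also have "\<dots> \<le> K * (real n + 1) ^ M"
    proof (intro mult_mono power_increasing)
      have "C' * 1 \<le> max C C' * 2 ^ M" using C' by (intro mult_mono) auto
      then show "C' \<le> K" by (simp add: K_def)
    qed (use C' K in \<open>auto simp: M_def\<close>)
    finally show ?thesis .
  qed
  have "x ^ Suc k * \<bar>lfun n p x\<bar> \<le> (K * (real p + 4)) * (real n + 1) ^ Suc M" if x: "0 \<le> x" for n x
  proof -
    let ?B = "K * (real n + 1) ^ M"
    have B: "0 \<le> ?B" using K by simp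
    have "x ^ Suc k * \<bar>lfun n p x\<bar> = x ^ k * \<bar>x * lfun n p x\<bar>" using x by (simp add: abs_mult mult_ac)
    also have "\<dots> \<le> x ^ k * ((2 * real n + 1) * \<bar>lfun n p x\<bar> + (real n + 1) * \<bar>lfun (Suc n) p x\<bar>
        + real n * \<bar>lfun (n - 1) p x\<bar> + real p * \<bar>lfun n (p - 1) x\<bar>)"
    proof (intro mult_left_mono)
      have tri: "\<bar>a - b - c - d\<bar> \<le> \<bar>a\<bar> + \<bar>b\<bar> + \<bar>c\<bar> + \<bar>d\<bar>" for a b c d :: real by linarith
      have "\<bar>x * lfun n p x\<bar> \<le> \<bar>(2 * real n + 1) * lfun n p x\<bar> + \<bar>(real n + 1) * lfun (Suc n) p x\<bar>
        + \<bar>real n * lfun (n - 1) p x\<bar> + \<bar>real p * lfun n (p - 1) x\<bar>"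
        unfolding X_lfun[of x n p] by (rule tri)
      then show "\<bar>x * lfun n p x\<bar> \<le> (2 * real n + 1) * \<bar>lfun n p x\<bar> + (real n + 1) * \<bar>lfun (Suc n) p x\<bar>
        + real n * \<bar>lfun (n - 1) p x\<bar> + real p * \<bar>lfun n (p - 1) x\<bar>"
        by (simp add: abs_mult)
    qed (use x in simp)
    also have "\<dots> = (2 * real n + 1) * (x ^ k * \<bar>lfun n p x\<bar>) + (real n + 1) * (x ^ k * \<bar>lfun (Suc n) p x\<bar>)
        + real n * (x ^ k * \<bar>lfun (n - 1) p x\<bar>) + real p * (x ^ k * \<bar>lfun n (p - 1) x\<bar>)"
      by (simp add: algebra_simps)
    also have "\<dots> \<le> (2 * real n + 1) * ?B + (real n + 1) * ?B + real n * ?B + real p * ?B"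
      using b1[OF _ x] b2[OF x] by (intro add_mono mult_left_mono) auto
    also have "\<dots> = (4 * real n + 2 + real p) * ?B" by (simp add: algebra_simps)
    also have "\<dots> \<le> ((real p + 4) * (real n + 1)) * ?B"
      using B by (intro mult_right_mono) (auto simp: algebra_simps)
    finally show ?thesis by (simp add: mult_ac)
  qed
  then show ?case using K by (intro exI[of _ "K * (real p + 4)"] conjI exI[of _ "Suc M"]) auto
qed

text \<open>The moments are explicit, and the binomial theorem sums them to
  \<open>(1 - 1 / (c + 1)) ^ n / (c + 1)\<close>.\<close>

lemma has_bochner_integral_exp_lfun:
  "has_bochner_integral lborel (\<lambda>x. indicator {0<..} x * (exp (- (real c + 1/2) * x) * lfun n 0 x))
     (real c ^ n / (real c + 1) ^ Suc n)"
proof -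
  have "has_bochner_integral lborel (\<lambda>x. \<Sum>k\<le>n. coeff (lag n) k * (indicator {0<..} x * (x ^ k * exp (- (real c + 1) * x))))
      (\<Sum>k\<le>n. coeff (lag n) k * (fact k / (real c + 1) ^ Suc k))"
    by (intro has_bochner_integral_sum has_bochner_integral_mult_right has_bochner_integral_power_exp) simp
  moreover have "(\<Sum>k\<le>n. coeff (lag n) k * (indicator {0<..} x * (x ^ k * exp (- (real c + 1) * x)))) =
      indicator {0<..} x * (exp (- (real c + 1/2) * x) * lfun n 0 x)" for x
  proof -
    have "degree (lag n) \<le> n" by (rule degree_le) (auto simp: coeff_lag binomial_eq_0)
    then have "poly (lag n) x = (\<Sum>k\<le>n. coeff (lag n) k * x ^ k)"
      by (simp add: poly_altdef) (rule sum.mono_neutral_left, auto simp: coeff_eq_0)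
    moreover have "exp (- (real c + 1/2) * x) * exp (- x / 2) = exp (- (real c + 1) * x)"
      by (simp flip: exp_add add: algebra_simps)
    ultimately show ?thesis
      by (simp add: lfun_def lagd_0 sum_distrib_left sum_distrib_right mult_ac)
  qed
  moreover have "(\<Sum>k\<le>n. coeff (lag n) k * (fact k / (real c + 1) ^ Suc k)) = real c ^ n / (real c + 1) ^ Suc n"
  proof -
    let ?z = "1 / (real c + 1)"
    have "(\<Sum>k\<le>n. coeff (lag n) k * (fact k / (real c + 1) ^ Suc k)) = ?z * (\<Sum>k\<le>n. real (n choose k) * (- ?z) ^ k * 1 ^ (n - k))"
      unfolding sum_distrib_left by (intro sum.cong refl) (simp add: coeff_lag power_minus[of "1 / (real c + 1)"] power_one_over)
    also have "\<dots> = ?z * (- ?z + 1) ^ n" by (subst binomial_ring) (rule refl)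
    also have "- ?z + 1 = real c / (real c + 1)" by (simp add: field_simps)
    finally show ?thesis by (simp add: power_divide)
  qed
  ultimately show ?thesis by simp
qed

lemma has_bochner_integral_exp_square:
  "has_bochner_integral lborel (\<lambda>x. indicator {0<..} x * (exp (- (real c + 1/2) * x))\<^sup>2) (1 / (2 * real c + 1))"
proof -
  have "(exp (- (real c + 1/2) * x))\<^sup>2 = x ^ 0 * exp (- (2 * real c + 1) * x)" for x
    by (simp add: power2_eq_square flip: exp_add)
  then show ?thesis using has_bochner_integral_power_exp[of "2 * real c + 1" 0] by simp
qed

text \<open>A geometric series whose sum is the squared norm of
  \<open>has_bochner_integral_exp_square\<close>: Parseval's identity for these exponentials,
  obtained before completeness is known.\<close>

lemma sums_exp_coeff_square: "(\<lambda>n. (real c ^ n / (real c + 1) ^ Suc n)\<^sup>2) sums (1 / (2 * real c + 1))"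
proof -
  let ?q = "(real c / (real c + 1))\<^sup>2"
  have "real c / (real c + 1) < 1" by simp
  then have q: "?q < 1" by (simp add: power_less_one_iff abs_square_less_1)
  have "(\<lambda>n. (1 / (real c + 1))\<^sup>2 * ?q ^ n) sums ((1 / (real c + 1))\<^sup>2 * (1 / (1 - ?q)))"
    using q by (intro sums_mult geometric_sums) simp
  moreover have "(1 / (real c + 1))\<^sup>2 * ?q ^ n = (real c ^ n / (real c + 1) ^ Suc n)\<^sup>2" for n
    by (simp add: power_divide power_mult_distrib power2_eq_square)
  moreover have "(1 / (real c + 1))\<^sup>2 * (1 / (1 - ?q)) = 1 / (2 * real c + 1)"
  proof -
    have "(real c + 1)\<^sup>2 * (1 - ?q) = 2 * real c + 1"
      by (simp add: power_divide right_diff_distrib) (simp add: power2_eq_square algebra_simps)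
    then show ?thesis by (simp add: power_divide)
  qed
  ultimately show ?thesis by simp
qed

section \<open>Product integrals and rapidly decaying functions on the orthant\<close>

section \<open>Integration over the orthant\<close>

lemma open_orthant: "open (orthant :: (real^'d::finite) set)"
proof -
  have "orthant = (\<Inter>l::'d. {x::real^'d. 0 < x $ l})" by (auto simp: orthant_def)
  moreover have "open (\<Inter>l::'d. {x::real^'d. 0 < x $ l})"
    by (intro open_INT finite ballI open_Collect_less continuous_intros)
  ultimately show ?thesis by simp
qed

lemma orthant_borel [measurable]: "orthant \<in> sets borel"
  by (rule borel_open[OF open_orthant])

lemma orthant_pos: "x \<in> orthant \<Longrightarrow> 0 < x $ l"
  by (simp add: orthant_def)

lemma indicator_orthant: "indicator orthant x = (\<Prod>l\<in>UNIV. indicator {0<..} (x $ l) :: real)"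
  for x :: "real^'d::finite"
  by (auto simp: indicator_def orthant_def prod_zero_iff split: if_splits)

lemma Basis_vec_real: "(Basis :: (real^'d::finite) set) = range (\<lambda>l. axis l 1)"
  by (auto simp: Basis_vec_def)

lemma inj_axis: "inj (\<lambda>l::'d::finite. axis l (1::real))"
  by (auto simp: inj_def axis_eq_axis)

text \<open>\<open>lborel\<close> on vectors is the image of the product measure over
  \<open>Basis\<close>, whose elements are the axis vectors; this is the form of Fubini used for the
  product functions below.\<close>

lemma has_bochner_integral_lborel_product:
  fixes F :: "'d::finite \<Rightarrow> real \<Rightarrow> real"
  assumes F: "\<And>l. has_bochner_integral lborel (F l) (I l)"
  shows "has_bochner_integral lborel (\<lambda>x::real^'d. \<Prod>l\<in>UNIV. F l (x $ l)) (\<Prod>l\<in>UNIV. I l)"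
proof -
  interpret product_sigma_finite "\<lambda>_::real^'d. lborel :: real measure" ..
  let ?ix = "inv (\<lambda>l::'d. axis l (1::real))"
  have ix: "?ix (axis l 1) = l" for l by (rule inv_f_f[OF inj_axis])
  let ?G = "\<lambda>b. F (?ix b)"
  have int: "integrable lborel (F l)" for l using F by (rule integrable.intros)
  have meas [measurable]: "F l \<in> borel_measurable borel" for l using borel_measurable_integrable[OF int] by simp
  have prod_Basis: "(\<Prod>b\<in>Basis. h b) = (\<Prod>l\<in>UNIV. h (axis l 1))" for h :: "real^'d \<Rightarrow> real"
    unfolding Basis_vec_real by (simp add: prod.reindex[OF inj_axis])
  let ?f = "\<lambda>x::real^'d. \<Prod>l\<in>UNIV. F l (x $ l)"
  let ?T = "\<lambda>f::real^'d \<Rightarrow> real. \<Sum>b\<in>Basis. f b *\<^sub>R b"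
  have fT: "?f (?T f) = (\<Prod>b\<in>Basis. ?G b (f b))" for f
  proof -
    have "?T f $ l = f (axis l 1)" for l
    proof -
      have "?T f $ l = ?T f \<bullet> axis l 1" by (simp add: inner_axis)
      also have "\<dots> = f (axis l 1)" by (rule inner_sum_left_Basis) (simp add: Basis_vec_real)
      finally show ?thesis .
    qed
    then show ?thesis unfolding prod_Basis ix by simp
  qed
  have m: "?f \<in> borel_measurable borel" by measurable
  have T: "?T \<in> measurable (\<Pi>\<^sub>M b\<in>Basis. lborel) borel" by measurable
  have "integrable (\<Pi>\<^sub>M b\<in>Basis. lborel) (\<lambda>f. \<Prod>b\<in>Basis. ?G b (f b))"
    by (rule product_integrable_prod) (auto intro: int)
  then have "integrable lborel ?f"
    by (subst lborel_eq, subst integrable_distr_eq[OF T m]) (simp only: fT)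
  moreover have "integral\<^sup>L lborel ?f = (\<Prod>l\<in>UNIV. I l)"
  proof -
    have "integral\<^sup>L lborel ?f = integral\<^sup>L (\<Pi>\<^sub>M b\<in>Basis. lborel) (\<lambda>f. \<Prod>b\<in>Basis. ?G b (f b))"
      by (subst lborel_eq, subst integral_distr[OF T m]) (simp only: fT)
    also have "\<dots> = (\<Prod>b\<in>Basis. integral\<^sup>L lborel (?G b))"
      by (rule product_integral_prod) (auto intro: int)
    also have "\<dots> = (\<Prod>l\<in>UNIV. I l)"
      unfolding prod_Basis ix using F by (intro prod.cong refl has_bochner_integral_integral_eq)
    finally show ?thesis .
  qed
  ultimately show ?thesis by (simp add: has_bochner_integral_iff)
qed

lemma has_bochner_integral_orthant_product:
  fixes g :: "'d::finite \<Rightarrow> real \<Rightarrow> real"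
  assumes "\<And>l. has_bochner_integral lborel (\<lambda>x. indicator {0<..} x * g l x) (I l)"
  shows "has_bochner_integral lborel (\<lambda>x::real^'d. indicator orthant x * (\<Prod>l\<in>UNIV. g l (x $ l))) (\<Prod>l\<in>UNIV. I l)"
  using has_bochner_integral_lborel_product[of "\<lambda>l x. indicator {0<..} x * g l x", OF assms]
  by (simp add: indicator_orthant prod.distrib)

text \<open>One weight that dominates 1 and every coordinate and for which \<open>1 / rho^2\<close>
  is integrable over the orthant, so that it supplies the dominating functions.\<close>

definition rho :: "real^'d \<Rightarrow> real" where
  "rho x = (\<Prod>l\<in>UNIV. 1 + x $ l)"

lemma rho_ge_1: "x \<in> orthant \<Longrightarrow> 1 \<le> rho x" for x :: "real^'d::finite"
  unfolding rho_def by (intro prod_ge_1) (simp add: orthant_def less_imp_le)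

lemma rho_pos: "x \<in> orthant \<Longrightarrow> 0 < rho x" for x :: "real^'d::finite"
  using rho_ge_1[of x] by simp

lemma component_le_rho: "x \<in> orthant \<Longrightarrow> x $ l \<le> rho x" for x :: "real^'d::finite"
proof -
  assume x: "x \<in> orthant"
  have "1 \<le> (\<Prod>j\<in>UNIV - {l}. 1 + x $ j)"
    using x by (intro prod_ge_1) (simp add: orthant_def less_imp_le)
  then have "(1 + x $ l) * 1 \<le> (1 + x $ l) * (\<Prod>j\<in>UNIV - {l}. 1 + x $ j)"
    using x by (intro mult_left_mono) (auto simp: orthant_def less_imp_le add_nonneg_nonneg)
  also have "\<dots> = rho x" unfolding rho_def by (subst prod.remove[of UNIV l]) auto
  finally show ?thesis by simp
qed

lemma has_bochner_integral_inverse_square: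
  "has_bochner_integral lborel (\<lambda>x::real. indicator {0<..} x * (1 / (1 + x)\<^sup>2)) 1"
proof (rule has_bochner_integral_nn_integral)
  have lim: "((\<lambda>x::real. - 1 / (1 + x)) \<longlongrightarrow> 0) at_top"
    by (rule tendsto_divide_0[OF tendsto_const])
      (intro filterlim_at_top_imp_at_infinity filterlim_tendsto_add_at_top[OF tendsto_const] filterlim_ident)
  have "(\<integral>\<^sup>+x. ennreal (1 / (1 + x)\<^sup>2) * indicator {0..} x \<partial>lborel) = ennreal (0 - (- 1 / (1 + 0)))"
  proof (rule nn_integral_FTC_atLeast[OF _ _ _ lim])
    show "((\<lambda>x. - 1 / (1 + x)) has_real_derivative 1 / (1 + x)\<^sup>2) (at x)" if "0 \<le> x" for x :: real
      using that by (auto intro!: derivative_eq_intros simp: power2_eq_square)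
  qed auto
  also have "(\<integral>\<^sup>+x. ennreal (1 / (1 + x)\<^sup>2) * indicator {0..} x \<partial>lborel) =
      (\<integral>\<^sup>+x. ennreal (indicator {0<..} x * (1 / (1 + x)\<^sup>2)) \<partial>lborel)"
  proof (rule nn_integral_cong_AE)
    show "AE x in lborel. ennreal (1 / (1 + x)\<^sup>2) * indicator {0..} x = ennreal (indicator {0<..} x * (1 / (1 + x)\<^sup>2))"
      using AE_lborel_singleton[of "0::real"] by eventually_elim (auto simp: indicator_def)
  qed
  finally show "(\<integral>\<^sup>+x. ennreal (indicator {0<..} x * (1 / (1 + x)\<^sup>2)) \<partial>lborel) = ennreal 1" by simp
qed auto

lemma integrable_rho: "integrable lborel (\<lambda>x::real^'d::finite. indicator orthant x * (1 / (rho x)\<^sup>2))"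
proof -
  have "has_bochner_integral lborel (\<lambda>x::real^'d. indicator orthant x * (\<Prod>l\<in>UNIV. 1 / (1 + x $ l)\<^sup>2)) (\<Prod>l\<in>(UNIV::'d set). 1)"
    by (rule has_bochner_integral_orthant_product) (rule has_bochner_integral_inverse_square)
  moreover have "(\<Prod>l\<in>UNIV. 1 / (1 + x $ l)\<^sup>2) = 1 / (rho x)\<^sup>2" for x :: "real^'d"
    by (simp add: rho_def prod_dividef prod_power_distrib)
  ultimately show ?thesis by (auto intro: integrable.intros)
qed

text \<open>Decay faster than every power of \<open>rho\<close>, with continuity only in the open
  orthant. The class contains the derivatives of test functions and of Laguerre functions and is
  stable under products and multiplication by coordinates, so integrability is settled once.\<close>

definition rdecay :: "(real^'d::finite \<Rightarrow> 'b::real_normed_vector) \<Rightarrow> bool" where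
  "rdecay g \<longleftrightarrow> continuous_on orthant g \<and> (\<forall>N. \<exists>C. \<forall>x\<in>orthant. norm (g x) * rho x ^ N \<le> C)"

lemma rdecay_continuous: "rdecay g \<Longrightarrow> continuous_on orthant g"
  by (simp add: rdecay_def)

lemma rdecayE:
  assumes "rdecay g"
  obtains C where "0 \<le> C" "\<And>x. x \<in> orthant \<Longrightarrow> norm (g x) * rho x ^ N \<le> C"
proof -
  obtain C where C: "\<forall>x\<in>orthant. norm (g x) * rho x ^ N \<le> C" using assms unfolding rdecay_def by blast
  then show thesis by (intro that[of "max 0 C"]) (auto simp: le_max_iff_disj)
qed

lemma borel_measurable_orthant:
  fixes g :: "real^'d::finite \<Rightarrow> 'b::euclidean_space"
  assumes "continuous_on orthant g"
  shows "(\<lambda>x. indicator orthant x *\<^sub>R g x) \<in> borel_measurable lborel"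
  using borel_measurable_continuous_on_indicator[OF _ assms] by simp

lemma set_integrable_bounded_rho:
  fixes g :: "real^'d::finite \<Rightarrow> 'b::euclidean_space"
  assumes "continuous_on orthant g" "\<And>x. x \<in> orthant \<Longrightarrow> norm (g x) * (rho x)\<^sup>2 \<le> C"
  shows "set_integrable lborel orthant g"
  unfolding set_integrable_def
proof (rule Bochner_Integration.integrable_bound)
  show "integrable lborel (\<lambda>x::real^'d. C * (indicator orthant x * (1 / (rho x)\<^sup>2)))"
    by (intro integrable_mult_right integrable_rho)
  show "AE x in lborel. norm (indicator orthant x *\<^sub>R g x) \<le> norm (C * (indicator orthant x * (1 / (rho x)\<^sup>2)))"
  proof (rule AE_I2)
    fix x
    show "norm (indicator orthant x *\<^sub>R g x) \<le> norm (C * (indicator orthant x * (1 / (rho x)\<^sup>2)))"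
    proof (cases "x \<in> orthant")
      case True
      have "norm (g x) \<le> C / (rho x)\<^sup>2"
        using assms(2)[OF True] rho_pos[OF True] by (simp add: pos_le_divide_eq)
      also have "\<dots> \<le> \<bar>C\<bar> / (rho x)\<^sup>2" by (intro divide_right_mono) auto
      finally show ?thesis using True by (simp add: abs_mult)
    qed simp
  qed
qed (rule borel_measurable_orthant[OF assms(1)])

lemma rdecay_integrable:
  fixes g :: "real^'d::finite \<Rightarrow> 'b::euclidean_space"
  assumes "rdecay g" shows "set_integrable lborel orthant g"
proof -
  obtain C where "\<And>x. x \<in> orthant \<Longrightarrow> norm (g x) * rho x ^ 2 \<le> C" using rdecayE[OF assms] by blast
  then show ?thesis using set_integrable_bounded_rho rdecay_continuous[OF assms] by blast
qed

lemma rdecay_add: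
  assumes "rdecay f" "rdecay g" shows "rdecay (\<lambda>x. f x + g x)"
  unfolding rdecay_def
proof (intro conjI allI)
  show "continuous_on orthant (\<lambda>x. f x + g x)" using assms by (intro continuous_on_add rdecay_continuous)
  fix N
  obtain C C' where C: "\<And>x. x \<in> orthant \<Longrightarrow> norm (f x) * rho x ^ N \<le> C"
    "\<And>x. x \<in> orthant \<Longrightarrow> norm (g x) * rho x ^ N \<le> C'"
    using rdecayE[OF assms(1)] rdecayE[OF assms(2)] by metis
  have "norm (f x + g x) * rho x ^ N \<le> C + C'" if x: "x \<in> orthant" for x
  proof -
    have "norm (f x + g x) * rho x ^ N \<le> (norm (f x) + norm (g x)) * rho x ^ N"
      using rho_pos[OF x] by (intro mult_right_mono norm_triangle_ineq) auto
    then show ?thesis using C[OF x] by (simp add: distrib_right)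
  qed
  then show "\<exists>C. \<forall>x\<in>orthant. norm (f x + g x) * rho x ^ N \<le> C" by blast
qed

lemma rdecay_product_bound:
  assumes f: "continuous_on orthant f" and a: "rdecay a"
    and b: "\<And>x. x \<in> orthant \<Longrightarrow> norm (b x) \<le> B * rho x ^ M" "0 \<le> B"
    and le: "\<And>x. x \<in> orthant \<Longrightarrow> norm (f x) \<le> norm (a x) * norm (b x)"
  shows "rdecay f"
  unfolding rdecay_def
proof (intro conjI allI f)
  fix N
  obtain C where C: "0 \<le> C" "\<And>x. x \<in> orthant \<Longrightarrow> norm (a x) * rho x ^ (M + N) \<le> C" using rdecayE[OF a] by blast
  have "norm (f x) * rho x ^ N \<le> C * B" if x: "x \<in> orthant" for x
  proof -
    have r: "0 \<le> rho x ^ N" using rho_pos[OF x] by simp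
    have "norm (f x) * rho x ^ N \<le> (norm (a x) * (B * rho x ^ M)) * rho x ^ N"
      using le[OF x] b(1)[OF x] by (intro mult_right_mono r order_trans[OF le[OF x]] mult_left_mono) auto
    also have "\<dots> = (norm (a x) * rho x ^ (M + N)) * B" by (simp add: power_add)
    also have "\<dots> \<le> C * B" using C(2)[OF x] b(2) by (intro mult_right_mono)
    finally show ?thesis .
  qed
  then show "\<exists>C. \<forall>x\<in>orthant. norm (f x) * rho x ^ N \<le> C" by blast
qed

lemma rdecay_product:
  assumes "continuous_on orthant f" "rdecay a" "rdecay b"
    and "\<And>x. x \<in> orthant \<Longrightarrow> norm (f x) \<le> norm (a x) * norm (b x)"
  shows "rdecay f"
proof -
  obtain B where "0 \<le> B" "\<And>x. x \<in> orthant \<Longrightarrow> norm (b x) * rho x ^ 0 \<le> B" using rdecayE[OF assms(3)] by blast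
  then show ?thesis using assms by (intro rdecay_product_bound[of f a b B 0]) auto
qed

lemma rdecay_scaleR:
  assumes g: "rdecay g" and h: "continuous_on orthant h" "\<And>x. x \<in> orthant \<Longrightarrow> \<bar>h x\<bar> \<le> B * rho x ^ M" "0 \<le> B"
  shows "rdecay (\<lambda>x. h x *\<^sub>R g x)"
proof (rule rdecay_product_bound[of _ g h B M])
  show "continuous_on orthant (\<lambda>x. h x *\<^sub>R g x)"
    by (intro continuous_on_scaleR h rdecay_continuous[OF g])
qed (use assms in \<open>simp_all add: mult.commute\<close>)

lemma rdecay_coord_power: "rdecay g \<Longrightarrow> rdecay (\<lambda>x. (x $ l) ^ c *\<^sub>R g x)"
proof (rule rdecay_scaleR[where B=1 and M=c])
  show "\<bar>(x $ l) ^ c\<bar> \<le> 1 * rho x ^ c" if "x \<in> orthant" for x :: "real^'a"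
    using component_le_rho[OF that, of l] orthant_pos[OF that, of l] by (simp add: power_mono)
qed (auto intro!: continuous_intros)

lemma rdecay_cmult: "rdecay g \<Longrightarrow> rdecay (\<lambda>x. r *\<^sub>R g x)"
  by (rule rdecay_scaleR[where B="\<bar>r\<bar>" and M=0]) auto

lemma rdecay_coord: "rdecay g \<Longrightarrow> rdecay (\<lambda>x. x $ l *\<^sub>R g x)"
  using rdecay_coord_power[of g l 1] by simp

lemma rdecay_diff: "rdecay f \<Longrightarrow> rdecay g \<Longrightarrow> rdecay (\<lambda>x. f x - g x)"
  using rdecay_add[OF _ rdecay_cmult[of g "-1"], of f] by simp

lemma rdecay_mult: "rdecay f \<Longrightarrow> rdecay g \<Longrightarrow> rdecay (\<lambda>x. f x * g x :: complex)"
  by (rule rdecay_product[of _ f g]) (simp_all add: continuous_on_mult rdecay_continuous norm_mult)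

lemma rdecay_cmod_square: "rdecay f \<Longrightarrow> rdecay (\<lambda>x. (cmod (f x))\<^sup>2)"
  by (rule rdecay_product[of _ f f])
    (simp_all add: continuous_on_mult continuous_on_norm rdecay_continuous power2_eq_square)

section \<open>Dilations of one coordinate and the vanishing of Euler integrals\<close>

subsection \<open>Integration by parts\<close>

text \<open>Unlike a translation, a dilation of one coordinate preserves the orthant; this is why no
  boundary terms arise.\<close>

definition dil :: "'d::finite \<Rightarrow> real \<Rightarrow> real^'d \<Rightarrow> real^'d" where
  "dil l r x = (\<chi> j. if j = l then r * x $ j else x $ j)"

lemma dil_1 [simp]: "dil l 1 x = x"
  by (simp add: dil_def vec_eq_iff)

lemma dil_orthant: "0 < r \<Longrightarrow> dil l r x \<in> orthant \<longleftrightarrow> x \<in> orthant"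
  unfolding orthant_def dil_def by (auto simp: zero_less_mult_iff split: if_splits)

lemma dil_axis: "dil l r x = x + ((r - 1) * x $ l) *\<^sub>R axis l 1"
  by (auto simp: dil_def vec_eq_iff axis_def algebra_simps)

lemma rho_dil:
  fixes x :: "real^'d::finite"
  assumes "x \<in> orthant" "1 \<le> r" shows "rho x \<le> rho (dil l r x)"
  unfolding rho_def
proof (rule prod_mono)
  fix j
  show "0 \<le> 1 + x $ j \<and> 1 + x $ j \<le> 1 + dil l r x $ j"
    using assms orthant_pos[OF assms(1), of j] mult_right_mono[of 1 r "x $ j"] by (auto simp: dil_def)
qed

lemma integral_dil:
  fixes f :: "real^'d::finite \<Rightarrow> 'b::euclidean_space"
  assumes r: "0 < r" and f: "f \<in> borel_measurable borel"
  shows "(LINT x|lborel. f (dil l r x)) = (1 / r) *\<^sub>R (LINT x|lborel. f x)"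
    and "integrable lborel f \<Longrightarrow> integrable lborel (\<lambda>x. f (dil l r x))"
proof -
  define c where "c b = (if b = axis l 1 then r else 1)" for b :: "real^'d"
  let ?T = "\<lambda>x::real^'d. 0 + (\<Sum>j\<in>Basis. (c j * (x \<bullet> j)) *\<^sub>R j)"
  have T: "?T x = dil l r x" for x
  proof -
    have "(\<Sum>j\<in>Basis. (c j * (x \<bullet> j)) *\<^sub>R j) = (\<Sum>j\<in>UNIV. (c (axis j 1) * x $ j) *\<^sub>R axis j 1)"
      unfolding Basis_vec_real by (subst sum.reindex[OF inj_axis]) (simp add: inner_axis)
    also have "\<dots> = dil l r x"
    proof -
      have c: "c (axis j 1) = (if j = l then r else 1)" for j by (simp add: c_def axis_eq_axis)
      have "(\<Sum>j\<in>UNIV. (c (axis j 1) * x $ j) *\<^sub>R axis j 1) $ i = c (axis i 1) * x $ i" for i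
        by (simp add: axis_def if_distrib cong: if_cong)
      then show ?thesis by (simp add: vec_eq_iff dil_def c)
    qed
    finally show ?thesis by simp
  qed
  have prod: "(\<Prod>j\<in>Basis. \<bar>c j\<bar>) = r"
  proof -
    have "(\<Prod>j\<in>Basis. \<bar>c j\<bar>) = (\<Prod>j\<in>UNIV. \<bar>c (axis j 1)\<bar>)"
      unfolding Basis_vec_real by (subst prod.reindex[OF inj_axis]) simp
    also have "\<dots> = (\<Prod>j\<in>UNIV. if j = l then r else 1)"
      using r by (intro prod.cong) (auto simp: c_def axis_eq_axis)
    finally show ?thesis by simp
  qed
  have lb: "lborel = density (distr lborel borel (dil l r)) (\<lambda>_. ennreal r)"
    using lborel_affine_euclidean[of c 0] r unfolding T[abs_def] prod by (auto simp: c_def)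
  have m: "dil l r \<in> borel_measurable borel"
    unfolding dil_axis[abs_def] by measurable
  have m': "dil l r \<in> measurable lborel borel" using m by simp
  have "(LINT x|lborel. f x) = r *\<^sub>R (LINT x|lborel. f (dil l r x))"
    by (subst lb, subst integral_density) (use r f in \<open>auto simp: integral_distr[OF m']\<close>)
  then show "(LINT x|lborel. f (dil l r x)) = (1 / r) *\<^sub>R (LINT x|lborel. f x)" using r by simp
  assume "integrable lborel f"
  then have "integrable (density (distr lborel borel (dil l r)) (\<lambda>_. ennreal r)) f" using lb by simp
  then have "integrable (distr lborel borel (dil l r)) (\<lambda>x. r *\<^sub>R f x)"
    by (subst (asm) integrable_density) (use r f in auto)
  then have "integrable lborel (\<lambda>x. r *\<^sub>R f (dil l r x))"
    by (subst (asm) integrable_distr_eq[OF m']) (use f in auto)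
  then have "integrable lborel (\<lambda>x. (1 / r) *\<^sub>R (r *\<^sub>R f (dil l r x)))" by (rule integrable_scaleR_right)
  then show "integrable lborel (\<lambda>x. f (dil l r x))" using r by simp
qed

definition has_dird :: "'d::finite \<Rightarrow> (real^'d \<Rightarrow> 'b::real_normed_vector) \<Rightarrow> (real^'d \<Rightarrow> 'b) \<Rightarrow> bool" where
  "has_dird l u u' \<longleftrightarrow> (\<forall>x\<in>orthant. ((\<lambda>s. u (x + s *\<^sub>R axis l 1)) has_vector_derivative u' x) (at 0))"

text \<open>
  The integral of \<open>r u(dil l r x)\<close> over the orthant does not depend on \<open>r\<close>; differentiating at \<open>r = 1\<close>
  yields an integration by parts without boundary terms.
\<close>

lemma integral_euler_zero:
  fixes u :: "real^'d::finite \<Rightarrow> 'b::euclidean_space"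
  assumes u: "rdecay u" and v: "rdecay v" and d: "has_dird l u u'"
    and veq: "\<And>x. x \<in> orthant \<Longrightarrow> v x = u x + x $ l *\<^sub>R u' x"
  shows "(LINT x:orthant|lborel. v x) = 0"
proof -
  have der: "((\<lambda>r. r *\<^sub>R u (dil l r x)) has_vector_derivative v (dil l r x)) (at r)"
    if x: "x \<in> orthant" and r: "0 < r" for x r
  proof -
    let ?y = "dil l r x"
    have y: "?y \<in> orthant" using x r by (simp add: dil_orthant)
    have "((\<lambda>s. u (?y + s *\<^sub>R axis l 1)) has_vector_derivative u' ?y) (at 0)"
      using d y by (simp add: has_dird_def)
    then have "((\<lambda>s. u (?y + s *\<^sub>R axis l 1)) has_vector_derivative u' ?y) (at ((r - r) * x $ l))" by simp
    moreover have "((\<lambda>q. (q - r) * x $ l) has_real_derivative x $ l) (at r)"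
      by (auto intro!: derivative_eq_intros)
    ultimately have "((\<lambda>s. u (?y + s *\<^sub>R axis l 1)) \<circ> (\<lambda>q. (q - r) * x $ l) has_vector_derivative x $ l *\<^sub>R u' ?y) (at r)"
      by (intro vector_diff_chain_at) (simp_all add: has_real_derivative_iff_has_vector_derivative)
    moreover have "(\<lambda>s. u (?y + s *\<^sub>R axis l 1)) \<circ> (\<lambda>q. (q - r) * x $ l) = (\<lambda>q. u (dil l q x))"
      by (auto simp: fun_eq_iff dil_axis algebra_simps simp flip: scaleR_add_left)
    ultimately have "((\<lambda>q. u (dil l q x)) has_vector_derivative x $ l *\<^sub>R u' ?y) (at r)" by simp
    then have "((\<lambda>q. q *\<^sub>R u (dil l q x)) has_vector_derivative r *\<^sub>R (x $ l *\<^sub>R u' ?y) + 1 *\<^sub>R u ?y) (at r)"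
      by (intro has_vector_derivative_scaleR) auto
    moreover have "v ?y = r *\<^sub>R (x $ l *\<^sub>R u' ?y) + 1 *\<^sub>R u ?y"
      using veq[OF y] by (simp add: dil_def)
    ultimately show ?thesis by simp
  qed
  obtain C where C: "0 \<le> C" "\<And>x. x \<in> orthant \<Longrightarrow> norm (v x) * rho x ^ 2 \<le> C" using rdecayE[OF v] by blast
  \<comment> \<open>The factors tend to 1 from above: then \<open>rho\<close> does not decrease
    under the dilation, and the decay of \<open>v\<close> at the dilated points is controlled by
    \<open>rho x\<close>. With this step size \<open>q k\<close> is a difference quotient at
    1.\<close>
  define rk where "rk k = 1 + 1 / (real k + 1)" for k :: nat
  have rk: "1 < rk k" "rk k \<le> 2" for k by (auto simp: rk_def field_simps)
  define q where "q k x = (real k + 1) *\<^sub>R (rk k *\<^sub>R u (dil l (rk k) x) - u x)" for k x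
  have bound: "norm (q k x) \<le> C * (1 / (rho x)\<^sup>2)" if x: "x \<in> orthant" for k x
  proof -
    have "norm (rk k *\<^sub>R u (dil l (rk k) x) - 1 *\<^sub>R u (dil l 1 x)) \<le> (C / (rho x)\<^sup>2) * norm (rk k - 1)"
    proof (rule differentiable_bound[where S="{1..rk k}"])
      fix r assume r: "r \<in> {1..rk k}"
      show "((\<lambda>r. r *\<^sub>R u (dil l r x)) has_derivative (\<lambda>h. h *\<^sub>R v (dil l r x))) (at r within {1..rk k})"
        using der[OF x, of r] r by (auto simp: has_vector_derivative_def intro: has_derivative_at_withinI)
      have "norm (v (dil l r x)) * rho x ^ 2 \<le> norm (v (dil l r x)) * rho (dil l r x) ^ 2"
        using rho_dil[OF x, of r l] rho_pos[OF x] r by (intro mult_left_mono power_mono) auto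
      also have "\<dots> \<le> C" using C(2)[of "dil l r x"] x r by (simp add: dil_orthant)
      finally have "norm (v (dil l r x)) \<le> C / (rho x)\<^sup>2" using rho_pos[OF x] by (simp add: pos_le_divide_eq)
      then show "onorm (\<lambda>h. h *\<^sub>R v (dil l r x)) \<le> C / (rho x)\<^sup>2"
        by (simp add: onorm_scaleR_left[OF bounded_linear_ident] onorm_id)
    qed (use rk[of k] in auto)
    then have "(real k + 1) * norm (rk k *\<^sub>R u (dil l (rk k) x) - 1 *\<^sub>R u (dil l 1 x))
        \<le> (real k + 1) * ((C / (rho x)\<^sup>2) * norm (rk k - 1))"
      by (rule mult_left_mono) simp
    then have "norm (q k x) \<le> (real k + 1) * ((C / (rho x)\<^sup>2) * norm (rk k - 1))"
      unfolding q_def by simp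
    also have "\<dots> = C * (1 / (rho x)\<^sup>2)" by (simp add: rk_def)
    finally show ?thesis .
  qed
  have lim: "(\<lambda>k. q k x) \<longlonglongrightarrow> v x" if x: "x \<in> orthant" for x
  proof -
    let ?h = "\<lambda>r. r *\<^sub>R u (dil l r x)"
    have "((\<lambda>r. (1 / (r - 1)) *\<^sub>R (?h r - ?h 1)) \<longlongrightarrow> v x) (at 1)"
    proof -
      have "((\<lambda>y. (1 / norm (y - 1)) *\<^sub>R (?h y - ?h 1 - (y - 1) *\<^sub>R v x)) \<longlongrightarrow> 0) (at 1)"
        using der[OF x, of 1] by (simp add: has_vector_derivative_def has_derivative_at_within divide_inverse)
      then have "((\<lambda>y. norm ((1 / norm (y - 1)) *\<^sub>R (?h y - ?h 1 - (y - 1) *\<^sub>R v x))) \<longlongrightarrow> 0) (at 1)"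
        by (rule tendsto_norm_zero)
      then have "((\<lambda>y. norm ((1 / (y - 1)) *\<^sub>R (?h y - ?h 1) - v x)) \<longlongrightarrow> 0) (at 1)"
      proof (rule Lim_transform_eventually)
        have "norm ((1 / norm (y - 1)) *\<^sub>R (?h y - ?h 1 - (y - 1) *\<^sub>R v x)) = norm ((1 / (y - 1)) *\<^sub>R (?h y - ?h 1) - v x)"
          if "y \<noteq> 1" for y
        proof -
          have "(1 / (y - 1)) *\<^sub>R (?h y - ?h 1) - v x = (1 / (y - 1)) *\<^sub>R (?h y - ?h 1 - (y - 1) *\<^sub>R v x)"
            using that by (simp add: scaleR_diff_right)
          then show ?thesis by simp
        qed
        then show "\<forall>\<^sub>F y in at 1. norm ((1 / norm (y - 1)) *\<^sub>R (?h y - ?h 1 - (y - 1) *\<^sub>R v x)) =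
            norm ((1 / (y - 1)) *\<^sub>R (?h y - ?h 1) - v x)"
          by (auto simp: eventually_at_filter)
      qed
      then show ?thesis by (rule LIM_zero_cancel[OF tendsto_norm_zero_cancel])
    qed
    moreover have "filterlim rk (at 1) sequentially"
    proof (rule filterlim_atI)
      have "(\<lambda>k. 1 + 1 / real (Suc k)) \<longlonglongrightarrow> 1 + 0" by (intro tendsto_intros LIMSEQ_Suc[OF lim_1_over_n])
      then show "rk \<longlonglongrightarrow> 1" by (simp add: rk_def[abs_def] add.commute)
      have "rk k \<noteq> 1" for k using rk(1)[of k] by simp
      then show "\<forall>\<^sub>F k in sequentially. rk k \<noteq> 1" by simp
    qed
    ultimately have "(\<lambda>k. (1 / (rk k - 1)) *\<^sub>R (?h (rk k) - ?h 1)) \<longlonglongrightarrow> v x"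
      by (rule filterlim_compose)
    then show ?thesis by (simp add: q_def rk_def)
  qed
  define U where "U x = indicator orthant x *\<^sub>R u x" for x
  have Um: "U \<in> borel_measurable borel"
    using borel_measurable_orthant[OF rdecay_continuous[OF u]] by (simp add: U_def[abs_def])
  have Ui: "integrable lborel U"
    using rdecay_integrable[OF u] by (simp add: U_def[abs_def] set_integrable_def)
  have ind: "indicator orthant (dil l (rk k) x) = (indicator orthant x :: real)" for k x
    using dil_orthant[of "rk k" l x] rk[of k] by (simp add: indicator_def)
  have qU: "indicator orthant x *\<^sub>R q k x = (real k + 1) *\<^sub>R (rk k *\<^sub>R U (dil l (rk k) x) - U x)" for k x
    by (simp add: q_def U_def ind scaleR_diff_right mult.commute)
  have "(LINT x|lborel. indicator orthant x *\<^sub>R q k x) = 0" for k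
  proof -
    have i: "integrable lborel (\<lambda>x. U (dil l (rk k) x))" using integral_dil(2)[OF _ Um Ui] rk[of k] by simp
    show ?thesis
      unfolding qU using integral_dil(1)[OF _ Um, of "rk k" l] rk[of k] i Ui by simp
  qed
  moreover have "(\<lambda>k. LINT x|lborel. indicator orthant x *\<^sub>R q k x) \<longlonglongrightarrow> (LINT x|lborel. indicator orthant x *\<^sub>R v x)"
  proof (rule integral_dominated_convergence[where w="\<lambda>x. C * (indicator orthant x * (1 / (rho x)\<^sup>2))"])
    show "(\<lambda>x. indicator orthant x *\<^sub>R v x) \<in> borel_measurable lborel"
      by (rule borel_measurable_orthant[OF rdecay_continuous[OF v]])
    show "(\<lambda>x. indicator orthant x *\<^sub>R q k x) \<in> borel_measurable lborel" for k
    proof -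
      have "dil l (rk k) \<in> borel_measurable borel" unfolding dil_axis[abs_def] by measurable
      then show ?thesis unfolding qU using Um by measurable
    qed
    show "integrable lborel (\<lambda>x::real^'d. C * (indicator orthant x * (1 / (rho x)\<^sup>2)))"
      by (intro integrable_mult_right integrable_rho)
    show "AE x in lborel. (\<lambda>k. indicator orthant x *\<^sub>R q k x) \<longlonglongrightarrow> indicator orthant x *\<^sub>R v x"
      using lim by (intro AE_I2) (auto simp: indicator_def)
    show "AE x in lborel. norm (indicator orthant x *\<^sub>R q k x) \<le> C * (indicator orthant x * (1 / (rho x)\<^sup>2))" for k
      using bound by (intro AE_I2) (auto simp: indicator_def)
  qed
  ultimately show ?thesis by (simp add: set_lebesgue_integral_def LIMSEQ_const_iff)
qed

section \<open>The Laguerre operator in one direction: Hardy inequality, symmetry, growth of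
  iterates\<close>

section \<open>Towers of directional derivatives\<close>

text \<open>\<open>g i\<close> plays the role of the \<open>i\<close>-th derivative of
  \<open>g 0\<close> in direction \<open>l\<close>. Carrying all derivatives along lets the Laguerre
  operator act on whole sequences and be iterated.\<close>

definition tower :: "'d::finite \<Rightarrow> (nat \<Rightarrow> real^'d \<Rightarrow> complex) \<Rightarrow> bool" where
  "tower l g \<longleftrightarrow> (\<forall>i. rdecay (g i) \<and> has_dird l (g i) (g (Suc i)))"

text \<open>A squared norm weighted in the single variable \<open>x $ l\<close>; squaring makes the
  half powers of the seminorms integral.\<close>

definition qnorm :: "'d::finite \<Rightarrow> nat \<Rightarrow> (real^'d \<Rightarrow> complex) \<Rightarrow> real" where
  "qnorm l c g = (LINT x:orthant|lborel. (x $ l) ^ c * (cmod (g x))\<^sup>2)"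

lemma rdecay_weighted_square: "rdecay g \<Longrightarrow> rdecay (\<lambda>x. (x $ l) ^ c * (cmod (g x))\<^sup>2)"
  using rdecay_coord_power[OF rdecay_cmod_square, of g l c] by simp

lemma qnorm_nonneg: "0 \<le> qnorm l c g"
  unfolding qnorm_def set_lebesgue_integral_def
  by (rule Bochner_Integration.integral_nonneg)
    (auto simp: indicator_def orthant_def less_imp_le intro!: mult_nonneg_nonneg)

lemma has_dird_coord_power:
  assumes "has_dird l g g'"
  shows "has_dird l (\<lambda>x. (x $ l) ^ c *\<^sub>R g x) (\<lambda>x. (real c * (x $ l) ^ (c - 1)) *\<^sub>R g x + (x $ l) ^ c *\<^sub>R g' x)"
  unfolding has_dird_def
proof
  fix x :: "real^'a" assume x: "x \<in> orthant"
  have "((\<lambda>s. (x $ l + s) ^ c) has_real_derivative real c * (x $ l) ^ (c - 1)) (at 0)"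
    by (auto intro!: derivative_eq_intros)
  then have "((\<lambda>s. (x $ l + s) ^ c *\<^sub>R g (x + s *\<^sub>R axis l 1)) has_vector_derivative
      (x $ l + 0) ^ c *\<^sub>R g' x + (real c * (x $ l) ^ (c - 1)) *\<^sub>R g (x + 0 *\<^sub>R axis l 1)) (at 0)"
    using assms x by (intro has_vector_derivative_scaleR) (auto simp: has_dird_def)
  then show "((\<lambda>s. ((x + s *\<^sub>R axis l 1) $ l) ^ c *\<^sub>R g (x + s *\<^sub>R axis l 1)) has_vector_derivative
      (real c * (x $ l) ^ (c - 1)) *\<^sub>R g x + (x $ l) ^ c *\<^sub>R g' x) (at 0)"
    by (simp add: add.commute axis_def)
qed

lemma has_dird_mult:
  fixes f g :: "real^'d::finite \<Rightarrow> complex"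
  assumes "has_dird l f f'" "has_dird l g g'"
  shows "has_dird l (\<lambda>x. f x * g x) (\<lambda>x. f x * g' x + f' x * g x)"
  using assms unfolding has_dird_def by (fastforce dest: has_vector_derivative_mult)

lemma has_dird_add: "has_dird l f f' \<Longrightarrow> has_dird l g g' \<Longrightarrow> has_dird l (\<lambda>x. f x + g x) (\<lambda>x. f' x + g' x)"
  and has_dird_diff: "has_dird l f f' \<Longrightarrow> has_dird l g g' \<Longrightarrow> has_dird l (\<lambda>x. f x - g x) (\<lambda>x. f' x - g' x)"
  and has_dird_cmult: "has_dird l f f' \<Longrightarrow> has_dird l (\<lambda>x. r *\<^sub>R f x) (\<lambda>x. r *\<^sub>R f' x)"
  unfolding has_dird_def
  by (auto intro!: has_vector_derivative_add has_vector_derivative_diff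
      has_vector_derivative_scaleR[of "\<lambda>_. r" 0, simplified])

lemma has_dird_cnj: "has_dird l f f' \<Longrightarrow> has_dird l (\<lambda>x. cnj (f x)) (\<lambda>x. cnj (f' x))"
  unfolding has_dird_def by (auto intro: has_vector_derivative_cnj)

lemma has_dird_Re: "has_dird l f f' \<Longrightarrow> has_dird l (\<lambda>x. Re (f x)) (\<lambda>x. Re (f' x))"
  unfolding has_dird_def by (auto intro: bounded_linear.has_vector_derivative[OF bounded_linear_Re])

lemma has_dird_cmod_square:
  assumes "has_dird l g g'" shows "has_dird l (\<lambda>x. (cmod (g x))\<^sup>2) (\<lambda>x. 2 * Re (g' x * cnj (g x)))"
proof -
  have "has_dird l (\<lambda>x. Re (g x * cnj (g x))) (\<lambda>x. Re (g x * cnj (g' x) + g' x * cnj (g x)))"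
    by (intro has_dird_Re has_dird_mult has_dird_cnj assms)
  then show ?thesis
    by (simp add: complex_mult_cnj cmod_power2 algebra_simps)
qed

text \<open>The Euler identity for \<open>x^c |g|^2\<close> says that
  \<open>(c + 1) x^c |g|^2\<close> and \<open>- 2 x^(c+1) Re (g' cnj g)\<close> have the same
  integral. By Young's inequality half of the first absorbs the part of the second that contains
  \<open>g\<close>.\<close>

lemma hardy_inequality:
  assumes g: "rdecay g" and g': "rdecay g'" and d: "has_dird l g g'"
  shows "(real c + 1)\<^sup>2 * qnorm l c g \<le> 4 * qnorm l (c + 2) g'"
proof -
  let ?u = "\<lambda>x. (x $ l) ^ c *\<^sub>R (cmod (g x))\<^sup>2"
  let ?v = "\<lambda>x. ((real c + 1) * ((x $ l) ^ c * (cmod (g x))\<^sup>2)) + 2 * ((x $ l) ^ (c + 1) * Re (g' x * cnj (g x)))"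
  have R: "rdecay (\<lambda>x. Re (g' x * cnj (g x)))"
  proof (rule rdecay_product[of _ g' g])
    show "continuous_on orthant (\<lambda>x. Re (g' x * cnj (g x)))"
      by (intro continuous_on_Re continuous_on_mult continuous_on_cnj rdecay_continuous g g')
    show "norm (Re (g' x * cnj (g x))) \<le> norm (g' x) * norm (g x)" for x
      using abs_Re_le_cmod[of "g' x * cnj (g x)"] by (simp only: real_norm_def norm_mult complex_mod_cnj)
  qed (use g g' in auto)
  have u: "rdecay ?u" using rdecay_weighted_square[OF g, of l c] by simp
  have v1: "rdecay (\<lambda>x. (real c + 1) * ((x $ l) ^ c * (cmod (g x))\<^sup>2))"
    using rdecay_cmult[OF rdecay_weighted_square[OF g, of l c], of "real c + 1"] by simp
  have v2: "rdecay (\<lambda>x. 2 * ((x $ l) ^ (c + 1) * Re (g' x * cnj (g x))))"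
    using rdecay_cmult[OF rdecay_coord_power[OF R, of l "c + 1"], of 2] by simp
  have v: "rdecay ?v" by (rule rdecay_add[OF v1 v2])
  have "(LINT x:orthant|lborel. ?v x) = 0"
  proof (rule integral_euler_zero[OF u v has_dird_coord_power[OF has_dird_cmod_square[OF d]]])
    fix x :: "real^'a" assume x: "x \<in> orthant"
    have cc: "(x $ l) ^ c = x $ l * (x $ l) ^ (c - 1)" if "c \<noteq> 0" using that by (cases c) auto
    then show "?v x = ?u x + x $ l *\<^sub>R ((real c * (x $ l) ^ (c - 1)) *\<^sub>R (cmod (g x))\<^sup>2 + (x $ l) ^ c *\<^sub>R (2 * Re (g' x * cnj (g x))))"
      by (cases "c = 0") (auto simp: cc algebra_simps)
  qed
  moreover have "(LINT x:orthant|lborel. (real c + 1) / 2 * ((x $ l) ^ c * (cmod (g x))\<^sup>2) - 2 / (real c + 1) * ((x $ l) ^ (c + 2) * (cmod (g' x))\<^sup>2))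
      \<le> (LINT x:orthant|lborel. ?v x)"
  proof (rule set_integral_mono)
    show "set_integrable lborel orthant (\<lambda>x. (real c + 1) / 2 * ((x $ l) ^ c * (cmod (g x))\<^sup>2) - 2 / (real c + 1) * ((x $ l) ^ (c + 2) * (cmod (g' x))\<^sup>2))"
      by (intro set_integral_diff set_integrable_mult_right rdecay_integrable rdecay_weighted_square g g')
    show "set_integrable lborel orthant ?v" by (rule rdecay_integrable[OF v])
    fix x :: "real^'a" assume x: "x \<in> orthant"
    define t where "t = x $ l"
    define A where "A = cmod (g x)"
    define B where "B = cmod (g' x)"
    have t: "0 < t" using orthant_pos[OF x] by (simp add: t_def)
    have "\<bar>Re (g' x * cnj (g x))\<bar> \<le> B * A"
      using abs_Re_le_cmod[of "g' x * cnj (g x)"] by (simp add: norm_mult A_def B_def)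
    then have "2 * (t ^ (c + 1) * Re (g' x * cnj (g x))) \<ge> - (2 * t ^ (c + 1) * (B * A))"
      using t mult_left_mono[of "- (B * A)" "Re (g' x * cnj (g x))" "2 * t ^ (c + 1)"] by simp
    \<comment> \<open>Expands the square of \<open>(c + 1) A - 2 t B\<close>; these coefficients
      leave exactly half of the term with \<open>A\<close>.\<close>
    moreover have "2 * t ^ (c + 1) * (B * A) \<le> (real c + 1) / 2 * (t ^ c * A\<^sup>2) + 2 / (real c + 1) * (t ^ (c + 2) * B\<^sup>2)"
    proof -
      let ?r = "real c + 1"
      have "0 \<le> t ^ c * (?r * A - 2 * t * B)\<^sup>2 / (2 * ?r)" using t by simp
      also have "\<dots> = ?r / 2 * (t ^ c * A\<^sup>2) + 2 / ?r * (t ^ (c + 2) * B\<^sup>2) - 2 * t ^ (c + 1) * (B * A)"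
        by (simp add: field_simps power2_eq_square)
      finally show ?thesis by simp
    qed
    ultimately show "(real c + 1) / 2 * ((x $ l) ^ c * (cmod (g x))\<^sup>2) - 2 / (real c + 1) * ((x $ l) ^ (c + 2) * (cmod (g' x))\<^sup>2) \<le> ?v x"
      unfolding t_def[symmetric] A_def[symmetric] B_def[symmetric] by linarith
  qed
  moreover have "(LINT x:orthant|lborel. (real c + 1) / 2 * ((x $ l) ^ c * (cmod (g x))\<^sup>2) - 2 / (real c + 1) * ((x $ l) ^ (c + 2) * (cmod (g' x))\<^sup>2))
      = (real c + 1) / 2 * qnorm l c g - 2 / (real c + 1) * qnorm l (c + 2) g'"
    unfolding qnorm_def set_integral_mult_right[symmetric]
    by (rule set_integral_diff(2)) (intro set_integrable_mult_right rdecay_integrable rdecay_weighted_square g g')+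
  ultimately have "(real c + 1) / 2 * qnorm l c g - 2 / (real c + 1) * qnorm l (c + 2) g' \<le> 0"
    by simp
  then have "(real c + 1) / 2 * qnorm l c g \<le> 2 / (real c + 1) * qnorm l (c + 2) g'" by simp
  then have "(2 * (real c + 1)) * ((real c + 1) / 2 * qnorm l c g) \<le> (2 * (real c + 1)) * (2 / (real c + 1) * qnorm l (c + 2) g')"
    by (rule mult_left_mono) simp
  moreover have "(2 * r) * (r / 2 * a) = r\<^sup>2 * a" for r a :: real by (simp add: power2_eq_square)
  moreover have "(2 * r) * (2 / r * a) = 4 * a" if "r \<noteq> 0" for r a :: real using that by simp
  moreover have "real c + 1 \<noteq> 0" by linarith
  ultimately show ?thesis by metis
qed

text \<open>
  If \<open>g i\<close> is the \<open>i\<close>-th derivative of \<open>g 0\<close> in direction \<open>l\<close>, then \<open>lagop l g i\<close> is the \<open>i\<close>-th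
  derivative of \<open>R (g 0)\<close> for the Laguerre operator \<open>R = D x D - x / 4\<close>.
\<close>

definition lagop :: "'d::finite \<Rightarrow> (nat \<Rightarrow> real^'d \<Rightarrow> complex) \<Rightarrow> nat \<Rightarrow> real^'d \<Rightarrow> complex" where
  "lagop l g p x = x $ l *\<^sub>R g (p + 2) x + (real p + 1) *\<^sub>R g (p + 1) x
     - (1/4) *\<^sub>R (x $ l *\<^sub>R g p x) - (real p / 4) *\<^sub>R g (p - 1) x"

lemma tower_lagop:
  assumes g: "tower l g" shows "tower l (lagop l g)"
  unfolding tower_def
proof (intro allI conjI)
  fix p
  have r: "rdecay (g i)" and d: "has_dird l (g i) (g (Suc i))" for i using g by (auto simp: tower_def)
  show "rdecay (lagop l g p)"
    unfolding lagop_def[abs_def] by (intro rdecay_diff rdecay_add rdecay_cmult rdecay_coord r)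
  have dx: "has_dird l (\<lambda>x. x $ l *\<^sub>R g i x) (\<lambda>x. g i x + x $ l *\<^sub>R g (Suc i) x)" for i
    using has_dird_coord_power[OF d, of 1 i] by simp
  have "has_dird l (lagop l g p) (\<lambda>x. (g (p + 2) x + x $ l *\<^sub>R g (Suc (p + 2)) x) + (real p + 1) *\<^sub>R g (Suc (p + 1)) x
     - (1/4) *\<^sub>R (g p x + x $ l *\<^sub>R g (Suc p) x) - (real p / 4) *\<^sub>R g (Suc (p - 1)) x)"
    unfolding lagop_def[abs_def] by (intro has_dird_diff has_dird_add has_dird_cmult dx d)
  moreover have "(g (p + 2) x + x $ l *\<^sub>R g (Suc (p + 2)) x) + (real p + 1) *\<^sub>R g (Suc (p + 1)) x
     - (1/4) *\<^sub>R (g p x + x $ l *\<^sub>R g (Suc p) x) - (real p / 4) *\<^sub>R g (Suc (p - 1)) x = lagop l g (Suc p) x" for x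
    by (cases p) (simp_all add: lagop_def scaleR_conv_of_real algebra_simps)
  ultimately show "has_dird l (lagop l g p) (lagop l g (Suc p))" by simp
qed

text \<open>\<open>x (g' f - g f')\<close> has the derivative \<open>(R g) f - g (R f)\<close>,
  because the terms \<open>x g' f'\<close> and \<open>x / 4\<close> cancel; the Euler integral of
  \<open>g' f - g f'\<close> vanishes.\<close>

lemma lagop_symmetric:
  assumes g: "tower l g" and f: "tower l f"
  shows "(LINT x:orthant|lborel. lagop l g 0 x * f 0 x) = (LINT x:orthant|lborel. g 0 x * lagop l f 0 x)"
proof -
  have r: "rdecay (g i)" "rdecay (f i)" and d: "has_dird l (g i) (g (Suc i))" "has_dird l (f i) (f (Suc i))" for i
    using g f by (auto simp: tower_def)
  have r': "rdecay (lagop l g 0)" "rdecay (lagop l f 0)" using tower_lagop[OF g] tower_lagop[OF f] by (auto simp: tower_def)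
  have "(LINT x:orthant|lborel. lagop l g 0 x * f 0 x - g 0 x * lagop l f 0 x) = 0"
  proof (rule integral_euler_zero[where u="\<lambda>x. g 1 x * f 0 x - g 0 x * f 1 x" and l=l])
    show "rdecay (\<lambda>x. g 1 x * f 0 x - g 0 x * f 1 x)" by (intro rdecay_diff rdecay_mult r)
    show "rdecay (\<lambda>x. lagop l g 0 x * f 0 x - g 0 x * lagop l f 0 x)" by (intro rdecay_diff rdecay_mult r r')
    show "has_dird l (\<lambda>x. g 1 x * f 0 x - g 0 x * f 1 x)
        (\<lambda>x. (g 1 x * f (Suc 0) x + g (Suc 1) x * f 0 x) - (g 0 x * f (Suc 1) x + g (Suc 0) x * f 1 x))"
      by (intro has_dird_diff has_dird_mult d)
  qed (simp add: lagop_def scaleR_conv_of_real numeral_2_eq_2 algebra_simps)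
  then show ?thesis
    by (subst (asm) set_integral_diff) (simp_all add: rdecay_integrable rdecay_mult r r')
qed

text \<open>The four terms of \<open>lagop\<close> are estimated separately. The one with
  \<open>g (p + 1)\<close> carries the weight \<open>p + k\<close>, one short of what the hypothesis
  offers if \<open>k = 0\<close>, and a factor \<open>p + 1\<close>; the Hardy inequality settles
  both by passing to \<open>g (p + 2)\<close> with weight \<open>p + k + 2\<close>.\<close>

lemma qnorm_lagop_le:
  assumes g: "tower l g" and B: "\<And>p k. qnorm l (p + k) (g p) \<le> B (p + k)"
  shows "qnorm l (p + k) (lagop l g p) \<le> 21 * B (p + k + 2) + (real (p + k))\<^sup>2 * B (p + k)"
proof -
  have r: "rdecay (g i)" and d: "has_dird l (g i) (g (Suc i))" for i using g by (auto simp: tower_def)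
  have nn: "0 \<le> B (p + k)" for p k using order_trans[OF qnorm_nonneg B[of p k]] .
  let ?s = "p + k"
  let ?w = "\<lambda>c i x. (x $ l) ^ c * (cmod (g i x))\<^sup>2"
  have int: "set_integrable lborel orthant (?w c i)" for c i by (intro rdecay_integrable rdecay_weighted_square r)
  have sq: "(a + b + c + d)\<^sup>2 \<le> 4 * (a\<^sup>2 + b\<^sup>2 + c\<^sup>2 + d\<^sup>2)" for a b c d :: real
  proof -
    have "4 * (a\<^sup>2 + b\<^sup>2 + c\<^sup>2 + d\<^sup>2) - (a + b + c + d)\<^sup>2 =
        (a - b)\<^sup>2 + (a - c)\<^sup>2 + (a - d)\<^sup>2 + (b - c)\<^sup>2 + (b - d)\<^sup>2 + (c - d)\<^sup>2"
      by (simp add: power2_eq_square algebra_simps)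
    also have "\<dots> \<ge> 0" by simp
    finally show ?thesis by simp
  qed
  have "qnorm l ?s (lagop l g p) \<le> (LINT x:orthant|lborel. 4 * (?w (?s + 2) (p + 2) x + (real p + 1)\<^sup>2 * ?w ?s (p + 1) x
      + 1/16 * ?w (?s + 2) p x + (real p)\<^sup>2 / 16 * ?w ?s (p - 1) x))"
    unfolding qnorm_def
  proof (rule set_integral_mono)
    show "set_integrable lborel orthant (\<lambda>x. (x $ l) ^ ?s * (cmod (lagop l g p x))\<^sup>2)"
      using tower_lagop[OF g] by (intro rdecay_integrable rdecay_weighted_square) (simp add: tower_def)
    show "set_integrable lborel orthant (\<lambda>x. 4 * (?w (?s + 2) (p + 2) x + (real p + 1)\<^sup>2 * ?w ?s (p + 1) x
      + 1/16 * ?w (?s + 2) p x + (real p)\<^sup>2 / 16 * ?w ?s (p - 1) x))"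
      by (intro set_integrable_mult_right set_integral_add int)
    fix x :: "real^'a" assume x: "x \<in> orthant"
    have t: "0 < x $ l" using orthant_pos[OF x] .
    have "cmod (lagop l g p x) \<le> cmod (x $ l *\<^sub>R g (p + 2) x) + cmod ((real p + 1) *\<^sub>R g (p + 1) x)
        + cmod ((1/4) *\<^sub>R (x $ l *\<^sub>R g p x)) + cmod ((real p / 4) *\<^sub>R g (p - 1) x)"
      unfolding lagop_def by (intro norm_triangle_le_diff add_mono norm_triangle_ineq order_refl)
    then have "cmod (lagop l g p x) \<le> x $ l * cmod (g (p + 2) x) + (real p + 1) * cmod (g (p + 1) x)
        + (x $ l / 4) * cmod (g p x) + (real p / 4) * cmod (g (p - 1) x)"
      using t by simp
    then have "(cmod (lagop l g p x))\<^sup>2 \<le> (x $ l * cmod (g (p + 2) x) + (real p + 1) * cmod (g (p + 1) x)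
        + (x $ l / 4) * cmod (g p x) + (real p / 4) * cmod (g (p - 1) x))\<^sup>2"
      by (intro power_mono) auto
    also have "\<dots> \<le> 4 * ((x $ l * cmod (g (p + 2) x))\<^sup>2 + ((real p + 1) * cmod (g (p + 1) x))\<^sup>2
        + ((x $ l / 4) * cmod (g p x))\<^sup>2 + ((real p / 4) * cmod (g (p - 1) x))\<^sup>2)" by (rule sq)
    finally have "(x $ l) ^ ?s * (cmod (lagop l g p x))\<^sup>2 \<le> (x $ l) ^ ?s * (4 * ((x $ l * cmod (g (p + 2) x))\<^sup>2 + ((real p + 1) * cmod (g (p + 1) x))\<^sup>2
        + ((x $ l / 4) * cmod (g p x))\<^sup>2 + ((real p / 4) * cmod (g (p - 1) x))\<^sup>2))"
      using t by (intro mult_left_mono) auto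
    also have "\<dots> = 4 * (?w (?s + 2) (p + 2) x + (real p + 1)\<^sup>2 * ?w ?s (p + 1) x
      + 1/16 * ?w (?s + 2) p x + (real p)\<^sup>2 / 16 * ?w ?s (p - 1) x)"
    proof -
      have "t ^ s * (4 * ((t * a2)\<^sup>2 + (q * a1)\<^sup>2 + ((t / 4) * a0)\<^sup>2 + ((r / 4) * am)\<^sup>2)) =
          4 * (t ^ (s + 2) * a2\<^sup>2 + q\<^sup>2 * (t ^ s * a1\<^sup>2) + 1/16 * (t ^ (s + 2) * a0\<^sup>2) + r\<^sup>2 / 16 * (t ^ s * am\<^sup>2))"
        for t q r a2 a1 a0 am :: real and s
        by (simp add: power_mult_distrib power_divide power_add power2_eq_square algebra_simps)
      then show ?thesis by blast
    qed
    finally show "(x $ l) ^ ?s * (cmod (lagop l g p x))\<^sup>2 \<le> 4 * (?w (?s + 2) (p + 2) x + (real p + 1)\<^sup>2 * ?w ?s (p + 1) x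
      + 1/16 * ?w (?s + 2) p x + (real p)\<^sup>2 / 16 * ?w ?s (p - 1) x)" .
  qed
  also have "\<dots> = 4 * (qnorm l (?s + 2) (g (p + 2)) + (real p + 1)\<^sup>2 * qnorm l ?s (g (p + 1))
      + 1/16 * qnorm l (?s + 2) (g p) + (real p)\<^sup>2 / 16 * qnorm l ?s (g (p - 1)))"
    unfolding qnorm_def
    by (subst set_integral_mult_right, (subst set_integral_add, intro set_integrable_mult_right set_integral_add int, intro set_integrable_mult_right int)+)
      simp
  also have "\<dots> \<le> 4 * (B (?s + 2) + 4 * B (?s + 2) + 1/16 * B (?s + 2) + (real ?s)\<^sup>2 / 16 * B ?s)"
  proof (intro mult_left_mono add_mono)
    show b2: "qnorm l (?s + 2) (g (p + 2)) \<le> B (?s + 2)" using B[of "p + 2" k] by (simp add: add_ac)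
    have "(real p + 1)\<^sup>2 * qnorm l ?s (g (p + 1)) \<le> (real ?s + 1)\<^sup>2 * qnorm l ?s (g (p + 1))"
      by (intro mult_right_mono power_mono qnorm_nonneg) auto
    also have "\<dots> \<le> 4 * qnorm l (?s + 2) (g (p + 2))"
      using hardy_inequality[where c="p + k", OF r r d] by simp
    finally show "(real p + 1)\<^sup>2 * qnorm l ?s (g (p + 1)) \<le> 4 * B (?s + 2)" using b2 by linarith
    show "qnorm l (?s + 2) (g p) \<le> B (?s + 2)" using B[of p "k + 2"] by (simp add: add_ac)
    show "(real p)\<^sup>2 / 16 * qnorm l ?s (g (p - 1)) \<le> (real ?s)\<^sup>2 / 16 * B ?s"
    proof (cases p)
      case 0
      then show ?thesis using nn[of 0 k] by simp
    next
      case (Suc q)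
      then have "qnorm l ?s (g (p - 1)) \<le> B ?s" using B[of q "k + 1"] by simp
      then show ?thesis by (intro mult_mono divide_right_mono power_mono qnorm_nonneg) auto
    qed
  qed auto
  \<comment> \<open>\<open>4 * (1 + 4 + 1/16)\<close> is below 21: the inner 4 stems from the Hardy
    inequality, the outer one from squaring a sum of four terms.\<close>
  also have "\<dots> \<le> 21 * B (?s + 2) + (real ?s)\<^sup>2 * B ?s"
  proof -
    have 1: "0 \<le> B (?s + 2)" using nn[of p "k + 2"] by (simp add: add_ac)
    have 2: "0 \<le> (real ?s)\<^sup>2 * B ?s" using nn[of p k] by simp
    have "4 * (a + 4 * a + 1/16 * a + b / 16 * c) \<le> 21 * a + b * c" if "0 \<le> a" "0 \<le> b * c" for a b c :: real
      using that by (simp add: field_simps)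
    then show ?thesis using 1 2 by blast
  qed
  finally show ?thesis .
qed

text \<open>One-variable form of \<open>mselfpow\<close> with the value 1 at \<open>s = 0\<close>.
  Squared seminorms carry the exponent \<alpha> in place of \<alpha>/2.\<close>

definition spow :: "real \<Rightarrow> nat \<Rightarrow> real" where
  "spow \<beta> s = (if s = 0 then 1 else real s powr (\<beta> * real s))"

lemma spow_nonneg: "0 \<le> spow \<beta> s"
  by (simp add: spow_def)

lemma spow_mult_le: assumes "0 \<le> \<beta>" shows "spow \<beta> p * spow \<beta> k \<le> spow \<beta> (p + k)"
proof (cases "p = 0 \<or> k = 0")
  case True then show ?thesis by (auto simp: spow_def)
next
  case False
  have "real p powr (\<beta> * real p) * real k powr (\<beta> * real k) \<le> real (p + k) powr (\<beta> * real p) * real (p + k) powr (\<beta> * real k)"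
    using False assms by (intro mult_mono powr_mono2) auto
  also have "\<dots> = real (p + k) powr (\<beta> * real (p + k))" using False by (simp add: powr_add[symmetric] distrib_left)
  finally show ?thesis using False by (simp add: spow_def)
qed

text \<open>Here \<open>\<alpha> \<ge> 1\<close> enters the decay estimate: the factor
  \<open>r^2\<close> of the second term in \<open>qnorm_lagop_le\<close> must not exceed the gain
  \<open>(r + 2)^(2 \<alpha>)\<close>.\<close>

lemma spow_step: assumes "1 \<le> \<alpha>" shows "(real r)\<^sup>2 * spow \<alpha> r \<le> spow \<alpha> (r + 2)"
proof (cases "r = 0")
  case True then show ?thesis by (simp add: spow_nonneg)
next
  case False
  have "(real r)\<^sup>2 = real r powr 2" using False by (simp add: powr_numeral)
  also have "\<dots> \<le> real r powr (\<alpha> * 2)" using False assms by (intro powr_mono) auto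
  also have "\<dots> \<le> real (r + 2) powr (\<alpha> * 2)" using assms by (intro powr_mono2) auto
  finally have 1: "(real r)\<^sup>2 \<le> real (r + 2) powr (\<alpha> * 2)" .
  have "(real r)\<^sup>2 * spow \<alpha> r \<le> real (r + 2) powr (\<alpha> * 2) * real (r + 2) powr (\<alpha> * real r)"
    using 1 False assms by (intro mult_mono) (auto simp: spow_def intro!: powr_mono2)
  also have "\<dots> = spow \<alpha> (r + 2)" by (simp add: spow_def powr_add[symmetric] algebra_simps)
  finally show ?thesis .
qed

text \<open>Each application of \<open>lagop\<close> raises \<open>p + k\<close> by 2 and multiplies
  the constant by 22, which is 21 plus 1 from the second term by \<open>spow_step\<close>. The
  powers of \<open>p\<close> and \<open>k\<close> are merged into one of \<open>p + k\<close> at the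
  start, as the operator mixes them.\<close>

lemma qnorm_lagop_power_le:
  assumes \<alpha>: "1 \<le> \<alpha>" and A: "1 \<le> A" and K: "0 \<le> K" and g: "tower l g"
    and B: "\<And>p k. qnorm l (p + k) (g p) \<le> K * A ^ (2 * (p + k)) * (spow \<alpha> p * spow \<alpha> k)"
  shows "tower l ((lagop l ^^ m) g) \<and> (\<forall>p k. qnorm l (p + k) ((lagop l ^^ m) g p) \<le> K * 22 ^ m * A ^ (2 * (p + k + 2 * m)) * spow \<alpha> (p + k + 2 * m))"
proof (induction m)
  case 0
  have "K * A ^ (2 * (p + k)) * (spow \<alpha> p * spow \<alpha> k) \<le> K * A ^ (2 * (p + k)) * spow \<alpha> (p + k)" for p k
    using K A \<alpha> spow_mult_le[of \<alpha> p k] by (intro mult_left_mono) auto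
  then show ?case using g order_trans[OF B] by auto
next
  case (Suc m)
  let ?h = "(lagop l ^^ m) g"
  let ?B = "\<lambda>s. K * 22 ^ m * A ^ (2 * (s + 2 * m)) * spow \<alpha> (s + 2 * m)"
  have h: "tower l ?h" and hB: "\<And>p k. qnorm l (p + k) (?h p) \<le> ?B (p + k)" using Suc by auto
  have "qnorm l (p + k) (lagop l ?h p) \<le> K * 22 ^ Suc m * A ^ (2 * (p + k + 2 * Suc m)) * spow \<alpha> (p + k + 2 * Suc m)" for p k
  proof -
    let ?s = "p + k"
    define r where "r = ?s + 2 * m"
    define c where "c = K * 22 ^ m * A ^ (2 * (r + 2))"
    have "qnorm l ?s (lagop l ?h p) \<le> 21 * ?B (?s + 2) + (real ?s)\<^sup>2 * ?B ?s"
      by (rule qnorm_lagop_le[OF h, where B="?B"]) (rule hB)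
    also have "?B (?s + 2) = c * spow \<alpha> (r + 2)" by (simp add: c_def r_def add_ac)
    also have "(real ?s)\<^sup>2 * ?B ?s \<le> c * spow \<alpha> (r + 2)"
    proof -
      have "(real ?s)\<^sup>2 * ?B ?s \<le> (real r)\<^sup>2 * (K * 22 ^ m * A ^ (2 * r) * spow \<alpha> r)"
        unfolding r_def using K A by (intro mult_right_mono power_mono) (auto simp: spow_nonneg)
      also have "\<dots> = (K * 22 ^ m * A ^ (2 * r)) * ((real r)\<^sup>2 * spow \<alpha> r)" by simp
      also have "\<dots> \<le> c * spow \<alpha> (r + 2)"
        unfolding c_def using K A spow_step[OF \<alpha>, of r]
        by (intro mult_mono mult_left_mono power_increasing) (auto simp: spow_nonneg)
      finally show ?thesis .
    qed
    finally have "qnorm l ?s (lagop l ?h p) \<le> 22 * (c * spow \<alpha> (r + 2))" by simp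
    also have "\<dots> = K * 22 ^ Suc m * A ^ (2 * (p + k + 2 * Suc m)) * spow \<alpha> (p + k + 2 * Suc m)"
      by (simp add: c_def r_def add_ac)
    finally show ?thesis .
  qed
  then show ?case using tower_lagop[OF h] by simp
qed

lemma lagop_power_eigen:
  assumes g: "tower l g" and f: "tower l f" and eig: "\<And>x. x \<in> orthant \<Longrightarrow> lagop l f 0 x = - \<mu> *\<^sub>R f 0 x"
  shows "(LINT x:orthant|lborel. (lagop l ^^ m) g 0 x * f 0 x) = (- \<mu>) ^ m *\<^sub>R (LINT x:orthant|lborel. g 0 x * f 0 x)"
proof -
  have "tower l ((lagop l ^^ m) g) \<and> ?thesis"
  proof (induction m)
    case 0 then show ?case using g by simp
  next
    case (Suc m)
    let ?h = "(lagop l ^^ m) g"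
    have h: "tower l ?h" using Suc by blast
    have "(LINT x:orthant|lborel. lagop l ?h 0 x * f 0 x) = (LINT x:orthant|lborel. ?h 0 x * lagop l f 0 x)"
      by (rule lagop_symmetric[OF h f])
    also have "\<dots> = (LINT x:orthant|lborel. - \<mu> *\<^sub>R (?h 0 x * f 0 x))"
      by (rule set_lebesgue_integral_cong) (auto simp: eig)
    also have "\<dots> = - \<mu> *\<^sub>R (LINT x:orthant|lborel. ?h 0 x * f 0 x)" by (rule set_integral_scaleR_right)
    finally show ?case using Suc tower_lagop[OF h] by simp
  qed
  then show ?thesis by blast
qed

lemma cauchy_schwarz_orthant:
  assumes f: "rdecay f" and g: "rdecay g" and "qnorm l 0 f \<le> K\<^sup>2" "qnorm l 0 g \<le> 1" "0 \<le> K"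
  shows "cmod (LINT x:orthant|lborel. f x * g x) \<le> K"
proof (rule field_le_epsilon)
  fix e :: real assume e: "0 < e"
  \<comment> \<open>A positive divisor is required, while \<open>K\<close> may be 0.\<close>
  let ?K = "K + e"
  have K: "0 < ?K" using assms e by simp
  have "cmod (LINT x:orthant|lborel. f x * g x) \<le> (LINT x:orthant|lborel. cmod (f x * g x))"
    by (rule set_integral_norm_bound[OF rdecay_integrable[OF rdecay_mult[OF f g]]])
  also have "\<dots> \<le> (LINT x:orthant|lborel. 1 / (2 * ?K) * ((x $ l) ^ 0 * (cmod (f x))\<^sup>2) + ?K / 2 * ((x $ l) ^ 0 * (cmod (g x))\<^sup>2))"
  proof (rule set_integral_mono)
    show "set_integrable lborel orthant (\<lambda>x. cmod (f x * g x))"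
      by (rule set_integrable_norm[OF rdecay_integrable[OF rdecay_mult[OF f g]]])
    show "set_integrable lborel orthant (\<lambda>x. 1 / (2 * ?K) * ((x $ l) ^ 0 * (cmod (f x))\<^sup>2) + ?K / 2 * ((x $ l) ^ 0 * (cmod (g x))\<^sup>2))"
      by (intro set_integral_add set_integrable_mult_right rdecay_integrable rdecay_weighted_square f g)
    fix x
    have "0 \<le> (cmod (f x) - ?K * cmod (g x))\<^sup>2 / (2 * ?K)" using K by simp
    also have "\<dots> = 1 / (2 * ?K) * (cmod (f x))\<^sup>2 + ?K / 2 * (cmod (g x))\<^sup>2 - cmod (f x) * cmod (g x)"
      using K by (simp add: power2_eq_square field_simps)
    finally show "cmod (f x * g x) \<le> 1 / (2 * ?K) * ((x $ l) ^ 0 * (cmod (f x))\<^sup>2) + ?K / 2 * ((x $ l) ^ 0 * (cmod (g x))\<^sup>2)"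
      by (simp add: norm_mult)
  qed
  also have "\<dots> = 1 / (2 * ?K) * qnorm l 0 f + ?K / 2 * qnorm l 0 g"
    unfolding qnorm_def
    by (subst set_integral_add) (intro set_integrable_mult_right rdecay_integrable rdecay_weighted_square f g, intro set_integrable_mult_right rdecay_integrable rdecay_weighted_square f g, simp only: set_integral_mult_right)
  also have "\<dots> \<le> 1 / (2 * ?K) * ?K\<^sup>2 + ?K / 2 * 1"
  proof (intro add_mono mult_left_mono)
    have "K\<^sup>2 \<le> ?K\<^sup>2" using assms e by (intro power_mono) auto
    then show "qnorm l 0 f \<le> ?K\<^sup>2" using assms by simp
  qed (use assms K in auto)
  also have "\<dots> = ?K" using K by (simp add: power2_eq_square field_simps)
  finally show "cmod (LINT x:orthant|lborel. f x * g x) \<le> K + e" .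
qed

text \<open>The exponent \<open>m\<close> is chosen so that \<open>c m\<^sup>\<alpha> / \<nu>\<close> is about \<open>1 / e\<close>.\<close>

lemma power_optimization:
  fixes c \<alpha> \<nu> a K :: real
  assumes \<alpha>: "1 \<le> \<alpha>" and c: "0 < c" and \<nu>: "0 \<le> \<nu>" and K: "0 \<le> K"
    and le: "\<And>m::nat. \<bar>a\<bar> * \<nu> ^ m \<le> K * (c ^ m * spow \<alpha> m)"
  shows "\<bar>a\<bar> \<le> exp 1 * K * exp (- ((\<nu> / (exp 1 * c)) powr (1 / \<alpha>)))"
proof -
  define y where "y = (\<nu> / (exp 1 * c)) powr (1 / \<alpha>)"
  have y: "0 \<le> y" by (simp add: y_def)
  define m where "m = nat \<lfloor>y\<rfloor>"
  have m: "real m \<le> y" "y \<le> real m + 1" using y by (auto simp: m_def)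
  have "\<bar>a\<bar> \<le> K * exp (- real m)"
  proof (cases "m = 0")
    case True
    then show ?thesis using le[of 0] by (simp add: spow_def)
  next
    case False
    then have y1: "1 \<le> y" using m by linarith
    then have \<nu>0: "0 < \<nu>" using \<nu> by (cases "\<nu> = 0") (auto simp: y_def)
    have "real m powr \<alpha> \<le> y powr \<alpha>" using m \<alpha> by (intro powr_mono2) auto
    also have "\<dots> = \<nu> / (exp 1 * c)" using \<alpha> c \<nu>0 by (simp add: y_def powr_powr)
    finally have mm: "c * real m powr \<alpha> \<le> \<nu> * exp (- 1)" using c by (simp add: exp_minus field_simps)
    have "c ^ m * spow \<alpha> m = (c * real m powr \<alpha>) ^ m"
      using False by (simp add: spow_def power_mult_distrib powr_powr[symmetric] powr_realpow)
    also have "\<dots> \<le> (\<nu> * exp (- 1)) ^ m" using mm c by (intro power_mono) auto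
    also have "\<dots> = \<nu> ^ m * exp (- real m)" by (simp add: power_mult_distrib exp_of_nat_mult[symmetric])
    finally have "\<bar>a\<bar> * \<nu> ^ m \<le> K * (\<nu> ^ m * exp (- real m))" using le[of m] K by (meson mult_left_mono order_trans)
    then have "\<bar>a\<bar> * \<nu> ^ m \<le> (K * exp (- real m)) * \<nu> ^ m" by (simp add: mult_ac)
    then show ?thesis using \<nu>0 by (simp add: mult_le_cancel_right)
  qed
  \<comment> \<open>Rounding \<open>y\<close> down to \<open>m\<close> loses at most one unit in the
    exponent, hence the factor \<open>exp 1\<close> of the conclusion.\<close>
  also have "\<dots> \<le> K * (exp 1 * exp (- y))"
    using m K by (intro mult_left_mono) (auto simp flip: exp_add)
  finally show ?thesis by (simp add: y_def mult_ac)
qed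

text \<open>Symmetry moves the eigenvalue power \<open>(\<nu> + 1/2)^m\<close> onto the coefficient,
  and the bound for the iterate is a square: \<open>22^m \<le> (5^m)^2\<close>,
  \<open>A^(4 m)\<close> is the square of \<open>A^(2 m)\<close>, and
  \<open>(2 m)^(2 \<alpha> m)\<close> that of \<open>2^(\<alpha> m) m^(\<alpha> m)\<close>. This is
  the origin of \<open>5 * A^2 * 2^\<alpha>\<close>.\<close>

lemma coefficient_decay:
  assumes \<alpha>: "1 \<le> \<alpha>" and A: "1 \<le> A" and K: "0 \<le> K" and g: "tower l g" and f: "tower l f"
    and B: "\<And>p k. qnorm l (p + k) (g p) \<le> K\<^sup>2 * A ^ (2 * (p + k)) * (spow \<alpha> p * spow \<alpha> k)"
    and eig: "\<And>x. x \<in> orthant \<Longrightarrow> lagop l f 0 x = - (\<nu> + 1/2) *\<^sub>R f 0 x" and \<nu>: "0 \<le> \<nu>"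
    and f1: "qnorm l 0 (f 0) \<le> 1"
  shows "cmod (LINT x:orthant|lborel. g 0 x * f 0 x) \<le>
    exp 1 * K * exp (- ((\<nu> / (exp 1 * (5 * A\<^sup>2 * 2 powr \<alpha>))) powr (1 / \<alpha>)))"
proof -
  let ?a = "cmod (LINT x:orthant|lborel. g 0 x * f 0 x)"
  have "\<bar>?a\<bar> \<le> exp 1 * K * exp (- ((\<nu> / (exp 1 * (5 * A\<^sup>2 * 2 powr \<alpha>))) powr (1 / \<alpha>)))"
  proof (rule power_optimization[OF \<alpha> _ \<nu> K])
    show "0 < 5 * A\<^sup>2 * 2 powr \<alpha>" using A by simp
    fix m :: nat
    let ?h = "(lagop l ^^ m) g"
    have all: "tower l ?h \<and> (\<forall>p k. qnorm l (p + k) (?h p) \<le> K\<^sup>2 * 22 ^ m * A ^ (2 * (p + k + 2 * m)) * spow \<alpha> (p + k + 2 * m))"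
      by (rule qnorm_lagop_power_le[OF \<alpha> A _ g B]) simp
    have h: "tower l ?h" using all by blast
    have hB: "qnorm l 0 (?h 0) \<le> K\<^sup>2 * 22 ^ m * A ^ (2 * (2 * m)) * spow \<alpha> (2 * m)"
      using all[THEN conjunct2, rule_format, of 0 0] by simp
    have s2: "spow \<alpha> (2 * m) = (2 powr \<alpha>) ^ (2 * m) * (spow \<alpha> m)\<^sup>2"
    proof (cases "m = 0")
      case False
      have "spow \<alpha> (2 * m) = 2 powr (\<alpha> * real (2 * m)) * real m powr (\<alpha> * real (2 * m))"
        using False by (simp add: spow_def powr_mult)
      also have "2 powr (\<alpha> * real (2 * m)) = (2 powr \<alpha>) ^ (2 * m)" by (simp only: powr_powr[symmetric] powr_realpow powr_gt_zero)
      also have "real m powr (\<alpha> * real (2 * m)) = (spow \<alpha> m)\<^sup>2"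
        using False by (simp add: spow_def power2_eq_square powr_add[symmetric] algebra_simps)
      finally show ?thesis .
    qed (simp add: spow_def)
    have "K\<^sup>2 * 22 ^ m * A ^ (2 * (2 * m)) * spow \<alpha> (2 * m) \<le> K\<^sup>2 * 25 ^ m * A ^ (2 * (2 * m)) * spow \<alpha> (2 * m)"
      using A by (intro mult_right_mono mult_left_mono power_mono) (auto simp: spow_nonneg)
    also have "\<dots> = (K * ((5 * A\<^sup>2 * 2 powr \<alpha>) ^ m * spow \<alpha> m))\<^sup>2"
    proof -
      have "(25::real) ^ m = (5 ^ m)\<^sup>2" by (simp add: power_mult[symmetric] power2_eq_square power_mult_distrib[symmetric])
      moreover have "A ^ (2 * (2 * m)) = ((A\<^sup>2) ^ m)\<^sup>2" by (simp add: power_mult[symmetric] mult_ac)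
      moreover have "(2 powr \<alpha>) ^ (2 * m) = ((2 powr \<alpha>) ^ m)\<^sup>2" by (simp add: power_mult[symmetric] mult_ac)
      ultimately show ?thesis unfolding s2 by (simp only: power_mult_distrib mult_ac)
    qed
    finally have "qnorm l 0 (?h 0) \<le> (K * ((5 * A\<^sup>2 * 2 powr \<alpha>) ^ m * spow \<alpha> m))\<^sup>2" using hB by linarith
    then have "cmod (LINT x:orthant|lborel. ?h 0 x * f 0 x) \<le> K * ((5 * A\<^sup>2 * 2 powr \<alpha>) ^ m * spow \<alpha> m)"
      using h f f1 K A by (intro cauchy_schwarz_orthant[of _ _ l]) (auto simp: tower_def spow_nonneg)
    moreover have "cmod (LINT x:orthant|lborel. ?h 0 x * f 0 x) = (\<nu> + 1/2) ^ m * ?a"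
    proof -
      have "(LINT x:orthant|lborel. ?h 0 x * f 0 x) = (- (\<nu> + 1/2)) ^ m *\<^sub>R (LINT x:orthant|lborel. g 0 x * f 0 x)"
        by (rule lagop_power_eigen[OF g f eig])
      moreover have "\<bar>(- (\<nu> + 1/2)) ^ m\<bar> = (\<nu> + 1/2) ^ m"
        using \<nu> by (simp add: power_abs add.commute)
      ultimately show ?thesis by simp
    qed
    moreover have "\<nu> ^ m * ?a \<le> (\<nu> + 1/2) ^ m * ?a" using \<nu> by (intro mult_right_mono power_mono) auto
    ultimately show "\<bar>?a\<bar> * \<nu> ^ m \<le> K * ((5 * A\<^sup>2 * 2 powr \<alpha>) ^ m * spow \<alpha> m)" by (simp add: mult.commute)
  qed
  then show ?thesis by simp
qed

section \<open>Iterated partial derivatives on the open orthant\<close>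

section \<open>Derivatives on the orthant\<close>

lemma eventually_line_orthant:
  assumes "x \<in> orthant" shows "eventually (\<lambda>s. x + s *\<^sub>R axis i 1 \<in> orthant) (nhds (0::real))"
proof -
  have "isCont (\<lambda>s::real. x + s *\<^sub>R axis i 1) 0" by (intro continuous_intros)
  then have "((\<lambda>s::real. x + s *\<^sub>R axis i 1) \<longlongrightarrow> x + 0 *\<^sub>R axis i 1) (nhds 0)"
    by (simp add: isCont_def tendsto_nhds_iff)
  then show ?thesis
    using topological_tendstoD[OF _ open_orthant] assms by fastforce
qed

lemma has_dird_cong:
  assumes "has_dird l f f'" "\<And>x. x \<in> orthant \<Longrightarrow> f x = g x" "\<And>x. x \<in> orthant \<Longrightarrow> f' x = g' x"
  shows "has_dird l g g'"
  unfolding has_dird_def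
proof
  fix x :: "real^'a" assume x: "x \<in> orthant"
  have "\<forall>\<^sub>F s in nhds (0::real). f (x + s *\<^sub>R axis l 1) = g (x + s *\<^sub>R axis l 1)"
    using eventually_line_orthant[OF x, of l] by eventually_elim (rule assms(2))
  then obtain T where T: "open T" "0 \<in> T" "\<And>s. s \<in> T \<Longrightarrow> f (x + s *\<^sub>R axis l 1) = g (x + s *\<^sub>R axis l 1)"
    by (auto simp: eventually_nhds)
  have "((\<lambda>s. f (x + s *\<^sub>R axis l 1)) has_vector_derivative f' x) (at 0)"
    using assms(1) x by (simp add: has_dird_def)
  then have "((\<lambda>s. g (x + s *\<^sub>R axis l 1)) has_vector_derivative f' x) (at 0)"
    by (rule has_vector_derivative_transform_within_open[OF _ T(1,2)]) (rule T(3))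
  then show "((\<lambda>s. g (x + s *\<^sub>R axis l 1)) has_vector_derivative g' x) (at 0)"
    using assms(3)[OF x] by simp
qed

lemma has_dird_partial_deriv: "has_dird l f f' \<Longrightarrow> x \<in> orthant \<Longrightarrow> partial_deriv l f x = f' x"
  unfolding has_dird_def partial_deriv_def by (auto intro: vector_derivative_at)

lemma smooth_has_dird:
  "smooth_on_orthant f \<Longrightarrow> has_dird i (iter_deriv js f) (iter_deriv (i # js) f)"
  unfolding has_dird_def smooth_on_orthant_def by (auto simp: partial_deriv_def vector_derivative_works[symmetric])

lemma smooth_continuous: "smooth_on_orthant f \<Longrightarrow> continuous_on orthant (iter_deriv js f)"
  by (simp add: smooth_on_orthant_def)

text \<open>\<open>G js\<close> proposes the derivative for each list of directions. A directional
  derivative at a point of the open orthant depends only on nearby values, so agreement on the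
  orthant propagates along the list. Sums, multiples and Laguerre series are treated in this
  way.\<close>

lemma smoothI:
  assumes "\<And>js. continuous_on orthant (G js)" "\<And>js i. has_dird i (G js) (G (i # js))"
    and "\<And>x. x \<in> orthant \<Longrightarrow> f x = G [] x"
  shows "smooth_on_orthant f" and "x \<in> orthant \<Longrightarrow> iter_deriv js f x = G js x"
proof -
  have eq: "\<forall>x\<in>orthant. iter_deriv js f x = G js x" for js
  proof (induction js)
    case Nil then show ?case using assms(3) by simp
  next
    case (Cons i js)
    have "has_dird i (iter_deriv js f) (G (i # js))"
      by (rule has_dird_cong[OF assms(2)[of i js]]) (use Cons in auto)
    then show ?case by (simp add: has_dird_partial_deriv)
  qed
  then show "x \<in> orthant \<Longrightarrow> iter_deriv js f x = G js x" by blast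
  show "smooth_on_orthant f"
    unfolding smooth_on_orthant_def
  proof (intro allI conjI ballI)
    fix js i and x :: "real^'a"
    show "continuous_on orthant (iter_deriv js f)"
      using assms(1)[of js] eq[of js] by (simp cong: continuous_on_cong)
    assume x: "x \<in> orthant"
    have "has_dird i (iter_deriv js f) (G (i # js))"
      by (rule has_dird_cong[OF assms(2)[of i js]]) (use eq in auto)
    then show "(\<lambda>s::real. iter_deriv js f (x + s *\<^sub>R axis i 1)) differentiable at 0"
      using x by (auto simp: has_dird_def intro: differentiableI_vector)
  qed
qed

lemma smooth_add:
  assumes "smooth_on_orthant f" "smooth_on_orthant g"
  shows "smooth_on_orthant (f + g)"
    and "x \<in> orthant \<Longrightarrow> iter_deriv js (f + g) x = iter_deriv js f x + iter_deriv js g x"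
proof -
  let ?G = "\<lambda>js x. iter_deriv js f x + iter_deriv js g x"
  have 1: "continuous_on orthant (?G js)" for js
    by (intro continuous_on_add smooth_continuous assms)
  have 2: "has_dird i (?G js) (?G (i # js))" for i js
    by (intro has_dird_add smooth_has_dird assms)
  show "smooth_on_orthant (f + g)" by (rule smoothI(1)[of ?G, OF 1 2]) simp
  show "x \<in> orthant \<Longrightarrow> iter_deriv js (f + g) x = ?G js x" by (rule smoothI(2)[of ?G, OF 1 2]) simp_all
qed

lemma smooth_scale:
  assumes "smooth_on_orthant f"
  shows "smooth_on_orthant (c *\<^sub>F f)"
    and "x \<in> orthant \<Longrightarrow> iter_deriv js (c *\<^sub>F f) x = c * iter_deriv js f x"
proof -
  let ?G = "\<lambda>js x. c * iter_deriv js f x"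
  have 1: "continuous_on orthant (?G js)" for js
    by (intro continuous_intros smooth_continuous assms)
  have 2: "has_dird i (?G js) (?G (i # js))" for i js
  proof -
    have "has_dird i (\<lambda>_. c) (\<lambda>_. 0)" by (simp add: has_dird_def)
    from has_dird_mult[OF this smooth_has_dird[OF assms]] show ?thesis by simp
  qed
  show "smooth_on_orthant (c *\<^sub>F f)" by (rule smoothI(1)[of ?G, OF 1 2]) simp
  show "x \<in> orthant \<Longrightarrow> iter_deriv js (c *\<^sub>F f) x = ?G js x" by (rule smoothI(2)[of ?G, OF 1 2]) simp_all
qed

lemma ex_count_list: "\<exists>js. \<forall>i. count_list js i = (p $ i :: nat)" for p :: "nat^'d::finite"
proof -
  have rep: "count_list (replicate k a) b = (if a = b then k else 0)" for k and a b :: 'd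
    by (induction k) auto
  have "\<exists>js. \<forall>i. count_list js i = (if i \<in> A then p $ i else 0)" if "finite A" for A
    using that
  proof induction
    case empty then show ?case by (intro exI[of _ "[]"]) simp
  next
    case (insert a A)
    then obtain js where "\<forall>i. count_list js i = (if i \<in> A then p $ i else 0)" by blast
    then show ?case using insert by (intro exI[of _ "replicate (p $ a) a @ js"]) (auto simp: rep)
  qed
  from this[of UNIV] show ?thesis by simp
qed

lemma mderivE:
  obtains js where "\<And>i. count_list js i = (p $ i :: nat)" "mderiv p = iter_deriv js"
proof -
  have "\<forall>i. count_list (SOME js. \<forall>i. count_list js i = p $ i) i = p $ i"
    by (rule someI_ex[OF ex_count_list])
  then show thesis using that[of "SOME js. \<forall>i. count_list js i = p $ i"] by (auto simp: mderiv_def fun_eq_iff)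
qed

text \<open>The list behind \<open>mderiv\<close> is chosen by \<open>SOME\<close>; for a multiple
  of one axis there is a single admissible list, so the choice is known.\<close>

lemma mderiv_axis: "mderiv (axis l k) f = iter_deriv (replicate k l) f"
proof -
  obtain js where js: "\<And>i. count_list js i = axis l k $ i" "mderiv (axis l k) = iter_deriv js"
    using mderivE[of "axis l k"] by blast
  have "set js \<subseteq> {l}"
  proof
    fix i assume "i \<in> set js"
    then have "count_list js i \<noteq> 0" by (simp add: count_list_0_iff)
    then show "i \<in> {l}" using js(1)[of i] by (auto simp: axis_def split: if_splits)
  qed
  then have 1: "js = replicate (length js) l" by (induction js) auto
  have rep: "count_list (replicate k a) a = k" for k and a :: 'a by (induction k) auto
  have "count_list js l = length js" by (subst 1) (rule rep)
  then have "length js = k" using js(1)[of l] by (simp add: axis_def)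
  then show ?thesis using js(2) 1 by simp
qed

lemma mderiv_add: "smooth_on_orthant f \<Longrightarrow> smooth_on_orthant g \<Longrightarrow> x \<in> orthant \<Longrightarrow> mderiv p (f + g) x = mderiv p f x + mderiv p g x"
  and mderiv_scale: "smooth_on_orthant f \<Longrightarrow> x \<in> orthant \<Longrightarrow> mderiv p (c *\<^sub>F f) x = c * mderiv p f x"
  by (auto simp: mderiv_def smooth_add smooth_scale)

lemma mderiv_continuous: "smooth_on_orthant f \<Longrightarrow> continuous_on orthant (mderiv p f)"
  by (simp add: mderiv_def smooth_continuous)

subsection \<open>The Schwartz space of the orthant\<close>

lemma schwartzD:
  assumes "f \<in> schwartz_orthant"
  shows "x \<notin> orthant \<Longrightarrow> f x = 0" "smooth_on_orthant f"
    "bdd_above ((\<lambda>x. mpow x k * cmod (mderiv p f x)) ` orthant)"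
    "\<exists>g. continuous_on closed_orthant g \<and> (\<forall>x\<in>orthant. g x = mderiv p f x)"
  using assms by (auto simp: schwartz_orthant_def)

lemma mpow_nonneg: "x \<in> orthant \<Longrightarrow> 0 \<le> mpow x k"
  unfolding mpow_def orthant_def by (auto intro!: prod_nonneg simp: less_imp_le)

text \<open>Converts seminorms with monomials into decay against \<open>rho\<close>. A sum over a
  box appears because the suitable monomial depends on \<open>x\<close>.\<close>

lemma rho_power_le_mpow:
  fixes x :: "real^'d::finite"
  assumes x: "x \<in> orthant"
  shows "rho x ^ N \<le> 2 ^ (CARD('d) * N) * (\<Sum>k\<in>{k::nat^'d. \<forall>l. k $ l \<le> N}. mpow x k)"
proof -
  \<comment> \<open>Full power for the coordinates above 1, none for the others: in both cases
    \<open>(1 + x $ l) ^ N\<close> is at most \<open>2 ^ N\<close> times the chosen factor.\<close>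
  define k :: "nat^'d" where "k = (\<chi> l. if 1 < x $ l then N else 0)"
  have "rho x ^ N = (\<Prod>l\<in>UNIV. (1 + x $ l) ^ N)" by (simp add: rho_def prod_power_distrib)
  also have "\<dots> \<le> (\<Prod>l\<in>UNIV. 2 ^ N * x $ l ^ k $ l)"
  proof (intro prod_mono conjI)
    fix l
    have p: "0 < x $ l" using orthant_pos[OF x] .
    then show "0 \<le> (1 + x $ l) ^ N" by simp
    show "(1 + x $ l) ^ N \<le> 2 ^ N * x $ l ^ k $ l"
    proof (cases "1 < x $ l")
      case True
      then have "(1 + x $ l) ^ N \<le> (2 * x $ l) ^ N" by (intro power_mono) auto
      then show ?thesis using True by (simp add: k_def power_mult_distrib)
    next
      case False
      then have "(1 + x $ l) ^ N \<le> 2 ^ N" using p by (intro power_mono) auto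
      then show ?thesis using False by (simp add: k_def)
    qed
  qed
  also have "\<dots> = 2 ^ (CARD('d) * N) * mpow x k"
    by (simp add: prod.distrib mpow_def power_mult[symmetric] mult.commute)
  also have "mpow x k \<le> (\<Sum>k\<in>{k::nat^'d. \<forall>l. k $ l \<le> N}. mpow x k)"
    by (rule member_le_sum) (auto simp: k_def finite_box mpow_nonneg[OF x])
  finally show ?thesis by simp
qed

lemma rdecay_mderiv:
  fixes f :: "real^'d::finite \<Rightarrow> complex"
  assumes f: "f \<in> schwartz_orthant" shows "rdecay (mderiv p f)"
  unfolding rdecay_def
proof (intro conjI allI)
  show "continuous_on orthant (mderiv p f)" using mderiv_continuous schwartzD(2)[OF f] .
  fix N
  have "\<forall>k. \<exists>C. \<forall>x\<in>orthant. mpow x k * cmod (mderiv p f x) \<le> C"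
    using schwartzD(3)[OF f] by (auto simp: bdd_above_def)
  then obtain C where C: "\<And>k x. x \<in> orthant \<Longrightarrow> mpow x k * cmod (mderiv p f x) \<le> C k" by metis
  have "norm (mderiv p f x) * rho x ^ N \<le> 2 ^ (CARD('d) * N) * (\<Sum>k\<in>{k::nat^'d. \<forall>l. k $ l \<le> N}. C k)"
    if x: "x \<in> orthant" for x
  proof -
    have "norm (mderiv p f x) * rho x ^ N \<le>
        norm (mderiv p f x) * (2 ^ (CARD('d) * N) * (\<Sum>k\<in>{k::nat^'d. \<forall>l. k $ l \<le> N}. mpow x k))"
      by (intro mult_left_mono rho_power_le_mpow x) simp
    also have "\<dots> = 2 ^ (CARD('d) * N) * (\<Sum>k\<in>{k::nat^'d. \<forall>l. k $ l \<le> N}. mpow x k * cmod (mderiv p f x))"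
      by (simp add: sum_distrib_left mult_ac)
    also have "\<dots> \<le> 2 ^ (CARD('d) * N) * (\<Sum>k\<in>{k::nat^'d. \<forall>l. k $ l \<le> N}. C k)"
      by (intro mult_left_mono sum_mono C x) simp
    finally show ?thesis .
  qed
  then show "\<exists>C. \<forall>x\<in>orthant. norm (mderiv p f x) * rho x ^ N \<le> C" by blast
qed

lemma mderiv_0: "mderiv 0 f = f"
  using mderiv_axis[of undefined 0 f] by (simp add: axis_def zero_vec_def[symmetric] cong: if_cong)

lemma rdecay_schwartz: "f \<in> schwartz_orthant \<Longrightarrow> rdecay f"
  using rdecay_mderiv[of f 0] by (simp add: mderiv_0)

lemma tower_schwartz:
  assumes f: "f \<in> schwartz_orthant" shows "tower l (\<lambda>i. mderiv (axis l i) f)"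
  unfolding tower_def
proof (intro allI conjI rdecay_mderiv f)
  fix i
  show "has_dird l (mderiv (axis l i) f) (mderiv (axis l (Suc i)) f)"
    unfolding mderiv_axis using smooth_has_dird[OF schwartzD(2)[OF f], of l "replicate i l"] by simp
qed

lemma subspace_schwartz: "cfun.subspace (schwartz_orthant :: (real^'a::finite \<Rightarrow> complex) set)"
proof (rule cfun.subspaceI)
  have G: "continuous_on orthant (\<lambda>_. 0::complex)" "has_dird i (\<lambda>_::real^'a. 0::complex) (\<lambda>_. 0)" for i
    by (auto simp: has_dird_def)
  have "smooth_on_orthant (0 :: real^'a \<Rightarrow> complex)"
    by (rule smoothI(1)[of "\<lambda>_ _. 0"]) (use G in auto)
  moreover have "mderiv p 0 x = 0" if "x \<in> orthant" for p and x :: "real^'a"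
    unfolding mderiv_def by (rule smoothI(2)[of "\<lambda>_ _. 0"]) (use G that in auto)
  ultimately show "(0 :: real^'a \<Rightarrow> complex) \<in> schwartz_orthant"
    unfolding schwartz_orthant_def by (auto intro!: exI[of _ "\<lambda>_. 0"] bdd_aboveI2[of _ _ 0])
next
  fix f g :: "real^'a \<Rightarrow> complex" assume f: "f \<in> schwartz_orthant" and g: "g \<in> schwartz_orthant"
  note sf = schwartzD(2)[OF f] and sg = schwartzD(2)[OF g]
  show "f + g \<in> schwartz_orthant"
    unfolding schwartz_orthant_def mem_Collect_eq
  proof (intro conjI allI)
    show "smooth_on_orthant (f + g)" using smooth_add(1)[OF sf sg] .
    show "x \<notin> orthant \<longrightarrow> (f + g) x = 0" for x using schwartzD(1)[OF f] schwartzD(1)[OF g] by auto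
    fix p
    obtain a b where "continuous_on closed_orthant a" "\<forall>x\<in>orthant. a x = mderiv p f x"
      "continuous_on closed_orthant b" "\<forall>x\<in>orthant. b x = mderiv p g x"
      using schwartzD(4)[OF f, of p] schwartzD(4)[OF g, of p] by blast
    then show "\<exists>h. continuous_on closed_orthant h \<and> (\<forall>x\<in>orthant. h x = mderiv p (f + g) x)"
      using mderiv_add[OF sf sg] by (intro exI[of _ "\<lambda>x. a x + b x"]) (auto intro!: continuous_intros)
    fix k
    obtain A B where AB: "\<And>x. x \<in> orthant \<Longrightarrow> mpow x k * cmod (mderiv p f x) \<le> A"
      "\<And>x. x \<in> orthant \<Longrightarrow> mpow x k * cmod (mderiv p g x) \<le> B"
      using schwartzD(3)[OF f, of k p] schwartzD(3)[OF g, of k p] by (auto simp: bdd_above_def)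
    have "mpow x k * cmod (mderiv p (f + g) x) \<le> A + B" if x: "x \<in> orthant" for x
    proof -
      have "mpow x k * cmod (mderiv p (f + g) x) \<le> mpow x k * (cmod (mderiv p f x) + cmod (mderiv p g x))"
        unfolding mderiv_add[OF sf sg x] by (intro mult_left_mono norm_triangle_ineq mpow_nonneg x)
      then show ?thesis using AB[OF x] by (simp add: distrib_left)
    qed
    then show "bdd_above ((\<lambda>x. mpow x k * cmod (mderiv p (f + g) x)) ` orthant)" by (rule bdd_aboveI2)
  qed
next
  fix c and f :: "real^'a \<Rightarrow> complex" assume f: "f \<in> schwartz_orthant"
  note sf = schwartzD(2)[OF f]
  show "c *\<^sub>F f \<in> schwartz_orthant"
    unfolding schwartz_orthant_def mem_Collect_eq
  proof (intro conjI allI)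
    show "smooth_on_orthant (c *\<^sub>F f)" using smooth_scale(1)[OF sf] .
    show "x \<notin> orthant \<longrightarrow> (c *\<^sub>F f) x = 0" for x using schwartzD(1)[OF f] by auto
    fix p
    obtain a where "continuous_on closed_orthant a" "\<forall>x\<in>orthant. a x = mderiv p f x"
      using schwartzD(4)[OF f, of p] by blast
    then show "\<exists>h. continuous_on closed_orthant h \<and> (\<forall>x\<in>orthant. h x = mderiv p (c *\<^sub>F f) x)"
      using mderiv_scale[OF sf] by (intro exI[of _ "\<lambda>x. c * a x"]) (auto intro!: continuous_intros)
    fix k
    obtain A where A: "\<And>x. x \<in> orthant \<Longrightarrow> mpow x k * cmod (mderiv p f x) \<le> A"
      using schwartzD(3)[OF f, of k p] by (auto simp: bdd_above_def)
    have "mpow x k * cmod (mderiv p (c *\<^sub>F f) x) \<le> cmod c * A" if x: "x \<in> orthant" for x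
      using mult_left_mono[OF A[OF x], of "cmod c"] mderiv_scale[OF sf x] by (simp add: norm_mult mult_ac)
    then show "bdd_above ((\<lambda>x. mpow x k * cmod (mderiv p (c *\<^sub>F f) x)) ` orthant)" by (rule bdd_aboveI2)
  qed
qed

section \<open>Weighted norms of square-integrable type and the step spaces of test
  functions\<close>

subsection \<open>The defining seminorms\<close>

definition wnorm :: "nat^'d::finite \<Rightarrow> (real^'d \<Rightarrow> complex) \<Rightarrow> real" where
  "wnorm s g = sqrt (LINT t:orthant|lborel. mpow t s * (cmod (g t))\<^sup>2)"

lemma rdecay_mpow_square:
  assumes g: "rdecay g" shows "rdecay (\<lambda>t. mpow t s * (cmod (g t))\<^sup>2)"
proof -
  have "rdecay (\<lambda>x. mpow x s *\<^sub>R (cmod (g x))\<^sup>2)"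
  proof (rule rdecay_scaleR[OF rdecay_cmod_square[OF g], where B=1 and M="msize s"])
    show "continuous_on orthant (\<lambda>x. mpow x s)" unfolding mpow_def by (intro continuous_intros)
    fix x :: "real^'a" assume x: "x \<in> orthant"
    have "mpow x s \<le> (\<Prod>l\<in>UNIV. rho x ^ (s $ l))"
      unfolding mpow_def using component_le_rho[OF x] orthant_pos[OF x]
      by (intro prod_mono conjI power_mono) (auto simp: less_imp_le)
    also have "\<dots> = rho x ^ msize s" by (simp add: msize_def power_sum)
    finally show "\<bar>mpow x s\<bar> \<le> 1 * rho x ^ msize s" using mpow_nonneg[OF x] by simp
  qed simp
  then show ?thesis by simp
qed

lemma wnorm_power2:
  "(wnorm s g)\<^sup>2 = (LINT t:orthant|lborel. mpow t s * (cmod (g t))\<^sup>2)" (is "_ = ?I")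
  and wnorm_nonneg: "0 \<le> wnorm s g"
proof -
  have "0 \<le> ?I"
    unfolding set_lebesgue_integral_def
    by (rule Bochner_Integration.integral_nonneg) (auto simp: indicator_def mpow_nonneg)
  then show "(wnorm s g)\<^sup>2 = ?I" "0 \<le> wnorm s g" by (simp_all add: wnorm_def)
qed

lemma wnorm_cong: "(\<And>x. x \<in> orthant \<Longrightarrow> f x = g x) \<Longrightarrow> wnorm s f = wnorm s g"
  unfolding wnorm_def by (rule arg_cong[where f=sqrt], rule set_lebesgue_integral_cong) auto

lemma wnorm_scale: "wnorm s (\<lambda>x. c * g x) = cmod c * wnorm s g"
proof -
  have "(LINT t:orthant|lborel. mpow t s * (cmod (c * g t))\<^sup>2) = (LINT t:orthant|lborel. (cmod c)\<^sup>2 * (mpow t s * (cmod (g t))\<^sup>2))"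
    by (simp add: norm_mult power_mult_distrib mult_ac)
  also have "\<dots> = (cmod c)\<^sup>2 * (LINT t:orthant|lborel. mpow t s * (cmod (g t))\<^sup>2)" by simp
  finally show ?thesis by (simp add: wnorm_def real_sqrt_mult)
qed

text \<open>Minkowski's inequality from
  \<open>(x + y)^2 \<le> (1 + b/a) x^2 + (1 + a/b) y^2\<close>, integrated with \<open>a\<close> and
  \<open>b\<close> close to the two norms; \<open>e\<close> keeps them positive.\<close>

lemma wnorm_triangle:
  assumes f: "rdecay f" and g: "rdecay g"
  shows "wnorm s (\<lambda>x. f x + g x) \<le> wnorm s f + wnorm s g"
proof (rule field_le_epsilon)
  fix e :: real assume e: "0 < e"
  define a where "a = wnorm s f + e / 2"
  define b where "b = wnorm s g + e / 2"
  have ab: "0 < a" "0 < b" using e wnorm_nonneg[of s f] wnorm_nonneg[of s g] by (auto simp: a_def b_def)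
  have "(wnorm s (\<lambda>x. f x + g x))\<^sup>2 \<le> (LINT t:orthant|lborel. (1 + b / a) * (mpow t s * (cmod (f t))\<^sup>2) + (1 + a / b) * (mpow t s * (cmod (g t))\<^sup>2))"
    unfolding wnorm_power2
  proof (rule set_integral_mono)
    show "set_integrable lborel orthant (\<lambda>t. mpow t s * (cmod (f t + g t))\<^sup>2)"
      by (intro rdecay_integrable rdecay_mpow_square rdecay_add f g)
    show "set_integrable lborel orthant (\<lambda>t. (1 + b / a) * (mpow t s * (cmod (f t))\<^sup>2) + (1 + a / b) * (mpow t s * (cmod (g t))\<^sup>2))"
      by (intro set_integral_add set_integrable_mult_right rdecay_integrable rdecay_mpow_square f g)
    fix t :: "real^'a" assume t: "t \<in> orthant"
    have "(x + y)\<^sup>2 \<le> (1 + b / a) * x\<^sup>2 + (1 + a / b) * y\<^sup>2" for x y :: real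
    proof -
      have "0 \<le> (b * x - a * y)\<^sup>2 / (a * b)" using ab by simp
      also have "\<dots> = b / a * x\<^sup>2 + a / b * y\<^sup>2 - 2 * x * y"
        using ab by (simp add: power2_eq_square field_simps)
      finally show ?thesis by (simp add: power2_eq_square algebra_simps)
    qed
    from this[of "cmod (f t)" "cmod (g t)"]
    have "(cmod (f t + g t))\<^sup>2 \<le> (1 + b / a) * (cmod (f t))\<^sup>2 + (1 + a / b) * (cmod (g t))\<^sup>2"
      using power_mono[OF norm_triangle_ineq[of "f t" "g t"], of 2] by (meson norm_ge_zero order_trans)
    from mult_left_mono[OF this mpow_nonneg[OF t, of s]]
    show "mpow t s * (cmod (f t + g t))\<^sup>2 \<le> (1 + b / a) * (mpow t s * (cmod (f t))\<^sup>2) + (1 + a / b) * (mpow t s * (cmod (g t))\<^sup>2)"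
      by (simp add: distrib_left mult.left_commute)
  qed
  also have "\<dots> = (1 + b / a) * (wnorm s f)\<^sup>2 + (1 + a / b) * (wnorm s g)\<^sup>2"
    unfolding wnorm_power2 set_integral_mult_right[symmetric]
    by (rule set_integral_add(2)) (intro set_integrable_mult_right rdecay_integrable rdecay_mpow_square f g)+
  also have "\<dots> \<le> (1 + b / a) * a\<^sup>2 + (1 + a / b) * b\<^sup>2"
    using ab e wnorm_nonneg[of s f] wnorm_nonneg[of s g]
    by (intro add_mono mult_left_mono power_mono) (auto simp: a_def b_def)
  also have "\<dots> = (a + b)\<^sup>2" using ab by (simp add: power2_eq_square field_simps)
  finally have "wnorm s (\<lambda>x. f x + g x) \<le> a + b" using ab by (simp add: power2_le_iff_abs_le wnorm_nonneg)
  then show "wnorm s (\<lambda>x. f x + g x) \<le> wnorm s f + wnorm s g + e" by (simp add: a_def b_def)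
qed

text \<open>The half powers of the definition become integral after squaring, which replaces
  \<open>powr\<close> by the monomial with exponent \<open>p + k\<close>.\<close>

lemma GS_quotient_eq:
  "GS_quotient \<alpha> A f p k = wnorm (p + k) (mderiv p f) / (A ^ msize (p + k) * mselfpow (\<alpha> / 2) k * mselfpow (\<alpha> / 2) p)"
proof -
  have "(LINT t:orthant|lborel. (cmod (complex_of_real (\<Prod>l\<in>UNIV. t $ l powr (real (p $ l + k $ l) / 2)) * mderiv p f t))\<^sup>2) =
      (LINT t:orthant|lborel. mpow t (p + k) * (cmod (mderiv p f t))\<^sup>2)"
  proof (rule set_lebesgue_integral_cong)
    show "\<forall>t. t \<in> orthant \<longrightarrow> (cmod (complex_of_real (\<Prod>l\<in>UNIV. t $ l powr (real (p $ l + k $ l) / 2)) * mderiv p f t))\<^sup>2 =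
        mpow t (p + k) * (cmod (mderiv p f t))\<^sup>2"
    proof (intro allI impI)
      fix t :: "real^'a" assume t: "t \<in> orthant"
      have "(\<Prod>l\<in>UNIV. t $ l powr (real (p $ l + k $ l) / 2))\<^sup>2 = mpow t (p + k)"
        unfolding mpow_def prod_power_distrib
      proof (rule prod.cong[OF refl])
        fix l
        have "(t $ l powr (real (p $ l + k $ l) / 2))\<^sup>2 = t $ l powr (real (p $ l + k $ l))"
          by (simp add: power2_eq_square powr_add[symmetric])
        then show "(t $ l powr (real (p $ l + k $ l) / 2))\<^sup>2 = t $ l ^ (p + k) $ l"
          by (simp only: powr_realpow[OF orthant_pos[OF t]] vector_add_component)
      qed
      then show "(cmod (complex_of_real (\<Prod>l\<in>UNIV. t $ l powr (real (p $ l + k $ l) / 2)) * mderiv p f t))\<^sup>2 =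
        mpow t (p + k) * (cmod (mderiv p f t))\<^sup>2"
        by (simp add: norm_mult power_mult_distrib del: of_real_prod)
    qed
  qed simp
  then show ?thesis by (simp add: GS_quotient_def l2_norm_orthant_def wnorm_def)
qed

lemma mselfpow_pos: "0 < mselfpow \<beta> p"
  unfolding mselfpow_def by (rule prod_pos) auto

lemma seminorm_on_GS_quotient:
  assumes A: "0 < A" shows "seminorm_on schwartz_orthant (\<lambda>f. GS_quotient \<alpha> A f p k)"
proof -
  let ?c = "1 / (A ^ msize (p + k) * mselfpow (\<alpha> / 2) k * mselfpow (\<alpha> / 2) p)"
  have c: "0 \<le> ?c" using A mselfpow_pos[of "\<alpha>/2" k] mselfpow_pos[of "\<alpha>/2" p] by simp
  have "seminorm_on schwartz_orthant (\<lambda>f. wnorm (p + k) (mderiv p f))"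
    unfolding seminorm_on_def
  proof (intro conjI ballI allI)
    fix f g :: "real^'a \<Rightarrow> complex" assume f: "f \<in> schwartz_orthant" and g: "g \<in> schwartz_orthant"
    have "wnorm (p + k) (mderiv p (f + g)) = wnorm (p + k) (\<lambda>x. mderiv p f x + mderiv p g x)"
      by (rule wnorm_cong) (rule mderiv_add[OF schwartzD(2)[OF f] schwartzD(2)[OF g]])
    also have "\<dots> \<le> wnorm (p + k) (mderiv p f) + wnorm (p + k) (mderiv p g)"
      by (rule wnorm_triangle) (intro rdecay_mderiv f g)+
    finally show "wnorm (p + k) (mderiv p (f + g)) \<le> wnorm (p + k) (mderiv p f) + wnorm (p + k) (mderiv p g)" .
  next
    fix c and f :: "real^'a \<Rightarrow> complex" assume f: "f \<in> schwartz_orthant"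
    have "wnorm (p + k) (mderiv p (c *\<^sub>F f)) = wnorm (p + k) (\<lambda>x. c * mderiv p f x)"
      by (rule wnorm_cong) (rule mderiv_scale[OF schwartzD(2)[OF f]])
    then show "wnorm (p + k) (mderiv p (c *\<^sub>F f)) = cmod c * wnorm (p + k) (mderiv p f)"
      by (simp add: wnorm_scale)
  qed (rule wnorm_nonneg)
  from seminorm_on_cmult[OF this c] show ?thesis by (simp add: GS_quotient_eq)
qed

lemma seminorm_on_sup_deriv:
  "seminorm_on schwartz_orthant (\<lambda>f :: real^'d::finite \<Rightarrow> complex. SUP t\<in>orthant. cmod (complex_of_real (mpow t k) * mderiv p f t))"
proof (rule seminorm_on_SUP[OF _ _ _ subspace_schwartz])
  have "(\<chi> l. 1) \<in> (orthant :: (real^'d) set)" by (simp add: orthant_def)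
  then show "(orthant :: (real^'d) set) \<noteq> {}" by blast
  show "seminorm_on schwartz_orthant (\<lambda>f. cmod (complex_of_real (mpow t k) * mderiv p f t))" if t: "t \<in> orthant" for t :: "real^'d"
    unfolding seminorm_on_def
  proof (intro conjI ballI allI)
    fix f g :: "real^'d \<Rightarrow> complex" assume f: "f \<in> schwartz_orthant" and g: "g \<in> schwartz_orthant"
    show "cmod (complex_of_real (mpow t k) * mderiv p (f + g) t) \<le>
        cmod (complex_of_real (mpow t k) * mderiv p f t) + cmod (complex_of_real (mpow t k) * mderiv p g t)"
      unfolding mderiv_add[OF schwartzD(2)[OF f] schwartzD(2)[OF g] t] distrib_left by (rule norm_triangle_ineq)
  next
    fix c and f :: "real^'d \<Rightarrow> complex" assume f: "f \<in> schwartz_orthant"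
    show "cmod (complex_of_real (mpow t k) * mderiv p (c *\<^sub>F f) t) = cmod c * cmod (complex_of_real (mpow t k) * mderiv p f t)"
      unfolding mderiv_scale[OF schwartzD(2)[OF f] t] by (simp add: norm_mult)
  qed simp
  show "bdd_above ((\<lambda>t. cmod (complex_of_real (mpow t k) * mderiv p f t)) ` orthant)"
    if f: "f \<in> schwartz_orthant" for f :: "real^'d \<Rightarrow> complex"
  proof -
    obtain C where "\<And>x. x \<in> orthant \<Longrightarrow> mpow x k * cmod (mderiv p f x) \<le> C"
      using schwartzD(3)[OF f, of k p] by (auto simp: bdd_above_def)
    then show ?thesis by (intro bdd_aboveI2[of _ _ C]) (simp add: norm_mult mpow_nonneg)
  qed
qed

lemma subspace_GS_step_carrier:
  assumes A: "0 < A" shows "cfun.subspace (GS_step_carrier \<alpha> A :: (real^'a::finite \<Rightarrow> complex) set)"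
proof (rule cfun.subspaceI)
  note sn = seminorm_onD[OF seminorm_on_GS_quotient[OF A, of \<alpha>]]
  have "GS_quotient \<alpha> A (0 :: real^'a \<Rightarrow> complex) p k = 0" for p k :: "nat^'a"
    using seminorm_on_zero[OF seminorm_on_GS_quotient[OF A] subspace_schwartz] .
  then show "(0 :: real^'a \<Rightarrow> complex) \<in> GS_step_carrier \<alpha> A"
    unfolding GS_step_carrier_def using cfun.subspace_0[OF subspace_schwartz]
    by (auto intro!: bdd_aboveI2[of _ _ 0])
  {
    fix f g :: "real^'a \<Rightarrow> complex" assume f: "f \<in> GS_step_carrier \<alpha> A" and g: "g \<in> GS_step_carrier \<alpha> A"
    obtain B C where "\<And>p k. GS_quotient \<alpha> A f p k \<le> B" "\<And>p k. GS_quotient \<alpha> A g p k \<le> C"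
      using f g by (auto simp: GS_step_carrier_def bdd_above_def)
    moreover have fg: "f \<in> schwartz_orthant" "g \<in> schwartz_orthant" using f g by (auto simp: GS_step_carrier_def)
    ultimately have "GS_quotient \<alpha> A (f + g) p k \<le> B + C" for p k
      using sn(2)[OF fg, of p k] add_mono by (meson order_trans)
    then show "f + g \<in> GS_step_carrier \<alpha> A"
      unfolding GS_step_carrier_def using cfun.subspace_add[OF subspace_schwartz fg]
      by (auto intro!: bdd_aboveI2[of _ _ "B + C"])
  }
  {
    fix c and f :: "real^'a \<Rightarrow> complex" assume f: "f \<in> GS_step_carrier \<alpha> A"
    obtain B where "\<And>p k. GS_quotient \<alpha> A f p k \<le> B" using f by (auto simp: GS_step_carrier_def bdd_above_def)
    moreover have fs: "f \<in> schwartz_orthant" using f by (auto simp: GS_step_carrier_def)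
    ultimately have "GS_quotient \<alpha> A (c *\<^sub>F f) p k \<le> cmod c * B" for p k
      using sn(3)[OF fs, of c p k] by (simp add: mult_left_mono)
    then show "c *\<^sub>F f \<in> GS_step_carrier \<alpha> A"
      unfolding GS_step_carrier_def using cfun.subspace_scale[OF subspace_schwartz fs]
      by (auto intro!: bdd_aboveI2[of _ _ "cmod c * B"])
  }
qed

lemma seminorm_on_GS_seminorm:
  assumes A: "0 < A" shows "seminorm_on (GS_step_carrier \<alpha> A) (GS_seminorm \<alpha> A j :: (real^'d::finite \<Rightarrow> complex) \<Rightarrow> real)"
proof -
  have sub: "GS_step_carrier \<alpha> A \<subseteq> schwartz_orthant" by (auto simp: GS_step_carrier_def)
  let ?J = "{(p :: nat^'d, k :: nat^'d). msize p \<le> j \<and> msize k \<le> j}"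
  have J: "finite ?J" "?J \<noteq> {}"
  proof -
    have "?J = {p. msize p \<le> j} \<times> {k. msize k \<le> j}" by auto
    then show "finite ?J" by (simp add: finite_msize_le)
    have "(0, 0) \<in> ?J" by (simp add: msize_def)
    then show "?J \<noteq> {}" by blast
  qed
  have 1: "seminorm_on (GS_step_carrier \<alpha> A) (\<lambda>f :: real^'d \<Rightarrow> complex. SUP pk. case pk of (p, k) \<Rightarrow> GS_quotient \<alpha> A f p k)"
  proof (rule seminorm_on_SUP[OF _ _ _ subspace_GS_step_carrier[OF A]])
    fix pk :: "(nat^'d) \<times> (nat^'d)"
    show "seminorm_on (GS_step_carrier \<alpha> A) (\<lambda>f. case pk of (p, k) \<Rightarrow> GS_quotient \<alpha> A f p k)"
    proof (cases pk)
      case (Pair p k)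
      then show ?thesis using seminorm_on_subset[OF seminorm_on_GS_quotient[OF A, of \<alpha> p k] sub] by simp
    qed
  qed (auto simp: GS_step_carrier_def)
  have 2: "seminorm_on (GS_step_carrier \<alpha> A) (\<lambda>f :: real^'d \<Rightarrow> complex. SUP pk\<in>?J. case pk of (p, k) \<Rightarrow>
      SUP t\<in>orthant. cmod (complex_of_real (mpow t k) * mderiv p f t))"
  proof (rule seminorm_on_SUP[OF J(2) _ _ subspace_GS_step_carrier[OF A]])
    fix pk :: "(nat^'d) \<times> (nat^'d)"
    show "seminorm_on (GS_step_carrier \<alpha> A) (\<lambda>f. case pk of (p, k) \<Rightarrow> SUP t\<in>orthant. cmod (complex_of_real (mpow t k) * mderiv p f t))"
    proof (cases pk)
      case (Pair p k)
      then show ?thesis using seminorm_on_subset[OF seminorm_on_sup_deriv[of k p] sub] by simp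
    qed
  qed (rule bdd_above_finite, rule finite_imageI, rule J(1))
  show ?thesis
    using 1 2 unfolding GS_seminorm_def seminorm_on_def by (simp add: algebra_simps) (smt (verit) add_mono)
qed

section \<open>Products of Laguerre functions and their derivatives\<close>

section \<open>Laguerre functions of several variables\<close>

text \<open>\<open>c\<close> gives the order of differentiation in each variable. It is a plain
  function so that one more derivative is a function update.\<close>

definition lagf :: "nat^'d::finite \<Rightarrow> ('d \<Rightarrow> nat) \<Rightarrow> real^'d \<Rightarrow> complex" where
  "lagf n c x = complex_of_real (\<Prod>l\<in>UNIV. lfun (n $ l) (c l) (x $ l))"

lemma laguerre_fun_eq: "x \<in> orthant \<Longrightarrow> laguerre_fun n x = lagf n (\<lambda>_. 0) x"
  by (simp add: laguerre_fun_def lagf_def lfun_0)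

lemma continuous_on_lagf: "continuous_on A (lagf n c)"
  unfolding lagf_def[abs_def]
  by (intro continuous_intros continuous_on_compose2[OF continuous_on_lfun[of UNIV]]) auto

lemma has_vector_derivative_lagf:
  "((\<lambda>s. lagf n c (x + s *\<^sub>R axis i 1)) has_vector_derivative lagf n (c(i := Suc (c i))) (x + s *\<^sub>R axis i 1)) (at s within A)"
proof -
  let ?y = "x + s *\<^sub>R axis i 1"
  let ?R = "\<Prod>l\<in>UNIV - {i}. lfun (n $ l) (c l) (x $ l)"
  have split: "lagf n b (x + t *\<^sub>R axis i 1) = complex_of_real (lfun (n $ i) (b i) (x $ i + t) * ?R)"
    if "\<And>l. l \<noteq> i \<Longrightarrow> b l = c l" for b t
  proof -
    have "(\<Prod>l\<in>UNIV - {i}. lfun (n $ l) (b l) ((x + t *\<^sub>R axis i 1) $ l)) = ?R"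
      using that by (intro prod.cong) (auto simp: axis_def)
    then show ?thesis unfolding lagf_def by (subst prod.remove[of UNIV i]) (auto simp: axis_def)
  qed
  have "((\<lambda>t. lfun (n $ i) (c i) (x $ i + t)) has_real_derivative lfun (n $ i) (Suc (c i)) (x $ i + s)) (at s within A)"
  proof -
    have "((\<lambda>t. x $ i + t) has_real_derivative 1) (at s within A)" by (auto intro!: derivative_eq_intros)
    from DERIV_chain2[where f="lfun (n $ i) (c i)" and g="\<lambda>t. x $ i + t", OF has_field_derivative_lfun[of "n $ i" "c i" "x $ i + s" UNIV] this]
    show ?thesis by simp
  qed
  then have "((\<lambda>t. lfun (n $ i) (c i) (x $ i + t) * ?R) has_real_derivative lfun (n $ i) (Suc (c i)) (x $ i + s) * ?R) (at s within A)"
    by (intro DERIV_cmult_right)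
  then have "((\<lambda>t. complex_of_real (lfun (n $ i) (c i) (x $ i + t) * ?R)) has_vector_derivative
      complex_of_real (lfun (n $ i) (Suc (c i)) (x $ i + s) * ?R)) (at s within A)"
    by (intro has_vector_derivative_of_real) (simp add: has_real_derivative_iff_has_vector_derivative)
  then show ?thesis by (simp add: split[of c] split[of "c(i := Suc (c i))"])
qed

lemma has_dird_lagf: "has_dird i (lagf n c) (lagf n (c(i := Suc (c i))))"
  unfolding has_dird_def using has_vector_derivative_lagf[of n c _ i 0 UNIV] by simp

lemma cmod_lagf: "cmod (lagf n c x) = (\<Prod>l\<in>UNIV. \<bar>lfun (n $ l) (c l) (x $ l)\<bar>)"
  unfolding lagf_def norm_of_real by (simp add: abs_prod)

text \<open>The bound is needed on the closed orthant: uniform convergence there yields the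
  continuous extension to the boundary that the test space demands.\<close>

lemma lagf_bound:
  fixes c :: "'d::finite \<Rightarrow> nat" and k :: "nat^'d"
  obtains C N where "0 < C"
    "\<And>n x. x \<in> closed_orthant \<Longrightarrow> mpow x k * cmod (lagf n c x) \<le> C * (1 + real (msize n)) ^ N"
proof -
  have "\<forall>l. \<exists>C N. 0 < C \<and> (\<forall>n. \<forall>x\<ge>0. x ^ (k $ l) * \<bar>lfun n (c l) x\<bar> \<le> C * (real n + 1) ^ N)"
    using lfun_bound by blast
  then obtain C N where CN: "\<And>l. 0 < C l"
    "\<And>l n x. 0 \<le> x \<Longrightarrow> x ^ (k $ l) * \<bar>lfun n (c l) x\<bar> \<le> C l * (real n + 1) ^ N l" by metis
  have "mpow x k * cmod (lagf n c x) \<le> (\<Prod>l\<in>UNIV. C l) * (1 + real (msize n)) ^ (\<Sum>l\<in>UNIV. N l)"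
    if x: "x \<in> closed_orthant" for n x
  proof -
    have "mpow x k * cmod (lagf n c x) = (\<Prod>l\<in>UNIV. x $ l ^ k $ l * \<bar>lfun (n $ l) (c l) (x $ l)\<bar>)"
      by (simp add: mpow_def cmod_lagf prod.distrib)
    also have "\<dots> \<le> (\<Prod>l\<in>UNIV. C l * (1 + real (msize n)) ^ N l)"
    proof (intro prod_mono conjI)
      fix l
      have xl: "0 \<le> x $ l" using x by (simp add: closed_orthant_def)
      then show "0 \<le> x $ l ^ k $ l * \<bar>lfun (n $ l) (c l) (x $ l)\<bar>" by simp
      have "x $ l ^ k $ l * \<bar>lfun (n $ l) (c l) (x $ l)\<bar> \<le> C l * (real (n $ l) + 1) ^ N l" by (rule CN(2)[OF xl])
      also have "\<dots> \<le> C l * (1 + real (msize n)) ^ N l"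
        using CN(1)[of l] component_le_msize[of n l] by (intro mult_left_mono power_mono) auto
      finally show "x $ l ^ k $ l * \<bar>lfun (n $ l) (c l) (x $ l)\<bar> \<le> C l * (1 + real (msize n)) ^ N l" .
    qed
    also have "\<dots> = (\<Prod>l\<in>UNIV. C l) * (1 + real (msize n)) ^ (\<Sum>l\<in>UNIV. N l)"
      by (simp add: prod.distrib power_sum)
    finally show ?thesis .
  qed
  moreover have "0 < (\<Prod>l\<in>UNIV. C l)" using CN(1) by (intro prod_pos) auto
  ultimately show thesis using that by blast
qed

lemma orthant_subset_closed: "orthant \<subseteq> closed_orthant"
  by (auto simp: orthant_def closed_orthant_def less_imp_le)

lemma rdecay_of_mpow_bounds:
  fixes g :: "real^'d::finite \<Rightarrow> complex"
  assumes "continuous_on orthant g" and "\<And>k. \<exists>C. \<forall>x\<in>orthant. mpow x k * cmod (g x) \<le> C"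
  shows "rdecay g"
  unfolding rdecay_def
proof (intro conjI allI assms(1))
  fix N
  obtain C where C: "\<And>k x. x \<in> orthant \<Longrightarrow> mpow x k * cmod (g x) \<le> C k" using assms(2) by metis
  have "norm (g x) * rho x ^ N \<le> 2 ^ (CARD('d) * N) * (\<Sum>k\<in>{k::nat^'d. \<forall>l. k $ l \<le> N}. C k)"
    if x: "x \<in> orthant" for x
  proof -
    have "norm (g x) * rho x ^ N \<le>
        norm (g x) * (2 ^ (CARD('d) * N) * (\<Sum>k\<in>{k::nat^'d. \<forall>l. k $ l \<le> N}. mpow x k))"
      by (intro mult_left_mono rho_power_le_mpow x) simp
    also have "\<dots> = 2 ^ (CARD('d) * N) * (\<Sum>k\<in>{k::nat^'d. \<forall>l. k $ l \<le> N}. mpow x k * cmod (g x))"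
      by (simp add: sum_distrib_left mult_ac)
    also have "\<dots> \<le> 2 ^ (CARD('d) * N) * (\<Sum>k\<in>{k::nat^'d. \<forall>l. k $ l \<le> N}. C k)"
      by (intro mult_left_mono sum_mono C x) simp
    finally show ?thesis .
  qed
  then show "\<exists>C. \<forall>x\<in>orthant. norm (g x) * rho x ^ N \<le> C" by blast
qed

lemma rdecay_lagf: "rdecay (lagf n c)"
proof (rule rdecay_of_mpow_bounds[OF continuous_on_lagf])
  fix k
  obtain C N where CN: "\<And>n x. x \<in> closed_orthant \<Longrightarrow> mpow x k * cmod (lagf n c x) \<le> C * (1 + real (msize n)) ^ N"
    using lagf_bound[of k c] by metis
  show "\<exists>C. \<forall>x\<in>orthant. mpow x k * cmod (lagf n c x) \<le> C"
    using CN[of _ n] orthant_subset_closed by blast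
qed

lemma tower_lagf: "tower l (\<lambda>i. lagf n ((\<lambda>_. 0)(l := i)))"
  unfolding tower_def
proof (intro allI conjI rdecay_lagf)
  fix i
  show "has_dird l (lagf n ((\<lambda>_. 0)(l := i))) (lagf n ((\<lambda>_. 0)(l := Suc i)))"
    using has_dird_lagf[of l n "(\<lambda>_. 0)(l := i)"] by simp
qed

text \<open>In direction \<open>l\<close> the other factors are constants, so the one-variable
  equation with \<open>p = 0\<close> gives an eigenvalue that depends on \<open>n $ l\<close>
  alone.\<close>

lemma lagop_lagf:
  "lagop l (\<lambda>i. lagf n ((\<lambda>_. 0)(l := i))) 0 x = - (real (n $ l) + 1/2) *\<^sub>R lagf n ((\<lambda>_. 0)(l := 0)) x"
proof -
  let ?R = "\<Prod>j\<in>UNIV - {l}. lfun (n $ j) 0 (x $ j)"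
  have split: "lagf n ((\<lambda>_. 0)(l := i)) x = complex_of_real (lfun (n $ l) i (x $ l) * ?R)" for i
  proof -
    have "(\<Prod>j\<in>UNIV - {l}. lfun (n $ j) (((\<lambda>_. 0)(l := i)) j) (x $ j)) = ?R" by (intro prod.cong) auto
    then show ?thesis unfolding lagf_def by (subst prod.remove[of UNIV l]) auto
  qed
  have "poly (X * lagd (n $ l) (Suc (Suc 0)) + smult (real 0 + 1) (lagd (n $ l) (Suc 0)) - smult (1/4) (X * lagd (n $ l) 0)
    - smult (real 0 / 4) (lagd (n $ l) (0 - 1)) + smult (real (n $ l) + 1/2) (lagd (n $ l) 0)) (x $ l) = 0"
    by (simp only: lagd_ode poly_0)
  then have "x $ l * lfun (n $ l) 2 (x $ l) + lfun (n $ l) 1 (x $ l) - (1/4) * (x $ l * lfun (n $ l) 0 (x $ l))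
      = - (real (n $ l) + 1/2) * lfun (n $ l) 0 (x $ l)"
  proof -
    have gen: "t * (P2 * E) + P1 * E - (1/4) * (t * (P0 * E)) = - (\<nu> + 1/2) * (P0 * E)"
      if "t * P2 + P1 - (1/4) * (t * P0) + (\<nu> + 1/2) * P0 = 0" for t P2 P1 P0 \<nu> E :: real
    proof -
      have "(t * P2 + P1 - (1/4) * (t * P0) + (\<nu> + 1/2) * P0) * E = 0" using that by simp
      then show ?thesis by (simp add: algebra_simps)
    qed
    assume "poly (X * lagd (n $ l) (Suc (Suc 0)) + smult (real 0 + 1) (lagd (n $ l) (Suc 0)) - smult (1/4) (X * lagd (n $ l) 0)
      - smult (real 0 / 4) (lagd (n $ l) (0 - 1)) + smult (real (n $ l) + 1/2) (lagd (n $ l) 0)) (x $ l) = 0"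
    then have "x $ l * poly (lagd (n $ l) 2) (x $ l) + poly (lagd (n $ l) 1) (x $ l) - (1/4) * (x $ l * poly (lagd (n $ l) 0) (x $ l))
        + (real (n $ l) + 1/2) * poly (lagd (n $ l) 0) (x $ l) = 0"
      by (simp add: numeral_2_eq_2)
    from gen[OF this] show ?thesis by (simp only: lfun_def)
  qed
  then have "complex_of_real ((x $ l * lfun (n $ l) 2 (x $ l) + lfun (n $ l) 1 (x $ l) - (1/4) * (x $ l * lfun (n $ l) 0 (x $ l))) * ?R)
      = complex_of_real (- (real (n $ l) + 1/2) * lfun (n $ l) 0 (x $ l) * ?R)" by (simp only:)
  then show ?thesis
    unfolding lagop_def split by (simp add: scaleR_conv_of_real numeral_2_eq_2 algebra_simps del: of_real_prod)
qed

lemma has_bochner_integral_lagf_mult: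
  "has_bochner_integral lborel (\<lambda>x. indicator orthant x * (\<Prod>l\<in>UNIV. lfun (n $ l) 0 (x $ l) * lfun (m $ l) 0 (x $ l)))
     (if n = m then 1 else 0)" for n m :: "nat^'d::finite"
proof -
  have "has_bochner_integral lborel (\<lambda>x. indicator orthant x * (\<Prod>l\<in>UNIV. lfun (n $ l) 0 (x $ l) * lfun (m $ l) 0 (x $ l)))
      (\<Prod>l\<in>UNIV. if n $ l = m $ l then 1 else 0)"
    by (rule has_bochner_integral_orthant_product) (rule has_bochner_integral_lfun_mult)
  moreover have "(\<Prod>l\<in>UNIV. if n $ l = m $ l then 1 else 0) = (if n = m then 1 else (0::real))"
    by (auto simp: vec_eq_iff prod_zero_iff split: if_splits)
  ultimately show ?thesis by simp
qed

lemma lagf_orthonormal: "(LINT x:orthant|lborel. lagf n (\<lambda>_. 0) x * lagf m (\<lambda>_. 0) x) = (if n = m then 1 else 0)"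
proof -
  have "(LINT x:orthant|lborel. lagf n (\<lambda>_. 0) x * lagf m (\<lambda>_. 0) x) =
      (LINT x|lborel. complex_of_real (indicator orthant x * (\<Prod>l\<in>UNIV. lfun (n $ l) 0 (x $ l) * lfun (m $ l) 0 (x $ l))))"
    unfolding set_lebesgue_integral_def
    by (intro Bochner_Integration.integral_cong) (simp_all add: lagf_def prod.distrib scaleR_conv_of_real)
  also have "\<dots> = complex_of_real (if n = m then 1 else 0)"
    unfolding integral_complex_of_real using has_bochner_integral_integral_eq[OF has_bochner_integral_lagf_mult[of n m]] by simp
  finally show ?thesis by simp
qed

lemma qnorm_lagf: "qnorm l 0 (lagf n (\<lambda>_. 0)) = 1"
proof -
  have "qnorm l 0 (lagf n (\<lambda>_. 0)) = (LINT x|lborel. indicator orthant x * (\<Prod>l\<in>UNIV. lfun (n $ l) 0 (x $ l) * lfun (n $ l) 0 (x $ l)))"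
    unfolding qnorm_def set_lebesgue_integral_def
    by (intro Bochner_Integration.integral_cong)
      (simp_all add: cmod_lagf prod_power_distrib[symmetric] power2_eq_square prod.distrib[symmetric])
  then show ?thesis using has_bochner_integral_integral_eq[OF has_bochner_integral_lagf_mult[of n n]] by simp
qed

lemma wnorm_lagf:
  "(wnorm s (lagf n c))\<^sup>2 = (\<Prod>l\<in>UNIV. lenergy (n $ l) (c l) (s $ l))"
proof -
  have "has_bochner_integral lborel (\<lambda>x. indicator orthant x * (\<Prod>l\<in>UNIV. (x $ l) ^ (s $ l) * (lfun (n $ l) (c l) (x $ l))\<^sup>2))
      (\<Prod>l\<in>UNIV. lenergy (n $ l) (c l) (s $ l))"
    by (rule has_bochner_integral_orthant_product) (rule has_bochner_integral_lfun_energy)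
  moreover have "(\<Prod>l\<in>UNIV. (x $ l) ^ (s $ l) * (lfun (n $ l) (c l) (x $ l))\<^sup>2) = mpow x s * (cmod (lagf n c x))\<^sup>2" for x
    by (simp add: mpow_def cmod_lagf prod.distrib prod_power_distrib)
  ultimately show ?thesis
    unfolding wnorm_power2 set_lebesgue_integral_def by (simp add: has_bochner_integral_integral_eq)
qed

section \<open>Subexponential growth of the energies with arbitrarily small rate\<close>

subsection \<open>Growth of the weighted norms of the Laguerre functions\<close>

lemma power_self_le: "real s ^ s \<le> exp (real s) * fact s"
proof -
  have "(\<lambda>n. real s ^ n / fact n) sums exp (real s)" "\<And>n. 0 \<le> real s ^ n / fact n"
    using exp_converges[of "real s"] by (auto simp: divide_inverse mult.commute)
  then have "real s ^ s / fact s \<le> exp (real s)"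
    using sum_le_suminf[of "\<lambda>n. real s ^ n / fact n" "{s}"] by (auto simp: sums_iff)
  then show ?thesis by (simp add: pos_divide_le_eq)
qed

lemma power_le_fact_exp: "0 \<le> y \<Longrightarrow> y ^ s \<le> fact s * exp y" for y :: real
proof -
  assume y: "0 \<le> y"
  have "(\<lambda>n. y ^ n / fact n) sums exp y" "\<And>n. 0 \<le> y ^ n / fact n"
    using exp_converges[of y] y by (auto simp: divide_inverse mult.commute)
  then have "y ^ s / fact s \<le> exp y"
    using sum_le_suminf[of "\<lambda>n. y ^ n / fact n" "{s}"] by (auto simp: sums_iff)
  then show ?thesis by (simp add: pos_divide_le_eq mult.commute)
qed

lemma fact_add_le: "fact (p + k) \<le> (2::real) ^ (p + k) * (fact p * fact k)"
proof -
  have "real ((p + k) choose p) = fact (p + k) / (fact p * fact k)"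
    using binomial_fact[of p "p + k", where 'a=real] by simp
  then have "fact (p + k) = real ((p + k) choose p) * (fact p * fact k)" by simp
  also have "\<dots> \<le> 2 ^ (p + k) * (fact p * fact k)"
  proof (rule mult_right_mono)
    show "real ((p + k) choose p) \<le> 2 ^ (p + k)"
      using binomial_le_pow2[of "p + k" p] by (metis of_nat_le_iff of_nat_numeral of_nat_power)
  qed simp
  finally show ?thesis .
qed

lemma fact_le_power_self: "fact p \<le> real p ^ p"
  using fact_le_power[of p, where 'a=real] by simp

text \<open>\<open>lenergy_bound\<close> leaves \<open>(n + s)^s\<close>. For the part
  \<open>n^s\<close> the inequality \<open>y^s \<le> s! e^y\<close> at
  \<open>y = \<delta> n^(1/\<alpha>)\<close> is raised to the power \<alpha>: a small \<delta> costs
  only a factor geometric in \<open>s\<close>. The part \<open>s^s\<close> is at most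
  \<open>e^s s!\<close>, and \<open>s! \<le> 2^s p^p k^k\<close> distributes the factorial over
  \<open>p\<close> and \<open>k\<close>.\<close>

lemma lenergy_growth:
  assumes \<alpha>: "1 \<le> \<alpha>" and \<delta>: "0 < \<delta>"
  obtains H where "1 \<le> H" "\<And>n p k. lenergy n p (p + k) \<le>
    2 * H ^ (2 * (p + k)) * exp (\<alpha> * \<delta> * real n powr (1 / \<alpha>)) * (spow \<alpha> p * spow \<alpha> k)"
proof -
  define D where "D = max 1 (1 / \<delta>)"
  \<comment> \<open>10 is 5 from \<open>lenergy_bound\<close> times 2 from splitting
    \<open>(n + s)^s\<close>; \<open>exp 1\<close> and \<open>D powr \<alpha>\<close> come from the
    two parts, and \<open>2 powr \<alpha>\<close> from the binomial coefficient in
    \<open>fact_add_le\<close>.\<close>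
  define G where "G = 10 * exp 1 * D powr \<alpha> * 2 powr \<alpha>"
  have D: "1 \<le> D" by (simp add: D_def)
  have Da: "1 \<le> D powr \<alpha>" using D \<alpha> by (simp add: ge_one_powr_ge_zero)
  have "1 * 1 * 1 * 1 \<le> G"
    unfolding G_def using Da \<alpha> by (intro mult_mono) (auto simp: ge_one_powr_ge_zero)
  then have G: "1 \<le> G" by simp
  have main: "lenergy n p s \<le> 2 * G ^ s * exp (\<alpha> * \<delta> * real n powr (1 / \<alpha>)) * (spow \<alpha> p * spow \<alpha> k)" if s: "s = p + k" for n p k s
  proof -
    let ?E = "exp (\<alpha> * \<delta> * real n powr (1 / \<alpha>))"
    define F where "F = (fact s :: real) powr \<alpha>"
    have F1: "fact s \<le> F" using powr_mono[of 1 \<alpha> "fact s"] \<alpha> by (simp add: F_def)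
    have E1: "1 \<le> ?E" using \<alpha> \<delta> by simp
    have F0: "1 \<le> F" using \<alpha> by (simp add: F_def ge_one_powr_ge_zero)
    have n: "real n ^ s \<le> (D powr \<alpha>) ^ s * F * ?E"
    proof (cases "n = 0")
      case True
      have "1 * 1 * 1 \<le> (D powr \<alpha>) ^ s * F * ?E"
        using one_le_power[OF Da, of s] F0 E1 by (intro mult_mono) auto
      moreover have "real n ^ s \<le> 1" using True by (cases s) auto
      ultimately show ?thesis by simp
    next
      case False
      define y where "y = \<delta> * real n powr (1 / \<alpha>)"
      have y: "0 < y" using False \<delta> by (simp add: y_def)
      have "real n powr (1 / \<alpha>) = (1 / \<delta>) * y" using \<delta> by (simp add: y_def)
      also have "\<dots> \<le> D * y" using y by (intro mult_right_mono) (auto simp: D_def)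
      finally have "(real n powr (1 / \<alpha>)) powr \<alpha> \<le> (D * y) powr \<alpha>" using \<alpha> by (intro powr_mono2) auto
      then have "real n \<le> (D * y) powr \<alpha>" using False \<alpha> by (simp add: powr_powr)
      then have "real n ^ s \<le> ((D * y) powr \<alpha>) ^ s" by (intro power_mono) auto
      also have "\<dots> = (D powr \<alpha>) ^ s * (y ^ s) powr \<alpha>"
        using D y by (simp add: powr_mult power_mult_distrib powr_power powr_realpow[symmetric] powr_powr mult.commute)
      also have "\<dots> \<le> (D powr \<alpha>) ^ s * (fact s * exp y) powr \<alpha>"
        using power_le_fact_exp[of y s] y \<alpha> by (intro mult_left_mono powr_mono2) auto
      also have "\<dots> = (D powr \<alpha>) ^ s * F * ?E"
        by (simp add: powr_mult F_def exp_powr_real y_def mult_ac)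
      finally show ?thesis .
    qed
    have ss: "real s ^ s \<le> exp 1 ^ s * F * ?E"
    proof -
      have "real s ^ s \<le> exp 1 ^ s * fact s" using power_self_le[of s] by (simp add: exp_of_nat_mult[symmetric])
      also have "\<dots> \<le> exp 1 ^ s * F * ?E"
        using F1 E1 F0 mult_mono[OF F1 E1] by (simp add: mult.assoc)
      finally show ?thesis .
    qed
    have Ffin: "F \<le> (2 powr \<alpha>) ^ s * (spow \<alpha> p * spow \<alpha> k)"
    proof -
      have sp: "(real q ^ q) powr \<alpha> = spow \<alpha> q" for q
        by (cases "q = 0") (auto simp: spow_def powr_realpow[symmetric] powr_powr mult.commute)
      have "fact s \<le> (2::real) ^ s * (real p ^ p * real k ^ k)"
        unfolding s by (rule order_trans[OF fact_add_le]) (intro mult_left_mono mult_mono fact_le_power_self, auto)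
      then have "F \<le> (2 ^ s * (real p ^ p * real k ^ k)) powr \<alpha>" unfolding F_def using \<alpha> by (intro powr_mono2) auto
      also have "\<dots> = (2 ^ s) powr \<alpha> * (spow \<alpha> p * spow \<alpha> k)" by (simp add: powr_mult sp)
      also have "(2 ^ s) powr \<alpha> = (2 powr \<alpha>) ^ s"
        by (simp add: powr_power powr_realpow[symmetric] powr_powr mult.commute)
      finally show ?thesis .
    qed
    have "lenergy n p s \<le> 5 ^ s * (real n + real s) ^ s" using s by (intro lenergy_bound) simp
    also have "\<dots> \<le> 5 ^ s * (2 ^ s * (real n ^ s + real s ^ s))"
    proof (intro mult_left_mono)
      have "(real n + real s) ^ s \<le> (2 * max (real n) (real s)) ^ s" by (intro power_mono) auto
      also have "\<dots> = 2 ^ s * (max (real n) (real s)) ^ s" by (simp add: power_mult_distrib)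
      also have "(max (real n) (real s)) ^ s \<le> real n ^ s + real s ^ s" by (auto simp: max_def)
      finally show "(real n + real s) ^ s \<le> 2 ^ s * (real n ^ s + real s ^ s)" by simp
    qed simp
    also have "\<dots> \<le> 5 ^ s * (2 ^ s * (((D powr \<alpha>) ^ s + exp 1 ^ s) * F * ?E))"
      using n ss by (intro mult_left_mono) (auto simp: algebra_simps)
    also have "\<dots> \<le> 5 ^ s * (2 ^ s * (2 * (exp 1 * D powr \<alpha>) ^ s * F * ?E))"
    proof (intro mult_left_mono mult_right_mono)
      have a: "1 \<le> (exp 1 :: real) ^ s" by (rule one_le_power) simp
      have b: "1 \<le> (D powr \<alpha>) ^ s" using Da by (rule one_le_power)
      have "x + z \<le> 2 * (z * x)" if "1 \<le> x" "1 \<le> z" for x z :: real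
      proof -
        have "x \<le> z * x" "z \<le> z * x" using that by (auto simp: mult_le_cancel_right1 mult_le_cancel_left1)
        then show ?thesis by linarith
      qed
      from this[OF b a] show "(D powr \<alpha>) ^ s + exp 1 ^ s \<le> 2 * (exp 1 * D powr \<alpha>) ^ s" by (simp add: power_mult_distrib)
    qed (use F0 in auto)
    also have "\<dots> = 2 * ((10 * exp 1 * D powr \<alpha>) ^ s * F * ?E)"
    proof -
      have "(10::real) ^ s = 5 ^ s * 2 ^ s" by (simp flip: power_mult_distrib)
      then show ?thesis by (simp only: power_mult_distrib mult_ac)
    qed
    finally have 1: "lenergy n p s \<le> 2 * ((10 * exp 1 * D powr \<alpha>) ^ s * F * ?E)" .
    also have "2 * ((10 * exp 1 * D powr \<alpha>) ^ s * F * ?E) \<le>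
        2 * ((10 * exp 1 * D powr \<alpha>) ^ s * ((2 powr \<alpha>) ^ s * (spow \<alpha> p * spow \<alpha> k)) * ?E)"
      using Ffin D by (intro mult_left_mono mult_right_mono) auto
    also have "\<dots> = 2 * G ^ s * ?E * (spow \<alpha> p * spow \<alpha> k)"
      unfolding G_def by (simp only: power_mult_distrib mult_ac)
    finally show ?thesis .
  qed
  have H: "1 \<le> sqrt G" "sqrt G ^ (2 * s) = G ^ s" for s
    using G by (auto simp: power_mult)
  show thesis
  proof (rule that[of "sqrt G"])
    show "1 \<le> sqrt G" using H(1) .
    fix n p k
    show "lenergy n p (p + k) \<le> 2 * sqrt G ^ (2 * (p + k)) * exp (\<alpha> * \<delta> * real n powr (1 / \<alpha>)) * (spow \<alpha> p * spow \<alpha> k)"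
      unfolding H(2) by (rule main) simp
  qed
qed

section \<open>Synthesis of test functions from coefficient sequences\<close>

section \<open>Laguerre series\<close>

definition lagser :: "(nat^'d::finite \<Rightarrow> complex) \<Rightarrow> ('d \<Rightarrow> nat) \<Rightarrow> real^'d \<Rightarrow> complex" where
  "lagser u c x = (\<Sum>m. u (enum_index m) * lagf (enum_index m) c x)"

text \<open>Membership in a step with an explicit bound \<open>R\<close>: estimates that are linear
  in \<open>R\<close> and uniform in \<open>u\<close> become continuity of the synthesis
  map.\<close>

definition coeff_bound :: "real \<Rightarrow> real \<Rightarrow> real \<Rightarrow> (nat^'d::finite \<Rightarrow> complex) \<Rightarrow> bool" where
  "coeff_bound \<alpha> a R u \<longleftrightarrow> (\<forall>n. cmod (u n) * weight \<alpha> a n \<le> R)"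

lemma coeff_bound_nonneg: "coeff_bound \<alpha> a R u \<Longrightarrow> 1 < a \<Longrightarrow> 0 \<le> R"
  unfolding coeff_bound_def using weight_pos[of a \<alpha>] by (meson less_trans mult_nonneg_nonneg norm_ge_zero order.strict_implies_order order_trans zero_less_one)

lemma coeff_boundD: "coeff_bound \<alpha> a R u \<Longrightarrow> 1 < a \<Longrightarrow> cmod (u n) \<le> R * (1 / weight \<alpha> a n)"
  unfolding coeff_bound_def using weight_pos[of a \<alpha> n] by (simp add: pos_le_divide_eq)

lemma summable_enum:
  fixes g :: "nat^'d::finite \<Rightarrow> real"
  assumes "g summable_on UNIV"
  shows "summable (\<lambda>m. g (enum_index m))"
proof -
  have "(\<lambda>m. g (enum_index m)) summable_on UNIV"
    using summable_on_reindex_bij_betw[OF bij_enum_index, of g] assms by simp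
  then show ?thesis by (rule summable_on_imp_summable)
qed

lemma summable_weight_enum:
  assumes "1 \<le> \<alpha>" "1 < a"
  shows "summable (\<lambda>m. (1 + real (msize (enum_index m :: nat^'d::finite))) ^ N / weight \<alpha> a (enum_index m :: nat^'d))"
  using assms by (intro summable_enum summable_on_weight) auto

text \<open>The majorant depends on neither \<open>u\<close> nor \<open>R\<close>, which makes all
  later constants uniform. It is summable because the Laguerre functions grow polynomially in the
  index.\<close>

lemma lagser_majorant:
  fixes c :: "'d::finite \<Rightarrow> nat" and k :: "nat^'d"
  assumes "1 \<le> \<alpha>" "1 < a"
  obtains M where "summable M" "\<And>(u :: nat^'d \<Rightarrow> complex) R m x. coeff_bound \<alpha> a R u \<Longrightarrow> x \<in> closed_orthant \<Longrightarrow>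
    mpow x k * cmod (u (enum_index m) * lagf (enum_index m) c x) \<le> R * M m" "\<And>m. 0 \<le> M m"
proof -
  obtain C N where CN: "0 < C" "\<And>n x. x \<in> closed_orthant \<Longrightarrow> mpow x k * cmod (lagf n c x) \<le> C * (1 + real (msize n)) ^ N"
    using lagf_bound[of k c] by metis
  let ?M = "\<lambda>m. C * ((1 + real (msize (enum_index m :: nat^'d))) ^ N / weight \<alpha> a (enum_index m :: nat^'d))"
  have w: "0 < weight \<alpha> a n" for n :: "nat^'d" using assms by simp
  show thesis
  proof (rule that[of ?M])
    show "summable ?M" by (intro summable_mult summable_weight_enum assms)
    show "0 \<le> ?M m" for m using CN(1) w by (simp add: less_imp_le)
    fix u :: "nat^'d \<Rightarrow> complex" and R m and x :: "real^'d"
    assume u: "coeff_bound \<alpha> a R u" and x: "x \<in> closed_orthant"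
    let ?n = "enum_index m :: nat^'d"
    have R: "0 \<le> R" using coeff_bound_nonneg[OF u assms(2)] .
    have "mpow x k * cmod (u ?n * lagf ?n c x) = cmod (u ?n) * (mpow x k * cmod (lagf ?n c x))"
      by (simp add: norm_mult)
    also have "\<dots> \<le> (R * (1 / weight \<alpha> a ?n)) * (C * (1 + real (msize ?n)) ^ N)"
      by (rule mult_mono[OF coeff_boundD[OF u assms(2)] CN(2)[OF x]])
        (use R w[of ?n] x in \<open>auto simp: mpow_def closed_orthant_def less_imp_le intro!: mult_nonneg_nonneg prod_nonneg\<close>)
    finally show "mpow x k * cmod (u ?n * lagf ?n c x) \<le> R * ?M m" by (simp add: mult_ac)
  qed
qed

lemma mpow_0 [simp]: "mpow x 0 = 1"
  by (simp add: mpow_def)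

lemma lagser_uniform_limit:
  fixes u :: "nat^'d::finite \<Rightarrow> complex"
  assumes "1 \<le> \<alpha>" "1 < a" and u: "coeff_bound \<alpha> a R u"
  shows "uniform_limit closed_orthant (\<lambda>M x. \<Sum>m<M. u (enum_index m) * lagf (enum_index m) c x) (lagser u c) sequentially"
proof -
  obtain M where M: "summable M" "\<And>(u :: nat^'d \<Rightarrow> complex) R m x. coeff_bound \<alpha> a R u \<Longrightarrow> x \<in> closed_orthant \<Longrightarrow>
    mpow x 0 * cmod (u (enum_index m) * lagf (enum_index m) c x) \<le> R * M m"
    using lagser_majorant[OF assms(1,2), of 0 c] by metis
  show ?thesis
    unfolding lagser_def[abs_def]
    by (rule Weierstrass_m_test[where M="\<lambda>m. R * M m"]) (use M u in \<open>auto intro: summable_mult\<close>)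
qed

lemma lagser_sums:
  fixes u :: "nat^'d::finite \<Rightarrow> complex"
  assumes "1 \<le> \<alpha>" "1 < a" and u: "coeff_bound \<alpha> a R u" and x: "x \<in> closed_orthant"
  shows "(\<lambda>m. u (enum_index m) * lagf (enum_index m) c x) sums lagser u c x"
  unfolding sums_def by (rule tendsto_uniform_limitI[OF lagser_uniform_limit[OF assms(1-3)] x])

lemma continuous_on_lagser:
  fixes u :: "nat^'d::finite \<Rightarrow> complex"
  assumes "1 \<le> \<alpha>" "1 < a" and u: "coeff_bound \<alpha> a R u"
  shows "continuous_on closed_orthant (lagser u c)"
  by (rule uniform_limit_theorem[OF _ lagser_uniform_limit[OF assms]])
    (auto intro!: always_eventually continuous_intros continuous_on_lagf)

lemma lagser_bound:
  fixes c :: "'d::finite \<Rightarrow> nat" and k :: "nat^'d"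
  assumes "1 \<le> \<alpha>" "1 < a"
  obtains K where "0 \<le> K" "\<And>(u :: nat^'d \<Rightarrow> complex) R x. coeff_bound \<alpha> a R u \<Longrightarrow> x \<in> closed_orthant \<Longrightarrow> mpow x k * cmod (lagser u c x) \<le> K * R"
proof -
  obtain M where M: "summable M" "\<And>(u :: nat^'d \<Rightarrow> complex) R m x. coeff_bound \<alpha> a R u \<Longrightarrow> x \<in> closed_orthant \<Longrightarrow>
    mpow x k * cmod (u (enum_index m) * lagf (enum_index m) c x) \<le> R * M m" "\<And>m. 0 \<le> M m"
    using lagser_majorant[OF assms, of k c] by metis
  show thesis
  proof (rule that[of "suminf M"])
    show "0 \<le> suminf M" using M by (intro suminf_nonneg) auto
    fix u :: "nat^'d \<Rightarrow> complex" and R and x :: "real^'d"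
    assume u: "coeff_bound \<alpha> a R u" and x: "x \<in> closed_orthant"
    have mp: "0 \<le> mpow x k" using x by (auto simp: mpow_def closed_orthant_def intro!: prod_nonneg)
    let ?t = "\<lambda>m. complex_of_real (mpow x k) * (u (enum_index m) * lagf (enum_index m) c x)"
    have n: "norm (?t m) \<le> R * M m" for m using M(2)[OF u x, of m] mp by (simp add: norm_mult)
    have s: "summable (\<lambda>m. norm (?t m))"
      by (rule summable_comparison_test'[of "\<lambda>m. R * M m" 0]) (use n M(1) in \<open>auto intro: summable_mult\<close>)
    have "?t sums (complex_of_real (mpow x k) * lagser u c x)"
      by (intro sums_mult lagser_sums[OF assms u x])
    then have "norm (complex_of_real (mpow x k) * lagser u c x) \<le> (\<Sum>m. norm (?t m))"
      using summable_norm[OF s] by (simp add: sums_iff)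
    also have "\<dots> \<le> (\<Sum>m. R * M m)" using n s M(1) by (intro suminf_le) (auto intro: summable_mult)
    also have "\<dots> = suminf M * R" using suminf_mult[OF M(1), of R] by (simp add: mult.commute)
    finally show "mpow x k * cmod (lagser u c x) \<le> suminf M * R" using mp by (simp add: norm_mult)
  qed
qed

lemma lagser_rho_bound:
  fixes c :: "'d::finite \<Rightarrow> nat"
  assumes "1 \<le> \<alpha>" "1 < a"
  obtains K where "0 \<le> K" "\<And>(u :: nat^'d \<Rightarrow> complex) R x. coeff_bound \<alpha> a R u \<Longrightarrow> x \<in> orthant \<Longrightarrow> cmod (lagser u c x) * rho x ^ N \<le> K * R"
proof -
  have "\<exists>K. \<forall>(u :: nat^'d \<Rightarrow> complex) R x. coeff_bound \<alpha> a R u \<longrightarrow> x \<in> closed_orthant \<longrightarrow> mpow x k * cmod (lagser u c x) \<le> K * R"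
    and "True" for k using lagser_bound[OF assms, of k c] by metis+
  then obtain K where K: "\<And>k (u :: nat^'d \<Rightarrow> complex) R x. coeff_bound \<alpha> a R u \<Longrightarrow> x \<in> closed_orthant \<Longrightarrow> mpow x k * cmod (lagser u c x) \<le> K k * R"
    by metis
  let ?K = "2 ^ (CARD('d) * N) * (\<Sum>k\<in>{k::nat^'d. \<forall>l. k $ l \<le> N}. K k)"
  have main: "cmod (lagser u c x) * rho x ^ N \<le> ?K * R" if u: "coeff_bound \<alpha> a R u" and x: "x \<in> orthant" for u :: "nat^'d \<Rightarrow> complex" and R and x :: "real^'d"
  proof -
    have x': "x \<in> closed_orthant" using x orthant_subset_closed by blast
    have "cmod (lagser u c x) * rho x ^ N \<le>
        cmod (lagser u c x) * (2 ^ (CARD('d) * N) * (\<Sum>k\<in>{k::nat^'d. \<forall>l. k $ l \<le> N}. mpow x k))"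
      by (intro mult_left_mono rho_power_le_mpow x) simp
    also have "\<dots> = 2 ^ (CARD('d) * N) * (\<Sum>k\<in>{k::nat^'d. \<forall>l. k $ l \<le> N}. mpow x k * cmod (lagser u c x))"
      by (simp add: sum_distrib_left mult_ac)
    also have "\<dots> \<le> 2 ^ (CARD('d) * N) * (\<Sum>k\<in>{k::nat^'d. \<forall>l. k $ l \<le> N}. K k * R)"
      by (intro mult_left_mono sum_mono K[OF u x']) simp
    finally show ?thesis by (simp add: sum_distrib_right mult.assoc)
  qed
  show thesis
  proof (rule that[of "max 0 ?K"])
    fix u :: "nat^'d \<Rightarrow> complex" and R and x :: "real^'d" assume u: "coeff_bound \<alpha> a R u" and x: "x \<in> orthant"
    have "?K * R \<le> max 0 ?K * R" using coeff_bound_nonneg[OF u assms(2)] by (intro mult_right_mono) auto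
    then show "cmod (lagser u c x) * rho x ^ N \<le> max 0 ?K * R" using main[OF u x] by linarith
  qed simp
qed

lemma rdecay_lagser:
  fixes u :: "nat^'d::finite \<Rightarrow> complex"
  assumes "1 \<le> \<alpha>" "1 < a" and u: "coeff_bound \<alpha> a R u"
  shows "rdecay (lagser u c)"
  unfolding rdecay_def
proof (intro conjI allI)
  show "continuous_on orthant (lagser u c)"
    using continuous_on_subset[OF continuous_on_lagser[OF assms] orthant_subset_closed] .
  fix N
  show "\<exists>C. \<forall>x\<in>orthant. norm (lagser u c x) * rho x ^ N \<le> C"
    using lagser_rho_bound[OF assms(1,2), of c N] u by metis
qed

text \<open>Termwise differentiation along a line: the differentiated series has the same shape,
  with one entry of \<open>c\<close> raised, and converges uniformly on the closed orthant.\<close>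

lemma has_dird_lagser:
  fixes u :: "nat^'d::finite \<Rightarrow> complex"
  assumes "1 \<le> \<alpha>" "1 < a" and u: "coeff_bound \<alpha> a R u"
  shows "has_dird i (lagser u c) (lagser u (c(i := Suc (c i))))"
  unfolding has_dird_def
proof
  fix x :: "real^'d" assume x: "x \<in> orthant"
  let ?c = "c(i := Suc (c i))" and ?y = "\<lambda>s. x + s *\<^sub>R axis i 1"
  \<comment> \<open>An open half line around 0 on which \<open>x + s\<close> times the axis vector
    stays in the orthant, so that the uniform convergence applies.\<close>
  let ?S = "{- (x $ i)<..}"
  have y: "?y s \<in> closed_orthant" if "s \<in> ?S" for s
    using that x by (auto simp: orthant_def closed_orthant_def axis_def less_imp_le)
  let ?t = "\<lambda>c m s. u (enum_index m) * lagf (enum_index m) c (?y s)"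
  have "\<exists>g. \<forall>s\<in>?S. (\<lambda>m. ?t c m s) sums g s \<and> (g has_derivative (\<lambda>h. h *\<^sub>R lagser u ?c (?y s))) (at s within ?S)"
  proof (rule has_derivative_series)
    show "convex ?S" by simp
    show "((?t c m) has_derivative (\<lambda>h. h *\<^sub>R ?t ?c m s)) (at s within ?S)" for m s
      using has_vector_derivative_mult_right[OF has_vector_derivative_lagf[of "enum_index m" c x i s ?S], of "u (enum_index m)"]
      by (simp add: has_vector_derivative_def)
    show "\<forall>\<^sub>F M in sequentially. \<forall>s\<in>?S. \<forall>h. norm ((\<Sum>m<M. h *\<^sub>R ?t ?c m s) - h *\<^sub>R lagser u ?c (?y s)) \<le> \<epsilon> * norm h"
      if eps: "0 < \<epsilon>" for \<epsilon>
      using uniform_limitD[OF lagser_uniform_limit[OF assms, of ?c] eps]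
    proof eventually_elim
      case (elim M)
      show ?case
      proof (intro ballI allI)
        fix s h assume "s \<in> ?S"
        then have "dist (\<Sum>m<M. ?t ?c m s) (lagser u ?c (?y s)) < \<epsilon>" using elim y by blast
        then have "norm (h *\<^sub>R ((\<Sum>m<M. ?t ?c m s) - lagser u ?c (?y s))) \<le> \<bar>h\<bar> * \<epsilon>"
          unfolding norm_scaleR by (intro mult_left_mono) (auto simp: dist_norm)
        then show "norm ((\<Sum>m<M. h *\<^sub>R ?t ?c m s) - h *\<^sub>R lagser u ?c (?y s)) \<le> \<epsilon> * norm h"
          by (simp add: scaleR_diff_right scaleR_sum_right mult.commute)
      qed
    qed
    show "0 \<in> ?S" using orthant_pos[OF x] by simp
    show "(\<lambda>m. ?t c m 0) sums lagser u c (?y 0)"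
      using lagser_sums[OF assms, of "?y 0" c] x orthant_subset_closed by auto
  qed
  then obtain g where g: "\<And>s. s \<in> ?S \<Longrightarrow> (\<lambda>m. ?t c m s) sums g s"
    "\<And>s. s \<in> ?S \<Longrightarrow> (g has_derivative (\<lambda>h. h *\<^sub>R lagser u ?c (?y s))) (at s within ?S)" by blast
  have gs: "g s = lagser u c (?y s)" if "s \<in> ?S" for s
    using sums_unique2[OF g(1)[OF that] lagser_sums[OF assms y[OF that]]] .
  have 0: "0 \<in> ?S" using orthant_pos[OF x] by simp
  have "(g has_vector_derivative lagser u ?c x) (at 0)"
    using g(2)[OF 0] at_within_open[OF 0] by (simp add: has_vector_derivative_def)
  then show "((\<lambda>s. lagser u c (?y s)) has_vector_derivative lagser u ?c x) (at 0)"
    by (rule has_vector_derivative_transform_within_open[OF _ _ 0]) (auto simp: gs)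
qed

definition lagsynth :: "(nat^'d::finite \<Rightarrow> complex) \<Rightarrow> real^'d \<Rightarrow> complex" where
  "lagsynth u x = (if x \<in> orthant then lagser u (\<lambda>_. 0) x else 0)"

lemma lagsynth_smooth:
  fixes u :: "nat^'d::finite \<Rightarrow> complex"
  assumes "1 \<le> \<alpha>" "1 < a" and u: "coeff_bound \<alpha> a R u"
  shows "smooth_on_orthant (lagsynth u)" and "x \<in> orthant \<Longrightarrow> mderiv p (lagsynth u) x = lagser u (($) p) x"
proof -
  let ?G = "\<lambda>js. lagser u (count_list js)"
  have 1: "continuous_on orthant (?G js)" for js by (intro rdecay_continuous rdecay_lagser[OF assms])
  have 2: "has_dird i (?G js) (?G (i # js))" for i js
  proof -
    have "(count_list js)(i := Suc (count_list js i)) = count_list (i # js)" by (auto simp: fun_eq_iff)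
    then show ?thesis using has_dird_lagser[OF assms, of i "count_list js"] by simp
  qed
  have 3: "lagsynth u x = ?G [] x" if "x \<in> orthant" for x
  proof -
    have "count_list [] = (\<lambda>_::'d. 0)" by auto
    then show ?thesis using that by (simp add: lagsynth_def)
  qed
  show "smooth_on_orthant (lagsynth u)" by (rule smoothI(1)[of ?G, OF 1 2 3])
  obtain js where js: "\<And>i. count_list js i = p $ i" "mderiv p = iter_deriv js" using mderivE[of p] by blast
  have "count_list js = ($) p" using js(1) by auto
  then show "x \<in> orthant \<Longrightarrow> mderiv p (lagsynth u) x = lagser u (($) p) x"
    using smoothI(2)[of ?G, OF 1 2 3, of x js] js(2) by simp
qed

lemma lagsynth_schwartz:
  fixes u :: "nat^'d::finite \<Rightarrow> complex"
  assumes "1 \<le> \<alpha>" "1 < a" and u: "coeff_bound \<alpha> a R u"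
  shows "lagsynth u \<in> schwartz_orthant"
  unfolding schwartz_orthant_def mem_Collect_eq
proof (intro conjI allI)
  show "smooth_on_orthant (lagsynth u)" by (rule lagsynth_smooth(1)[OF assms])
  show "\<exists>g. continuous_on closed_orthant g \<and> (\<forall>x\<in>orthant. g x = mderiv p (lagsynth u) x)" for p
    using continuous_on_lagser[OF assms, of "($) p"] lagsynth_smooth(2)[OF assms] by auto
  show "bdd_above ((\<lambda>x. mpow x k * cmod (mderiv p (lagsynth u) x)) ` orthant)" for k p
  proof -
    obtain K where K: "\<And>(u :: nat^'d \<Rightarrow> complex) R x. coeff_bound \<alpha> a R u \<Longrightarrow> x \<in> closed_orthant \<Longrightarrow> mpow x k * cmod (lagser u (($) p) x) \<le> K * R"
      using lagser_bound[OF assms(1,2), of k "($) p"] by metis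
    show ?thesis
      by (rule bdd_aboveI2[of _ _ "K * R"])
        (use K[OF u] orthant_subset_closed lagsynth_smooth(2)[OF assms] in auto)
  qed
qed (simp add: lagsynth_def)

section \<open>Passage to the limit in weighted norms and in the coefficients\<close>

subsection \<open>Weighted norms of Laguerre series\<close>

text \<open>Partial sums are written as full series with truncated coefficients: these satisfy the
  same \<open>coeff_bound\<close>, so the bounds for series supply the dominating functions
  below.\<close>

definition truncate :: "nat \<Rightarrow> (nat^'d::finite \<Rightarrow> complex) \<Rightarrow> nat^'d \<Rightarrow> complex" where
  "truncate M u n = (if n \<in> enum_index ` {..<M} then u n else 0)"

lemma enum_index_inj: "enum_index i = (enum_index j :: nat^'d::finite) \<longleftrightarrow> i = j"
  using bij_is_inj[OF bij_enum_index] by (auto simp: inj_def)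

lemma truncate_enum: "truncate M u (enum_index m) = (if m < M then u (enum_index m) else 0)"
  unfolding truncate_def image_iff by (auto simp: enum_index_inj)

lemma coeff_bound_truncate: "coeff_bound \<alpha> a R u \<Longrightarrow> 1 < a \<Longrightarrow> coeff_bound \<alpha> a R (truncate M u)"
  using coeff_bound_nonneg[of \<alpha> a R u] by (auto simp: coeff_bound_def truncate_def)

lemma lagser_truncate: "lagser (truncate M u) c x = (\<Sum>m<M. u (enum_index m) * lagf (enum_index m) c x)"
proof -
  have "(\<lambda>m. truncate M u (enum_index m) * lagf (enum_index m) c x) sums
      (\<Sum>m<M. truncate M u (enum_index m) * lagf (enum_index m) c x)"
    by (rule sums_finite) (auto simp: truncate_enum)
  then show ?thesis unfolding lagser_def by (simp add: sums_iff truncate_enum)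
qed

lemma wnorm_lagser_truncate: "wnorm s (lagser (truncate M u) c) \<le> (\<Sum>m<M. cmod (u (enum_index m)) * wnorm s (lagf (enum_index m) c))"
proof -
  have "rdecay (\<lambda>x. \<Sum>m<M. u (enum_index m) * lagf (enum_index m) c x) \<and>
      wnorm s (\<lambda>x. \<Sum>m<M. u (enum_index m) * lagf (enum_index m) c x) \<le> (\<Sum>m<M. cmod (u (enum_index m)) * wnorm s (lagf (enum_index m) c))"
  proof (induction M)
    case 0
    have "wnorm s (\<lambda>x. 0) = 0" using wnorm_scale[of s 0 "\<lambda>x. 0"] by simp
    then show ?case by (auto simp: rdecay_def intro!: exI[of _ 0])
  next
    case (Suc M)
    let ?f = "\<lambda>x. \<Sum>m<M. u (enum_index m) * lagf (enum_index m) c x"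
    have r: "rdecay (\<lambda>x. u (enum_index M) * lagf (enum_index M) c x)"
      by (rule rdecay_product_bound[OF _ rdecay_lagf[of "enum_index M" c], of _ "\<lambda>_. u (enum_index M)" "cmod (u (enum_index M))" 0])
        (auto intro!: continuous_intros continuous_on_lagf simp: norm_mult)
    have "wnorm s (\<lambda>x. ?f x + u (enum_index M) * lagf (enum_index M) c x) \<le>
        wnorm s ?f + wnorm s (\<lambda>x. u (enum_index M) * lagf (enum_index M) c x)"
      by (rule wnorm_triangle) (use Suc r in auto)
    then show ?case using Suc rdecay_add[OF _ r] by (simp add: wnorm_scale)
  qed
  then show ?thesis by (simp add: lagser_truncate[abs_def])
qed

text \<open>The triangle inequality bounds the partial sums; dominated convergence of the squared
  norms carries the bound over to the series.\<close>

lemma wnorm_lagser_le: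
  fixes u :: "nat^'d::finite \<Rightarrow> complex"
  assumes "1 \<le> \<alpha>" "1 < a" and u: "coeff_bound \<alpha> a R u"
    and B: "\<And>M. (\<Sum>m<M. cmod (u (enum_index m)) * wnorm s (lagf (enum_index m) c)) \<le> B"
  shows "wnorm s (lagser u c) \<le> B"
proof -
  have cont: "continuous_on orthant (\<lambda>x :: real^'d. mpow x s)" unfolding mpow_def by (intro continuous_intros)
  \<comment> \<open>In the exponent \<open>msize s + 1\<close> the part \<open>msize s\<close>
    compensates the weight \<open>mpow x s\<close>, and the extra 1 leaves the integrable
    \<open>1 / rho^2\<close> after squaring.\<close>
  obtain K where K: "0 \<le> K" "\<And>(u :: nat^'d \<Rightarrow> complex) R x. coeff_bound \<alpha> a R u \<Longrightarrow> x \<in> orthant \<Longrightarrow> cmod (lagser u c x) * rho x ^ (msize s + 1) \<le> K * R"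
    using lagser_rho_bound[OF assms(1,2), of c "msize s + 1"] by metis
  let ?h = "\<lambda>M x. mpow x s * (cmod (lagser (truncate M u) c x))\<^sup>2"
  have "(\<lambda>M. LINT x|lborel. indicator orthant x *\<^sub>R ?h M x) \<longlonglongrightarrow> (LINT x|lborel. indicator orthant x *\<^sub>R (mpow x s * (cmod (lagser u c x))\<^sup>2))"
  proof (rule integral_dominated_convergence[where w="\<lambda>x. (K * R)\<^sup>2 * (indicator orthant x * (1 / (rho x)\<^sup>2))"])
    show "(\<lambda>x. indicator orthant x *\<^sub>R (mpow x s * (cmod (lagser u c x))\<^sup>2)) \<in> borel_measurable lborel"
      by (intro borel_measurable_orthant rdecay_continuous rdecay_mpow_square rdecay_lagser[OF assms(1-3)])
    show "(\<lambda>x. indicator orthant x *\<^sub>R ?h M x) \<in> borel_measurable lborel" for M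
      by (intro borel_measurable_orthant rdecay_continuous rdecay_mpow_square
          rdecay_lagser[OF assms(1,2) coeff_bound_truncate[OF u assms(2)]])
    show "integrable lborel (\<lambda>x::real^'d. (K * R)\<^sup>2 * (indicator orthant x * (1 / (rho x)\<^sup>2)))"
      by (intro integrable_mult_right integrable_rho)
    show "AE x in lborel. (\<lambda>M. indicator orthant x *\<^sub>R ?h M x) \<longlonglongrightarrow> indicator orthant x *\<^sub>R (mpow x s * (cmod (lagser u c x))\<^sup>2)"
    proof (rule AE_I2)
      fix x :: "real^'d"
      show "(\<lambda>M. indicator orthant x *\<^sub>R ?h M x) \<longlonglongrightarrow> indicator orthant x *\<^sub>R (mpow x s * (cmod (lagser u c x))\<^sup>2)"
      proof (cases "x \<in> orthant")
        case True
        then have "(\<lambda>M. lagser (truncate M u) c x) \<longlonglongrightarrow> lagser u c x"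
          using lagser_sums[OF assms(1-3), of x c] orthant_subset_closed by (auto simp: sums_def lagser_truncate)
        then show ?thesis by (intro tendsto_intros)
      qed simp
    qed
    show "AE x in lborel. norm (indicator orthant x *\<^sub>R ?h M x) \<le> (K * R)\<^sup>2 * (indicator orthant x * (1 / (rho x)\<^sup>2))" for M
    proof (rule AE_I2)
      fix x :: "real^'d"
      show "norm (indicator orthant x *\<^sub>R ?h M x) \<le> (K * R)\<^sup>2 * (indicator orthant x * (1 / (rho x)\<^sup>2))"
      proof (cases "x \<in> orthant")
        case True
        let ?g = "cmod (lagser (truncate M u) c x)"
        have r: "1 \<le> rho x" using rho_ge_1[OF True] .
        have "mpow x s \<le> (\<Prod>l\<in>UNIV. rho x ^ (s $ l))"
          unfolding mpow_def using component_le_rho[OF True] orthant_pos[OF True]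
          by (intro prod_mono conjI power_mono) (auto simp: less_imp_le)
        also have "\<dots> = rho x ^ msize s" by (simp add: msize_def power_sum)
        also have "\<dots> \<le> (rho x ^ msize s)\<^sup>2" using one_le_power[OF r, of "msize s"] by (simp add: power2_eq_square)
        finally have mp: "mpow x s \<le> (rho x ^ msize s)\<^sup>2" .
        have "?h M x * (rho x)\<^sup>2 \<le> (rho x ^ msize s)\<^sup>2 * ?g\<^sup>2 * (rho x)\<^sup>2"
          using mp by (intro mult_right_mono) auto
        also have "\<dots> = (?g * rho x ^ (msize s + 1))\<^sup>2" by (simp add: power_mult_distrib power2_eq_square mult_ac)
        also have "\<dots> \<le> (K * R)\<^sup>2"
          using K(2)[OF coeff_bound_truncate[OF u assms(2)] True, of M] r by (intro power_mono) auto
        finally have "?h M x \<le> (K * R)\<^sup>2 / (rho x)\<^sup>2" using r by (simp add: pos_le_divide_eq)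
        then show ?thesis using True mpow_nonneg[OF True, of s] by (simp add: abs_mult)
      qed simp
    qed
  qed
  then have "(\<lambda>M. (wnorm s (lagser (truncate M u) c))\<^sup>2) \<longlonglongrightarrow> (wnorm s (lagser u c))\<^sup>2"
    unfolding wnorm_power2 set_lebesgue_integral_def .
  then have "(wnorm s (lagser u c))\<^sup>2 \<le> B\<^sup>2"
  proof (rule tendsto_upperbound)
    have "wnorm s (lagser (truncate M u) c) \<le> B" for M using wnorm_lagser_truncate[of s M u c] B[of M] by linarith
    then show "\<forall>\<^sub>F M in sequentially. (wnorm s (lagser (truncate M u) c))\<^sup>2 \<le> B\<^sup>2"
      by (intro always_eventually allI power_mono wnorm_nonneg)
  qed simp
  moreover have "0 \<le> B" using B[of 0] by simp
  ultimately show ?thesis using wnorm_nonneg[of s "lagser u c"] by (simp add: power2_le_iff_abs_le)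
qed

lemma mselfpow_half_square: "(mselfpow (\<alpha> / 2) p)\<^sup>2 = (\<Prod>l\<in>UNIV. spow \<alpha> (p $ l))"
  unfolding mselfpow_def prod_power_distrib
proof (rule prod.cong[OF refl])
  fix l
  show "(if p $ l = 0 then 1 else real (p $ l) powr (\<alpha> / 2 * real (p $ l)))\<^sup>2 = spow \<alpha> (p $ l)"
    by (auto simp: spow_def power2_eq_square powr_add[symmetric])
qed

lemma wnorm_lagf_growth:
  assumes \<alpha>: "1 \<le> \<alpha>" and b: "1 < b"
  obtains H where "1 \<le> H" "\<And>n p k. wnorm (p + k) (lagf n (($) p)) \<le>
    2 ^ CARD('d::finite) * H ^ msize (p + k) * weight \<alpha> b (n :: nat^'d) * (mselfpow (\<alpha> / 2) p * mselfpow (\<alpha> / 2) k)"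
proof -
  \<comment> \<open>With this value the \<open>d\<close> factors
    \<open>exp (\<alpha> \<delta> |n|^(1/\<alpha>))\<close> multiply up to exactly
    \<open>weight \<alpha> b n\<close>.\<close>
  define \<delta> where "\<delta> = ln b / (\<alpha> * real CARD('d))"
  have \<delta>: "0 < \<delta>" using \<alpha> b by (simp add: \<delta>_def)
  obtain H where H: "1 \<le> H" "\<And>n p k. lenergy n p (p + k) \<le>
    2 * H ^ (2 * (p + k)) * exp (\<alpha> * \<delta> * real n powr (1 / \<alpha>)) * (spow \<alpha> p * spow \<alpha> k)"
    using lenergy_growth[OF \<alpha> \<delta>] by metis
  have "wnorm (p + k) (lagf n (($) p)) \<le>
    2 ^ CARD('d) * H ^ msize (p + k) * weight \<alpha> b n * (mselfpow (\<alpha> / 2) p * mselfpow (\<alpha> / 2) k)" for n p k :: "nat^'d"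
  proof -
    have "(wnorm (p + k) (lagf n (($) p)))\<^sup>2 = (\<Prod>l\<in>UNIV. lenergy (n $ l) (p $ l) (p $ l + k $ l))"
      by (simp add: wnorm_lagf)
    also have "\<dots> \<le> (\<Prod>l\<in>UNIV. 2 * H ^ (2 * (p $ l + k $ l)) * exp (\<alpha> * \<delta> * real (msize n) powr (1 / \<alpha>)) * (spow \<alpha> (p $ l) * spow \<alpha> (k $ l)))"
    proof (intro prod_mono conjI lenergy_nonneg)
      fix l
      have "exp (\<alpha> * \<delta> * real (n $ l) powr (1 / \<alpha>)) \<le> exp (\<alpha> * \<delta> * real (msize n) powr (1 / \<alpha>))"
        using \<alpha> \<delta> component_le_msize[of n l] by (simp add: powr_mono2)
      then show "lenergy (n $ l) (p $ l) (p $ l + k $ l) \<le>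
          2 * H ^ (2 * (p $ l + k $ l)) * exp (\<alpha> * \<delta> * real (msize n) powr (1 / \<alpha>)) * (spow \<alpha> (p $ l) * spow \<alpha> (k $ l))"
        using H(1) by (intro order_trans[OF H(2)] mult_right_mono mult_left_mono) (auto simp: spow_nonneg)
    qed
    also have "\<dots> = 2 ^ CARD('d) * (\<Prod>l\<in>UNIV. H ^ (2 * (p $ l + k $ l))) * exp (\<alpha> * \<delta> * real (msize n) powr (1 / \<alpha>)) ^ CARD('d)
        * ((mselfpow (\<alpha> / 2) p)\<^sup>2 * (mselfpow (\<alpha> / 2) k)\<^sup>2)"
      by (simp add: prod.distrib mselfpow_half_square)
    also have "(\<Prod>l\<in>(UNIV::'d set). H ^ (2 * (p $ l + k $ l))) = (H ^ msize (p + k))\<^sup>2"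
    proof -
      have "(\<Prod>l\<in>(UNIV::'d set). H ^ (2 * (p $ l + k $ l))) = H ^ (\<Sum>l\<in>UNIV. 2 * (p $ l + k $ l))" by (rule power_sum[symmetric])
      also have "(\<Sum>l\<in>UNIV. 2 * (p $ l + k $ l)) = 2 * msize (p + k)" by (simp add: msize_def sum_distrib_left)
      finally show ?thesis by (simp add: power_mult[symmetric] mult.commute)
    qed
    also have "exp (\<alpha> * \<delta> * real (msize n) powr (1 / \<alpha>)) ^ CARD('d) = weight \<alpha> b n"
    proof -
      have "exp (\<alpha> * \<delta> * real (msize n) powr (1 / \<alpha>)) ^ CARD('d) = exp (real CARD('d) * (\<alpha> * \<delta> * real (msize n) powr (1 / \<alpha>)))"
        by (rule exp_of_nat_mult[symmetric])
      also have "real CARD('d) * (\<alpha> * \<delta> * real (msize n) powr (1 / \<alpha>)) = (real CARD('d) * \<alpha> * \<delta>) * real (msize n) powr (1 / \<alpha>)" by simp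
      also have "real CARD('d) * \<alpha> * \<delta> = ln b" using \<alpha> by (simp add: \<delta>_def)
      finally show ?thesis using b by (simp add: weight_def powr_def mult.commute)
    qed
    also have "2 ^ CARD('d) * (H ^ msize (p + k))\<^sup>2 * weight \<alpha> b n * ((mselfpow (\<alpha> / 2) p)\<^sup>2 * (mselfpow (\<alpha> / 2) k)\<^sup>2)
        \<le> (2 ^ CARD('d))\<^sup>2 * (H ^ msize (p + k))\<^sup>2 * (weight \<alpha> b n)\<^sup>2 * ((mselfpow (\<alpha> / 2) p)\<^sup>2 * (mselfpow (\<alpha> / 2) k)\<^sup>2)"
    proof (intro mult_right_mono mult_mono)
      have sq: "x \<le> x\<^sup>2" if "1 \<le> x" for x :: real using that by (simp add: power2_eq_square)
      show "(2::real) ^ CARD('d) \<le> (2 ^ CARD('d))\<^sup>2" by (rule sq) simp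
      show "weight \<alpha> b n \<le> (weight \<alpha> b n)\<^sup>2" using b by (intro sq weight_ge_1) simp
    qed (use b in \<open>auto simp: less_imp_le\<close>)
    also have "\<dots> = (2 ^ CARD('d) * H ^ msize (p + k) * weight \<alpha> b n * (mselfpow (\<alpha> / 2) p * mselfpow (\<alpha> / 2) k))\<^sup>2"
      by (simp only: power_mult_distrib)
    finally show ?thesis
      using H(1) b mselfpow_pos[of "\<alpha>/2" p] mselfpow_pos[of "\<alpha>/2" k]
      by (simp add: power2_le_iff_abs_le wnorm_nonneg less_imp_le)
  qed
  with H(1) show thesis by (rule that)
qed

lemma lagsynth_GS_quotient:
  assumes \<alpha>: "1 \<le> \<alpha>" and a: "1 < a"
  obtains H K where "1 \<le> H" "0 \<le> K"
    "\<And>(u :: nat^'d::finite \<Rightarrow> complex) R p k. coeff_bound \<alpha> a R u \<Longrightarrow> GS_quotient \<alpha> H (lagsynth u) p k \<le> K * R"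
proof -
  \<comment> \<open>Half of the decay of the coefficients compensates the growth of the weighted
    norms, the other half makes the remaining series summable.\<close>
  define b where "b = sqrt a"
  have b: "1 < b" "b * b = a" using a by (auto simp: b_def)
  obtain H where H: "1 \<le> H" "\<And>n p k. wnorm (p + k) (lagf n (($) p)) \<le>
    2 ^ CARD('d) * H ^ msize (p + k) * weight \<alpha> b (n :: nat^'d) * (mselfpow (\<alpha> / 2) p * mselfpow (\<alpha> / 2) k)"
    using wnorm_lagf_growth[OF \<alpha> b(1)] by metis
  let ?w = "\<lambda>m. (1 + real (msize (enum_index m :: nat^'d))) ^ 0 / weight \<alpha> b (enum_index m :: nat^'d)"
  define W where "W = suminf ?w"
  have sw: "summable ?w" by (rule summable_weight_enum[OF \<alpha> b(1)])
  have w0: "0 \<le> ?w m" for m using b by (simp add: less_imp_le)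
  have W: "0 \<le> W" unfolding W_def by (rule suminf_nonneg[OF sw w0])
  have main: "GS_quotient \<alpha> H (lagsynth u) p k \<le> (2 ^ CARD('d) * W) * R" if u: "coeff_bound \<alpha> a R u" for u :: "nat^'d \<Rightarrow> complex" and R p k
  proof -
    let ?D = "H ^ msize (p + k) * mselfpow (\<alpha> / 2) k * mselfpow (\<alpha> / 2) p"
    have D: "0 < ?D" using H(1) mselfpow_pos[of "\<alpha>/2" p] mselfpow_pos[of "\<alpha>/2" k] by simp
    have R: "0 \<le> R" by (rule coeff_bound_nonneg[OF u a])
    have "wnorm (p + k) (lagser u (($) p)) \<le> (2 ^ CARD('d) * ?D * R) * W"
    proof (rule wnorm_lagser_le[OF \<alpha> a u])
      fix M
      have "(\<Sum>m<M. cmod (u (enum_index m)) * wnorm (p + k) (lagf (enum_index m) (($) p))) \<le> (\<Sum>m<M. (2 ^ CARD('d) * ?D * R) * ?w m)"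
      proof (rule sum_mono)
        fix m
        let ?n = "enum_index m :: nat^'d"
        have wb: "0 < weight \<alpha> b ?n" using b by simp
        have wa: "weight \<alpha> a ?n = weight \<alpha> b ?n * weight \<alpha> b ?n" using b weight_mult[of b b \<alpha> ?n] by simp
        have "cmod (u ?n) * wnorm (p + k) (lagf ?n (($) p)) \<le>
            (R * (1 / weight \<alpha> a ?n)) * (2 ^ CARD('d) * H ^ msize (p + k) * weight \<alpha> b ?n * (mselfpow (\<alpha> / 2) p * mselfpow (\<alpha> / 2) k))"
          using R wb by (intro mult_mono coeff_boundD[OF u a] H(2) wnorm_nonneg) (simp add: wa)
        also have "\<dots> = (2 ^ CARD('d) * ?D * R) * ?w m" unfolding wa using wb by simp
        finally show "cmod (u ?n) * wnorm (p + k) (lagf ?n (($) p)) \<le> (2 ^ CARD('d) * ?D * R) * ?w m" .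
      qed
      also have "\<dots> = (2 ^ CARD('d) * ?D * R) * (\<Sum>m<M. ?w m)" by (rule sum_distrib_left[symmetric])
      also have "\<dots> \<le> (2 ^ CARD('d) * ?D * R) * W"
        unfolding W_def using D R w0 by (intro mult_left_mono sum_le_suminf[OF sw]) auto
      finally show "(\<Sum>m<M. cmod (u (enum_index m)) * wnorm (p + k) (lagf (enum_index m) (($) p))) \<le> (2 ^ CARD('d) * ?D * R) * W" .
    qed
    moreover have "wnorm (p + k) (mderiv p (lagsynth u)) = wnorm (p + k) (lagser u (($) p))"
      by (rule wnorm_cong) (rule lagsynth_smooth(2)[OF \<alpha> a u])
    ultimately have "GS_quotient \<alpha> H (lagsynth u) p k \<le> (2 ^ CARD('d) * ?D * R) * W / ?D"
      unfolding GS_quotient_eq using D by (intro divide_right_mono) auto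
    also have "\<dots> = (2 ^ CARD('d) * W) * R"
    proof -
      have cancel: "(x * D * R) * W / D = (x * W) * R" if "D \<noteq> 0" for x D :: real using that by simp
      show ?thesis by (rule cancel[OF less_imp_neq[OF D, symmetric]])
    qed
    finally show ?thesis .
  qed
  show thesis by (rule that[OF H(1) _ main]) (use W in simp)
qed

lemma GS_seminorm_le:
  fixes f :: "real^'d::finite \<Rightarrow> complex"
  assumes "\<And>p k. GS_quotient \<alpha> A f p k \<le> B"
    and "\<And>p k t. msize p \<le> j \<Longrightarrow> msize k \<le> j \<Longrightarrow> t \<in> orthant \<Longrightarrow> mpow t k * cmod (mderiv p f t) \<le> C"
  shows "GS_seminorm \<alpha> A j f \<le> B + C"
proof -
  have ne: "(\<chi> l. 1) \<in> (orthant :: (real^'d) set)" by (simp add: orthant_def)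
  have "(SUP (p, k). GS_quotient \<alpha> A f p k) \<le> B"
    by (rule cSUP_least) (use assms(1) in auto)
  moreover have "(SUP (p, k)\<in>{(p, k). msize p \<le> j \<and> msize k \<le> j}. SUP t\<in>orthant. cmod (complex_of_real (mpow t k) * mderiv p f t)) \<le> C"
  proof (rule cSUP_least)
    have "(0, 0) \<in> {(p :: nat^'d, k :: nat^'d). msize p \<le> j \<and> msize k \<le> j}" by (simp add: msize_def)
    then show "{(p :: nat^'d, k :: nat^'d). msize p \<le> j \<and> msize k \<le> j} \<noteq> {}" by blast
    fix pk assume pk: "pk \<in> {(p :: nat^'d, k :: nat^'d). msize p \<le> j \<and> msize k \<le> j}"
    have "(SUP t\<in>orthant. cmod (complex_of_real (mpow t (snd pk)) * mderiv (fst pk) f t)) \<le> C"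
      by (rule cSUP_least) (use ne pk assms(2) in \<open>auto simp: norm_mult mpow_nonneg\<close>)
    then show "(case pk of (p, k) \<Rightarrow> SUP t\<in>orthant. cmod (complex_of_real (mpow t k) * mderiv p f t)) \<le> C"
      by (simp add: case_prod_beta)
  qed
  ultimately show ?thesis unfolding GS_seminorm_def by linarith
qed

text \<open>One \<open>H\<close> serves all \<open>j\<close>, so the target is a single step; only
  the constant \<open>K\<close> depends on \<open>j\<close>, through the finitely many pairs of
  multi-indices of size at most \<open>j\<close>.\<close>

lemma lagsynth_GS_seminorm:
  assumes \<alpha>: "1 \<le> \<alpha>" and a: "1 < a"
  obtains H where "1 \<le> H" "\<And>(u :: nat^'d::finite \<Rightarrow> complex) R. coeff_bound \<alpha> a R u \<Longrightarrow> lagsynth u \<in> GS_step_carrier \<alpha> H"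
    "\<And>j. \<exists>K. \<forall>(u :: nat^'d \<Rightarrow> complex) R. coeff_bound \<alpha> a R u \<longrightarrow> GS_seminorm \<alpha> H j (lagsynth u) \<le> K * R"
proof -
  obtain H K where H: "1 \<le> H" "0 \<le> K"
    "\<And>(u :: nat^'d::finite \<Rightarrow> complex) R p k. coeff_bound \<alpha> a R u \<Longrightarrow> GS_quotient \<alpha> H (lagsynth u) p k \<le> K * R"
    using lagsynth_GS_quotient[OF \<alpha> a] by metis
  show thesis
  proof (rule that[OF H(1)])
    fix u :: "nat^'d \<Rightarrow> complex" and R assume u: "coeff_bound \<alpha> a R u"
    show "lagsynth u \<in> GS_step_carrier \<alpha> H"
      unfolding GS_step_carrier_def using lagsynth_schwartz[OF \<alpha> a u] H(3)[OF u] by (auto intro!: bdd_aboveI2[of _ _ "K * R"])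
  next
    fix j
    let ?J = "{p :: nat^'d. msize p \<le> j}"
    have "\<forall>p k :: nat^'d. \<exists>K\<ge>0. \<forall>(u :: nat^'d \<Rightarrow> complex) R x. coeff_bound \<alpha> a R u \<longrightarrow> x \<in> closed_orthant \<longrightarrow> mpow x k * cmod (lagser u (($) p) x) \<le> K * R"
      using lagser_bound[OF \<alpha> a] by metis
    then obtain L where L: "\<And>p k. 0 \<le> L p k" "\<And>p k (u :: nat^'d \<Rightarrow> complex) R x. coeff_bound \<alpha> a R u \<Longrightarrow> x \<in> closed_orthant \<Longrightarrow>
        mpow x k * cmod (lagser u (($) p) x) \<le> L p k * R" by metis
    define L' where "L' = (\<Sum>(p, k)\<in>?J \<times> ?J. L p k)"
    have "GS_seminorm \<alpha> H j (lagsynth u) \<le> (K + L') * R" if u: "coeff_bound \<alpha> a R u" for u :: "nat^'d \<Rightarrow> complex" and R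
    proof -
      have R: "0 \<le> R" by (rule coeff_bound_nonneg[OF u a])
      have "GS_seminorm \<alpha> H j (lagsynth u) \<le> K * R + L' * R"
      proof (rule GS_seminorm_le[OF H(3)[OF u]])
        fix p k :: "nat^'d" and t :: "real^'d" assume pk: "msize p \<le> j" "msize k \<le> j" and t: "t \<in> orthant"
        have "mpow t k * cmod (mderiv p (lagsynth u) t) = mpow t k * cmod (lagser u (($) p) t)"
          using lagsynth_smooth(2)[OF \<alpha> a u t] by simp
        also have "\<dots> \<le> L p k * R" using L(2)[OF u] t orthant_subset_closed by blast
        also have "\<dots> \<le> L' * R"
        proof (rule mult_right_mono[OF _ R])
          have "(case (p, k) of (p, k) \<Rightarrow> L p k) \<le> L'"
            unfolding L'_def using pk L(1) finite_msize_le[of j, where 'd='d] by (intro member_le_sum) auto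
          then show "L p k \<le> L'" by simp
        qed
        finally show "mpow t k * cmod (mderiv p (lagsynth u) t) \<le> L' * R" .
      qed
      then show ?thesis by (simp add: distrib_right)
    qed
    then show "\<exists>K. \<forall>(u :: nat^'d \<Rightarrow> complex) R. coeff_bound \<alpha> a R u \<longrightarrow> GS_seminorm \<alpha> H j (lagsynth u) \<le> K * R" by blast
  qed
qed

lemma laguerre_coeff_eq: "laguerre_coeff f n = (LINT t:orthant|lborel. f t * lagf n (\<lambda>_. 0) t)"
  unfolding laguerre_coeff_def by (rule set_lebesgue_integral_cong) (auto simp: laguerre_fun_eq)

text \<open>By orthonormality the coefficients of the partial sums are eventually
  \<open>u n\<close>. The partial sums are uniformly bounded and the Laguerre function is
  integrable, which permits the passage to the limit.\<close>

lemma laguerre_coeff_lagsynth: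
  fixes u :: "nat^'d::finite \<Rightarrow> complex"
  assumes \<alpha>: "1 \<le> \<alpha>" and a: "1 < a" and u: "coeff_bound \<alpha> a R u"
  shows "laguerre_coeff (lagsynth u) = u"
proof
  fix n :: "nat^'d"
  let ?L = "lagf n (\<lambda>_. 0)" and ?z = "\<lambda>_::'d. 0::nat"
  obtain K where K: "0 \<le> K" "\<And>(u :: nat^'d \<Rightarrow> complex) R x. coeff_bound \<alpha> a R u \<Longrightarrow> x \<in> orthant \<Longrightarrow> cmod (lagser u ?z x) * rho x ^ 0 \<le> K * R"
    using lagser_rho_bound[OF \<alpha> a, of ?z 0] by metis
  have "(\<lambda>M. LINT x|lborel. indicator orthant x *\<^sub>R (lagser (truncate M u) ?z x * ?L x)) \<longlonglongrightarrow>
      (LINT x|lborel. indicator orthant x *\<^sub>R (lagser u ?z x * ?L x))"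
  proof (rule integral_dominated_convergence[where w="\<lambda>x. (K * R) * (indicator orthant x *\<^sub>R cmod (?L x))"])
    show "(\<lambda>x. indicator orthant x *\<^sub>R (lagser u ?z x * ?L x)) \<in> borel_measurable lborel"
      by (intro borel_measurable_orthant rdecay_continuous rdecay_mult rdecay_lagf rdecay_lagser[OF assms])
    show "(\<lambda>x. indicator orthant x *\<^sub>R (lagser (truncate M u) ?z x * ?L x)) \<in> borel_measurable lborel" for M
      by (intro borel_measurable_orthant rdecay_continuous rdecay_mult rdecay_lagf
          rdecay_lagser[OF assms(1,2) coeff_bound_truncate[OF u a]])
    show "integrable lborel (\<lambda>x. (K * R) * (indicator orthant x *\<^sub>R cmod (?L x)))"
      using set_integrable_norm[OF rdecay_integrable[OF rdecay_lagf[of n ?z]]]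
      by (intro integrable_mult_right) (simp add: set_integrable_def)
    show "AE x in lborel. (\<lambda>M. indicator orthant x *\<^sub>R (lagser (truncate M u) ?z x * ?L x)) \<longlonglongrightarrow>
        indicator orthant x *\<^sub>R (lagser u ?z x * ?L x)"
    proof (rule AE_I2)
      fix x :: "real^'d"
      show "(\<lambda>M. indicator orthant x *\<^sub>R (lagser (truncate M u) ?z x * ?L x)) \<longlonglongrightarrow> indicator orthant x *\<^sub>R (lagser u ?z x * ?L x)"
      proof (cases "x \<in> orthant")
        case True
        then have "(\<lambda>M. lagser (truncate M u) ?z x) \<longlonglongrightarrow> lagser u ?z x"
          using lagser_sums[OF assms, of x ?z] orthant_subset_closed by (auto simp: sums_def lagser_truncate)
        then show ?thesis by (intro tendsto_intros)
      qed simp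
    qed
    show "AE x in lborel. norm (indicator orthant x *\<^sub>R (lagser (truncate M u) ?z x * ?L x)) \<le> (K * R) * (indicator orthant x *\<^sub>R cmod (?L x))" for M
    proof (rule AE_I2)
      fix x :: "real^'d"
      show "norm (indicator orthant x *\<^sub>R (lagser (truncate M u) ?z x * ?L x)) \<le> (K * R) * (indicator orthant x *\<^sub>R cmod (?L x))"
      proof (cases "x \<in> orthant")
        case True
        then show ?thesis
          using mult_right_mono[OF K(2)[OF coeff_bound_truncate[OF u a] True, of M], of "cmod (?L x)"] by (simp add: norm_mult)
      qed simp
    qed
  qed
  moreover have "(LINT x|lborel. indicator orthant x *\<^sub>R (lagser (truncate M u) ?z x * ?L x)) = truncate M u n" for M
  proof -
    have "(LINT x:orthant|lborel. lagser (truncate M u) ?z x * ?L x) =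
        (LINT x:orthant|lborel. \<Sum>m<M. u (enum_index m) * (lagf (enum_index m) ?z x * ?L x))"
      by (simp add: lagser_truncate sum_distrib_right mult.assoc)
    also have "\<dots> = (\<Sum>m<M. (LINT x:orthant|lborel. u (enum_index m) * (lagf (enum_index m) ?z x * ?L x)))"
      unfolding set_lebesgue_integral_def scaleR_sum_right
    proof (rule Bochner_Integration.integral_sum)
      fix m
      have "set_integrable lborel orthant (\<lambda>x. u (enum_index m) * (lagf (enum_index m) ?z x * ?L x))"
        by (intro set_integrable_mult_right rdecay_integrable rdecay_mult rdecay_lagf)
      then show "integrable lborel (\<lambda>x. indicator orthant x *\<^sub>R (u (enum_index m) * (lagf (enum_index m) ?z x * ?L x)))"
        by (simp add: set_integrable_def)
    qed
    also have "\<dots> = (\<Sum>m<M. u (enum_index m) * (if enum_index m = n then 1 else 0))"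
      by (simp add: lagf_orthonormal)
    also have "\<dots> = truncate M u n"
    proof (cases "n \<in> enum_index ` {..<M}")
      case True
      then obtain j where j: "j < M" "n = enum_index j" by auto
      then show ?thesis using True by (simp add: truncate_def enum_index_inj if_distrib cong: if_cong)
    next
      case False
      then show ?thesis by (simp add: truncate_def) (intro sum.neutral, auto)
    qed
    finally show ?thesis by (simp add: set_lebesgue_integral_def)
  qed
  ultimately have 1: "(\<lambda>M. truncate M u n) \<longlonglongrightarrow> (LINT x:orthant|lborel. lagser u ?z x * ?L x)"
    by (simp add: set_lebesgue_integral_def)
  obtain j where j: "n = enum_index j" using bij_enum_index by (metis bij_pointE)
  have "\<forall>\<^sub>F M in sequentially. truncate M u n = u n"
    using eventually_gt_at_top[of j] by eventually_elim (simp add: j truncate_enum)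
  then have 2: "(\<lambda>M. truncate M u n) \<longlonglongrightarrow> u n" by (rule tendsto_eventually)
  have "laguerre_coeff (lagsynth u) n = (LINT x:orthant|lborel. lagser u ?z x * ?L x)"
    unfolding laguerre_coeff_eq by (rule set_lebesgue_integral_cong) (auto simp: lagsynth_def)
  then show "laguerre_coeff (lagsynth u) n = u n" using LIMSEQ_unique[OF 1 2] by simp
qed

section \<open>Analysis: from the seminorms of a test function to its coefficients\<close>

section \<open>Decay of the Laguerre coefficients\<close>

lemma GS_quotient_nonneg: "0 < A \<Longrightarrow> 0 \<le> GS_quotient \<alpha> A f p k"
  unfolding GS_quotient_eq using mselfpow_pos[of "\<alpha>/2" k] mselfpow_pos[of "\<alpha>/2" p]
  by (intro divide_nonneg_nonneg) (auto simp: wnorm_nonneg)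

lemma GS_quotient_le_seminorm:
  fixes f :: "real^'d::finite \<Rightarrow> complex"
  assumes f: "f \<in> GS_step_carrier \<alpha> A"
  shows "GS_quotient \<alpha> A f p k \<le> GS_seminorm \<alpha> A j f"
proof -
  have fs: "f \<in> schwartz_orthant" using f by (simp add: GS_step_carrier_def)
  let ?J = "{(p :: nat^'d, k :: nat^'d). msize p \<le> j \<and> msize k \<le> j}"
  let ?s = "\<lambda>(p, k). SUP t\<in>orthant. cmod (complex_of_real (mpow t k) * mderiv p f t)"
  have "?J = {p. msize p \<le> j} \<times> {k. msize k \<le> j}" by auto
  then have J: "finite ?J" by (simp add: finite_msize_le)
  have "0 \<le> ?s (0, 0)"
    using seminorm_onD(1)[OF seminorm_on_sup_deriv fs, of 0 0] by (simp only: prod.case)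
  also have "?s (0, 0) \<le> (SUP pk\<in>?J. ?s pk)"
    by (rule cSUP_upper) (use J in \<open>auto simp: msize_def\<close>)
  finally have "0 \<le> (SUP pk\<in>?J. ?s pk)" .
  moreover have "GS_quotient \<alpha> A f p k \<le> (SUP pk. case pk of (p, k) \<Rightarrow> GS_quotient \<alpha> A f p k)"
    using cSUP_upper[of "(p, k)" UNIV "\<lambda>(p, k). GS_quotient \<alpha> A f p k"] f by (simp add: GS_step_carrier_def)
  ultimately show ?thesis unfolding GS_seminorm_def by linarith
qed

lemma GS_step_carrier_mono:
  assumes "0 < A" "A \<le> A'" shows "GS_step_carrier \<alpha> A \<subseteq> GS_step_carrier \<alpha> A'"
proof
  fix f :: "real^'a \<Rightarrow> complex" assume f: "f \<in> GS_step_carrier \<alpha> A"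
  obtain B where B: "\<And>p k. GS_quotient \<alpha> A f p k \<le> B" using f by (auto simp: GS_step_carrier_def bdd_above_def)
  have "GS_quotient \<alpha> A' f p k \<le> GS_quotient \<alpha> A f p k" for p k
    unfolding GS_quotient_eq using assms mselfpow_pos[of "\<alpha>/2" k] mselfpow_pos[of "\<alpha>/2" p]
    by (intro divide_left_mono mult_right_mono power_mono mult_pos_pos) (auto simp: wnorm_nonneg less_imp_le)
  then have "GS_quotient \<alpha> A' f p k \<le> B" for p k using B order_trans by blast
  then show "f \<in> GS_step_carrier \<alpha> A'"
    using f by (auto simp: GS_step_carrier_def intro!: bdd_aboveI2[of _ _ B])
qed

text \<open>The seminorm is evaluated at multi-indices concentrated in direction \<open>l\<close>;
  squaring turns \<open>mselfpow (\<alpha> / 2)\<close> into \<open>spow \<alpha>\<close>.\<close>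

lemma qnorm_mderiv_le:
  fixes f :: "real^'d::finite \<Rightarrow> complex"
  assumes A: "0 < A" and B: "\<And>p k. GS_quotient \<alpha> A f p k \<le> K"
  shows "qnorm l (p + k) (mderiv (axis l p) f) \<le> K\<^sup>2 * A ^ (2 * (p + k)) * (spow \<alpha> p * spow \<alpha> k)"
proof -
  let ?p = "axis l p :: nat^'d" and ?k = "axis l k :: nat^'d"
  have ms: "msize (?p + ?k) = p + k"
    by (simp add: msize_def axis_def sum.distrib)
  have sq: "(mselfpow (\<alpha> / 2) (axis l q :: nat^'d))\<^sup>2 = spow \<alpha> q" for q
  proof -
    have "(\<Prod>j\<in>UNIV. spow \<alpha> ((axis l q :: nat^'d) $ j)) = (\<Prod>j\<in>UNIV. if j = l then spow \<alpha> q else 1)"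
      by (intro prod.cong) (auto simp: axis_def spow_def)
    then show ?thesis by (simp add: mselfpow_half_square)
  qed
  have mp: "mpow t (?p + ?k) = (t $ l) ^ (p + k)" for t
  proof -
    have "mpow t (?p + ?k) = (\<Prod>j\<in>UNIV. if j = l then (t $ l) ^ (p + k) else 1)"
      unfolding mpow_def by (intro prod.cong) (auto simp: axis_def)
    then show ?thesis by simp
  qed
  let ?D = "A ^ (p + k) * mselfpow (\<alpha> / 2) ?k * mselfpow (\<alpha> / 2) ?p"
  have D: "0 < ?D" using A mselfpow_pos[of "\<alpha>/2" ?k] mselfpow_pos[of "\<alpha>/2" ?p] by simp
  have "wnorm (?p + ?k) (mderiv ?p f) \<le> K * ?D"
    using B[of ?p ?k] D unfolding GS_quotient_eq ms by (simp add: pos_divide_le_eq)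
  then have "(wnorm (?p + ?k) (mderiv ?p f))\<^sup>2 \<le> (K * ?D)\<^sup>2" by (intro power_mono wnorm_nonneg)
  also have "(K * ?D)\<^sup>2 = K\<^sup>2 * (A ^ (p + k))\<^sup>2 * (spow \<alpha> p * spow \<alpha> k)"
    by (simp add: power_mult_distrib sq mult_ac)
  finally show ?thesis
    unfolding wnorm_power2 mp qnorm_def by (simp add: power_mult[symmetric] mult.commute)
qed

lemma laguerre_coeff_decay:
  assumes \<alpha>: "1 \<le> \<alpha>" and A: "0 < A"
  obtains a where "1 < a" "\<And>f (n :: nat^'d::finite). f \<in> GS_step_carrier \<alpha> A \<Longrightarrow>
    cmod (laguerre_coeff f n) * weight \<alpha> a n \<le> exp 1 * GS_seminorm \<alpha> A j f"
proof -
  \<comment> \<open>\<open>coefficient_decay\<close> works with a constant of at least 1.\<close>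
  define H where "H = max A 1"
  define D where "D = exp 1 * (5 * H\<^sup>2 * 2 powr \<alpha>)"
  \<comment> \<open>The factor \<open>d\<close> accounts for \<open>|n| \<le> d * n_l\<close> at the
    largest component. The value of \<open>a\<close> is then the one for which
    \<open>weight \<alpha> a n\<close> equals \<open>exp ((|n| / C)^(1/\<alpha>))\<close>.\<close>
  define C where "C = real CARD('d) * D"
  define a where "a = exp (C powr - (1 / \<alpha>))"
  have H: "1 \<le> H" "0 < H" "A \<le> H" by (auto simp: H_def)
  have D: "0 < D" using H by (simp add: D_def)
  have C: "0 < C" using D by (simp add: C_def)
  have a: "1 < a" using C by (simp add: a_def)
  have "cmod (laguerre_coeff f n) * weight \<alpha> a n \<le> exp 1 * GS_seminorm \<alpha> A j f"
    if f: "f \<in> GS_step_carrier \<alpha> A" for f and n :: "nat^'d"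
  proof -
    define K where "K = GS_seminorm \<alpha> A j f"
    have fs: "f \<in> schwartz_orthant" using f by (simp add: GS_step_carrier_def)
    have BA: "GS_quotient \<alpha> A f p k \<le> K" for p k unfolding K_def by (rule GS_quotient_le_seminorm[OF f])
    have K: "0 \<le> K" using BA[of 0 0] GS_quotient_nonneg[OF A, of \<alpha> f 0 0] by linarith
    obtain l where l: "\<And>i. n $ i \<le> n $ l"
    proof -
      have "Max (range (($) n)) \<in> range (($) n)" by (rule Max_in) auto
      then obtain l where "n $ l = Max (range (($) n))" by force
      then show thesis using that[of l] by simp
    qed
    have "msize n \<le> CARD('d) * n $ l" unfolding msize_def using sum_bounded_above[of UNIV "($) n" "n $ l"] l by simp
    then have nl: "real (msize n) \<le> real CARD('d) * real (n $ l)" by (metis of_nat_le_iff of_nat_mult)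
    have z: "(\<lambda>_::'d. 0::nat)(l := 0) = (\<lambda>_. 0)" by auto
    have ax: "axis l 0 = (0 :: nat^'d)" by (simp add: vec_eq_iff axis_def)
    have "cmod (LINT x:orthant|lborel. mderiv (axis l 0) f x * lagf n ((\<lambda>_. 0)(l := 0)) x) \<le>
        exp 1 * K * exp (- ((real (n $ l) / D) powr (1 / \<alpha>)))"
      unfolding D_def
    proof (rule coefficient_decay[OF \<alpha> H(1) K tower_schwartz[OF fs] tower_lagf])
      fix p k
      have "qnorm l (p + k) (mderiv (axis l p) f) \<le> K\<^sup>2 * A ^ (2 * (p + k)) * (spow \<alpha> p * spow \<alpha> k)"
        by (rule qnorm_mderiv_le[OF A BA])
      also have "\<dots> \<le> K\<^sup>2 * H ^ (2 * (p + k)) * (spow \<alpha> p * spow \<alpha> k)"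
        using A H by (intro mult_right_mono mult_left_mono power_mono) (auto simp: spow_nonneg)
      finally show "qnorm l (p + k) (mderiv (axis l p) f) \<le> K\<^sup>2 * H ^ (2 * (p + k)) * (spow \<alpha> p * spow \<alpha> k)" .
    qed (auto simp only: lagop_lagf z qnorm_lagf order_refl of_nat_0_le_iff)
    then have c: "cmod (laguerre_coeff f n) \<le> exp 1 * K * exp (- ((real (n $ l) / D) powr (1 / \<alpha>)))"
      unfolding z ax mderiv_0 laguerre_coeff_eq .
    have "real (msize n) / C \<le> real (n $ l) / D"
      using nl D by (simp add: C_def field_simps)
    then have "(real (msize n) / C) powr (1 / \<alpha>) \<le> (real (n $ l) / D) powr (1 / \<alpha>)"
      using C \<alpha> by (intro powr_mono2) auto
    moreover have "weight \<alpha> a n = exp ((real (msize n) / C) powr (1 / \<alpha>))"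
    proof -
      have "weight \<alpha> a n = exp (C powr - (1 / \<alpha>) * real (msize n) powr (1 / \<alpha>))"
        by (simp add: weight_def a_def powr_def mult.commute)
      also have "C powr - (1 / \<alpha>) * real (msize n) powr (1 / \<alpha>) = (real (msize n) / C) powr (1 / \<alpha>)"
        using C powr_divide[of "real (msize n)" C "1 / \<alpha>"] by (simp add: powr_minus divide_inverse mult.commute)
      finally show ?thesis .
    qed
    ultimately have w: "weight \<alpha> a n \<le> exp ((real (n $ l) / D) powr (1 / \<alpha>))" by simp
    have "cmod (laguerre_coeff f n) * weight \<alpha> a n \<le>
        (exp 1 * K * exp (- ((real (n $ l) / D) powr (1 / \<alpha>)))) * exp ((real (n $ l) / D) powr (1 / \<alpha>))"
      using a K by (intro mult_mono c w) (auto simp: less_imp_le)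
    also have "\<dots> = exp 1 * K" by (simp add: mult.assoc exp_minus_inverse flip: exp_add)
    finally show ?thesis by (simp add: K_def)
  qed
  with a show thesis by (rule that)
qed

section \<open>Orthogonality to exponentials, polynomial approximation on the cube, and
  uniqueness\<close>

section \<open>Completeness of the Laguerre functions\<close>

text \<open>The substitution \<open>y = exp (- x)\<close> maps the orthant into the compact unit
  cube, where polynomial approximation applies; polynomials in \<open>y\<close> are exponential sums
  in \<open>x\<close>.\<close>

definition expvec :: "real^'d::finite \<Rightarrow> real^'d" where
  "expvec x = (\<chi> l. exp (- (x $ l)))"

lemma expvec_nth [simp]: "expvec x $ l = exp (- (x $ l))"
  by (simp add: expvec_def)

lemma continuous_on_expvec [continuous_intros]: "continuous_on A expvec"
  unfolding expvec_def by (intro continuous_intros)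

definition gexp :: "nat^'d::finite \<Rightarrow> real^'d \<Rightarrow> real" where
  "gexp m x = (\<Prod>l\<in>UNIV. exp (- (real (m $ l) + 1/2) * (x $ l)))"

lemma gexp_eq: "gexp m x = gexp 0 x * mpow (expvec x) m"
  unfolding gexp_def mpow_def prod.distrib[symmetric]
  by (intro prod.cong refl) (simp add: algebra_simps exp_of_nat_mult[symmetric] flip: exp_add)

lemma lagf_0: "lagf 0 (\<lambda>_. 0) x = complex_of_real (gexp 0 x)"
  unfolding lagf_def gexp_def by (simp add: lfun_def lagd_0)

lemma rdecay_bounded_mult:
  fixes h :: "real^'d::finite \<Rightarrow> complex" and w :: "real^'d \<Rightarrow> real"
  assumes h: "rdecay h" and w: "continuous_on orthant w" "\<And>x. x \<in> orthant \<Longrightarrow> \<bar>w x\<bar> \<le> B"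
  shows "rdecay (\<lambda>x. complex_of_real (w x) * h x)"
proof (rule rdecay_product_bound[OF _ h, of _ w "max 0 B" 0])
  show "norm (w x) \<le> max 0 B * rho x ^ 0" if "x \<in> orthant" for x using w(2)[OF that] by simp
qed (auto intro!: continuous_intros w(1) rdecay_continuous[OF h] simp: norm_mult)

lemma mpow_expvec_bounds: "x \<in> orthant \<Longrightarrow> 0 \<le> mpow (expvec x) m \<and> mpow (expvec x) m \<le> 1"
  unfolding mpow_def by (auto intro!: prod_nonneg prod_le_1 power_le_one simp: orthant_def less_imp_le)

lemma continuous_on_mpow_expvec: "continuous_on A (\<lambda>x. mpow (expvec x) m)"
  unfolding mpow_def by (intro continuous_intros)

lemma rdecay_mpow_expvec: "rdecay h \<Longrightarrow> rdecay (\<lambda>x. complex_of_real (mpow (expvec x) m) * h x)"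
  by (rule rdecay_bounded_mult[where B=1, OF _ continuous_on_mpow_expvec])
    (use mpow_expvec_bounds in \<open>auto simp: abs_le_iff intro: order_trans[of _ 0]\<close>)

lemma rdecay_gexp: "rdecay (\<lambda>x. complex_of_real (gexp m x))"
  using rdecay_mpow_expvec[OF rdecay_lagf[of 0 "\<lambda>_. 0"], of m] by (simp add: gexp_eq[of m] lagf_0 mult.commute)

definition gcoef :: "nat \<Rightarrow> nat \<Rightarrow> real" where
  "gcoef c n = real c ^ n / (real c + 1) ^ Suc n"

text \<open>Bessel's identity: when the square is expanded, the mixed terms contribute minus twice
  the sum of \<open>(c n)^2\<close>, and orthonormality reduces the double sum to that sum
  once.\<close>

lemma has_bochner_integral_gexp_residual:
  fixes m :: "nat^'d::finite"
  defines "c \<equiv> \<lambda>n :: nat^'d. \<Prod>l\<in>UNIV. gcoef (m $ l) (n $ l)" and "L \<equiv> \<lambda>n x. \<Prod>l\<in>UNIV. lfun (n $ l) 0 (x $ l)"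
  assumes B: "finite B"
  shows "has_bochner_integral lborel (\<lambda>x. indicator orthant x * (gexp m x - (\<Sum>n\<in>B. c n * L n x))\<^sup>2)
    ((\<Prod>l\<in>UNIV. 1 / (2 * real (m $ l) + 1)) - (\<Sum>n\<in>B. (c n)\<^sup>2))"
proof -
  have 1: "has_bochner_integral lborel (\<lambda>x. indicator orthant x * (gexp m x * gexp m x)) (\<Prod>l\<in>UNIV. 1 / (2 * real (m $ l) + 1))"
    unfolding gexp_def prod.distrib[symmetric]
    using has_bochner_integral_exp_square by (intro has_bochner_integral_orthant_product) (simp add: power2_eq_square)
  have 2: "has_bochner_integral lborel (\<lambda>x. indicator orthant x * (gexp m x * L n x)) (c n)" for n
    unfolding gexp_def prod.distrib[symmetric] c_def L_def gcoef_def
    by (intro has_bochner_integral_orthant_product has_bochner_integral_exp_lfun)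
  have 3: "has_bochner_integral lborel (\<lambda>x. indicator orthant x * (L n x * L k x)) (if n = k then 1 else 0)" for n k
    using has_bochner_integral_lagf_mult[of n k] by (simp add: L_def prod.distrib)
  have "has_bochner_integral lborel (\<lambda>x. indicator orthant x * (gexp m x * gexp m x)
        - 2 * (\<Sum>n\<in>B. c n * (indicator orthant x * (gexp m x * L n x)))
        + (\<Sum>n\<in>B. \<Sum>k\<in>B. (c n * c k) * (indicator orthant x * (L n x * L k x))))
      ((\<Prod>l\<in>UNIV. 1 / (2 * real (m $ l) + 1)) - 2 * (\<Sum>n\<in>B. c n * c n) + (\<Sum>n\<in>B. \<Sum>k\<in>B. (c n * c k) * (if n = k then 1 else 0)))"
    by (intro has_bochner_integral_add has_bochner_integral_diff has_bochner_integral_mult_right has_bochner_integral_sum 1 2 3)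
  moreover have "indicator orthant x * (gexp m x * gexp m x)
        - 2 * (\<Sum>n\<in>B. c n * (indicator orthant x * (gexp m x * L n x)))
        + (\<Sum>n\<in>B. \<Sum>k\<in>B. (c n * c k) * (indicator orthant x * (L n x * L k x)))
      = indicator orthant x * (gexp m x - (\<Sum>n\<in>B. c n * L n x))\<^sup>2" for x
  proof -
    have "(\<Sum>n\<in>B. c n * (indicator orthant x * (gexp m x * L n x))) = indicator orthant x * (gexp m x * (\<Sum>n\<in>B. c n * L n x))"
      by (simp add: sum_distrib_left mult_ac)
    moreover have "(\<Sum>n\<in>B. \<Sum>k\<in>B. (c n * c k) * (indicator orthant x * (L n x * L k x)))
        = indicator orthant x * ((\<Sum>n\<in>B. c n * L n x) * (\<Sum>n\<in>B. c n * L n x))"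
      unfolding sum_product by (simp only: sum_distrib_left mult_ac)
    ultimately show ?thesis by (simp add: power2_eq_square algebra_simps)
  qed
  moreover have "(\<Sum>n\<in>B. \<Sum>k\<in>B. (c n * c k) * (if n = k then 1 else 0)) = (\<Sum>n\<in>B. (c n)\<^sup>2)"
    using B by (simp add: power2_eq_square if_distrib sum.delta cong: if_cong)
  ultimately show ?thesis by (simp add: power2_eq_square)
qed

text \<open>Subtracting a partial sum from \<open>gexp m\<close> does not change the integral
  against \<open>f\<close>. Cauchy-Schwarz bounds the integral by the norm of the residual, which
  tends to 0 because the one-variable Parseval series multiply.\<close>

lemma gexp_orthogonal:
  fixes f :: "real^'d::finite \<Rightarrow> complex"
  assumes f: "rdecay f" and 0: "\<And>n. (LINT x:orthant|lborel. f x * lagf n (\<lambda>_. 0) x) = 0"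
  shows "(LINT x:orthant|lborel. f x * complex_of_real (gexp m x)) = 0"
proof -
  \<comment> \<open>\<open>qnorm\<close> asks for a direction; with exponent 0 every direction gives
    the plain squared norm.\<close>
  fix l :: 'd
  define c where "c = (\<lambda>n :: nat^'d. \<Prod>l\<in>UNIV. gcoef (m $ l) (n $ l))"
  define L where "L = (\<lambda>(n::nat^'d) (x::real^'d). \<Prod>l\<in>UNIV. lfun (n $ l) 0 (x $ l))"
  define B where "B = (\<lambda>N. {n::nat^'d. \<forall>l. n $ l \<le> N})"
  define \<epsilon> where "\<epsilon> = (\<lambda>N. (\<Prod>l\<in>UNIV. 1 / (2 * real (m $ l) + 1)) - (\<Sum>n\<in>B N. (c n)\<^sup>2))"
  \<comment> \<open>The summand 1 keeps \<open>M\<close> away from 0 and gives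
    \<open>M \<le> M^2\<close>, so that \<open>f / M\<close> has norm at most 1.\<close>
  define M where "M = qnorm l 0 f + 1"
  have q: "0 \<le> qnorm l 0 f" by (rule qnorm_nonneg)
  have M: "1 \<le> M" "qnorm l 0 f \<le> M\<^sup>2" using q by (auto simp: M_def power2_eq_square algebra_simps)
  have lag: "lagf n (\<lambda>_. 0) x = complex_of_real (L n x)" for n x by (simp add: lagf_def L_def)
  let ?I = "LINT x:orthant|lborel. f x * complex_of_real (gexp m x)"
  have le: "cmod ?I \<le> M * sqrt (\<epsilon> N)" for N
  proof -
    let ?r = "\<lambda>x. complex_of_real (gexp m x - (\<Sum>n\<in>B N. c n * L n x))"
    have fin: "finite (B N)" unfolding B_def by (rule finite_box)
    have "rdecay (\<lambda>x. \<Sum>n\<in>A. c n *\<^sub>R lagf n (\<lambda>_. 0) x)" if "finite A" for A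
      using that
    proof (induction A)
      case empty show ?case by (auto simp: rdecay_def intro!: exI[of _ 0])
    next
      case (insert n A)
      then show ?case using rdecay_add[OF rdecay_cmult[OF rdecay_lagf[of n "\<lambda>_. 0"], of "c n"]] by simp
    qed
    from rdecay_diff[OF rdecay_gexp[of m] this[OF fin]]
    have rr: "rdecay ?r" by (simp add: lag scaleR_conv_of_real)
    have "qnorm l 0 ?r = (LINT x|lborel. indicator orthant x * (gexp m x - (\<Sum>n\<in>B N. c n * L n x))\<^sup>2)"
      unfolding qnorm_def set_lebesgue_integral_def by (simp only: norm_of_real power_0 power2_abs mult_1_left real_scaleR_def)
    also have "\<dots> = \<epsilon> N"
      unfolding \<epsilon>_def c_def L_def by (rule has_bochner_integral_integral_eq[OF has_bochner_integral_gexp_residual[OF fin]])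
    finally have qr: "qnorm l 0 ?r = \<epsilon> N" .
    then have \<epsilon>: "0 \<le> \<epsilon> N" using qnorm_nonneg[of l 0 ?r] by simp
    have "qnorm l 0 (\<lambda>x. (1 / M) *\<^sub>R f x) = (1 / M)\<^sup>2 * qnorm l 0 f"
    proof -
      have "qnorm l 0 (\<lambda>x. (1 / M) *\<^sub>R f x) = (LINT x:orthant|lborel. (1 / M)\<^sup>2 * (x $ l ^ 0 * (cmod (f x))\<^sup>2))"
        unfolding qnorm_def by (intro set_lebesgue_integral_cong) (auto simp: power_mult_distrib power_divide)
      then show ?thesis by (simp add: qnorm_def)
    qed
    also have "\<dots> \<le> 1" using M by (simp add: power_divide)
    finally have "cmod (LINT x:orthant|lborel. ?r x * ((1 / M) *\<^sub>R f x)) \<le> sqrt (\<epsilon> N)"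
      using qr \<epsilon> by (intro cauchy_schwarz_orthant[OF rr rdecay_cmult[OF f]]) (simp_all only: real_sqrt_pow2 real_sqrt_ge_zero order_refl)
    also have "(LINT x:orthant|lborel. ?r x * ((1 / M) *\<^sub>R f x)) = (1 / M) *\<^sub>R (LINT x:orthant|lborel. f x * ?r x)"
    proof -
      have "(LINT x:orthant|lborel. ?r x * ((1 / M) *\<^sub>R f x)) = (LINT x:orthant|lborel. (1 / M) *\<^sub>R (f x * ?r x))"
        by (intro set_lebesgue_integral_cong) (auto simp: mult.commute)
      then show ?thesis by simp
    qed
    also have "(LINT x:orthant|lborel. f x * ?r x) = ?I"
    proof -
      have "(LINT x:orthant|lborel. f x * ?r x) =
          (LINT x:orthant|lborel. f x * complex_of_real (gexp m x) - (\<Sum>n\<in>B N. complex_of_real (c n) * (f x * lagf n (\<lambda>_. 0) x)))"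
        by (intro set_lebesgue_integral_cong) (auto simp: lag algebra_simps sum_distrib_left)
      also have "\<dots> = ?I - (LINT x:orthant|lborel. (\<Sum>n\<in>B N. complex_of_real (c n) * (f x * lagf n (\<lambda>_. 0) x)))"
      proof (rule set_integral_diff(2))
        show "set_integrable lborel orthant (\<lambda>x. f x * complex_of_real (gexp m x))"
          by (intro rdecay_integrable rdecay_mult f rdecay_gexp)
        show "set_integrable lborel orthant (\<lambda>x. \<Sum>n\<in>B N. complex_of_real (c n) * (f x * lagf n (\<lambda>_. 0) x))"
          unfolding set_integrable_def scaleR_sum_right
        proof (rule Bochner_Integration.integrable_sum)
          fix n
          have "set_integrable lborel orthant (\<lambda>x. complex_of_real (c n) * (f x * lagf n (\<lambda>_. 0) x))"
            by (intro set_integrable_mult_right rdecay_integrable rdecay_mult f rdecay_lagf)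
          then show "integrable lborel (\<lambda>x. indicator orthant x *\<^sub>R (complex_of_real (c n) * (f x * lagf n (\<lambda>_. 0) x)))"
            by (simp add: set_integrable_def)
        qed
      qed
      also have "(LINT x:orthant|lborel. (\<Sum>n\<in>B N. complex_of_real (c n) * (f x * lagf n (\<lambda>_. 0) x))) = 0"
      proof -
        have i: "set_integrable lborel orthant (\<lambda>x. complex_of_real (c n) * (f x * lagf n (\<lambda>_. 0) x))" for n
          by (intro set_integrable_mult_right rdecay_integrable rdecay_mult f rdecay_lagf)
        have "(LINT x:orthant|lborel. (\<Sum>n\<in>B N. complex_of_real (c n) * (f x * lagf n (\<lambda>_. 0) x))) =
            (\<Sum>n\<in>B N. (LINT x:orthant|lborel. complex_of_real (c n) * (f x * lagf n (\<lambda>_. 0) x)))"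
          unfolding set_lebesgue_integral_def scaleR_sum_right
          by (rule Bochner_Integration.integral_sum) (use i in \<open>simp add: set_integrable_def\<close>)
        then show ?thesis using 0 by simp
      qed
      finally show ?thesis by simp
    qed
    finally show ?thesis using M(1) by (simp add: pos_divide_le_eq mult.commute)
  qed
  have "(\<lambda>N. \<epsilon> N) \<longlonglongrightarrow> 0"
  proof -
    have "(\<Sum>n\<in>B N. (c n)\<^sup>2) = (\<Prod>l\<in>UNIV. \<Sum>j\<le>N. (gcoef (m $ l) j)\<^sup>2)" for N
      unfolding c_def B_def prod_power_distrib by (rule sum_box_product)
    moreover have "(\<lambda>N. \<Prod>l\<in>UNIV. \<Sum>j\<le>N. (gcoef (m $ l) j)\<^sup>2) \<longlonglongrightarrow> (\<Prod>l\<in>UNIV. 1 / (2 * real (m $ l) + 1))"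
      using sums_exp_coeff_square unfolding gcoef_def sums_def_le by (intro tendsto_prod) auto
    ultimately have "(\<lambda>N. (\<Sum>n\<in>B N. (c n)\<^sup>2)) \<longlonglongrightarrow> (\<Prod>l\<in>UNIV. 1 / (2 * real (m $ l) + 1))" by simp
    from tendsto_diff[OF tendsto_const[of "\<Prod>l\<in>UNIV. 1 / (2 * real (m $ l) + 1)"] this] show ?thesis unfolding \<epsilon>_def by simp
  qed
  from tendsto_mult[OF tendsto_const tendsto_real_sqrt[OF this]]
  have "(\<lambda>N. M * sqrt (\<epsilon> N)) \<longlonglongrightarrow> 0" by simp
  then have "cmod ?I \<le> 0" using le by (intro LIMSEQ_le_const) auto
  then show ?thesis by simp
qed

text \<open>Demanding that all moments in \<open>exp (- x)\<close> vanish, and not just the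
  integral, makes the class stable under multiplication by coordinates of
  \<open>expvec\<close>.\<close>

definition moment_free :: "(real^'d::finite \<Rightarrow> complex) \<Rightarrow> bool" where
  "moment_free h \<longleftrightarrow> rdecay h \<and> (\<forall>m. (LINT x:orthant|lborel. complex_of_real (mpow (expvec x) m) * h x) = 0)"

lemma moment_free_add:
  assumes "moment_free f" "moment_free g" shows "moment_free (\<lambda>x. f x + g x)"
  unfolding moment_free_def
proof (intro conjI allI)
  show "rdecay (\<lambda>x. f x + g x)" using assms by (auto simp: moment_free_def intro: rdecay_add)
  fix m
  have "set_integrable lborel orthant (\<lambda>x. complex_of_real (mpow (expvec x) m) * f x)"
    and "set_integrable lborel orthant (\<lambda>x. complex_of_real (mpow (expvec x) m) * g x)"
    using assms by (auto simp: moment_free_def intro!: rdecay_integrable rdecay_mpow_expvec)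
  from set_integral_add(2)[OF this]
  show "(LINT x:orthant|lborel. complex_of_real (mpow (expvec x) m) * (f x + g x)) = 0"
    using assms by (simp add: distrib_left moment_free_def)
qed

lemma moment_free_scale:
  assumes "moment_free f" shows "moment_free (\<lambda>x. complex_of_real c * f x)"
  unfolding moment_free_def
proof (intro conjI allI)
  show "rdecay (\<lambda>x. complex_of_real c * f x)" using rdecay_cmult[of f c] assms by (simp add: moment_free_def scaleR_conv_of_real)
  show "(LINT x:orthant|lborel. complex_of_real (mpow (expvec x) m) * (complex_of_real c * f x)) = 0" for m
    using assms by (simp add: moment_free_def mult.left_commute[of _ "complex_of_real c"])
qed

lemma moment_free_coord:
  assumes "moment_free f" shows "moment_free (\<lambda>x. complex_of_real (expvec x $ l) * f x)"
proof -
  have ax: "mpow y (axis l 1) = y $ l" for y :: "real^'a"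
  proof -
    have "mpow y (axis l 1) = (\<Prod>j\<in>UNIV. if j = l then y $ l else 1)" unfolding mpow_def by (intro prod.cong) (auto simp: axis_def)
    then show ?thesis by simp
  qed
  have "mpow y m * y $ l = mpow y (m + axis l 1)" for y :: "real^'a" and m
    unfolding ax[symmetric] by (simp add: mpow_def power_add prod.distrib)
  then have "complex_of_real (mpow (expvec x) m) * (complex_of_real (expvec x $ l) * f x) = complex_of_real (mpow (expvec x) (m + axis l 1)) * f x" for x m
    by (metis mult.assoc of_real_mult)
  then show ?thesis
    using assms rdecay_mpow_expvec[of f "axis l 1"] unfolding moment_free_def ax by presburger
qed

text \<open>Induction over polynomial functions with \<open>h\<close> arbitrary: in the product case
  the second factor is first absorbed into \<open>h\<close>.\<close>

lemma moment_free_polynomial: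
  fixes P :: "real^'d::finite \<Rightarrow> real"
  assumes "real_polynomial_function P" "moment_free h"
  shows "moment_free (\<lambda>x. complex_of_real (P (expvec x)) * h x)"
  using assms
proof (induction arbitrary: h)
  case (linear P)
  have P: "P y = (\<Sum>l\<in>UNIV. P (axis l 1) * y $ l)" for y
  proof -
    have "y = (\<Sum>l\<in>UNIV. y $ l *\<^sub>R axis l 1)" by (simp add: basis_expansion flip: scalar_mult_eq_scaleR)
    then have "P y = P (\<Sum>l\<in>UNIV. y $ l *\<^sub>R axis l 1)" by simp
    also have "\<dots> = (\<Sum>l\<in>UNIV. P (axis l 1) * y $ l)"
      using linear(1) by (simp add: linear_sum bounded_linear.linear linear_scale mult.commute)
    finally show ?thesis .
  qed
  have "moment_free (\<lambda>x. \<Sum>l\<in>A. complex_of_real (P (axis l 1)) * (complex_of_real (expvec x $ l) * h x))" if "finite A" for A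
    using that
  proof (induction A)
    case empty
    show ?case using moment_free_scale[OF linear(2), of 0] by simp
  next
    case (insert l A)
    then show ?case using moment_free_add[OF moment_free_scale[OF moment_free_coord[OF linear(2), of l], of "P (axis l 1)"]] by simp
  qed
  from this[of UNIV] show ?case by (simp add: P[of "expvec _"] sum_distrib_right mult.assoc)
next
  case (const c)
  then show ?case by (rule moment_free_scale)
next
  case (add P Q)
  then show ?case using moment_free_add[OF add.IH(1)[OF add.prems] add.IH(2)[OF add.prems]] by (simp add: distrib_right)
next
  case (mult P Q)
  then show ?case using mult.IH(1)[OF mult.IH(2)[OF mult.prems]] by (simp add: mult.assoc)
qed

lemma moment_free_continuous:
  fixes \<phi> :: "real^'d::finite \<Rightarrow> real"
  assumes h: "moment_free h" and \<phi>: "continuous_on (cbox 0 1) \<phi>"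
  shows "(LINT x:orthant|lborel. complex_of_real (\<phi> (expvec x)) * h x) = 0"
proof -
  have r: "rdecay h" using h by (simp add: moment_free_def)
  have box: "expvec x \<in> cbox 0 1" if "x \<in> orthant" for x :: "real^'d"
    using that by (auto simp: mem_box_cart orthant_def less_imp_le)
  have bnd: "rdecay (\<lambda>x. complex_of_real (\<psi> (expvec x)) * h x)" if "continuous_on (cbox 0 1) \<psi>" for \<psi> :: "real^'d \<Rightarrow> real"
  proof -
    have "bounded (\<psi> ` cbox 0 1)" using that by (intro compact_imp_bounded compact_continuous_image) auto
    then obtain B where "\<And>y. y \<in> cbox 0 1 \<Longrightarrow> \<bar>\<psi> y\<bar> \<le> B" by (auto simp: bounded_iff)
    then show ?thesis using box
      by (intro rdecay_bounded_mult[where B=B] r continuous_on_compose2[OF that continuous_on_expvec]) auto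
  qed
  define I where "I = (LINT x:orthant|lborel. cmod (h x))"
  have ih: "set_integrable lborel orthant (\<lambda>x. cmod (h x))" by (intro set_integrable_norm rdecay_integrable r)
  have I: "0 \<le> I" unfolding I_def set_lebesgue_integral_def by (intro Bochner_Integration.integral_nonneg) (auto simp: indicator_def)
  have "cmod (LINT x:orthant|lborel. complex_of_real (\<phi> (expvec x)) * h x) \<le> 0 + e" if e: "0 < e" for e
  proof -
    \<comment> \<open>\<open>I + 1\<close> exceeds the integral of \<open>cmod (h x)\<close> and
      cannot vanish.\<close>
    let ?e = "e / (I + 1)"
    have e': "0 < ?e" using e I by simp
    obtain P where P: "real_polynomial_function P" "\<And>y. y \<in> cbox 0 1 \<Longrightarrow> \<bar>\<phi> y - P y\<bar> < ?e"
      using Stone_Weierstrass_real_polynomial_function[OF compact_cbox \<phi> e'] by metis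
    have cP: "continuous_on (cbox 0 1) P" using P(1) continuous_real_polymonial_function continuous_at_imp_continuous_on by blast
    have d: "complex_of_real (\<phi> (expvec x) - P (expvec x)) * h x = complex_of_real (\<phi> (expvec x)) * h x - complex_of_real (P (expvec x)) * h x" for x
      by (simp add: algebra_simps)
    have "(LINT x:orthant|lborel. complex_of_real (P (expvec x)) * h x) = 0"
      using moment_free_polynomial[OF P(1) h] unfolding moment_free_def by (metis (no_types, lifting) mpow_0 mult_1 of_real_1 set_lebesgue_integral_cong sets_lborel orthant_borel)
    then have "(LINT x:orthant|lborel. complex_of_real (\<phi> (expvec x)) * h x) = (LINT x:orthant|lborel. complex_of_real (\<phi> (expvec x) - P (expvec x)) * h x)"
      unfolding d by (subst set_integral_diff(2)) (auto intro!: rdecay_integrable bnd \<phi> cP)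
    also have "cmod \<dots> \<le> (LINT x:orthant|lborel. cmod (complex_of_real (\<phi> (expvec x) - P (expvec x)) * h x))"
      by (intro set_integral_norm_bound rdecay_integrable bnd continuous_intros \<phi> cP)
    also have "\<dots> \<le> (LINT x:orthant|lborel. ?e * cmod (h x))"
    proof (rule set_integral_mono)
      show "set_integrable lborel orthant (\<lambda>x. cmod (complex_of_real (\<phi> (expvec x) - P (expvec x)) * h x))"
        by (intro set_integrable_norm rdecay_integrable bnd continuous_intros \<phi> cP)
      show "set_integrable lborel orthant (\<lambda>x. ?e * cmod (h x))" by (intro set_integrable_mult_right ih)
      show "cmod (complex_of_real (\<phi> (expvec x) - P (expvec x)) * h x) \<le> ?e * cmod (h x)" if "x \<in> orthant" for x
        unfolding norm_mult norm_of_real using less_imp_le[OF P(2)[OF box[OF that]]] by (intro mult_right_mono) auto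
    qed
    also have "\<dots> = ?e * I" by (simp add: I_def)
    also have "\<dots> \<le> e" using e I by (simp add: field_simps)
    finally show ?thesis by simp
  qed
  then have "cmod (LINT x:orthant|lborel. complex_of_real (\<phi> (expvec x)) * h x) \<le> 0" by (rule field_le_epsilon)
  then show ?thesis by simp
qed

text \<open>A tent function of \<open>expvec x\<close> around \<open>expvec x0\<close> is tested
  against \<open>h\<close>. After multiplication by \<open>cnj (h x0)\<close> the integrand has a
  nonnegative real part that is positive on an open set, which contradicts a vanishing
  integral.\<close>

lemma moment_free_zero:
  fixes h :: "real^'d::finite \<Rightarrow> complex"
  assumes h: "moment_free h" and x0: "x0 \<in> orthant"
  shows "h x0 = 0"
proof (rule ccontr)
  assume nz: "h x0 \<noteq> 0"
  have r: "rdecay h" using h by (simp add: moment_free_def)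
  have ch: "continuous_on orthant h" by (rule rdecay_continuous[OF r])
  define g where "g x = Re (cnj (h x0) * h x)" for x
  have cg: "continuous_on orthant g" unfolding g_def by (intro continuous_intros ch)
  have "g x0 = (cmod (h x0))\<^sup>2" by (simp add: g_def cmod_power2 flip: power2_eq_square)
  then have gx0: "0 < g x0" using nz by simp
  have "open (orthant \<inter> g -` {0<..})" by (rule continuous_open_preimage[OF cg open_orthant]) simp
  then obtain \<delta> where \<delta>: "0 < \<delta>" "ball x0 \<delta> \<subseteq> orthant \<inter> g -` {0<..}"
    using gx0 x0 open_contains_ball by (metis IntI greaterThan_iff vimageI)
  \<comment> \<open>Inverse of \<open>expvec\<close>; its continuity at \<open>expvec x0\<close>
    shows that a narrow tent sees only points near \<open>x0\<close>, where \<open>g\<close> is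
    positive.\<close>
  let ?L = "\<lambda>y :: real^'d. \<chi> l. - ln (y $ l)"
  have Lx: "?L (expvec x) = x" for x by (simp add: vec_eq_iff)
  have "isCont ?L (expvec x0)"
    unfolding isCont_def
  proof (intro vec_tendstoI)
    fix i
    have "((\<lambda>y. - ln (y $ i)) \<longlongrightarrow> - ln (expvec x0 $ i)) (at (expvec x0))"
      by (intro tendsto_intros) simp
    then show "((\<lambda>y. ?L y $ i) \<longlongrightarrow> ?L (expvec x0) $ i) (at (expvec x0))" by simp
  qed
  then obtain \<rho> where \<rho>: "0 < \<rho>" "\<And>y. dist y (expvec x0) < \<rho> \<Longrightarrow> dist (?L y) (?L (expvec x0)) < \<delta>"
    unfolding continuous_at_eps_delta using \<delta>(1) by metis
  define \<phi> where "\<phi> y = max 0 (\<rho> - dist y (expvec x0))" for y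
  have \<phi>: "continuous_on A \<phi>" for A unfolding \<phi>_def by (intro continuous_intros)
  let ?F = "\<lambda>x. indicator orthant x * (\<phi> (expvec x) * g x)"
  have nn: "0 \<le> ?F x" for x
  proof (cases "x \<in> orthant \<and> dist (expvec x) (expvec x0) < \<rho>")
    case True
    then have "x \<in> ball x0 \<delta>" using \<rho>(2)[of "expvec x"] by (simp add: Lx dist_commute)
    then have "0 < g x" using \<delta>(2) by auto
    then show ?thesis by (simp add: \<phi>_def)
  next
    case False
    then show ?thesis by (auto simp: \<phi>_def)
  qed
  have rd: "rdecay (\<lambda>x. complex_of_real (\<phi> (expvec x)) * h x)"
    by (rule rdecay_bounded_mult[OF r, where B=\<rho>]) (use \<rho>(1) in \<open>auto intro!: continuous_intros simp: \<phi>_def\<close>)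
  have int: "set_integrable lborel orthant (\<lambda>x. cnj (h x0) * (complex_of_real (\<phi> (expvec x)) * h x))"
    by (intro set_integrable_mult_right rdecay_integrable rd)
  have F: "?F x = Re (indicator orthant x *\<^sub>R (cnj (h x0) * (complex_of_real (\<phi> (expvec x)) * h x)))" for x
    by (simp add: g_def algebra_simps)
  have iF: "integrable lborel ?F" unfolding F by (intro integrable_Re int[unfolded set_integrable_def])
  have "(LINT x|lborel. ?F x) = Re (LINT x:orthant|lborel. cnj (h x0) * (complex_of_real (\<phi> (expvec x)) * h x))"
    unfolding F set_lebesgue_integral_def by (rule integral_Re[OF int[unfolded set_integrable_def]])
  also have "\<dots> = 0" using moment_free_continuous[OF h \<phi>] by simp
  finally have "AE x in lborel. ?F x = 0" using integral_nonneg_eq_0_iff_AE[OF iF] nn by simp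
  moreover define U where "U = ball x0 \<delta> \<inter> expvec -` ball (expvec x0) \<rho>"
  have FU: "?F x \<noteq> 0" if "x \<in> U" for x
  proof -
    have "x \<in> orthant" "0 < g x" "dist (expvec x) (expvec x0) < \<rho>" using that \<delta>(2) by (auto simp: U_def dist_commute)
    then show ?thesis by (simp add: \<phi>_def)
  qed
  ultimately have "AE x in lborel. x \<notin> U" by (auto elim: eventually_mono)
  have oU: "open U" unfolding U_def
    by (intro open_Int open_ball open_vimage) (auto intro: continuous_on_expvec)
  have "U \<in> null_sets lborel" using \<open>AE x in lborel. x \<notin> U\<close> oU by (simp add: AE_iff_null_sets)
  then have "negligible U" unfolding negligible_iff_null_sets by (rule null_sets_completionI)
  moreover have "x0 \<in> U" using \<delta>(1) \<rho>(1) by (simp add: U_def)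
  ultimately show False using open_not_negligible[OF oU] by blast
qed

text \<open>The factor \<open>gexp 0\<close> turns the monomials in \<open>expvec\<close> into the
  functions \<open>gexp m\<close>; it has no zeros and can be divided out at the end.\<close>

lemma laguerre_complete:
  fixes f :: "real^'d::finite \<Rightarrow> complex"
  assumes f: "rdecay f" and 0: "\<And>n. (LINT x:orthant|lborel. f x * lagf n (\<lambda>_. 0) x) = 0" and x: "x \<in> orthant"
  shows "f x = 0"
proof -
  let ?h = "\<lambda>x. f x * complex_of_real (gexp 0 x)"
  have "moment_free ?h"
    unfolding moment_free_def
  proof (intro conjI allI rdecay_mult f rdecay_gexp)
    fix m
    have "complex_of_real (mpow (expvec x) m) * ?h x = f x * complex_of_real (gexp m x)" for x
      by (simp add: gexp_eq[of m])
    then show "(LINT x:orthant|lborel. complex_of_real (mpow (expvec x) m) * ?h x) = 0"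
      using gexp_orthogonal[OF f 0, of m] by (simp only:)
  qed
  from moment_free_zero[OF this x] have "f x = 0 \<or> gexp 0 x = 0" by simp
  then show ?thesis by (simp add: gexp_def)
qed

section \<open>Analysis and synthesis as mutually inverse continuous maps of the limits\<close>

section \<open>The isomorphism\<close>

lemma linear_map_on_laguerre_coeff: "linear_map_on schwartz_orthant (laguerre_coeff :: (real^'d::finite \<Rightarrow> complex) \<Rightarrow> _)"
  unfolding linear_map_on_def
proof (intro conjI ballI allI ext)
  fix f g :: "real^'d \<Rightarrow> complex" and n assume f: "f \<in> schwartz_orthant" and g: "g \<in> schwartz_orthant"
  have "set_integrable lborel orthant (\<lambda>x. h x * lagf n (\<lambda>_. 0) x)" if "h \<in> schwartz_orthant" for h :: "real^'d \<Rightarrow> complex"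
    by (intro rdecay_integrable rdecay_mult rdecay_schwartz that rdecay_lagf)
  from set_integral_add(2)[OF this[OF f] this[OF g]]
  show "laguerre_coeff (f + g) n = (laguerre_coeff f + laguerre_coeff g) n"
    by (simp add: laguerre_coeff_eq distrib_right)
next
  fix c and f :: "real^'d \<Rightarrow> complex" and n
  show "laguerre_coeff (c *\<^sub>F f) n = (c *\<^sub>F laguerre_coeff f) n"
    by (simp add: laguerre_coeff_eq mult.assoc)
qed

text \<open>Both functions have the same coefficients, so completeness applied to their difference
  gives equality on the orthant; outside it both vanish.\<close>

lemma lagsynth_laguerre_coeff:
  assumes \<alpha>: "1 \<le> \<alpha>" and a: "1 < a" and f: "f \<in> schwartz_orthant" and u: "coeff_bound \<alpha> a R (laguerre_coeff f)"
  shows "lagsynth (laguerre_coeff f) = f"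
proof
  fix x
  let ?g = "lagsynth (laguerre_coeff f)"
  have g: "?g \<in> schwartz_orthant" by (rule lagsynth_schwartz[OF \<alpha> a u])
  show "?g x = f x"
  proof (cases "x \<in> orthant")
    case True
    have i: "set_integrable lborel orthant (\<lambda>x. h x * lagf n (\<lambda>_. 0) x)" if "h \<in> schwartz_orthant" for h n
      by (intro rdecay_integrable rdecay_mult rdecay_schwartz that rdecay_lagf)
    have "?g x - f x = 0"
    proof (rule laguerre_complete[OF _ _ True])
      show "rdecay (\<lambda>x. ?g x - f x)" by (intro rdecay_diff rdecay_schwartz f g)
      show "(LINT x:orthant|lborel. (?g x - f x) * lagf n (\<lambda>_. 0) x) = 0" for n
        using set_integral_diff(2)[OF i[OF g] i[OF f], of n n] laguerre_coeff_lagsynth[OF \<alpha> a u]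
        by (simp add: laguerre_coeff_eq[symmetric] left_diff_distrib)
    qed
    then show ?thesis by simp
  next
    case False
    then show ?thesis using schwartzD(1)[OF f False] by (simp add: lagsynth_def)
  qed
qed

lemma topspace_GS_step [simp]: "topspace (GS_step \<alpha> A) = GS_step_carrier \<alpha> A"
  by (simp add: GS_step_def)

lemma topspace_seq_step [simp]: "topspace (seq_step \<alpha> a) = seq_step_carrier \<alpha> a"
  by (simp add: seq_step_def)

lemma topspace_GS_space: "topspace (GS_space \<alpha>) = (\<Union>A\<in>{0<..}. GS_step_carrier \<alpha> A)"
  by (simp add: GS_space_def lc_inductive_limit_def Let_def)

lemma subspace_GS_space: "cfun.subspace (topspace (GS_space \<alpha> :: (real^'d::finite \<Rightarrow> complex) topology))"
  unfolding topspace_GS_space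
proof (rule cfun.subspaceI)
  show "0 \<in> (\<Union>A\<in>{0<..}. GS_step_carrier \<alpha> A :: (real^'d \<Rightarrow> complex) set)"
    using cfun.subspace_0[OF subspace_GS_step_carrier[of 1 \<alpha>]] by auto
next
  fix f g :: "real^'d \<Rightarrow> complex"
  assume "f \<in> (\<Union>A\<in>{0<..}. GS_step_carrier \<alpha> A :: (real^'d \<Rightarrow> complex) set)" "g \<in> (\<Union>A\<in>{0<..}. GS_step_carrier \<alpha> A)"
  then obtain A B where AB: "0 < A" "f \<in> GS_step_carrier \<alpha> A" "0 < B" "g \<in> GS_step_carrier \<alpha> B" by auto
  have "f \<in> GS_step_carrier \<alpha> (max A B)" "g \<in> GS_step_carrier \<alpha> (max A B)"
    using AB GS_step_carrier_mono[of A "max A B" \<alpha>] GS_step_carrier_mono[of B "max A B" \<alpha>] by auto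
  then have "f + g \<in> GS_step_carrier \<alpha> (max A B)" using AB by (intro cfun.subspace_add subspace_GS_step_carrier) auto
  then show "f + g \<in> (\<Union>A\<in>{0<..}. GS_step_carrier \<alpha> A)" using AB(1) by (intro UN_I[of "max A B"]) auto
next
  fix c f assume "f \<in> (\<Union>A\<in>{0<..}. GS_step_carrier \<alpha> A :: (real^'d \<Rightarrow> complex) set)"
  then obtain A where A: "0 < A" "f \<in> GS_step_carrier \<alpha> A" by auto
  then show "c *\<^sub>F f \<in> (\<Union>A\<in>{0<..}. GS_step_carrier \<alpha> A)"
    using cfun.subspace_scale[OF subspace_GS_step_carrier[OF A(1)] A(2)] by auto
qed

lemma coeff_bound_seq_norm: "1 < a \<Longrightarrow> u \<in> seq_step_carrier \<alpha> a \<Longrightarrow> coeff_bound \<alpha> a (seq_norm \<alpha> a u) u"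
  by (simp add: coeff_bound_def le_seq_norm)

lemma coeff_bound_mem: "coeff_bound \<alpha> a R u \<Longrightarrow> u \<in> seq_step_carrier \<alpha> a"
  unfolding coeff_bound_def by (rule mem_seq_step_carrierI) auto

lemma GS_step_carrier_schwartz: "GS_step_carrier \<alpha> A \<subseteq> schwartz_orthant"
  by (auto simp: GS_step_carrier_def)

lemma linear_map_on_subset: "linear_map_on S f \<Longrightarrow> T \<subseteq> S \<Longrightarrow> linear_map_on T f"
  unfolding linear_map_on_def by blast

lemma bij_betw_laguerre_coeff:
  assumes \<alpha>: "1 \<le> \<alpha>"
  shows "bij_betw laguerre_coeff (topspace (GS_space \<alpha> :: (real^'d::finite \<Rightarrow> complex) topology)) (topspace (seq_space \<alpha>))"
    and "u \<in> topspace (seq_space \<alpha>) \<Longrightarrow>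
      inv_into (topspace (GS_space \<alpha> :: (real^'d::finite \<Rightarrow> complex) topology)) laguerre_coeff u = lagsynth u"
proof -
  let ?S = "topspace (GS_space \<alpha> :: (real^'d::finite \<Rightarrow> complex) topology)"
  have 1: "laguerre_coeff f \<in> topspace (seq_space \<alpha>) \<and> lagsynth (laguerre_coeff f) = f" if "f \<in> ?S" for f
  proof -
    obtain A where A: "0 < A" "f \<in> GS_step_carrier \<alpha> A" using \<open>f \<in> ?S\<close> by (auto simp: topspace_GS_space)
    obtain a where a: "1 < a" "\<And>f (n :: nat^'d). f \<in> GS_step_carrier \<alpha> A \<Longrightarrow>
        cmod (laguerre_coeff f n) * weight \<alpha> a n \<le> exp 1 * GS_seminorm \<alpha> A 0 f"
      using laguerre_coeff_decay[OF \<alpha> A(1)] by metis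
    have c: "coeff_bound \<alpha> a (exp 1 * GS_seminorm \<alpha> A 0 f) (laguerre_coeff f)"
      unfolding coeff_bound_def using a(2)[OF A(2)] by blast
    have fs: "f \<in> schwartz_orthant" using A(2) GS_step_carrier_schwartz by blast
    show ?thesis
      using coeff_bound_mem[OF c] a(1) lagsynth_laguerre_coeff[OF \<alpha> a(1) fs c] by (auto simp: topspace_seq_space)
  qed
  have 2: "lagsynth u \<in> ?S \<and> laguerre_coeff (lagsynth u) = u" if "u \<in> topspace (seq_space \<alpha>)" for u :: "nat^'d \<Rightarrow> complex"
  proof -
    obtain a where a: "1 < a" "u \<in> seq_step_carrier \<alpha> a" using \<open>u \<in> _\<close> by (auto simp: topspace_seq_space)
    note c = coeff_bound_seq_norm[OF a]
    obtain H where "1 \<le> H" "lagsynth u \<in> GS_step_carrier \<alpha> H" using lagsynth_GS_seminorm[OF \<alpha> a(1)] c by metis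
    then have "lagsynth u \<in> ?S" unfolding topspace_GS_space by (intro UN_I[of H]) auto
    then show ?thesis using laguerre_coeff_lagsynth[OF \<alpha> a(1) c] by blast
  qed
  show b: "bij_betw laguerre_coeff ?S (topspace (seq_space \<alpha>))"
    by (rule bij_betw_byWitness[where f'=lagsynth]) (use 1 2 in auto)
  show "inv_into ?S laguerre_coeff u = lagsynth u" if "u \<in> topspace (seq_space \<alpha>)"
    using 2[OF that] b by (metis bij_betw_imp_inj_on inv_into_f_f)
qed

text \<open>Analysis sends each step \<open>A\<close> into some step \<open>a\<close>, synthesis
  each step \<open>a\<close> into some step \<open>A\<close>, both with seminorm bounds;
  \<open>lc_inductive_limit_isomorphism\<close> asks for nothing more.\<close>

lemma laguerre_coeff_isomorphism:
  assumes \<alpha>: "1 \<le> \<alpha>"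
  shows "topological_isomorphism (GS_space \<alpha> :: (real^'d::finite \<Rightarrow> complex) topology) (seq_space \<alpha>) laguerre_coeff"
proof -
  let ?S = "\<Union>A\<in>{0<..}. GS_step_carrier \<alpha> A :: (real^'d \<Rightarrow> complex) set"
  have S: "topspace (GS_space \<alpha>) = ?S" by (rule topspace_GS_space)
  have S': "topspace (seq_space \<alpha>) = (\<Union>a\<in>{1<..}. seq_step_carrier \<alpha> a :: (nat^'d \<Rightarrow> complex) set)" by (rule topspace_seq_space)
  have sub: "cfun.subspace ?S" using subspace_GS_space[of \<alpha>, where 'd='d] unfolding S .
  have lin: "linear_map_on ?S laguerre_coeff"
    by (rule linear_map_on_subset[OF linear_map_on_laguerre_coeff]) (use GS_step_carrier_schwartz in blast)
  have bij: "bij_betw laguerre_coeff ?S (\<Union>a\<in>{1<..}. seq_step_carrier \<alpha> a :: (nat^'d \<Rightarrow> complex) set)"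
    using bij_betw_laguerre_coeff(1)[OF \<alpha>, where 'd='d] unfolding S S' .
  have inv: "inv_into ?S laguerre_coeff u = lagsynth u" if "u \<in> seq_step_carrier \<alpha> a" "1 < a" for u a
    using bij_betw_laguerre_coeff(2)[OF \<alpha>, of u] that unfolding S S' by auto
  have fwd: "\<exists>a\<in>{1<..}. continuous_map (GS_step \<alpha> A) (seq_step \<alpha> a) (laguerre_coeff :: (real^'d \<Rightarrow> complex) \<Rightarrow> _)" if "A \<in> {0<..}" for A
  proof -
    have A: "0 < A" using that by simp
    obtain a where a: "1 < a" "\<And>f (n :: nat^'d). f \<in> GS_step_carrier \<alpha> A \<Longrightarrow>
        cmod (laguerre_coeff f n) * weight \<alpha> a n \<le> exp 1 * GS_seminorm \<alpha> A 0 f"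
      using laguerre_coeff_decay[OF \<alpha> A] by metis
    have "continuous_map (GS_step \<alpha> A) (seq_step \<alpha> a) (laguerre_coeff :: (real^'d \<Rightarrow> complex) \<Rightarrow> _)"
      unfolding GS_step_def seq_step_def
    proof (rule continuous_map_seminorm_topology[OF subspace_GS_step_carrier[OF A] _ subspace_seq_step_carrier])
      show "linear_map_on (GS_step_carrier \<alpha> A) (laguerre_coeff :: (real^'d \<Rightarrow> complex) \<Rightarrow> _)"
        by (rule linear_map_on_subset[OF linear_map_on_laguerre_coeff GS_step_carrier_schwartz])
      show "laguerre_coeff ` GS_step_carrier \<alpha> A \<subseteq> (seq_step_carrier \<alpha> a :: (nat^'d \<Rightarrow> complex) set)"
        using a(2) by (auto intro: mem_seq_step_carrierI)
      show "\<exists>p\<in>range (GS_seminorm \<alpha> A). \<exists>C. \<forall>x\<in>GS_step_carrier \<alpha> A. q (laguerre_coeff x :: nat^'d \<Rightarrow> complex) \<le> C * p x"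
        if "q \<in> {seq_norm \<alpha> a}" for q
      proof (intro bexI[of _ "GS_seminorm \<alpha> A 0"] exI[of _ "exp 1"] ballI)
        fix f :: "real^'d \<Rightarrow> complex" assume "f \<in> GS_step_carrier \<alpha> A"
        then show "q (laguerre_coeff f) \<le> exp 1 * GS_seminorm \<alpha> A 0 f" using that a(2) by (auto intro!: seq_norm_leI)
      qed simp
    qed (auto intro: seminorm_on_GS_seminorm[OF A] seminorm_on_seq_norm)
    then show ?thesis using a(1) by auto
  qed
  have bwd: "\<exists>A\<in>{0<..}. continuous_map (seq_step \<alpha> a) (GS_step \<alpha> A) (inv_into ?S laguerre_coeff)" if "a \<in> {1<..}" for a
  proof -
    have a: "1 < a" using that by simp
    obtain H where H: "1 \<le> H" "\<And>(u :: nat^'d \<Rightarrow> complex) R. coeff_bound \<alpha> a R u \<Longrightarrow> lagsynth u \<in> GS_step_carrier \<alpha> H"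
      "\<And>j. \<exists>K. \<forall>(u :: nat^'d \<Rightarrow> complex) R. coeff_bound \<alpha> a R u \<longrightarrow> GS_seminorm \<alpha> H j (lagsynth u) \<le> K * R"
      using lagsynth_GS_seminorm[OF \<alpha> a] by metis
    have H0: "0 < H" using H(1) by simp
    note c = coeff_bound_seq_norm[OF a, of _ \<alpha>]
    have "continuous_map (seq_step \<alpha> a) (GS_step \<alpha> H) (inv_into ?S laguerre_coeff)"
      unfolding GS_step_def seq_step_def
    proof (rule continuous_map_seminorm_topology[OF subspace_seq_step_carrier _ subspace_GS_step_carrier[OF H0]])
      have "seq_step_carrier \<alpha> a \<subseteq> (\<Union>a\<in>{1<..}. seq_step_carrier \<alpha> a :: (nat^'d \<Rightarrow> complex) set)" using a by auto
      then show "linear_map_on (seq_step_carrier \<alpha> a) (inv_into ?S laguerre_coeff)"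
        by (rule linear_map_on_subset[OF linear_map_on_inv_into[OF sub lin bij]])
      show "inv_into ?S laguerre_coeff ` seq_step_carrier \<alpha> a \<subseteq> GS_step_carrier \<alpha> H"
        using inv[OF _ a] H(2)[OF c] by auto
      show "\<exists>p\<in>{seq_norm \<alpha> a}. \<exists>C. \<forall>u\<in>seq_step_carrier \<alpha> a. q (inv_into ?S laguerre_coeff u) \<le> C * p u"
        if qr: "q \<in> range (GS_seminorm \<alpha> H)" for q
      proof -
        obtain j where q: "q = GS_seminorm \<alpha> H j" using qr by blast
        obtain K where "\<And>(u :: nat^'d \<Rightarrow> complex) R. coeff_bound \<alpha> a R u \<Longrightarrow> GS_seminorm \<alpha> H j (lagsynth u) \<le> K * R"
          using H(3)[of j] by blast
        then have "\<forall>u\<in>seq_step_carrier \<alpha> a. q (inv_into ?S laguerre_coeff u) \<le> K * seq_norm \<alpha> a u"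
          unfolding q using inv[OF _ a] c by auto
        then show ?thesis by blast
      qed
    qed (auto intro: seminorm_on_GS_seminorm[OF H0] seminorm_on_seq_norm)
    then show ?thesis using H0 by auto
  qed
  show ?thesis
    unfolding GS_space_def seq_space_def
    by (rule lc_inductive_limit_isomorphism) (use sub lin bij fwd bwd in \<open>simp_all only: topspace_GS_step topspace_seq_step\<close>)
qed

text \<open>Identifies the abstract unit vectors with the Laguerre functions, including the value 0
  outside the orthant.\<close>

lemma lagsynth_unit:
  assumes \<alpha>: "1 \<le> \<alpha>" shows "lagsynth (\<lambda>m. if m = n then 1 else 0) = laguerre_fun n"
proof
  fix x
  show "lagsynth (\<lambda>m. if m = n then 1 else 0) x = laguerre_fun n x"
  proof (cases "x \<in> orthant")
    case True
    obtain j where j: "n = enum_index j" using bij_enum_index by (metis bij_pointE)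
    have "(\<lambda>m. (if enum_index m = n then 1 else 0) * lagf (enum_index m) (\<lambda>_. 0) x) sums
        (\<Sum>m\<in>{j}. (if enum_index m = n then 1 else 0) * lagf (enum_index m) (\<lambda>_. 0) x)"
      by (rule sums_finite) (auto simp: j enum_index_inj)
    then show ?thesis using True by (simp add: lagsynth_def lagser_def sums_iff j laguerre_fun_eq)
  next
    case False
    then show ?thesis by (simp add: lagsynth_def laguerre_fun_def)
  qed
qed

theorem theorem6p1:
  fixes \<alpha> :: real
  assumes "1 \<le> \<alpha>"
  shows "topological_isomorphism
           (GS_space \<alpha> :: (real^'d::finite \<Rightarrow> complex) topology)
           (seq_space \<alpha> :: (nat^'d \<Rightarrow> complex) topology)
           laguerre_coeff
       \<and> DFN_space (GS_space \<alpha> :: (real^'d \<Rightarrow> complex) topology)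
       \<and> FN_space (strong_dual (GS_space \<alpha> :: (real^'d \<Rightarrow> complex) topology))
       \<and> (\<forall>f \<in> topspace (GS_space \<alpha> :: (real^'d \<Rightarrow> complex) topology).
            limitin (GS_space \<alpha>)
              (\<lambda>N. \<Sum>n\<in>N. laguerre_coeff f n *\<^sub>F laguerre_fun n)
              f (finite_subsets_at_top UNIV))"
proof -
  interpret L: coefficient_space \<alpha> "GS_space \<alpha> :: (real^'d \<Rightarrow> complex) topology" laguerre_coeff
    by unfold_locales (use assms subspace_GS_space laguerre_coeff_isomorphism in auto)
  \<comment> \<open>Once the unit vectors are recognized as Laguerre functions, the abstract
    expansion \<open>L.limitin_expansion\<close> is the Laguerre series.\<close>
  have e: "L.e n = laguerre_fun n" for n
  proof -
    have "(\<lambda>m. if m = n then 1 else 0) \<in> topspace (seq_space \<alpha>)"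
      using L.iota_e[of n] L.e_in[of n] L.bij by (metis bij_betwE)
    then show ?thesis
      using bij_betw_laguerre_coeff(2)[OF assms, where 'd='d] lagsynth_unit[OF assms, of n] by (simp add: L.e_def)
  qed
  have "L.part f = (\<lambda>N. \<Sum>n\<in>N. laguerre_coeff f n *\<^sub>F laguerre_fun n)" for f
    by (simp add: L.part_def[abs_def] e)
  then show ?thesis
    using laguerre_coeff_isomorphism[OF assms] L.DFN L.FN_strong_dual L.limitin_expansion by metis
qed

end
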